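(* The subbundle $$\mathcal{D}_M=\coprod_{A\in\mathcal{A}_M}\bigl\{\,a\oplus(A\wedge a-a\wedge A)\;\bigm|\;a\in T_A\mathcal{A}_M\,\bigr\}$$ of $T\mathcal{A}_M\oplus T^*\mathcal{A}_M$ is a $\kappa$-twisted Dirac structure on $\mathcal{A}_M$, where $\kappa$ is the Cartan 3-form $$\kappa_A(a,b,c)=\frac{1}{8\pi^3}\int_M\mathrm{tr}\,[(a\wedge b-b\wedge a)\wedge c],\qquad a,b,c\in T_A\mathcal{A}_M.$$
   Context: $M$ is a compact connected oriented Riemannian 3-manifold, $G=SU(n)$ with $n\ge2$, $\mathfrak g=\mathfrak{su}(n)$. $\mathcal{A}_M$ is the space of irreducible connections on the trivial bundle $M\times G$, regarded as $\mathfrak g$-valued 1-forms. $\Omega^r_s(M,\mathfrak g)$ denotes the $\mathfrak g$-valued $r$-forms on $M$ of Sobolev class $L^2_s$. The tangent space is $T_A\mathcal{A}_M=\Omega^1_{s-1}(M,\mathfrak g)$, and the cotangent space $T^*_A\mathcal{A}_M$ is identified with $\Omega^2_{s-1}(M,\mathfrak g)$ by the pairing $\langle\alpha\mid a\rangle_M=\frac{1}{24\pi^3}\int_M\mathrm{tr}(\alpha\wedge a)$. Products of matrix-valued forms are wedge products combined with matrix multiplication. Calculus: $\partial_a H(A)=\lim_{\epsilon\to0}\frac1\epsilon\{H(A+\epsilon a)-H(A)\}$; for vector fields $[V,W](A)=(\partial_{V(A)}W)(A)-(\partial_{W(A)}V)(A)$; for a 1-form $\theta$, $(\mathcal{L}_V\theta)(W)=\partial_V\langle\theta\mid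 W\rangle-\langle\theta\mid[V,W]\rangle$ and $(\tilde{\mathrm d}\theta)(V,W)=\partial_V\langle\theta\mid W\rangle-\partial_W\langle\theta\mid V\rangle-\langle\theta\mid[V,W]\rangle$; $i_V\tilde{\mathrm d}\theta=\tilde{\mathrm d}\theta(V,\cdot)$; $i_{V\wedge W}\kappa=\kappa(V,W,\cdot)$. On $T\mathcal{A}_M\oplus T^*\mathcal{A}_M$ take the symmetric bilinear form $\langle a\oplus\alpha,b\oplus\beta\rangle_+=\frac12\{\langle\alpha\mid b\rangle_M+\langle\beta\mid a\rangle_M\}$, the anchor $\rho(a\oplus\alpha)=a$, and the bracket of sections $$[\![a\oplus\alpha,b\oplus\beta]\!]_\kappa=[a,b]\oplus(\mathcal{L}_a\beta-i_b\tilde{\mathrm d}\alpha-i_{a\wedge b}\kappa).$$ A $\kappa$-twisted Dirac structure is a maximal isotropic subbundle (for $\langle\cdot,\cdot\rangle_+$) whose sections are closed under $[\![\cdot,\cdot]\!]_\kappa$.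
   Formalization: Since A∧a−a∧A is Hermitian-valued and so not in Ω²(M,su(n)), the cotangent space is taken as the functionals ⟨α|·⟩_M of complex-matrix-valued 2-forms α of class L²_{s-1}; s is an integer ≥ 3, so that products stay in L²_{s-1}. *)

theory Defs
  imports "HOL-Analysis.Analysis" "HOL-Library.Function_Algebras"
begin

section \<open>Functions as a real vector space\<close>

instantiation "fun" :: (type, scaleR) scaleR
begin
definition "scaleR r f = (\<lambda>x. r *\<^sub>R f x)"
instance ..
end

instance "fun" :: (type, real_vector) real_vector
  by standard (auto simp: scaleR_fun_def fun_eq_iff scaleR_add_right scaleR_add_left)


section \<open>Calculus on open subsets of topological vector spaces\<close>

text \<open>A topological vector space is given by a topology whose underlying set is a real subspace
  of the ambient type.\<close>

definition dderiv :: "'y::real_vector topology \<Rightarrow> ('x::real_vector \<Rightarrow> 'y) \<Rightarrow> 'x \<Rightarrow> 'x \<Rightarrow> 'y" where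
  "dderiv Y f A a = (THE l. limitin Y (\<lambda>t::real. (1 / t) *\<^sub>R (f (A + t *\<^sub>R a) - f A)) l (at 0))"

text \<open>Smoothness in the sense of Michal and Bastiani, which on Banach spaces is the usual
  notion: all iterated directional derivatives \<open>D [a1, \<dots>, am] A\<close> exist and are jointly continuous
  in the base point and the directions.  Values of \<open>f\<close> off the open set \<open>U\<close> are irrelevant.\<close>

definition gsmooth ::
    "'x::real_vector topology \<Rightarrow> 'x set \<Rightarrow> 'y::real_vector topology \<Rightarrow> ('x \<Rightarrow> 'y) \<Rightarrow> bool" where
  "gsmooth X U Y f \<longleftrightarrow> openin X U \<and>
     (\<exists>D :: 'x list \<Rightarrow> 'x \<Rightarrow> 'y.
        (\<forall>A\<in>U. D [] A = f A) \<and>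
        (\<forall>as\<in>lists (topspace X). \<forall>a\<in>topspace X. \<forall>A\<in>U.
           limitin Y (\<lambda>t::real. (1 / t) *\<^sub>R (D as (A + t *\<^sub>R a) - D as A)) (D (a # as) A) (at 0)) \<and>
        (\<forall>m::nat. continuous_map
           (prod_topology (subtopology X U) (product_topology (\<lambda>_. X) {..<m})) Y
           (\<lambda>(A, h). D (map h [0..<m]) A)))"

definition vf_bracket ::
    "'v::real_vector topology \<Rightarrow> ('v \<Rightarrow> 'v) \<Rightarrow> ('v \<Rightarrow> 'v) \<Rightarrow> 'v \<Rightarrow> 'v" where
  "vf_bracket X V W A = dderiv X W A (V A) - dderiv X V A (W A)"

definition contract :: "('v \<Rightarrow> 'v \<Rightarrow> complex) \<Rightarrow> ('v \<Rightarrow> 'v) \<Rightarrow> 'v \<Rightarrow> complex" where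
  "contract \<theta> W A = \<theta> A (W A)"

definition lie_deriv ::
    "'v::real_vector topology \<Rightarrow> ('v \<Rightarrow> 'v) \<Rightarrow> ('v \<Rightarrow> 'v \<Rightarrow> complex) \<Rightarrow> ('v \<Rightarrow> 'v) \<Rightarrow> 'v \<Rightarrow> complex" where
  "lie_deriv X V \<theta> W A =
     dderiv euclidean (contract \<theta> W) A (V A) - contract \<theta> (vf_bracket X V W) A"

definition ext_deriv ::
    "'v::real_vector topology \<Rightarrow> ('v \<Rightarrow> 'v \<Rightarrow> complex) \<Rightarrow> ('v \<Rightarrow> 'v) \<Rightarrow> ('v \<Rightarrow> 'v) \<Rightarrow> 'v \<Rightarrow> complex" where
  "ext_deriv X \<theta> V W A =
     dderiv euclidean (contract \<theta> W) A (V A) - dderiv euclidean (contract \<theta> V) A (W A)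
       - contract \<theta> (vf_bracket X V W) A"


section \<open>Twisted Dirac structures\<close>

text \<open>\<open>X\<close> is the (constant) tangent space of the open set \<open>U\<close> and \<open>Y\<close> its cotangent space, a
  space of functionals on the tangent space; the fibre of the sum of the two bundles is the
  underlying set of \<open>prod_topology X Y\<close>.\<close>

definition plus_form :: "'v \<times> ('v \<Rightarrow> complex) \<Rightarrow> 'v \<times> ('v \<Rightarrow> complex) \<Rightarrow> complex" where
  "plus_form x y = (1 / 2) * (snd x (fst y) + snd y (fst x))"

definition isotropic :: "('v \<times> ('v \<Rightarrow> complex)) set \<Rightarrow> bool" where
  "isotropic L \<longleftrightarrow> (\<forall>x\<in>L. \<forall>y\<in>L. plus_form x y = 0)"

definition maximal_isotropic ::
    "'v::real_vector topology \<Rightarrow> ('v \<Rightarrow> complex) topology \<Rightarrow> ('v \<times> ('v \<Rightarrow> complex)) set \<Rightarrow> bool" where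
  "maximal_isotropic X Y L \<longleftrightarrow>
     subspace L \<and> L \<subseteq> topspace (prod_topology X Y) \<and> isotropic L \<and>
     (\<forall>L'. subspace L' \<and> L' \<subseteq> topspace (prod_topology X Y) \<and> isotropic L' \<and> L \<subseteq> L' \<longrightarrow> L' = L)"

definition linear_on_set :: "'a::real_vector set \<Rightarrow> ('a \<Rightarrow> 'b::real_vector) \<Rightarrow> bool" where
  "linear_on_set S f \<longleftrightarrow>
     (\<forall>x\<in>S. \<forall>y\<in>S. f (x + y) = f x + f y) \<and> (\<forall>x\<in>S. \<forall>r. f (r *\<^sub>R x) = r *\<^sub>R f x)"

text \<open>A subbundle is a family of subspaces that, near every point, is carried by a smooth
  automorphism \<open>\<Phi>\<close> (with smooth inverse \<open>\<Psi>\<close>) of the trivial bundle with fibre \<open>E\<close> onto a constant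
  closed subspace \<open>F\<close> that has a closed complement \<open>G\<close>.\<close>

definition smooth_subbundle ::
    "'v::real_vector topology \<Rightarrow> 'v set \<Rightarrow> 'e::real_vector topology \<Rightarrow> ('v \<Rightarrow> 'e set) \<Rightarrow> bool" where
  "smooth_subbundle X U E D \<longleftrightarrow>
     (\<forall>A\<in>U. subspace (D A) \<and> D A \<subseteq> topspace E) \<and>
     (\<forall>A0\<in>U. \<exists>N \<Phi> \<Psi> F G. openin X N \<and> A0 \<in> N \<and> N \<subseteq> U \<and>
        gsmooth (prod_topology X E) (N \<times> topspace E) E (\<lambda>(A, e). \<Phi> A e) \<and>
        gsmooth (prod_topology X E) (N \<times> topspace E) E (\<lambda>(A, e). \<Psi> A e) \<and>
        (\<forall>A\<in>N. linear_on_set (topspace E) (\<Phi> A) \<and>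
           (\<forall>e\<in>topspace E. \<Psi> A (\<Phi> A e) = e \<and> \<Phi> A (\<Psi> A e) = e) \<and>
           \<Phi> A ` D A = F) \<and>
        subspace F \<and> closedin E F \<and> subspace G \<and> closedin E G \<and>
        F \<inter> G = {0} \<and> topspace E = {x + y | x y. x \<in> F \<and> y \<in> G})"

definition section_of ::
    "'v::real_vector topology \<Rightarrow> 'v set \<Rightarrow> 'e::real_vector topology \<Rightarrow> ('v \<Rightarrow> 'e set) \<Rightarrow> ('v \<Rightarrow> 'e) \<Rightarrow> bool" where
  "section_of X U E D e \<longleftrightarrow> gsmooth X U E e \<and> (\<forall>A\<in>U. e A \<in> D A)"

text \<open>The cotangent component of the bracket of \<open>e1 = a \<oplus> \<alpha>\<close> and \<open>e2 = b \<oplus> \<beta>\<close> is the 1-form given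
  on vector fields \<open>W\<close> by \<open>(L\<^sub>a \<beta>)(W) - (d\<alpha>)(b, W) - \<kappa>(a, b, W)\<close>.  Letting \<open>W\<close> range over the constant
  vector fields shows that \<open>e3\<close> is determined on \<open>U\<close> by this relation.\<close>

definition is_courant_bracket ::
    "'v::real_vector topology \<Rightarrow> 'v set \<Rightarrow> ('v \<Rightarrow> 'v \<Rightarrow> 'v \<Rightarrow> 'v \<Rightarrow> complex) \<Rightarrow>
     ('v \<Rightarrow> 'v \<times> ('v \<Rightarrow> complex)) \<Rightarrow> ('v \<Rightarrow> 'v \<times> ('v \<Rightarrow> complex)) \<Rightarrow>
     ('v \<Rightarrow> 'v \<times> ('v \<Rightarrow> complex)) \<Rightarrow> bool" where
  "is_courant_bracket X U \<kappa> e1 e2 e3 \<longleftrightarrow>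
     (let a = (\<lambda>A. fst (e1 A)); \<alpha> = (\<lambda>A. snd (e1 A));
          b = (\<lambda>A. fst (e2 A)); \<beta> = (\<lambda>A. snd (e2 A))
      in \<forall>A\<in>U. fst (e3 A) = vf_bracket X a b A \<and>
           (\<forall>W. gsmooth X U X W \<longrightarrow>
              snd (e3 A) (W A) =
                lie_deriv X a \<beta> W A - ext_deriv X \<alpha> b W A - \<kappa> A (a A) (b A) (W A)))"

definition twisted_dirac_structure ::
    "'v::real_vector topology \<Rightarrow> 'v set \<Rightarrow> ('v \<Rightarrow> complex) topology \<Rightarrow>
     ('v \<Rightarrow> 'v \<Rightarrow> 'v \<Rightarrow> 'v \<Rightarrow> complex) \<Rightarrow> ('v \<Rightarrow> ('v \<times> ('v \<Rightarrow> complex)) set) \<Rightarrow> bool" where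
  "twisted_dirac_structure X U Y \<kappa> D \<longleftrightarrow>
     smooth_subbundle X U (prod_topology X Y) D \<and>
     (\<forall>A\<in>U. maximal_isotropic X Y (D A)) \<and>
     (\<forall>e1 e2. section_of X U (prod_topology X Y) D e1 \<and> section_of X U (prod_topology X Y) D e2 \<longrightarrow>
        (\<exists>e3. section_of X U (prod_topology X Y) D e3 \<and> is_courant_bracket X U \<kappa> e1 e2 e3))"


section \<open>Oriented Riemannian 3-manifolds\<close>

fun Ck :: "nat \<Rightarrow> (real^3) set \<Rightarrow> (real^3 \<Rightarrow> 'b::real_normed_vector) \<Rightarrow> bool" where
  "Ck 0 S f \<longleftrightarrow> continuous_on S f"
| "Ck (Suc k) S f \<longleftrightarrow> (\<forall>x\<in>S. f differentiable (at x)) \<and>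
     (\<forall>i. Ck k S (\<lambda>x. frechet_derivative f (at x) (axis i 1)))"

definition smooth3 :: "(real^3) set \<Rightarrow> (real^3 \<Rightarrow> 'b::real_normed_vector) \<Rightarrow> bool" where
  "smooth3 S f \<longleftrightarrow> (\<forall>k. Ck k S f)"

type_synonym 'm chart = "'m set \<times> ('m \<Rightarrow> real^3)"

abbreviation cdom :: "'m chart \<Rightarrow> 'm set" where "cdom c \<equiv> fst c"
abbreviation cmap :: "'m chart \<Rightarrow> 'm \<Rightarrow> real^3" where "cmap c \<equiv> snd c"

definition cinv :: "'m chart \<Rightarrow> real^3 \<Rightarrow> 'm" where "cinv c = inv_into (cdom c) (cmap c)"
definition cimg :: "'m chart \<Rightarrow> (real^3) set" where "cimg c = cmap c ` cdom c"

text \<open>\<open>jac c d p $ k $ i\<close> is the partial derivative of the k-th coordinate of \<open>d\<close> with respect to the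
  i-th coordinate of \<open>c\<close> at \<open>p\<close>.\<close>

definition jac :: "'m chart \<Rightarrow> 'm chart \<Rightarrow> 'm \<Rightarrow> real^3^3" where
  "jac c d p = matrix (frechet_derivative (\<lambda>x. cmap d (cinv c x)) (at (cmap c p)))"

definition oriented_atlas :: "'m::topological_space chart set \<Rightarrow> bool" where
  "oriented_atlas At \<longleftrightarrow>
     (\<forall>c\<in>At. open (cdom c) \<and> open (cimg c) \<and> homeomorphism (cdom c) (cimg c) (cmap c) (cinv c)) \<and>
     (\<Union>c\<in>At. cdom c) = UNIV \<and>
     (\<forall>c\<in>At. \<forall>d\<in>At. smooth3 (cmap c ` (cdom c \<inter> cdom d)) (\<lambda>x. cmap d (cinv c x))) \<and>
     (\<forall>c\<in>At. \<forall>d\<in>At. \<forall>p\<in>cdom c \<inter> cdom d. det (jac c d p) > 0)"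

definition riemannian_metric ::
    "'m chart set \<Rightarrow> ('m chart \<Rightarrow> 'm \<Rightarrow> real^3^3) \<Rightarrow> bool" where
  "riemannian_metric At g \<longleftrightarrow>
     (\<forall>c\<in>At. smooth3 (cimg c) (\<lambda>x. g c (cinv c x)) \<and>
        (\<forall>p\<in>cdom c. transpose (g c p) = g c p \<and> (\<forall>v. v \<noteq> 0 \<longrightarrow> v \<bullet> (g c p *v v) > 0))) \<and>
     (\<forall>c\<in>At. \<forall>d\<in>At. \<forall>p\<in>cdom c \<inter> cdom d.
        g c p = transpose (jac c d p) ** g d p ** jac c d p)"

definition compact_connected_oriented_riemannian_3manifold ::
    "'m::t2_space chart set \<Rightarrow> ('m chart \<Rightarrow> 'm \<Rightarrow> real^3^3) \<Rightarrow> bool" where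
  "compact_connected_oriented_riemannian_3manifold At g \<longleftrightarrow>
     compact (UNIV :: 'm set) \<and> connected (UNIV :: 'm set) \<and>
     oriented_atlas At \<and> riemannian_metric At g"


section \<open>Local Sobolev spaces\<close>

definition test_function :: "(real^3) set \<Rightarrow> (real^3 \<Rightarrow> real) \<Rightarrow> bool" where
  "test_function S \<phi> \<longleftrightarrow> smooth3 UNIV \<phi> \<and> (\<exists>K. compact K \<and> K \<subseteq> S \<and> (\<forall>x. x \<notin> K \<longrightarrow> \<phi> x = 0))"

definition weak_pd ::
    "(real^3) set \<Rightarrow> 3 \<Rightarrow> (real^3 \<Rightarrow> 'b::euclidean_space) \<Rightarrow> (real^3 \<Rightarrow> 'b) \<Rightarrow> bool" where
  "weak_pd S i f g \<longleftrightarrow> (\<forall>\<phi>. test_function S \<phi> \<longrightarrow>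
     (LINT x:S|lborel. frechet_derivative \<phi> (at x) (axis i 1) *\<^sub>R f x) =
       - (LINT x:S|lborel. \<phi> x *\<^sub>R g x))"

definition L2_loc :: "(real^3) set \<Rightarrow> (real^3 \<Rightarrow> 'b::euclidean_space) \<Rightarrow> bool" where
  "L2_loc S f \<longleftrightarrow> set_borel_measurable lborel S f \<and>
     (\<forall>K. compact K \<and> K \<subseteq> S \<longrightarrow> set_integrable lborel K (\<lambda>x. (norm (f x))\<^sup>2))"

fun sobolev_loc :: "nat \<Rightarrow> (real^3) set \<Rightarrow> (real^3 \<Rightarrow> 'b::euclidean_space) \<Rightarrow> bool" where
  "sobolev_loc 0 S f \<longleftrightarrow> L2_loc S f"
| "sobolev_loc (Suc k) S f \<longleftrightarrow> L2_loc S f \<and> (\<forall>i. \<exists>g. weak_pd S i f g \<and> sobolev_loc k S g)"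

text \<open>The squared Sobolev norm of order \<open>k\<close> over a compact \<open>K \<subseteq> S\<close>.  The weak derivative is unique
  almost everywhere, so that the choice made below does not matter.\<close>

fun sobolev_sq :: "nat \<Rightarrow> (real^3) set \<Rightarrow> (real^3) set \<Rightarrow> (real^3 \<Rightarrow> 'b::euclidean_space) \<Rightarrow> real" where
  "sobolev_sq 0 S K f = (LINT x:K|lborel. (norm (f x))\<^sup>2)"
| "sobolev_sq (Suc k) S K f = (LINT x:K|lborel. (norm (f x))\<^sup>2) +
     (\<Sum>i\<in>UNIV. sobolev_sq k S K (SOME g. weak_pd S i f g \<and> sobolev_loc k S g))"


section \<open>Matrix-valued forms\<close>

text \<open>A form assigns to a chart \<open>c\<close> and a point \<open>p\<close> of its domain its coefficients at \<open>p\<close> with respect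
  to the coordinates of \<open>c\<close>: \<open>a c p $ i = a(\<partial>\<^sub>i)\<close> for a 1-form and
  \<open>\<alpha> c p $ i $ j = \<alpha>(\<partial>\<^sub>i, \<partial>\<^sub>j)\<close> for a 2-form.  It vanishes by convention on
  all other arguments, so that equality of forms is equality of functions.\<close>

type_synonym 'n cmat = "complex^'n^'n"
type_synonym ('m, 'n) form1 = "'m chart \<Rightarrow> 'm \<Rightarrow> ('n cmat)^3"
type_synonym ('m, 'n) form2 = "'m chart \<Rightarrow> 'm \<Rightarrow> ('n cmat)^3^3"

definition su :: "('n::finite) cmat set" where
  "su = {X. (\<forall>i j. cnj (X $ j $ i) = - (X $ i $ j)) \<and> trace X = 0}"

definition supported_on_charts :: "'m chart set \<Rightarrow> ('m chart \<Rightarrow> 'm \<Rightarrow> 'b::zero) \<Rightarrow> bool" where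
  "supported_on_charts At \<omega> \<longleftrightarrow> (\<forall>c p. c \<notin> At \<or> p \<notin> cdom c \<longrightarrow> \<omega> c p = 0)"

text \<open>In dimension 3 every function of class \<open>L\<^sup>2\<^sub>k\<close> with \<open>k \<ge> 2\<close> has a unique continuous
  representative, by the Sobolev embedding theorem.  Elements of the Sobolev spaces
  are these representatives rather than classes modulo null sets.\<close>

definition sobolev_family ::
    "'m::topological_space chart set \<Rightarrow> nat \<Rightarrow> ('m chart \<Rightarrow> 'm \<Rightarrow> 'b::euclidean_space) \<Rightarrow> bool" where
  "sobolev_family At k \<omega> \<longleftrightarrow>
     (\<forall>c\<in>At. continuous_on (cdom c) (\<omega> c) \<and> sobolev_loc k (cimg c) (\<lambda>x. \<omega> c (cinv c x)))"

definition Omega0 :: "'m::t2_space chart set \<Rightarrow> nat \<Rightarrow> ('n::finite) cmat set \<Rightarrow> ('m \<Rightarrow> 'n cmat) set" where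
  "Omega0 At k \<V> = {\<xi>. (\<forall>p. \<xi> p \<in> \<V>) \<and> sobolev_family At k (\<lambda>_. \<xi>)}"

definition Omega1 :: "'m::t2_space chart set \<Rightarrow> nat \<Rightarrow> ('n::finite) cmat set \<Rightarrow> ('m, 'n) form1 set" where
  "Omega1 At k \<V> = {a. supported_on_charts At a \<and> sobolev_family At k a \<and>
     (\<forall>c\<in>At. \<forall>p\<in>cdom c. \<forall>i. a c p $ i \<in> \<V>) \<and>
     (\<forall>c\<in>At. \<forall>d\<in>At. \<forall>p\<in>cdom c \<inter> cdom d. \<forall>i.
        a c p $ i = (\<Sum>k\<in>UNIV. (jac c d p $ k $ i) *\<^sub>R (a d p $ k)))}"

definition Omega2 :: "'m::t2_space chart set \<Rightarrow> nat \<Rightarrow> ('n::finite) cmat set \<Rightarrow> ('m, 'n) form2 set" where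
  "Omega2 At k \<V> = {\<alpha>. supported_on_charts At \<alpha> \<and> sobolev_family At k \<alpha> \<and>
     (\<forall>c\<in>At. \<forall>p\<in>cdom c. \<forall>i j. \<alpha> c p $ i $ j \<in> \<V> \<and> \<alpha> c p $ i $ j = - (\<alpha> c p $ j $ i)) \<and>
     (\<forall>c\<in>At. \<forall>d\<in>At. \<forall>p\<in>cdom c \<inter> cdom d. \<forall>i j.
        \<alpha> c p $ i $ j =
          (\<Sum>k\<in>UNIV. \<Sum>l\<in>UNIV. (jac c d p $ k $ i * jac c d p $ l $ j) *\<^sub>R (\<alpha> d p $ k $ l)))}"

definition sobolev_topology ::
    "'m chart set \<Rightarrow> nat \<Rightarrow> ('m chart \<Rightarrow> 'm \<Rightarrow> 'b::euclidean_space) set \<Rightarrow>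
     ('m chart \<Rightarrow> 'm \<Rightarrow> 'b) topology" where
  "sobolev_topology At k \<F> = topology_generated_by
     {{\<eta>\<in>\<F>. sobolev_sq k (cimg c) K (\<lambda>x. (\<eta> - \<omega>) c (cinv c x)) < r} | \<omega> c K r.
        \<omega> \<in> \<F> \<and> c \<in> At \<and> compact K \<and> K \<subseteq> cimg c \<and> 0 < r}"

text \<open>\<open>(a \<and> b)(u, v) = a(u) b(v) - a(v) b(u)\<close> with matrix products.\<close>

definition wedge11 :: "('m, 'n::finite) form1 \<Rightarrow> ('m, 'n) form1 \<Rightarrow> ('m, 'n) form2" where
  "wedge11 a b = (\<lambda>c p. \<chi> i j. a c p $ i ** b c p $ j - a c p $ j ** b c p $ i)"

text \<open>A 3-form is given by its coefficient \<open>\<omega>(\<partial>\<^sub>1, \<partial>\<^sub>2, \<partial>\<^sub>3)\<close>.\<close>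

definition wedge21 :: "('m, 'n::finite) form2 \<Rightarrow> ('m, 'n) form1 \<Rightarrow> 'm chart \<Rightarrow> 'm \<Rightarrow> 'n cmat" where
  "wedge21 \<alpha> a = (\<lambda>c p. \<alpha> c p $ 1 $ 2 ** a c p $ 3 + \<alpha> c p $ 2 $ 3 ** a c p $ 1
                        + \<alpha> c p $ 3 $ 1 ** a c p $ 2)"

text \<open>The integral of a 3-form: the manifold is cut into finitely many disjoint Borel pieces, each
  inside a compact subset of a chart of the oriented atlas, and the coefficients are integrated
  over the coordinate images of the pieces.  By the change of variables formula the result does
  not depend on the pieces.\<close>

definition compact_cover :: "'m::topological_space chart set \<Rightarrow> ('m chart \<times> 'm set) list \<Rightarrow> bool" where
  "compact_cover At cs \<longleftrightarrow>
     (\<forall>(c, K)\<in>set cs. c \<in> At \<and> compact K \<and> K \<subseteq> cdom c) \<and> (\<Union>(c, K)\<in>set cs. K) = UNIV"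

definition integral3 :: "'m::topological_space chart set \<Rightarrow> ('m chart \<Rightarrow> 'm \<Rightarrow> complex) \<Rightarrow> complex" where
  "integral3 At \<omega> =
     (let cs = (SOME cs. compact_cover At cs)
      in \<Sum>j<length cs.
           let c = fst (cs ! j); P = snd (cs ! j) - (\<Union>i<j. snd (cs ! i))
           in LINT x:(cmap c ` P)|lborel. \<omega> c (cinv c x))"

definition integral_tr :: "'m::t2_space chart set \<Rightarrow> ('m chart \<Rightarrow> 'm \<Rightarrow> ('n::finite) cmat) \<Rightarrow> complex" where
  "integral_tr At \<omega> = integral3 At (\<lambda>c p. trace (\<omega> c p))"


section \<open>The space of irreducible connections\<close>

text \<open>Throughout, \<open>s\<close> is the Sobolev order of 0-forms; connections are of class \<open>L\<^sup>2\<^sub>s\<^sub>-\<^sub>1\<close>.\<close>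

definition tangent_top :: "'m::t2_space chart set \<Rightarrow> nat \<Rightarrow> ('m, 'n::finite) form1 topology" where
  "tangent_top At s = sobolev_topology At (s - 1) (Omega1 At (s - 1) su)"

text \<open>\<open>d\<^sub>A \<xi> = d\<xi> + [A, \<xi>] = 0\<close>\<close>

definition covariantly_constant ::
    "'m::t2_space chart set \<Rightarrow> ('m, 'n::finite) form1 \<Rightarrow> ('m \<Rightarrow> 'n cmat) \<Rightarrow> bool" where
  "covariantly_constant At A \<xi> \<longleftrightarrow> (\<forall>c\<in>At. \<forall>i.
     weak_pd (cimg c) i (\<lambda>x. \<xi> (cinv c x))
       (\<lambda>x. - (A c (cinv c x) $ i ** \<xi> (cinv c x) - \<xi> (cinv c x) ** A c (cinv c x) $ i)))"

text \<open>A connection is irreducible if \<open>d\<^sub>A\<close> is injective on \<open>\<Omega>\<^sup>0\<^sub>s(M, su(n))\<close>.\<close>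

definition irreducible_connections ::
    "'m::t2_space chart set \<Rightarrow> nat \<Rightarrow> ('m, 'n::finite) form1 set" where
  "irreducible_connections At s = {A \<in> Omega1 At (s - 1) su.
     \<forall>\<xi>\<in>Omega0 At s su. covariantly_constant At A \<xi> \<longrightarrow> (\<forall>p. \<xi> p = 0)}"

definition pairing :: "'m::t2_space chart set \<Rightarrow> ('m, 'n::finite) form2 \<Rightarrow> ('m, 'n) form1 \<Rightarrow> complex" where
  "pairing At \<alpha> a = complex_of_real (1 / (24 * pi^3)) * integral_tr At (wedge21 \<alpha> a)"

text \<open>The 2-form \<open>\<alpha>\<close> as a cotangent vector.\<close>

definition covector ::
    "'m::t2_space chart set \<Rightarrow> nat \<Rightarrow> ('m, 'n::finite) form2 \<Rightarrow> ('m, 'n) form1 \<Rightarrow> complex" where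
  "covector At s \<alpha> = (\<lambda>a. if a \<in> Omega1 At (s - 1) su then pairing At \<alpha> a else 0)"

text \<open>The cotangent space consists of the functionals \<open>\<langle>\<alpha> | \<cdot>\<rangle>\<close> with \<open>\<alpha>\<close> a matrix-valued 2-form of class
  \<open>L\<^sup>2\<^sub>s\<^sub>-\<^sub>1\<close>, with the quotient topology.  Arbitrary complex matrices are admitted as values
  because \<open>A \<and> a - a \<and> A\<close> takes its values in the Hermitian matrices and not in \<open>su(n)\<close>.  Forms that
  differ by a multiple of the identity matrix give the same functional, so this is
  the complexification of \<open>\<Omega>\<^sup>2(M, su(n))\<close>.\<close>

definition cotangent_top ::
    "'m::t2_space chart set \<Rightarrow> nat \<Rightarrow> (('m, 'n::finite) form1 \<Rightarrow> complex) topology" where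
  "cotangent_top At s = topology (\<lambda>\<W>. \<W> \<subseteq> covector At s ` Omega2 At (s - 1) UNIV \<and>
     openin (sobolev_topology At (s - 1) (Omega2 At (s - 1) UNIV))
       {\<alpha> \<in> Omega2 At (s - 1) UNIV. covector At s \<alpha> \<in> \<W>})"

definition cartan_form ::
    "'m::t2_space chart set \<Rightarrow> ('m, 'n::finite) form1 \<Rightarrow> ('m, 'n) form1 \<Rightarrow> ('m, 'n) form1 \<Rightarrow>
     ('m, 'n) form1 \<Rightarrow> complex" where
  "cartan_form At A a b c = complex_of_real (1 / (8 * pi^3)) *
     integral_tr At (wedge21 (wedge11 a b - wedge11 b a) c)"

definition dirac_bundle ::
    "'m::t2_space chart set \<Rightarrow> nat \<Rightarrow> ('m, 'n::finite) form1 \<Rightarrow>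
     (('m, 'n) form1 \<times> (('m, 'n) form1 \<Rightarrow> complex)) set" where
  "dirac_bundle At s A =
     {(a, covector At s (wedge11 A a - wedge11 a A)) | a. a \<in> Omega1 At (s - 1) su}"

end

theory Submission
  imports Defs
begin

text \<open>
  The trilinear form \<open>T(A,b,c) = \<langle>A \<and> b - b \<and> A | c\<rangle>\<close> is totally antisymmetric, so the graphs are maximal isotropic,
  \<open>\<kappa> = 3 T\<close>, and expanding derivatives of sections \<open>T(A,a,\<cdot>)\<close> and \<open>T(A,b,\<cdot>)\<close> shows that their twisted bracket
  is \<open>([a,b], T(A,[a,b],\<cdot>))\<close>. Smoothness of the graph follows from continuity of the product on \<open>L\<^sup>2\<^sub>s\<^sub>-\<^sub>1\<close>, an algebra
  in dimension 3 because \<open>s - 1 \<ge> 2\<close>. Openness of the irreducible connections is proved by contradiction: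
  normalised parallel sections of reducible connections converging to \<open>A\<close> have constant norm, so along a subsequence
  they converge to a nonzero regular \<open>A\<close>-parallel section.
\<close>

section \<open>Topological vector spaces carried by subspaces\<close>

text \<open>The forms fill only a subspace of a function type, so their topology is a value, not a
  type class instance; calculus is done with \<open>limitin\<close>, and the analysis passes through
  seminorms. The bracket differentiates one vector field along another, so the direction moves with
  the base point. This calls for linearity of iterated directional derivatives in their oldest slot,
  which the definition of smoothness does not state and which is derived from joint continuity. The
  Sobolev seminorms are taken over compact subsets of charts, and product and embedding estimates
  bound the seminorm over \<open>K\<close> by seminorms over a possibly larger \<open>K'\<close>;
  the loss is harmless, as continuity may use any seminorm of the family. The cotangent space is a
  quotient; its quotient map is open, so sums and scalings descend. Openness of the base enters
  because smooth maps are defined on open sets only. The factor 3 in \<kappa> = 3 T is the ratio of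
  the normalisations 1/(8 pi^3) and 1/(24 pi^3), and it matches the three undifferentiated terms
  produced by the product rule.\<close>

definition tvs :: "'v::real_vector topology => bool" where
	"tvs T \<longleftrightarrow> subspace (topspace T) \<and>
		 continuous_map (prod_topology T T) T (\<lambda>(x, y). x + y) \<and>
		 continuous_map (prod_topology euclideanreal T) T (\<lambda>(r, x). r *\<^sub>R x)"

lemma limitin_Pair: assumes "limitin X f a G" "limitin Y g b G"
	shows "limitin (prod_topology X Y) (\<lambda>t. (f t, g t)) (a, b) G" using assms by (simp add: limitin_pairwise comp_def)

lemma limitin_continuous_map2: assumes "continuous_map (prod_topology X Y) Z (\<lambda>(x, y). h x y)"
		and "limitin X f a G" "limitin Y g b G" shows "limitin Z (\<lambda>t. h (f t) (g t)) (h a b) G"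
	using continuous_map_limit[OF assms(1) limitin_Pair[OF assms(2,3)]] by (simp add: comp_def)

lemma limitin_eventually_eq: assumes "limitin X f a G" "eventually (\<lambda>t. f t = g t) G" shows "limitin X g a G"
	using limitin_transform_eventually[OF assms(2,1)] .

lemma limitin_const: "a\<in>topspace X ==> limitin X (\<lambda>_. a) a G" by (simp add: limitin_def)

lemma tvs_subspace: "tvs T ==> subspace (topspace T)" by (simp add: tvs_def)

lemma tvs_add: "tvs T ==> x\<in>topspace T ==> y\<in>topspace T ==> x + y\<in>topspace T" using tvs_subspace subspace_add by blast

lemma tvs_scale: "tvs T ==> x\<in>topspace T ==> r *\<^sub>R x\<in>topspace T" using tvs_subspace subspace_scale by blast

lemma tvs_diff: "tvs T ==> x\<in>topspace T ==> y\<in>topspace T ==> x - y\<in>topspace T" using tvs_subspace subspace_diff by blast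

lemma tvs_0: "tvs T ==> 0\<in>topspace T" using tvs_subspace subspace_0 by blast

lemma limitin_add: assumes "tvs T" "limitin T f a G" "limitin T g b G" shows "limitin T (\<lambda>t. f t + g t) (a + b) G"
	using assms by (intro limitin_continuous_map2[where h = "(+)"]) (auto simp: tvs_def)

lemma limitin_scale: assumes "tvs T" "((r :: _ => real) \<longlongrightarrow> s) G" "limitin T f a G"
	shows "limitin T (\<lambda>t. r t *\<^sub>R f t) (s *\<^sub>R a) G"
	using assms by (intro limitin_continuous_map2[where h = scaleR]) (auto simp: tvs_def)

lemma limitin_diff: assumes "tvs T" "limitin T f a G" "limitin T g b G" shows "limitin T (\<lambda>t. f t - g t) (a - b) G"
	using limitin_add[OF assms(1,2) limitin_scale[OF assms(1) tendsto_const[of "-1"] assms(3)]] by simp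

lemma limitin_sum_list: assumes "tvs T" "\<And>i. i\<in>set is ==> limitin T (f i) (a i) G"
	shows "limitin T (\<lambda>t. \<Sum>i\<leftarrow>is. f i t) (\<Sum>i\<leftarrow>is. a i) G" using assms(2) proof (induction "is")
	case Nil
	thus ?case using tvs_0[OF assms(1)] by (simp add: limitin_const)
next
	case (Cons i js)
	thus ?case by (simp add: limitin_add[OF assms(1)])
qed

lemma continuous_map_sum_list: assumes "tvs T" "\<And>i. i\<in>set is ==> continuous_map X T (f i)"
	shows "continuous_map X T (\<lambda>x. \<Sum>i\<leftarrow>is. f i x)"
	using assms by (auto simp: continuous_map_atin intro!: limitin_sum_list)

lemma continuous_map_tvs_add: assumes "tvs T" "continuous_map X T f" "continuous_map X T g"
	shows "continuous_map X T (\<lambda>x. f x + g x)" using assms by (auto simp: continuous_map_atin intro!: limitin_add)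

lemma continuous_map_tvs_diff: assumes "tvs T" "continuous_map X T f" "continuous_map X T g"
	shows "continuous_map X T (\<lambda>x. f x - g x)" using assms by (auto simp: continuous_map_atin intro!: limitin_diff)

lemma continuous_map_compose2: assumes "continuous_map (prod_topology X Y) Z (\<lambda>(x, y). h x y)"
		and "continuous_map W X f" "continuous_map W Y g" shows "continuous_map W Z (\<lambda>w. h (f w) (g w))"
	using assms by (auto simp: continuous_map_atin[of W] intro!: limitin_continuous_map2[OF assms(1)])

lemma tvs_euclidean: "tvs (euclidean :: 'a::real_normed_vector topology)" unfolding tvs_def proof (intro conjI)
	show "continuous_map (prod_topology euclidean euclidean) euclidean (\<lambda>(x::'a, y). x + y)"
		by (auto simp: euclidean_product_topology case_prod_unfold intro!: continuous_intros)
	show "continuous_map (prod_topology euclideanreal euclidean) euclidean (\<lambda>(r, x::'a). r *\<^sub>R x)"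
		by (auto simp: euclidean_product_topology case_prod_unfold intro!: continuous_intros)
qed auto

lemma tvs_prod: assumes "tvs X" "tvs Y" shows "tvs (prod_topology X Y)" unfolding tvs_def proof (intro conjI)
	let ?u = "prod_topology X Y"
	show "subspace (topspace ?u)" using assms by (auto simp: tvs_def intro: subspace_Times)
	have 1: "continuous_map (prod_topology ?u ?u) X (\<lambda>z. fst (fst z))"
		and 2: "continuous_map (prod_topology ?u ?u) Y (\<lambda>z. snd (fst z))"
		and 3: "continuous_map (prod_topology ?u ?u) X (\<lambda>z. fst (snd z))"
		and 4: "continuous_map (prod_topology ?u ?u) Y (\<lambda>z. snd (snd z))"
		using continuous_map_compose[OF continuous_map_fst continuous_map_fst]
			continuous_map_compose[OF continuous_map_fst continuous_map_snd]
			continuous_map_compose[OF continuous_map_snd continuous_map_fst]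
			continuous_map_compose[OF continuous_map_snd continuous_map_snd] by (auto simp: comp_def)
	have "continuous_map (prod_topology ?u ?u) ?u
		(\<lambda>z. (fst (fst z) + fst (snd z), snd (fst z) + snd (snd z)))"
		using continuous_map_tvs_add[OF assms(1) 1 3] continuous_map_tvs_add[OF assms(2) 2 4] by (simp add: continuous_map_pairwise comp_def)
	thus "continuous_map (prod_topology ?u ?u) ?u
		(\<lambda>(x, y). x + y)" by (simp add: case_prod_unfold plus_prod_def)
	have 1: "continuous_map (prod_topology euclideanreal ?u) euclideanreal fst"
		and 2: "continuous_map (prod_topology euclideanreal ?u) X (\<lambda>z. fst (snd z))"
		and 3: "continuous_map (prod_topology euclideanreal ?u) Y (\<lambda>z. snd (snd z))"
		using continuous_map_compose[OF continuous_map_snd continuous_map_fst]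
			continuous_map_compose[OF continuous_map_snd continuous_map_snd] by (auto simp: comp_def intro: continuous_map_fst)
	have s: "continuous_map (prod_topology euclideanreal X) X (\<lambda>(r, x). r *\<^sub>R x)"
		"continuous_map (prod_topology euclideanreal Y) Y (\<lambda>(r, x). r *\<^sub>R x)" using assms by (auto simp: tvs_def)
	have "continuous_map (prod_topology euclideanreal ?u) ?u
		(\<lambda>z. (fst z *\<^sub>R fst (snd z), fst z *\<^sub>R snd (snd z)))"
		using continuous_map_compose2[OF s(1) 1 2] continuous_map_compose2[OF s(2) 1 3] by (simp add: continuous_map_pairwise comp_def)
	thus "continuous_map (prod_topology euclideanreal ?u) ?u
		(\<lambda>(r, x). r *\<^sub>R x)" by (simp add: case_prod_unfold scaleR_prod_def)
qed

section \<open>Topologies generated by seminorms\<close>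

text \<open>The generating sets are balls of a single seminorm about an arbitrary centre; finite
  intersections come from \<open>topology_generated_by\<close>. A nonempty family makes these balls
  cover \<open>F\<close>, so that \<open>topspace_eq\<close> holds.\<close>

locale seminorm_topology =
	fixes F :: "'v::real_vector set" and P :: "('v => real) set" and T :: "'v topology"
	assumes subspace_F: "subspace F" and nonempty: "P \<noteq> {}"
		and triangle: "\<And>p x y. p\<in>P ==> x\<in>F ==> y\<in>F ==> p (x + y) \<le> p x + p y"
		and scale: "\<And>p x r. p\<in>P ==> x\<in>F ==> p (r *\<^sub>R x) = \<bar>r\<bar> * p x"
		and topology_eq: "T = topology_generated_by
			{{y\<in>F. p (y - x) < r} | p x r. p\<in>P \<and> x\<in>F \<and> 0 < r}"
begin

lemma in_F: "x\<in>F ==> y\<in>F ==> x + y\<in>F" "x\<in>F ==> y\<in>F ==> x - y\<in>F"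
	"x\<in>F ==> r *\<^sub>R x\<in>F" "0\<in>F" using subspace_F by (auto intro: subspace_add subspace_diff subspace_scale subspace_0)

lemma seminorm_zero: "p\<in>P ==> p 0 = 0" using scale[of p 0 0] in_F by simp

lemma seminorm_nonneg: assumes "p\<in>P" "x\<in>F" shows "0 \<le> p x" proof -
	have "p (x + (-1) *\<^sub>R x) \<le> p x + p ((-1) *\<^sub>R x)" using assms in_F(3) by (intro triangle) blast+
	thus ?thesis using assms scale[of p x "-1"] seminorm_zero[of p] by simp
qed

lemma seminorm_diff_le: assumes "p\<in>P" "x\<in>F" "y\<in>F" shows "p (x - y) \<le> p x + p y"
	using triangle[of p x "(-1) *\<^sub>R y"] scale[of p y "-1"] assms in_F(3)[of y "-1"] by simp

lemma seminorm_triangle: assumes "p\<in>P" "x\<in>F" "y\<in>F" "z\<in>F" shows "p (x - z) \<le> p (x - y) + p (y - z)"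
	using triangle[of p "x - y" "y - z"] assms in_F by simp

lemma topspace_eq: "topspace T = F" proof -
	obtain p where p: "p\<in>P" using nonempty by blast
	show ?thesis unfolding topology_eq topology_generated_by_topspace proof
		show "F\<subseteq>\<Union> {{y\<in>F. p (y - x) < r} | p x r. p\<in>P \<and> x\<in>F \<and> 0 < r}" proof
			fix x assume x: "x\<in>F"
			hence "x\<in>{y\<in>F. p (y - x) < 1}" using seminorm_zero[OF p] by simp
			moreover have "{y\<in>F. p (y - x) < 1}\<in>{{y\<in>F. p (y - x) < r} | p x r. p\<in>P \<and> x\<in>F \<and> 0 < r}"
				using p x zero_less_one by blast
			ultimately show "x\<in>\<Union> {{y\<in>F. p (y - x) < r} | p x r. p\<in>P \<and> x\<in>F \<and> 0 < r}" by (rule UnionI[rotated])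
		qed
	qed blast
qed

lemma openin_ball: "p\<in>P ==> x\<in>F ==> 0 < r ==> openin T {y\<in>F. p (y - x) < r}" unfolding topology_eq
	by (rule topology_generated_by_Basis, rule CollectI, rule exI[of _ p], rule exI[of _ x], rule exI[of _ r]) simp

text \<open>Reduces continuity to convergence of real functions. For the converse, induct over the
  generation of an open set: if \<open>l\<close> lies in a ball about \<open>x\<close>, the triangle
  inequality leaves the margin \<open>r - p (l - x)\<close> around \<open>l\<close>.\<close>

lemma limitin_iff:
	"limitin T f l G \<longleftrightarrow> l\<in>F \<and> eventually (\<lambda>t. f t\<in>F) G \<and> (\<forall>p\<in>P. ((\<lambda>t. p (f t - l)) \<longlongrightarrow> 0) G)"
proof
	assume L: "limitin T f l G"
	hence l: "l\<in>F" using limitin_topspace[of T f l G] by (simp only: topspace_eq)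
	have ev: "eventually (\<lambda>t. f t\<in>F) G" using L openin_topspace[of T] l unfolding limitin_def topspace_eq by auto
	have "((\<lambda>t. p (f t - l)) \<longlongrightarrow> 0) G" if p: "p\<in>P" for p proof (rule tendstoI)
		fix e :: real assume "0 < e"
		hence "openin T {y\<in>F. p (y - l) < e}" "l\<in>{y\<in>F. p (y - l) < e}" using l openin_ball[OF p l] seminorm_zero[OF p] by auto
		hence "eventually (\<lambda>t. f t\<in>{y\<in>F. p (y - l) < e}) G" using L unfolding limitin_def by blast
		thus "eventually (\<lambda>t. dist (p (f t - l)) 0 < e) G"
			by eventually_elim (use seminorm_nonneg[OF p in_F(2)[OF _ l]] in \<open>auto simp: dist_real_def\<close>)
	qed
	with l ev show "l\<in>F \<and> eventually (\<lambda>t. f t\<in>F) G \<and> (\<forall>p\<in>P. ((\<lambda>t. p (f t - l)) \<longlongrightarrow> 0) G)" by blast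
next
	assume R: "l\<in>F \<and> eventually (\<lambda>t. f t\<in>F) G \<and> (\<forall>p\<in>P. ((\<lambda>t. p (f t - l)) \<longlongrightarrow> 0) G)"
	have "eventually (\<lambda>t. f t\<in>U) G"
		if "generate_topology_on {{y\<in>F. p (y - x) < r} | p x r. p\<in>P \<and> x\<in>F \<and> 0 < r} U" "l\<in>U" for U
		using that proof (induction rule: generate_topology_on.induct)
		case Empty
		thus ?case by simp
	next
		case (Int a b)
		thus ?case by (simp add: eventually_conj)
	next
		case (UN K)
		then obtain k where "k\<in>K" "l\<in>k" by blast
		with UN have "eventually (\<lambda>t. f t\<in>k) G" by blast
		thus ?case by eventually_elim (use \<open>k\<in>K\<close> in blast)
	next
		case (Basis s)
		then obtain p x r where s: "s = {y\<in>F. p (y - x) < r}" "p\<in>P" "x\<in>F" "0 < r" by blast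
		hence "p (l - x) < r" using Basis by simp
		moreover have "((\<lambda>t. p (f t - l)) \<longlongrightarrow> 0) G" using R s by blast
		ultimately have "eventually (\<lambda>t. p (f t - l) < r - p (l - x)) G" by (intro order_tendstoD(2)) auto
		moreover have "eventually (\<lambda>t. f t\<in>F) G" using R by blast
		ultimately show ?case by eventually_elim (use s R seminorm_triangle[of p _ l x] in force)
	qed
	thus "limitin T f l G" using R topspace_eq unfolding limitin_def topology_eq openin_topology_generated_by_iff by auto
qed

lemma tvs: "tvs T" unfolding tvs_def proof (intro conjI)
	let ?u = "prod_topology euclideanreal T"
	show "subspace (topspace T)" by (simp add: topspace_eq subspace_F)
	show "continuous_map (prod_topology T T) T (\<lambda>(x, y). x + y)" unfolding continuous_map_atin proof
		fix z assume z: "z\<in>topspace (prod_topology T T)"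
		then obtain a b where ab: "z = (a, b)" "a\<in>F" "b\<in>F" by (auto simp: topspace_eq)
		let ?G = "atin (prod_topology T T) z"
		have 1: "limitin T fst a ?G" "limitin T snd b ?G" using z ab continuous_map_fst continuous_map_snd by (auto intro!: limitin_continuous_map)
		hence ev: "eventually (\<lambda>t. fst t\<in>F \<and> snd t\<in>F) ?G" unfolding limitin_iff by (auto simp: eventually_conj_iff)
		have "((\<lambda>t. p ((fst t + snd t) - (a + b))) \<longlongrightarrow> 0) ?G" if p: "p\<in>P" for p proof (rule tendsto_sandwich)
			show "eventually (\<lambda>t. 0 \<le> p ((fst t + snd t) - (a + b))) ?G"
				using ev by eventually_elim (use p ab in_F seminorm_nonneg in auto)
			show "eventually (\<lambda>t. p ((fst t + snd t) - (a + b)) \<le> p (fst t - a) + p (snd t - b)) ?G" using ev proof eventually_elim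
				case (elim t)
				thus ?case using triangle[of p "fst t - a" "snd t - b"] p ab in_F by (simp add: algebra_simps)
			qed
			show "((\<lambda>t. p (fst t - a) + p (snd t - b)) \<longlongrightarrow> 0) ?G"
				using 1 p unfolding limitin_iff by (auto intro!: tendsto_eq_intros)
		qed simp
		thus "limitin T (\<lambda>(x, y). x + y) (case z of (x, y) => x + y) ?G" unfolding limitin_iff using ab ev in_F
			by (auto simp: case_prod_unfold elim!: eventually_mono)
	qed
	show "continuous_map ?u T (\<lambda>(r, x). r *\<^sub>R x)" unfolding continuous_map_atin proof
		fix z assume z: "z\<in>topspace ?u"
		then obtain a b where ab: "z = (a, b)" "b\<in>F" by (auto simp: topspace_eq)
		let ?G = "atin ?u z"
		have 1: "limitin euclideanreal fst a ?G" "limitin T snd b ?G"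
			using limitin_continuous_map[OF continuous_map_fst z] limitin_continuous_map[OF continuous_map_snd z] ab by simp_all
		hence ev: "eventually (\<lambda>t. snd t\<in>F) ?G" unfolding limitin_iff by auto
		have "((\<lambda>t. p (fst t *\<^sub>R snd t - a *\<^sub>R b)) \<longlongrightarrow> 0) ?G" if p: "p\<in>P" for p
		proof (rule tendsto_sandwich)
			show "eventually (\<lambda>t. 0 \<le> p (fst t *\<^sub>R snd t - a *\<^sub>R b)) ?G"
				using ev by eventually_elim (use p ab in_F seminorm_nonneg in auto)
			show "eventually (\<lambda>t. p (fst t *\<^sub>R snd t - a *\<^sub>R b)
					\<le> \<bar>fst t\<bar> * p (snd t - b) + \<bar>fst t - a\<bar> * p b) ?G" using ev proof eventually_elim
				case (elim t)
				hence "p (fst t *\<^sub>R (snd t - b) + (fst t - a) *\<^sub>R b) \<le> p (fst t *\<^sub>R (snd t - b)) + p ((fst t - a) *\<^sub>R b)"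
					using p ab in_F by (intro triangle) auto
				moreover have "p (fst t *\<^sub>R (snd t - b)) = \<bar>fst t\<bar> * p (snd t - b)" "p ((fst t - a) *\<^sub>R b) = \<bar>fst t - a\<bar> * p b"
					using ab elim in_F by (auto intro!: scale p)
				moreover have "fst t *\<^sub>R (snd t - b) + (fst t - a) *\<^sub>R b = fst t *\<^sub>R snd t - a *\<^sub>R b" by (simp add: algebra_simps)
				ultimately show ?case by simp
			qed
			show "((\<lambda>t. \<bar>fst t\<bar> * p (snd t - b) + \<bar>fst t - a\<bar> * p b) \<longlongrightarrow> 0) ?G" proof -
				have f: "(fst \<longlongrightarrow> a) ?G" using 1 by simp
				have g: "((\<lambda>t. p (snd t - b)) \<longlongrightarrow> 0) ?G" using 1 p unfolding limitin_iff by blast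
				have "((\<lambda>t. \<bar>fst t\<bar> * p (snd t - b) + \<bar>fst t - a\<bar> * p b) \<longlongrightarrow> \<bar>a\<bar> * 0 + \<bar>a - a\<bar> * p b) ?G"
					by (intro tendsto_intros f g)
				thus ?thesis by simp
			qed
		qed simp
		thus "limitin T (\<lambda>(r, x). r *\<^sub>R x) (case z of (r, x) => r *\<^sub>R x) ?G"
			unfolding limitin_iff using ab ev in_F by (auto simp: case_prod_unfold elim!: eventually_mono)
	qed
qed

lemma Hausdorff: assumes "\<And>x. x\<in>F ==> (\<And>p. p\<in>P ==> p x = 0) ==> x = 0"
	shows "Hausdorff_space T" unfolding Hausdorff_space_def topspace_eq proof (intro allI impI)
	fix x y assume xy: "x\<in>F \<and> y\<in>F \<and> x \<noteq> y"
	then obtain p where p: "p\<in>P" "p (x - y) \<noteq> 0" using assms[of "x - y"] in_F by auto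
	define r where "r = p (x - y)/2"
	have r: "0 < r" using p xy seminorm_nonneg[of p "x - y"] in_F unfolding r_def by force
	have xys: "p (x - y) = p (y - x)" using scale[of p "x - y" "-1"] p xy in_F by simp
	have "disjnt {z\<in>F. p (z - x) < r} {z\<in>F. p (z - y) < r}" proof -
		have False if "z\<in>F" "p (z - x) < r" "p (z - y) < r" for z proof -
			have "p (x - y) \<le> p (x - z) + p (z - y)" using seminorm_triangle p xy that by blast
			moreover have "p (x - z) = p (z - x)" using scale[of p "x - z" "-1"] p xy that in_F by simp
			ultimately show False using that unfolding r_def by simp
		qed
		thus ?thesis unfolding disjnt_def by blast
	qed
	moreover have "x\<in>{z\<in>F. p (z - x) < r}" "y\<in>{z\<in>F. p (z - y) < r}" using xy r seminorm_zero[OF p(1)] by auto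
	ultimately show "\<exists>U V. openin T U \<and> openin T V \<and> x\<in>U \<and> y\<in>V \<and> disjnt U V"
		using openin_ball[OF p(1) _ r] xy by blast
qed

text \<open>Mean value inequality in one seminorm, by Bolzano's principle instead of linear
  functionals: with a slightly larger slope \<open>e'\<close> the estimate holds on every short
  interval around a given point, and it adds up under concatenation.\<close>

lemma mean_value_seminorm:
	fixes \<gamma> :: "real => 'v" assumes p: "p\<in>P" and ab: "a \<le> b" and v: "v\<in>F"
		and \<gamma>: "\<And>t. a \<le> t ==> t \<le> b ==> \<gamma> t\<in>F"
		and der: "\<And>t. a \<le> t ==> t \<le> b ==> limitin T (\<lambda>h. (1/h) *\<^sub>R (\<gamma> (t + h) - \<gamma> t)) (\<gamma>' t) (at 0)"
		and bound: "\<And>t. a \<le> t ==> t \<le> b ==> p (\<gamma>' t - v) \<le> e"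
	shows "p (\<gamma> b - \<gamma> a - (b - a) *\<^sub>R v) \<le> e * (b - a)" proof (rule field_le_epsilon)
	let ?u = "\<lambda>y x. \<gamma> y - \<gamma> x - (y - x) *\<^sub>R v"
	let ?v = "\<lambda>h x. (1/h) *\<^sub>R (\<gamma> (x + h) - \<gamma> x) - \<gamma>' x"
	let ?w = "\<lambda>z x. \<gamma> z - \<gamma> x - (z - x) *\<^sub>R v"
	let ?a = "\<lambda>h x. (1/h) *\<^sub>R (\<gamma> (x + h) - \<gamma> x) - v"
	let ?b = "\<lambda>z y. \<gamma> z - \<gamma> y - (z - y) *\<^sub>R v"
	fix d :: real assume "0 < d"
	\<comment> \<open>The slack is spread over the interval; adding 1 to the length keeps the
	  denominator positive when \<open>a = b\<close>, and the total loss is at most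
	  \<open>d\<close>.\<close>
	define e' where "e' = e + d/(b - a + 1)"
	have e': "e < e'" unfolding e'_def using \<open>0 < d\<close> ab by simp
	define Q where "Q = (\<lambda>x y. a \<le> x \<and> y \<le> b \<longrightarrow> p (?u y x) \<le> e' * (y - x))"
	have "Q a b" proof (rule Bolzano[OF ab])
		fix x y z assume trans: "Q x y" "Q y z" "x \<le> y" "y \<le> z"
		show "Q x z" unfolding Q_def proof
			assume xz: "a \<le> x \<and> z \<le> b"
			hence F: "\<gamma> x\<in>F" "\<gamma> y\<in>F" "\<gamma> z\<in>F" using trans by (auto intro!: \<gamma>)
			have "p ((?u y x) + (?b z y))
				\<le> p (?u y x) + p (?b z y)" using F v in_F p by (intro triangle) auto
			also have "\<dots> \<le> e' * (y - x) + e' * (z - y)" using trans xz unfolding Q_def by (intro add_mono) auto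
			finally show "p (?w z x) \<le> e' * (z - x)" by (simp add: algebra_simps)
		qed
	next
		fix x assume local: "a \<le> x" "x \<le> b"
		have "limitin T (\<lambda>h. (1/h) *\<^sub>R (\<gamma> (x + h) - \<gamma> x)) (\<gamma>' x) (at 0)" using local der by simp
		hence lim: "((\<lambda>h. p (?v h x)) \<longlongrightarrow> 0) (at 0)" "\<gamma>' x\<in>F" using p unfolding limitin_iff by auto
		have "eventually (\<lambda>h. p (?v h x) < e' - e) (at 0)" using order_tendstoD(2)[OF lim(1)] e' by simp
		then obtain \<delta> where \<delta>: "0 < \<delta>" and
			D: "\<And>h. h \<noteq> 0 ==> \<bar>h\<bar> < \<delta> ==> p (?v h x) < e' - e" unfolding eventually_at by (auto simp: dist_real_def)
		have key: "p (\<gamma> (x + h) - \<gamma> x - h *\<^sub>R v) \<le> e' * \<bar>h\<bar>"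
			if h: "\<bar>h\<bar> < \<delta>" and r: "a \<le> x + h" "x + h \<le> b" for h proof (cases "h = 0")
			case True
			thus ?thesis using seminorm_zero[OF p] by simp
		next
			case False
			have F: "\<gamma> x\<in>F" "\<gamma> (x + h)\<in>F" using \<gamma> local r by auto
			have "p ((?v h x) + (\<gamma>' x - v))
				\<le> p (?v h x) + p (\<gamma>' x - v)" using F lim v in_F p by (intro triangle) auto
			also have "\<dots> \<le> (e' - e) + e" using D[OF False h] bound[of x] local by (intro add_mono) auto
			finally have 1: "p (?a h x) \<le> e'" by simp
			have mem: "(1/h) *\<^sub>R (\<gamma> (x + h) - \<gamma> x) - v\<in>F" by (intro in_F F v)
			have eq: "\<gamma> (x + h) - \<gamma> x - h *\<^sub>R v = h *\<^sub>R (?a h x)" using False by (simp add: algebra_simps)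
			have "p (\<gamma> (x + h) - \<gamma> x - h *\<^sub>R v) = \<bar>h\<bar> * p (?a h x)" unfolding eq by (rule scale[OF p mem])
			also have "\<dots> \<le> \<bar>h\<bar> * e'" using 1 by (intro mult_left_mono) auto
			finally show ?thesis by (simp add: mult.commute)
		qed
		\<comment> \<open>An interval containing x is cut at x, so \<open>key\<close> is used once with a
		  nonnegative and once with a nonpositive increment.\<close>
		show "\<exists>d>0. \<forall>y z. y \<le> x \<and> x \<le> z \<and> z - y < d \<longrightarrow> Q y z" unfolding Q_def
		proof (intro exI[of _ \<delta>] conjI \<delta> allI impI)
			fix y z assume yz: "y \<le> x \<and> x \<le> z \<and> z - y < \<delta>" "a \<le> y \<and> z \<le> b"
			have k1: "p (?w z x) \<le> e' * (z - x)" using key[of "z - x"] yz local by simp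
			have k2: "p (?u y x) \<le> e' * (x - y)" using key[of "y - x"] yz local abs_of_nonpos[of "y - x"] by simp
			have F: "\<gamma> x\<in>F" "\<gamma> y\<in>F" "\<gamma> z\<in>F" using yz local by (auto intro!: \<gamma>)
			have "p ((?w z x) - (?u y x))
				\<le> p (?w z x) + p (?u y x)" using F v in_F p by (intro seminorm_diff_le) auto
			also have "\<dots> \<le> e' * (z - x) + e' * (x - y)" by (intro add_mono k1 k2)
			also have "\<dots> = e' * (z - y)" by (simp add: algebra_simps)
			also have "(?w z x) - (?u y x) = \<gamma> z - \<gamma> y - (z - y) *\<^sub>R v" by (simp add: algebra_simps)
			finally show "p (?b z y) \<le> e' * (z - y)" .
		qed
	qed
	hence "p (\<gamma> b - \<gamma> a - (b - a) *\<^sub>R v) \<le> e' * (b - a)" unfolding Q_def by simp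
	also have "\<dots> = e * (b - a) + d * ((b - a)/(b - a + 1))" unfolding e'_def by (simp add: algebra_simps)
	also have "\<dots> \<le> e * (b - a) + d" using ab \<open>0 < d\<close> by (auto simp: divide_le_eq intro!: mult_left_le)
	finally show "p (\<gamma> b - \<gamma> a - (b - a) *\<^sub>R v) \<le> e * (b - a) + d" .
qed

end

section \<open>Michal-Bastiani calculus\<close>

abbreviation has_dderiv ::
		"'y::real_vector topology => ('x::real_vector => 'y) => 'x => 'x => 'y => bool" where
	"has_dderiv Y f A a l \<equiv> limitin Y (\<lambda>t::real. (1/t) *\<^sub>R (f (A + t *\<^sub>R a) - f A)) l (at 0)"

abbreviation jet_topology :: "'x topology => 'x set => nat => ('x\<times>(nat => 'x)) topology" where
	"jet_topology X U m \<equiv> prod_topology (subtopology X U) (product_topology (\<lambda>_. X) {..<m})"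

text \<open>The witness hidden in \<open>gsmooth\<close>, kept apart from the function so that
  derivatives can be exhibited explicitly. The newest direction stands at the head of the list, the
  oldest at its end.\<close>

definition smooth_tower ::
		"'x::real_vector topology => 'x set => 'y::real_vector topology => ('x list => 'x => 'y) => bool" where
	"smooth_tower X U Y D \<longleftrightarrow>
		 (\<forall>as\<in>lists (topspace X). \<forall>a\<in>topspace X. \<forall>A\<in>U.
				has_dderiv Y (D as) A a (D (a # as) A)) \<and>
		 (\<forall>m::nat. continuous_map
				(jet_topology X U m) Y
				(\<lambda>(A, h). D (map h [0..<m]) A))"

lemma gsmooth_iff_tower:
	"gsmooth X U Y f \<longleftrightarrow> openin X U \<and> (\<exists>D. (\<forall>A\<in>U. D [] A = f A) \<and> smooth_tower X U Y D)"
	unfolding gsmooth_def smooth_tower_def by blast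

lemma smooth_towerD: assumes "smooth_tower X U Y D" "as\<in>lists (topspace X)" "a\<in>topspace X" "A\<in>U"
	shows "has_dderiv Y (D as) A a (D (a # as) A)" using assms unfolding smooth_tower_def by blast

text \<open>Joint continuity is stated for functions on \<open>{..<m}\<close>; this is the form for
  a list of moving directions. Restricting \<open>?h\<close> and \<open>?l\<close> makes them
  extensional, as points of a product topology must be.\<close>

lemma smooth_tower_limitin: assumes D: "smooth_tower X U Y D" and U: "U\<subseteq>topspace X"
		and B: "limitin (subtopology X U) B A G"
		and xs: "length xs = length l" "\<And>i. i < length l ==> limitin X (xs ! i) (l ! i) G"
	shows "limitin Y (\<lambda>z. D (map (\<lambda>x. x z) xs) (B z)) (D l A) G" proof -
	let ?m = "length l"
	let ?h = "\<lambda>z. \<lambda>i\<in>{..<?m}. (xs ! i) z"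
	let ?l = "\<lambda>i\<in>{..<?m}. l ! i"
	have c: "continuous_map (prod_topology (subtopology X U) (product_topology (\<lambda>_. X) {..<?m})) Y
			(\<lambda>(A, h). D (map h [0..<?m]) A)" using D unfolding smooth_tower_def by blast
	have ev: "eventually (\<lambda>z. ?h z\<in>topspace (product_topology (\<lambda>_. X) {..<?m})) G" proof -
		have "eventually (\<lambda>z. (xs ! i) z\<in>topspace X) G" if "i < ?m" for i using xs(2)[OF that] unfolding limitin_def by blast
		hence "eventually (\<lambda>z. \<forall>i\<in>{..<?m}. (xs ! i) z\<in>topspace X) G" by (intro eventually_ball_finite) auto
		thus ?thesis by eventually_elim auto
	qed
	have "limitin (product_topology (\<lambda>_. X) {..<?m}) ?h ?l G" unfolding limitin_componentwise using ev xs(2) by auto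
	from limitin_continuous_map2[OF c B this]
	have "limitin Y (\<lambda>z. D (map (?h z) [0..<?m]) (B z)) (D (map ?l [0..<?m]) A) G" .
	moreover have "map (?h z) [0..<?m] = map (\<lambda>x. x z) xs" for z by (intro nth_equalityI) (auto simp: xs(1))
	moreover have "map ?l [0..<?m] = l" by (intro nth_equalityI) auto
	ultimately show ?thesis by simp
qed

lemma smooth_tower_topspace: assumes "smooth_tower X U Y D" "U\<subseteq>topspace X" "as\<in>lists (topspace X)" "A\<in>U"
	shows "D as A\<in>topspace Y" proof -
	have "limitin Y (\<lambda>z::nat. D (map (\<lambda>x. x z) (map (\<lambda>a _. a) as)) A) (D as A) sequentially"
		using assms by (intro smooth_tower_limitin[OF assms(1,2)])
			(auto simp: limitin_subtopology limitin_const subset_iff set_conv_nth)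
	thus ?thesis by (rule limitin_topspace)
qed

text \<open>Indices may be omitted or permuted in \<open>is\<close>, as happens when the Leibniz
  rule hands each factor only part of the directions.\<close>

lemma smooth_tower_continuous: assumes D: "smooth_tower X U Y D" and U: "U\<subseteq>topspace X" and "is": "set is\<subseteq>{..<m}"
	shows "continuous_map (jet_topology X U m) Y
			(\<lambda>(A, h). D (map h is) A)" unfolding continuous_map_atin proof
	let ?Z = "jet_topology X U m"
	fix z assume z: "z\<in>topspace ?Z"
	have 1: "limitin (subtopology X U) fst (fst z) (atin ?Z z)" using limitin_continuous_map[OF continuous_map_fst z] by simp
	have 2: "limitin (product_topology (\<lambda>_. X) {..<m}) snd (snd z) (atin ?Z z)"
		using limitin_continuous_map[OF continuous_map_snd z] by simp
	have "limitin Y (\<lambda>w. D (map (\<lambda>x. x w) (map (\<lambda>i w. snd w i) is)) (fst w)) (D (map (snd z) is) (fst z)) (atin ?Z z)"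
	proof (rule smooth_tower_limitin[OF D U 1])
		fix i assume "i < length (map (snd z) is)"
		hence "is ! i\<in>set is" by simp
		hence "is ! i\<in>{..<m}" using "is" by blast
		thus "limitin X (map (\<lambda>i w. snd w i) is ! i) (map (snd z) is ! i) (atin ?Z z)"
			using 2 \<open>i < length _\<close> unfolding limitin_componentwise by auto
	qed simp
	thus "limitin Y (\<lambda>(A, h). D (map h is) A) (case z of (A, h) => D (map h is) A) (atin ?Z z)" by (simp add: case_prod_unfold comp_def)
qed

lemma gsmoothE: assumes "gsmooth X U Y f"
	obtains D where "openin X U" "U\<subseteq>topspace X" "\<And>A. A\<in>U ==> D [] A = f A" "smooth_tower X U Y D"
	using assms openin_subset unfolding gsmooth_iff_tower by metis

lemma gsmooth_openin: "gsmooth X U Y f ==> openin X U" by (simp add: gsmooth_def)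

lemma gsmooth_cong: assumes "gsmooth X U Y f" "\<And>A. A\<in>U ==> f A = g A" shows "gsmooth X U Y g"
	using assms unfolding gsmooth_def by simp

lemma limitin_line: assumes "tvs X" "A\<in>topspace X" "a\<in>topspace X" "(r \<longlongrightarrow> s) G"
	shows "limitin X (\<lambda>t. A + r t *\<^sub>R a) (A + s *\<^sub>R a) G" using assms by (intro limitin_add limitin_scale limitin_const)

lemma limitin_line_open: assumes "tvs X" "openin X U" "A\<in>U" "a\<in>topspace X" "(r \<longlongrightarrow> 0) G"
	shows "limitin (subtopology X U) (\<lambda>t. A + r t *\<^sub>R a) A G" proof -
	have "A\<in>topspace X" using assms(2,3) openin_subset by blast
	from limitin_line[OF assms(1) this assms(4,5)]
	have "limitin X (\<lambda>t. A + r t *\<^sub>R a) A G" by simp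
	moreover from this have "eventually (\<lambda>t. A + r t *\<^sub>R a\<in>U) G" using assms(2,3) unfolding limitin_def by blast
	ultimately show ?thesis using assms(3) by (simp add: limitin_subtopology)
qed

lemma eventually_line_open: assumes "tvs X" "openin X U" "A\<in>U" "a\<in>topspace X" "(r \<longlongrightarrow> 0) G"
	shows "eventually (\<lambda>t. A + r t *\<^sub>R a\<in>U) G" using limitin_line_open[OF assms] by (simp add: limitin_subtopology)

text \<open>\<open>dderiv\<close> is a definite description, so it names the derivative where limits
  are unique; this is what the Hausdorff hypothesis provides.\<close>

lemma gsmooth_limit: assumes X: "tvs X" and f: "gsmooth X U Y f" and A: "A\<in>U" and a: "a\<in>topspace X"
		and H: "Hausdorff_space Y" shows "has_dderiv Y f A a (dderiv Y f A a)" proof -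
	obtain D where D: "openin X U" "U\<subseteq>topspace X" "\<And>A. A\<in>U ==> D [] A = f A" "smooth_tower X U Y D"
		by (rule gsmoothE[OF f]) (rule that)
	have L: "has_dderiv Y f A a (D [a] A)" proof (rule limitin_eventually_eq[OF smooth_towerD[OF D(4) _ a A, of "[]"]])
		show "\<forall>\<^sub>F t in at 0. (1/t) *\<^sub>R (D [] (A + t *\<^sub>R a) - D [] A) = (1/t) *\<^sub>R (f (A + t *\<^sub>R a) - f A)"
			using eventually_line_open[OF X D(1) A a tendsto_ident_at] by eventually_elim (simp add: D(3) A)
	qed simp
	have "dderiv Y f A a = D [a] A" unfolding dderiv_def by (rule the_equality, rule L, erule limitin_Hausdorff_unique[OF _ L _ H]) simp
	thus ?thesis using L by simp
qed

lemma dderiv_eqI: assumes "has_dderiv Y f A a l" "Hausdorff_space Y" shows "dderiv Y f A a = l" unfolding dderiv_def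
	by (rule the_equality, rule assms(1), erule limitin_Hausdorff_unique[OF _ assms(1) _ assms(2)]) simp

lemma gsmooth_Pair: assumes "gsmooth X U Y f" "gsmooth X U Z g" shows "gsmooth X U (prod_topology Y Z) (\<lambda>A. (f A, g A))" proof -
	obtain D where D: "openin X U" "U\<subseteq>topspace X" "\<And>A. A\<in>U ==> D [] A = f A" "smooth_tower X U Y D"
		by (rule gsmoothE[OF assms(1)]) (rule that)
	obtain E where E: "openin X U" "U\<subseteq>topspace X" "\<And>A. A\<in>U ==> E [] A = g A" "smooth_tower X U Z E"
		by (rule gsmoothE[OF assms(2)]) (rule that)
	have "smooth_tower X U (prod_topology Y Z) (\<lambda>as A. (D as A, E as A))" using D(4) E(4) unfolding smooth_tower_def
		by (auto simp: limitin_pairwise continuous_map_pairwise comp_def case_prod_unfold)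
	thus ?thesis unfolding gsmooth_iff_tower using D(1,3) E(3) by (intro conjI exI[of _ "\<lambda>as A. (D as A, E as A)"]) auto
qed

lemma gsmooth_linear_compose: assumes X: "tvs X" and Y: "tvs Y" and f: "gsmooth X U Y f"
		and L: "continuous_map Y Z L" "linear_on_set (topspace Y) L" shows "gsmooth X U Z (\<lambda>A. L (f A))" proof -
	obtain D where D: "openin X U" "U\<subseteq>topspace X" "\<And>A. A\<in>U ==> D [] A = f A" "smooth_tower X U Y D"
		by (rule gsmoothE[OF f]) (rule that)
	have La: "L (x + y) = L x + L y" if "x\<in>topspace Y" "y\<in>topspace Y" for x y using L(2) that unfolding linear_on_set_def by blast
	have Ls: "L (r *\<^sub>R x) = r *\<^sub>R L x" if "x\<in>topspace Y" for x r using L(2) that unfolding linear_on_set_def by blast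
	have Ld: "L (x - y) = L x - L y" if "x\<in>topspace Y" "y\<in>topspace Y" for x y
		using La[of x "(-1) *\<^sub>R y"] Ls[of y "-1"] tvs_scale[OF Y, of y "-1"] that by simp
	have "smooth_tower X U Z (\<lambda>as A. L (D as A))" unfolding smooth_tower_def proof (intro conjI ballI allI)
		fix as a A assume as: "as\<in>lists (topspace X)" "a\<in>topspace X" "A\<in>U"
		show "limitin Z (\<lambda>t. (1/t) *\<^sub>R (L (D as (A + t *\<^sub>R a)) - L (D as A))) (L (D (a # as) A)) (at 0)"
		proof (rule limitin_eventually_eq[OF continuous_map_limit[OF L(1) smooth_towerD[OF D(4) as]]])
			show "\<forall>\<^sub>F t in at 0. (L \<circ> (\<lambda>t. (1/t) *\<^sub>R (D as (A + t *\<^sub>R a) - D as A))) t =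
							(1/t) *\<^sub>R (L (D as (A + t *\<^sub>R a)) - L (D as A))"
				using eventually_line_open[OF X D(1) as(3,2) tendsto_ident_at] proof eventually_elim
				case (elim t)
				have "D as (A + t *\<^sub>R a)\<in>topspace Y" "D as A\<in>topspace Y" using smooth_tower_topspace[OF D(4,2) as(1)] elim as(3) by auto
				thus ?case by (simp only: o_def Ld Ls tvs_diff[OF Y])
			qed
		qed
	next
		fix m :: nat
		have "continuous_map (jet_topology X U m) Y
				(\<lambda>(A, h). D (map h [0..<m]) A)" using D(4) unfolding smooth_tower_def by blast
		from continuous_map_compose[OF this L(1)]
		show "continuous_map (jet_topology X U m) Z
				(\<lambda>(A, h). L (D (map h [0..<m]) A))" by (simp add: case_prod_unfold comp_def)
	qed
	thus ?thesis unfolding gsmooth_iff_tower using D(1,3) by (intro conjI exI[of _ "\<lambda>as A. L (D as A)"]) auto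
qed

lemma continuous_map_fst_openin: assumes "openin X U" "continuous_map X Y f"
	shows "continuous_map (prod_topology (subtopology X U) Z) Y (\<lambda>(A, h). f A)"
	using continuous_map_compose[OF continuous_map_fst continuous_map_from_subtopology[OF assms(2)], of U Z]
	by (simp add: comp_def case_prod_unfold)

lemma gsmooth_linear: assumes X: "tvs X" and Y: "tvs Y" and U: "openin X U"
		and L: "continuous_map X Y L" "linear_on_set (topspace X) L" shows "gsmooth X U Y L" proof -
	define D where "D as A = (case as of [] => L A | [a] => L a | _ => 0)" for as A
	have La: "L (x + y) = L x + L y" if "x\<in>topspace X" "y\<in>topspace X" for x y using L(2) that unfolding linear_on_set_def by blast
	have Ls: "L (r *\<^sub>R x) = r *\<^sub>R L x" if "x\<in>topspace X" for x r using L(2) that unfolding linear_on_set_def by blast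
	have sub: "U\<subseteq>topspace X" using U by (rule openin_subset)
	have "smooth_tower X U Y D" unfolding smooth_tower_def proof (intro conjI ballI allI)
		fix as a A assume as: "as\<in>lists (topspace X)" "a\<in>topspace X" "A\<in>U"
		show "has_dderiv Y (D as) A a (D (a # as) A)" proof (cases "as = []")
			case True
			have A: "A\<in>topspace X" using as sub by blast
			have La': "L a\<in>topspace Y" using L(1) as(2) by (auto simp: continuous_map_def)
			have "eventually (\<lambda>t::real. L a = (1/t) *\<^sub>R (D as (A + t *\<^sub>R a) - D as A)) (at 0)"
				unfolding eventually_at using True by (intro exI[of _ 1]) (simp add: D_def La[OF A tvs_scale[OF X as(2)]] Ls[OF as(2)])
			from limitin_eventually_eq[OF limitin_const[OF La'] this] True show ?thesis by (simp add: D_def)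
		next
			case False
			then obtain b bs where "as = b # bs" by (cases as) auto
			hence "D as (A + t *\<^sub>R a) - D as A = 0" "D (a # as) A = 0" for t by (auto simp: D_def split: list.splits)
			thus ?thesis using limitin_const[OF tvs_0[OF Y]] by (simp add: scaleR_zero_right)
		qed
	next
		fix m :: nat
		let ?Z = "jet_topology X U m"
		consider "m = 0" | "m = 1" | k where "m = Suc (Suc k)" by (metis One_nat_def not0_implies_Suc)
		thus "continuous_map ?Z Y (\<lambda>(A, h). D (map h [0..<m]) A)" proof cases
			case 1
			thus ?thesis using continuous_map_fst_openin[OF U L(1)] by (simp add: D_def)
		next
			case 2
			have "continuous_map ?Z X (\<lambda>z. snd z 0)"
				using continuous_map_compose[OF continuous_map_snd continuous_map_product_projection, of 0 "{..<m}"] 2 by (auto simp: comp_def)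
			from continuous_map_compose[OF this L(1)] 2 show ?thesis by (simp add: comp_def case_prod_unfold D_def)
		next
			case 3
			have "D (map h [0..<m]) A = 0" for A and h :: "nat => 'a" by (simp add: D_def 3 upt_conv_Cons del: upt_Suc)
			thus ?thesis using tvs_0[OF Y] by (simp add: case_prod_unfold)
		qed
	qed
	thus ?thesis unfolding gsmooth_iff_tower using U by (intro conjI exI[of _ D]) (auto simp: D_def)
qed

text \<open>Both halves keep the order of the entries, so the newest direction stays at the head of
  whichever half receives it.\<close>

fun splits :: "'a list => ('a list\<times>'a list) list" where
	"splits [] = [([], [])]"
| "splits (a # as) = map (\<lambda>(x, y). (a # x, y)) (splits as) @ map (\<lambda>(x, y). (x, a # y)) (splits as)"

lemma splits_map: "splits (map h xs) = map (\<lambda>(x, y). (map h x, map h y)) (splits xs)" by (induction xs) (auto simp: case_prod_unfold)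

lemma splits_subset: "(x, y)\<in>set (splits as) ==> set x\<subseteq>set as \<and> set y\<subseteq>set as"
	by (induction as arbitrary: x y) (auto, blast+)

text \<open>The Leibniz rule: the derivatives of a product are sums over the splittings of the list of
	directions.\<close>

lemma gsmooth_splits:
	fixes X :: "'v::real_vector topology" and Y :: "'w::real_vector topology"
	assumes Y: "tvs Y" and U: "openin X U" and T: "\<And>A. A\<in>U ==> T [] [] A = f A"
		and der: "\<And>xs ys a A. xs\<in>lists (topspace X) ==> ys\<in>lists (topspace X) ==> a\<in>topspace X ==> A\<in>U ==>
			has_dderiv Y (T xs ys) A a (T (a # xs) ys A + T xs (a # ys) A)"
		and cont: "\<And>is js (m::nat). set is\<subseteq>{..<m} ==> set js\<subseteq>{..<m} ==>
			continuous_map (jet_topology X U m) Y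
				(\<lambda>(A, h). T (map h is) (map h js) A)" shows "gsmooth X U Y f" proof -
	define D where "D as A = (\<Sum>p\<leftarrow>splits as. T (fst p) (snd p) A)" for as A
	have sd: "(\<Sum>p\<leftarrow>ps. f p) - (\<Sum>p\<leftarrow>ps. g p) = (\<Sum>p\<leftarrow>ps. f p - g p)"
		for ps :: "('v list\<times>'v list) list" and f g :: "_ => 'w" by (induction ps) auto
	have ss: "r *\<^sub>R (\<Sum>p\<leftarrow>ps. f p) = (\<Sum>p\<leftarrow>ps. r *\<^sub>R f p)"
		for ps :: "('v list\<times>'v list) list" and f :: "_ => 'w" and r by (induction ps) (auto simp: scaleR_add_right)
	have sa: "(\<Sum>p\<leftarrow>ps. f p + g p) = (\<Sum>p\<leftarrow>ps. f p) + (\<Sum>p\<leftarrow>ps. g p)"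
		for ps :: "('v list\<times>'v list) list" and f g :: "_ => 'w" by (induction ps) auto
	have Dc: "D (a # as) A = (\<Sum>p\<leftarrow>splits as. T (a # fst p) (snd p) A + T (fst p) (a # snd p) A)" for a as A
		unfolding D_def sa by (simp add: comp_def case_prod_unfold)
	have "smooth_tower X U Y D" unfolding smooth_tower_def proof (intro conjI ballI allI)
		fix as a A assume as: "as\<in>lists (topspace X)" "a\<in>topspace X" "A\<in>U"
		have "limitin Y (\<lambda>t::real. \<Sum>p\<leftarrow>splits as. (1/t) *\<^sub>R (T (fst p) (snd p) (A + t *\<^sub>R a) - T (fst p) (snd p) A))
			(\<Sum>p\<leftarrow>splits as. T (a # fst p) (snd p) A + T (fst p) (a # snd p) A) (at 0)" proof (rule limitin_sum_list[OF Y])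
			fix p assume "p\<in>set (splits as)"
			hence "set (fst p)\<subseteq>set as" "set (snd p)\<subseteq>set as" using splits_subset[of "fst p" "snd p" as] by auto
			thus "has_dderiv Y (T (fst p) (snd p)) A a (T (a # fst p) (snd p) A + T (fst p) (a # snd p) A)" using as by (intro der) auto
		qed
		thus "has_dderiv Y (D as) A a (D (a # as) A)" unfolding Dc by (simp add: D_def sd ss)
	next
		fix m :: nat
		let ?Z = "jet_topology X U m"
		have "continuous_map ?Z Y (\<lambda>z. \<Sum>p\<leftarrow>splits [0..<m]. T (map (snd z) (fst p)) (map (snd z) (snd p)) (fst z))"
		proof (rule continuous_map_sum_list[OF Y])
			fix p assume "p\<in>set (splits [0..<m])"
			hence "set (fst p)\<subseteq>{..<m}" "set (snd p)\<subseteq>{..<m}" using splits_subset[of "fst p" "snd p" "[0..<m]"] by auto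
			from cont[OF this]
			show "continuous_map ?Z Y (\<lambda>z. T (map (snd z) (fst p)) (map (snd z) (snd p)) (fst z))" by (simp add: case_prod_unfold)
		qed
		thus "continuous_map ?Z Y (\<lambda>(A, h). D (map h [0..<m]) A)" by (simp add: D_def splits_map comp_def case_prod_unfold)
	qed
	thus ?thesis unfolding gsmooth_iff_tower using U T by (intro conjI exI[of _ D]) (auto simp: D_def)
qed

definition bilinear_on_sets ::
		"'a::real_vector set => 'b::real_vector set => ('a => 'b => 'c::real_vector) => bool" where
	"bilinear_on_sets S R B \<longleftrightarrow>
		 (\<forall>y\<in>R. linear_on_set S (\<lambda>x. B x y)) \<and> (\<forall>x\<in>S. linear_on_set R (B x))"

lemma linear_on_setD: assumes "linear_on_set S L" "subspace S" "x\<in>S" "y\<in>S"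
	shows "L (x + y) = L x + L y" "L (r *\<^sub>R x) = r *\<^sub>R L x" "L (x - y) = L x - L y" proof -
	show 1: "L (x + y) = L x + L y" "L (r *\<^sub>R x) = r *\<^sub>R L x" using assms unfolding linear_on_set_def by blast+
	have "L (x + (-1) *\<^sub>R y) = L x + (-1) *\<^sub>R L y" using assms subspace_scale[of S y "-1"] unfolding linear_on_set_def by metis
	thus "L (x - y) = L x - L y" by simp
qed

text \<open>Adding and subtracting \<open>B x y'\<close> separates the increments of the two
  arguments.\<close>

lemma bilinear_difference_quotient:
	fixes B :: "'a::real_vector => 'b::real_vector => 'c::real_vector" assumes B: "bilinear_on_sets S R B" "subspace S" "subspace R"
		and x: "x\<in>S" "x'\<in>S" "y\<in>R" "y'\<in>R"
	shows "r *\<^sub>R (B x' y' - B x y) = B (r *\<^sub>R (x' - x)) y' + B x (r *\<^sub>R (y' - y))" proof -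
	have 1: "B (r *\<^sub>R (x' - x)) y' = r *\<^sub>R (B x' y' - B x y')" using B x subspace_diff[OF B(2) x(2,1)] unfolding bilinear_on_sets_def
		by (simp add: linear_on_setD[where L = "\<lambda>x. B x y'" and S = S])
	have 2: "B x (r *\<^sub>R (y' - y)) = r *\<^sub>R (B x y' - B x y)" using B x subspace_diff[OF B(3) x(4,3)] unfolding bilinear_on_sets_def
		by (simp add: linear_on_setD[where L = "B x" and S = R])
	show ?thesis unfolding 1 2 by (simp add: algebra_simps)
qed

lemma bilinear_derivative:
	fixes f :: "real => 'a::real_vector" and g :: "real => 'b::real_vector" assumes Y: "tvs Y" and Z: "tvs Z" and W: "tvs W"
		and B: "bilinear_on_sets (topspace Y) (topspace Z) B" "continuous_map (prod_topology Y Z) W (\<lambda>(x, y). B x y)"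
		and f: "limitin Y (\<lambda>t. (1/t) *\<^sub>R (f t - f0)) f' (at 0)" "f0\<in>topspace Y" "eventually (\<lambda>t. f t\<in>topspace Y) (at 0)"
		and g: "limitin Z (\<lambda>t. (1/t) *\<^sub>R (g t - g0)) g' (at 0)" "g0\<in>topspace Z" "eventually (\<lambda>t. g t\<in>topspace Z) (at 0)"
	shows "limitin W (\<lambda>t. (1/t) *\<^sub>R (B (f t) (g t) - B f0 g0)) (B f' g0 + B f0 g') (at 0)" proof -
	let ?u = "\<lambda>t. (1/t) *\<^sub>R (g t - g0)"
	\<comment> \<open>Differentiability implies continuity because \<open>g t\<close> is
	  \<open>g0\<close> plus \<open>t\<close> times its difference quotient.\<close>
	have gl: "limitin Z g g0 (at 0)" proof (rule limitin_eventually_eq)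
		have "limitin Z (\<lambda>t. g0 + t *\<^sub>R (?u t)) (g0 + 0 *\<^sub>R g') (at 0)"
			by (intro limitin_add[OF Z] limitin_scale[OF Z] g limitin_const tendsto_ident_at)
		thus "limitin Z (\<lambda>t. g0 + t *\<^sub>R (?u t)) g0 (at 0)" by simp
		show "\<forall>\<^sub>F t in at 0. g0 + t *\<^sub>R (1/t) *\<^sub>R (g t - g0) = g t" unfolding eventually_at by (intro exI[of _ 1]) simp
	qed
	have "limitin W (\<lambda>t. B ((1/t) *\<^sub>R (f t - f0)) (g t) + B f0 (?u t)) (B f' g0 + B f0 g') (at 0)"
		by (intro limitin_add[OF W] limitin_continuous_map2[OF B(2)] f g gl limitin_const)
	thus ?thesis proof (rule limitin_eventually_eq)
		show "\<forall>\<^sub>F t in at 0. B ((1/t) *\<^sub>R (f t - f0)) (g t) + B f0 (?u t) =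
				(1/t) *\<^sub>R (B (f t) (g t) - B f0 g0)" using f(3) g(3) by eventually_elim
				(simp only: bilinear_difference_quotient[OF B(1) tvs_subspace[OF Y] tvs_subspace[OF Z]] f g)
	qed
qed

lemma gsmooth_bilinear: assumes X: "tvs X" and Y: "tvs Y" and Z: "tvs Z" and W: "tvs W"
		and f: "gsmooth X U Y f" and g: "gsmooth X U Z g"
		and B: "bilinear_on_sets (topspace Y) (topspace Z) B" "continuous_map (prod_topology Y Z) W (\<lambda>(x, y). B x y)"
	shows "gsmooth X U W (\<lambda>A. B (f A) (g A))" proof -
	obtain D where D: "openin X U" "U\<subseteq>topspace X" "\<And>A. A\<in>U ==> D [] A = f A" "smooth_tower X U Y D"
		by (rule gsmoothE[OF f]) (rule that)
	obtain E where E: "openin X U" "U\<subseteq>topspace X" "\<And>A. A\<in>U ==> E [] A = g A" "smooth_tower X U Z E"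
		by (rule gsmoothE[OF g]) (rule that)
	show ?thesis proof (rule gsmooth_splits[OF W D(1), where T = "\<lambda>xs ys A. B (D xs A) (E ys A)"])
		fix xs ys a A
		assume as: "xs\<in>lists (topspace X)" "ys\<in>lists (topspace X)" "a\<in>topspace X" "A\<in>U"
		have ev: "eventually (\<lambda>t::real. A + t *\<^sub>R a\<in>U) (at 0)" using eventually_line_open[OF X D(1) as(4,3) tendsto_ident_at] .
		show "limitin W (\<lambda>t. (1/t) *\<^sub>R (B (D xs (A + t *\<^sub>R a)) (E ys (A + t *\<^sub>R a)) - B (D xs A) (E ys A)))
				(B (D (a # xs) A) (E ys A) + B (D xs A) (E (a # ys) A)) (at 0)" proof (rule bilinear_derivative[OF Y Z W B])
			show "\<forall>\<^sub>F t in at 0. D xs (A + t *\<^sub>R a)\<in>topspace Y"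
				using ev by eventually_elim (use smooth_tower_topspace[OF D(4,2) as(1)] in blast)
			show "\<forall>\<^sub>F t in at 0. E ys (A + t *\<^sub>R a)\<in>topspace Z"
				using ev by eventually_elim (use smooth_tower_topspace[OF E(4) D(2) as(2)] in blast)
		qed (use smooth_towerD[OF D(4)] smooth_towerD[OF E(4)] smooth_tower_topspace[OF D(4,2)]
				smooth_tower_topspace[OF E(4) D(2)] as in auto)
	next
		fix "is" js :: "nat list" and m :: nat
		assume "is": "set is\<subseteq>{..<m}" and js: "set js\<subseteq>{..<m}"
		show "continuous_map (jet_topology X U m) W
				(\<lambda>(A, h). B (D (map h is) A) (E (map h js) A))"
			using continuous_map_compose2[OF B(2) smooth_tower_continuous[OF D(4,2) "is"] smooth_tower_continuous[OF E(4) D(2) js]]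
			by (simp add: case_prod_unfold)
	qed (simp add: D(3) E(3))
qed

lemma gsmooth_add: assumes "tvs X" "tvs Y" "gsmooth X U Y f" "gsmooth X U Y g" shows "gsmooth X U Y (\<lambda>A. f A + g A)"
	using gsmooth_linear_compose[OF assms(1) tvs_prod[OF assms(2,2)] gsmooth_Pair[OF assms(3,4)],
			where L = "\<lambda>(x, y). x + y" and Z = Y] assms(2) by (auto simp: tvs_def linear_on_set_def algebra_simps)

lemma gsmooth_diff: assumes "tvs X" "tvs Y" "gsmooth X U Y f" "gsmooth X U Y g" shows "gsmooth X U Y (\<lambda>A. f A - g A)" proof -
	have "continuous_map (prod_topology Y Y) Y (\<lambda>(x, y). x - y)"
		using continuous_map_tvs_diff[OF assms(2) continuous_map_fst continuous_map_snd] by (simp add: case_prod_unfold)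
	thus ?thesis using gsmooth_linear_compose[OF assms(1) tvs_prod[OF assms(2,2)] gsmooth_Pair[OF assms(3,4)],
				where L = "\<lambda>(x, y). x - y" and Z = Y] by (auto simp: linear_on_set_def algebra_simps)
qed

lemma gsmooth_fst: "tvs X ==> tvs Y ==> tvs Z ==> gsmooth X U (prod_topology Y Z) f ==> gsmooth X U Y (\<lambda>A. fst (f A))"
	by (rule gsmooth_linear_compose[OF _ tvs_prod]) (auto simp: linear_on_set_def continuous_map_fst)

lemma gsmooth_snd: "tvs X ==> tvs Y ==> tvs Z ==> gsmooth X U (prod_topology Y Z) f ==> gsmooth X U Z (\<lambda>A. snd (f A))"
	by (rule gsmooth_linear_compose[OF _ tvs_prod]) (auto simp: linear_on_set_def continuous_map_snd)

lemma limitin_filterlim_compose: assumes "limitin X f l G" "filterlim g G H" shows "limitin X (\<lambda>x. f (g x)) l H"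
	unfolding limitin_def proof (intro conjI allI impI)
	show "l\<in>topspace X" using assms(1) by (rule limitin_topspace)
	fix U assume "openin X U \<and> l\<in>U"
	hence "eventually (\<lambda>y. f y\<in>U) G" using assms(1) unfolding limitin_def by blast
	thus "eventually (\<lambda>x. f (g x)\<in>U) H" using assms(2) by (rule eventually_compose_filterlim)
qed

section \<open>Derivatives of vector fields along vector fields\<close>

context seminorm_topology
begin

text \<open>For a function \<open>\<phi> t\<close> that itself varies with \<open>t\<close>, the
  quotient over the step from 0 to \<open>t\<close> still converges: by the mean value inequality it
  is as close to \<open>l\<close> as the derivatives in between. The filter lets the step parameter
  \<open>snd z\<close> be 0 while \<open>fst z\<close> stays away from 0.\<close>

lemma mean_value_quotient:
	fixes \<phi> \<phi>' :: "real => real => 'v" assumes lim: "limitin T (\<lambda>z. \<phi>' (fst z) (snd z)) l (at 0 \<times>\<^sub>F nhds 0)"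
		and ev: "eventually (\<lambda>z. \<phi> (fst z) (snd z)\<in>F \<and>
			limitin T (\<lambda>h. (1/h) *\<^sub>R (\<phi> (fst z) (snd z + h) - \<phi> (fst z) (snd z))) (\<phi>' (fst z) (snd z)) (at 0))
			(at 0 \<times>\<^sub>F nhds 0)" shows "limitin T (\<lambda>t. (1/t) *\<^sub>R (\<phi> t t - \<phi> t 0)) l (at 0)" proof -
	let ?u = "\<lambda>t. (1/t) *\<^sub>R (\<phi> t t - \<phi> t 0) - l"
	let ?v = "at 0 \<times>\<^sub>F nhds 0"
	have l: "l\<in>F" using limitin_topspace[OF lim] topspace_eq by simp
	\<comment> \<open>An event of the product filter holds, for every \<open>t\<close> near 0, on an
	  interval of \<open>u\<close> whose radius does not depend on \<open>t\<close>; since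
	  \<open>\<bar>t\<bar> < \<delta>\<close>, this interval contains the segment from 0 to
	  \<open>t\<close>.\<close>
	have ev': "\<exists>\<delta>>0. eventually (\<lambda>t. t \<noteq> 0 \<and> \<bar>t\<bar> < \<delta> \<and> (\<forall>u. \<bar>u\<bar> < \<delta> \<longrightarrow> Q t u)) (at 0)"
		if "eventually (\<lambda>z. Q (fst z) (snd z)) ?v" for Q :: "real => real => bool" proof -
		obtain Pf Pg where P: "eventually Pf (at 0)" "eventually Pg (nhds 0)" "\<And>t u. Pf t ==> Pg u ==> Q t u"
			using \<open>eventually (\<lambda>z. Q (fst z) (snd z)) (at 0 \<times>\<^sub>F nhds 0)\<close> unfolding eventually_prod_filter by auto
		obtain \<delta> where \<delta>: "0 < \<delta>" "\<And>u. \<bar>u\<bar> < \<delta> ==> Pg u"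
			using P(2) unfolding eventually_nhds_metric by (auto simp: dist_real_def)
		have "eventually (\<lambda>t::real. t \<noteq> 0 \<and> \<bar>t\<bar> < \<delta>) (at 0)"
			unfolding eventually_at using \<delta>(1) by (intro exI[of _ \<delta>]) (simp add: dist_real_def)
		hence "eventually (\<lambda>t. t \<noteq> 0 \<and> \<bar>t\<bar> < \<delta> \<and> (\<forall>u. \<bar>u\<bar> < \<delta> \<longrightarrow> Q t u)) (at 0)"
			using P(1) by eventually_elim (simp add: P(3) \<delta>(2))
		thus ?thesis using \<delta>(1) by blast
	qed
	have inF: "eventually (\<lambda>t. (1/t) *\<^sub>R (\<phi> t t - \<phi> t 0)\<in>F) (at 0)" proof -
		obtain \<delta> where d: "0 < \<delta>" and "eventually (\<lambda>t. t \<noteq> 0 \<and> \<bar>t\<bar> < \<delta> \<and> (\<forall>u. \<bar>u\<bar> < \<delta> \<longrightarrow> \<phi> t u\<in>F \<and>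
				limitin T (\<lambda>h. (1/h) *\<^sub>R (\<phi> t (u + h) - \<phi> t u)) (\<phi>' t u) (at 0))) (at 0)" using ev'[OF ev] by blast
		from this(2) show ?thesis by eventually_elim (use d in \<open>auto intro!: in_F\<close>)
	qed
	have "((\<lambda>t. p (?u t)) \<longlongrightarrow> 0) (at 0)" if p: "p\<in>P" for p proof (rule tendstoI)
		fix e :: real assume e: "0 < e"
		have "((\<lambda>z. p (\<phi>' (fst z) (snd z) - l)) \<longlongrightarrow> 0) ?v" using lim p unfolding limitin_iff by blast
		hence "eventually (\<lambda>z. p (\<phi>' (fst z) (snd z) - l) < e/2) ?v" using e by (intro order_tendstoD(2)) auto
		with ev have "eventually (\<lambda>z. (\<phi> (fst z) (snd z)\<in>F \<and>
			limitin T (\<lambda>h. (1/h) *\<^sub>R (\<phi> (fst z) (snd z + h) - \<phi> (fst z) (snd z))) (\<phi>' (fst z) (snd z)) (at 0)) \<and>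
			p (\<phi>' (fst z) (snd z) - l) < e/2) ?v" by (rule eventually_conj)
		from ev'[OF this] obtain \<delta> where d: "0 < \<delta>" and ev2: "eventually (\<lambda>t. t \<noteq> 0 \<and> \<bar>t\<bar> < \<delta> \<and> (\<forall>u. \<bar>u\<bar> < \<delta> \<longrightarrow>
				(\<phi> t u\<in>F \<and> limitin T (\<lambda>h. (1/h) *\<^sub>R (\<phi> t (u + h) - \<phi> t u)) (\<phi>' t u) (at 0)) \<and>
				p (\<phi>' t u - l) < e/2)) (at 0)" by blast
		from ev2 show "eventually (\<lambda>t. dist (p (?u t)) 0 < e) (at 0)" proof eventually_elim
			case (elim t)
			have F: "\<phi> t t\<in>F" "\<phi> t 0\<in>F" using elim d by auto
			\<comment> \<open>Ordering the endpoints covers negative \<open>t\<close>; the sign disappears in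
			  the quotient.\<close>
			let ?a = "min 0 t" let ?b = "max 0 t" let ?w = "\<phi> t ?b - \<phi> t ?a - (?b - ?a) *\<^sub>R l"
			have ab: "0 < ?b - ?a" using elim by auto
			have "p ?w \<le> e/2 * (?b - ?a)" proof (rule mean_value_seminorm[OF p _ l, where \<gamma> = "\<phi> t" and \<gamma>' = "\<phi>' t"])
				fix s assume "?a \<le> s" "s \<le> ?b"
				hence s: "\<bar>s\<bar> < \<delta>" using elim by auto
				show "\<phi> t s\<in>F" using elim s by blast
				show "limitin T (\<lambda>h. (1/h) *\<^sub>R (\<phi> t (s + h) - \<phi> t s)) (\<phi>' t s) (at 0)" using elim s by blast
				show "p (\<phi>' t s - l) \<le> e/2" using elim s less_imp_le by blast
			qed simp
			moreover have mem: "?w\<in>F" using F by (intro in_F l) (auto simp: min_def max_def)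
			have "(1/t) *\<^sub>R (\<phi> t t - \<phi> t 0) - l = (1/(?b - ?a)) *\<^sub>R ?w"
				using elim by (cases "0 \<le> t") (simp_all add: min_def max_def scaleR_diff_right scaleR_add_right)
			hence "p (?u t) = p ?w/(?b - ?a)" using scale[OF p mem, of "1/(?b - ?a)"] ab by simp
			ultimately have "p (?u t) \<le> e/2" using ab by (simp add: divide_le_eq)
			moreover have "0 \<le> p (?u t)" by (intro seminorm_nonneg p in_F F l)
			ultimately show ?case using e by (simp add: dist_real_def)
		qed
	qed
	thus ?thesis unfolding limitin_iff using inF l by blast
qed

end

locale hausdorff_seminorm_topology = seminorm_topology + assumes separated: "\<And>x. x\<in>F ==> (\<And>p. p\<in>P ==> p x = 0) ==> x = 0"
begin

lemma Hausdorff_T: "Hausdorff_space T" using Hausdorff separated by blast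

lemma limit_unique: "limitin T f a G ==> limitin T f b G ==> G \<noteq> bot ==> a = b"
	using limitin_Hausdorff_unique[OF _ _ _ Hausdorff_T] by blast

text \<open>The last entry of the list is the direction differentiated first. A linear relation
  there persists under every further differentiation, because limits are linear and unique.\<close>

lemma tower_linear_last: assumes D: "smooth_tower T U T D" and U: "openin T U" and F: "x\<in>F" "y\<in>F" "z\<in>F"
		and base: "\<And>A. A\<in>U ==> D [z] A = r *\<^sub>R D [x] A + q *\<^sub>R D [y] A" and "as\<in>lists F" "A\<in>U"
	shows "D (as @ [z]) A = r *\<^sub>R D (as @ [x]) A + q *\<^sub>R D (as @ [y]) A" using assms(7,8) proof (induction as arbitrary: A)
	case (Cons a as)
	have AU: "A\<in>U" and a: "a\<in>topspace T" using Cons topspace_eq by auto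
	have d: "has_dderiv T (D (as @ [u])) A a (D (a # as @ [u]) A)" if "u\<in>F" for u
		using Cons that topspace_eq by (intro smooth_towerD[OF D _ _ AU]) auto
	have "limitin T (\<lambda>t. r *\<^sub>R (1/t) *\<^sub>R (D (as @ [x]) (A + t *\<^sub>R a) - D (as @ [x]) A) +
			q *\<^sub>R (1/t) *\<^sub>R (D (as @ [y]) (A + t *\<^sub>R a) - D (as @ [y]) A))
			(r *\<^sub>R D (a # as @ [x]) A + q *\<^sub>R D (a # as @ [y]) A) (at 0)"
		by (intro limitin_add[OF tvs] limitin_scale[OF tvs] d F tendsto_const)
	hence "has_dderiv T (D (as @ [z])) A a (r *\<^sub>R D (a # as @ [x]) A + q *\<^sub>R D (a # as @ [y]) A)"
		by (rule limitin_eventually_eq, intro eventually_mono[OF eventually_line_open[OF tvs U AU a tendsto_ident_at]])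
			(use Cons in \<open>simp add: algebra_simps\<close>)
	from limit_unique[OF d[OF F(3)] this] show ?case by simp
qed (simp add: base)

lemma tower_scale_last: assumes D: "smooth_tower T U T D" and U: "openin T U" and x: "x\<in>F" and as: "as\<in>lists F" "A\<in>U"
	shows "D (as @ [r *\<^sub>R x]) A = r *\<^sub>R D (as @ [x]) A" proof -
	have "D [r *\<^sub>R x] A = r *\<^sub>R D [x] A + 0 *\<^sub>R D [x] A" if AU: "A\<in>U" for A proof -
		have d: "has_dderiv T (D []) A u (D [u] A)" if "u\<in>F" for u using smooth_towerD[OF D _ _ AU, of "[]" u] that topspace_eq by simp
		have "has_dderiv T (D []) A (r *\<^sub>R x) (r *\<^sub>R D [x] A)" proof (cases "r = 0")
			case True
			thus ?thesis using in_F topspace_eq by (simp add: limitin_const)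
		next
			case False
			\<comment> \<open>For \<open>r = 0\<close> this substitution would leave the punctured
			  neighbourhood, hence the separate case.\<close>
			hence "filterlim (\<lambda>t. r * t) (at 0) (at (0::real))"
				by (auto simp: filterlim_at eventually_at intro!: tendsto_eq_intros exI[of _ 1])
			from limitin_scale[OF tvs tendsto_const limitin_filterlim_compose[OF d[OF x] this], of r]
			show ?thesis using False by (simp add: mult.commute)
		qed
		from limit_unique[OF d[OF in_F(3)[OF x]] this] show ?thesis by simp
	qed
	from tower_linear_last[OF D U x x in_F(3)[OF x] this as] show ?thesis by simp
qed

text \<open>Additivity of a directional derivative is not automatic; it follows from joint
  continuity of the first derivative. The step along \<open>x + y\<close> is made in two legs, and
  the second leg starts at the moving point \<open>A + t *\<^sub>R x\<close>, which is the situation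
  of \<open>mean_value_quotient\<close>.\<close>

lemma tower_add_last: assumes D: "smooth_tower T U T D" and U: "openin T U"
		and x: "x\<in>F" and y: "y\<in>F" and as: "as\<in>lists F" "A\<in>U" shows "D (as @ [x + y]) A = D (as @ [x]) A + D (as @ [y]) A" proof -
	note sub = openin_subset[OF U]
	have "D [x + y] A = 1 *\<^sub>R D [x] A + 1 *\<^sub>R D [y] A" if AU: "A\<in>U" for A proof -
		have xy: "x\<in>topspace T" "y\<in>topspace T" "x + y\<in>topspace T" "A\<in>topspace T" using x y in_F topspace_eq AU sub by auto
		have d: "has_dderiv T (D []) A u (D [u] A)" if "u\<in>topspace T" for u using smooth_towerD[OF D _ that AU, of "[]"] by simp
		let ?G = "at (0::real) \<times>\<^sub>F nhds (0::real)" and ?p = "\<lambda>t u. A + t *\<^sub>R x + u *\<^sub>R y"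
		have base: "limitin (subtopology T U) (\<lambda>z. ?p (fst z) (snd z)) A ?G" proof -
			have f: "((\<lambda>z. fst z) \<longlongrightarrow> (0::real)) ?G" "((\<lambda>z. snd z) \<longlongrightarrow> (0::real)) ?G"
				by (rule filterlim_mono[OF filterlim_fst at_within_le_nhds order_refl], rule filterlim_snd)
			have l: "limitin T (\<lambda>z. ?p (fst z) (snd z)) (?p 0 0) ?G" by (intro limitin_add[OF tvs] limitin_scale[OF tvs] limitin_const xy f)
			hence "eventually (\<lambda>z. ?p (fst z) (snd z)\<in>U) ?G" using U AU unfolding limitin_def by simp
			thus ?thesis using l AU by (simp add: limitin_subtopology)
		qed
		have Y: "limitin T (\<lambda>t. (1/t) *\<^sub>R (D [] (?p t t) - D [] (?p t 0))) (D [y] A) (at 0)"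
		proof (rule mean_value_quotient[where \<phi>' = "\<lambda>t u. D [y] (?p t u)"])
			have "limitin T (\<lambda>z. D (map (\<lambda>x. x z) [\<lambda>_. y]) (?p (fst z) (snd z))) (D [y] A) ?G"
				by (rule smooth_tower_limitin[OF D sub base]) (auto intro: limitin_const xy)
			thus "limitin T (\<lambda>z. D [y] (?p (fst z) (snd z))) (D [y] A) ?G" by simp
			have "eventually (\<lambda>z. ?p (fst z) (snd z)\<in>U) ?G" using base by (simp add: limitin_subtopology)
			thus "\<forall>\<^sub>F z in ?G. D [] (?p (fst z) (snd z))\<in>F \<and>
				 limitin T (\<lambda>h. (1/h) *\<^sub>R (D [] (?p (fst z) (snd z + h)) - D [] (?p (fst z) (snd z)))) (D [y] (?p (fst z) (snd z))) (at 0)"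
			proof eventually_elim
				case (elim z)
				show ?case using smooth_tower_topspace[OF D sub _ elim, of "[]"] smooth_towerD[OF D _ xy(2) elim, of "[]"]
					by (simp add: topspace_eq scaleR_add_left add.assoc)
			qed
		qed
		have "has_dderiv T (D []) A (x + y) (D [x] A + D [y] A)" using limitin_add[OF tvs d[OF xy(1)] Y] by (simp add: algebra_simps)
		from limit_unique[OF d[OF xy(3)] this] show ?thesis by simp
	qed
	from tower_linear_last[OF D U x y in_F(1)[OF x y] this as] show ?thesis by simp
qed

text \<open>With towers \<open>D\<close> of \<open>W\<close> and \<open>E\<close> of
  \<open>V\<close>, the function is \<open>D [V A] A\<close>. Its derivatives are sums of terms
  \<open>D (xs @ [E ys A]) A\<close>: each new direction either differentiates \<open>W\<close> once
  more and enters \<open>xs\<close>, or differentiates the argument and enters \<open>ys\<close>.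
  The argument occupies the oldest slot, where linearity is available.\<close>

lemma gsmooth_derivative_along: assumes W: "gsmooth T U T W" and V: "gsmooth T U T V"
	shows "gsmooth T U T (\<lambda>A. dderiv T W A (V A))" proof -
	obtain D where D: "openin T U" "U\<subseteq>topspace T" "\<And>A. A\<in>U ==> D [] A = W A" "smooth_tower T U T D"
		by (rule gsmoothE[OF W]) (rule that)
	obtain E where E: "openin T U" "U\<subseteq>topspace T" "\<And>A. A\<in>U ==> E [] A = V A" "smooth_tower T U T E"
		by (rule gsmoothE[OF V]) (rule that)
	have Ein: "E ys A\<in>F" if "ys\<in>lists F" "A\<in>U" for ys A
		using smooth_tower_topspace[OF E(4) D(2), of ys A] that by (simp add: topspace_eq)
	show ?thesis proof (rule gsmooth_splits[OF tvs D(1), where T = "\<lambda>xs ys A. D (xs @ [E ys A]) A"])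
		fix A assume A: "A\<in>U"
		have "has_dderiv T W A (V A) (dderiv T W A (V A))"
			using Ein[of "[]" A] A E(3) by (intro gsmooth_limit[OF tvs W A _ Hausdorff_T]) (auto simp: topspace_eq)
		moreover have "has_dderiv T W A (V A) (D [V A] A)" proof (rule limitin_eventually_eq)
			show "limitin T (\<lambda>t. (1/t) *\<^sub>R (D [] (A + t *\<^sub>R V A) - D [] A)) (D [V A] A) (at 0)"
				using Ein[of "[]" A] A E(3) by (intro smooth_towerD[OF D(4)]) (auto simp: topspace_eq)
			have "V A\<in>topspace T" using Ein[of "[]" A] A E(3) by (simp add: topspace_eq)
			from eventually_line_open[OF tvs D(1) A this tendsto_ident_at]
			show "\<forall>\<^sub>F t in at 0. (1/t) *\<^sub>R (D [] (A + t *\<^sub>R V A) - D [] A) = (1/t) *\<^sub>R (W (A + t *\<^sub>R V A) - W A)"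
				by eventually_elim (simp add: D(3) A)
		qed
		ultimately show "D ([] @ [E [] A]) A = dderiv T W A (V A)" using limit_unique E(3)[OF A] by (metis append_Nil at_neq_bot)
	next
		fix xs ys a A
		assume as: "xs\<in>lists (topspace T)" "ys\<in>lists (topspace T)" "a\<in>topspace T" "A\<in>U"
		hence as': "xs\<in>lists F" "ys\<in>lists F" "a\<in>F" "A\<in>U" by (auto simp: topspace_eq)
		define v where "v t = E ys (A + t *\<^sub>R a)" for t
		have v0: "E ys A\<in>F" using Ein as' by blast
		have evU: "eventually (\<lambda>t. A + t *\<^sub>R a\<in>U) (at 0)" using eventually_line_open[OF tvs D(1) as(4,3) tendsto_ident_at] .
		hence evv: "eventually (\<lambda>t. v t\<in>F) (at 0)" by eventually_elim (use Ein as' in \<open>auto simp: v_def\<close>)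
		let ?G = "at (0::real) \<times>\<^sub>F nhds (0::real)"
		\<comment> \<open>The base point moves while the oldest direction is held at its new value
		  \<open>v t\<close>.\<close>
		have 1: "limitin T (\<lambda>t. (1/t) *\<^sub>R (D (xs @ [v t]) (A + t *\<^sub>R a) - D (xs @ [v t]) (A + 0 *\<^sub>R a)))
				(D (a # xs @ [E ys A]) A) (at 0)" proof (rule mean_value_quotient[where \<phi>' = "\<lambda>t u. D (a # xs @ [v t]) (A + u *\<^sub>R a)"])
			have s: "((\<lambda>z. snd z) \<longlongrightarrow> (0::real)) ?G" by (rule filterlim_snd)
			have base: "limitin (subtopology T U) (\<lambda>z. A + snd z *\<^sub>R a) A ?G" by (rule limitin_line_open[OF tvs D(1) as(4,3) s])
			have vlim: "limitin T (\<lambda>z. v (fst z)) (E ys A) ?G" proof -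
				have f: "((\<lambda>z. fst z) \<longlongrightarrow> (0::real)) ?G" by (rule filterlim_mono[OF filterlim_fst at_within_le_nhds order_refl])
				have b: "limitin (subtopology T U) (\<lambda>z. A + fst z *\<^sub>R a) A ?G" by (rule limitin_line_open[OF tvs D(1) as(4,3) f])
				have "limitin T (\<lambda>z. E (map (\<lambda>x. x z) (map (\<lambda>y _. y) ys)) (A + fst z *\<^sub>R a)) (E ys A) ?G"
					using as(2) by (intro smooth_tower_limitin[OF E(4,2) b]) (auto intro!: limitin_const simp: in_lists_conv_set)
				thus ?thesis by (simp add: v_def comp_def)
			qed
			have "limitin T (\<lambda>z. D (map (\<lambda>x. x z) ((\<lambda>_. a) # map (\<lambda>y _. y) xs @ [\<lambda>z. v (fst z)])) (A + snd z *\<^sub>R a))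
					(D (a # xs @ [E ys A]) A) ?G" proof (rule smooth_tower_limitin[OF D(4,2) base])
				fix i assume i: "i < length (a # xs @ [E ys A])"
				consider "i = 0" | j where "i = Suc j" "j < length xs" | "i = Suc (length xs)" using i by (cases i) (auto simp: less_Suc_eq)
				thus "limitin T (((\<lambda>_. a) # map (\<lambda>y _. y) xs @ [\<lambda>z. v (fst z)]) ! i) ((a # xs @ [E ys A]) ! i) ?G" proof cases
					case 2
					thus ?thesis using as(1) by (auto simp: nth_append in_lists_conv_set intro!: limitin_const)
				qed (use as(3) vlim in \<open>auto simp: nth_append intro: limitin_const\<close>)
			qed simp
			thus "limitin T (\<lambda>z. D (a # xs @ [v (fst z)]) (A + snd z *\<^sub>R a)) (D (a # xs @ [E ys A]) A) ?G" by (simp add: comp_def)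
			have "eventually (\<lambda>z. v (fst z)\<in>F \<and> A + snd z *\<^sub>R a\<in>U) ?G" proof (rule eventually_conj)
				show "eventually (\<lambda>z. v (fst z)\<in>F) ?G" using vlim unfolding limitin_iff by blast
				show "eventually (\<lambda>z. A + snd z *\<^sub>R a\<in>U) ?G" using base by (simp add: limitin_subtopology)
			qed
			thus "\<forall>\<^sub>F z in ?G. D (xs @ [v (fst z)]) (A + snd z *\<^sub>R a)\<in>F \<and>
					limitin T (\<lambda>h. (1/h) *\<^sub>R (D (xs @ [v (fst z)]) (A + (snd z + h) *\<^sub>R a) - D (xs @ [v (fst z)]) (A + snd z *\<^sub>R a)))
						(D (a # xs @ [v (fst z)]) (A + snd z *\<^sub>R a)) (at 0)" proof eventually_elim
				case (elim z)
				hence m: "xs @ [v (fst z)]\<in>lists (topspace T)" "A + snd z *\<^sub>R a\<in>U" using as(1) by (auto simp: topspace_eq)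
				show ?case using smooth_tower_topspace[OF D(4,2) m] smooth_towerD[OF D(4) m(1) as(3) m(2)]
					by (simp add: topspace_eq scaleR_add_left add.assoc)
			qed
		qed
		\<comment> \<open>The base point stays and the oldest direction moves; linearity of the slot later
		  turns this term into a difference quotient.\<close>
		have 2: "limitin T (\<lambda>t. D (xs @ [(1/t) *\<^sub>R (v t - E ys A)]) A) (D (xs @ [E (a # ys) A]) A) (at 0)" proof -
			have b: "limitin (subtopology T U) (\<lambda>_::real. A) A (at 0)"
				using as(4) D(2) by (auto simp: limitin_subtopology intro!: limitin_const)
			have e: "limitin T (\<lambda>t. (1/t) *\<^sub>R (v t - E ys A)) (E (a # ys) A) (at 0)"
				unfolding v_def by (rule smooth_towerD[OF E(4) as(2,3,4)])
			have "limitin T (\<lambda>z. D (map (\<lambda>x. x z) (map (\<lambda>y _. y) xs @ [\<lambda>t. (1/t) *\<^sub>R (v t - E ys A)])) A)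
					(D (xs @ [E (a # ys) A]) A) (at 0)" proof (rule smooth_tower_limitin[OF D(4,2) b])
				fix i assume i: "i < length (xs @ [E (a # ys) A])"
				consider "i < length xs" | "i = length xs" using i by (auto simp: less_Suc_eq)
				thus "limitin T ((map (\<lambda>y _. y) xs @ [\<lambda>t. (1/t) *\<^sub>R (v t - E ys A)]) ! i) ((xs @ [E (a # ys) A]) ! i) (at 0)"
				proof cases
					case 1
					thus ?thesis using as(1) by (auto simp: nth_append in_lists_conv_set intro!: limitin_const)
				qed (use e in \<open>auto simp: nth_append\<close>)
			qed simp
			thus ?thesis by (simp add: comp_def)
		qed
		have "limitin T (\<lambda>t. (1/t) *\<^sub>R (D (xs @ [v t]) (A + t *\<^sub>R a) - D (xs @ [v t]) (A + 0 *\<^sub>R a)) +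
				D (xs @ [(1/t) *\<^sub>R (v t - E ys A)]) A) (D (a # xs @ [E ys A]) A + D (xs @ [E (a # ys) A]) A) (at 0)"
			by (rule limitin_add[OF tvs 1 2])
		thus "limitin T (\<lambda>t. (1/t) *\<^sub>R (D (xs @ [E ys (A + t *\<^sub>R a)]) (A + t *\<^sub>R a) - D (xs @ [E ys A]) A))
				(D ((a # xs) @ [E ys A]) A + D (xs @ [E (a # ys) A]) A) (at 0)" proof (simp only: append_Cons, rule limitin_eventually_eq)
			show "\<forall>\<^sub>F t in at 0. (1/t) *\<^sub>R (D (xs @ [v t]) (A + t *\<^sub>R a) - D (xs @ [v t]) (A + 0 *\<^sub>R a)) +
					D (xs @ [(1/t) *\<^sub>R (v t - E ys A)]) A =
					(1/t) *\<^sub>R (D (xs @ [E ys (A + t *\<^sub>R a)]) (A + t *\<^sub>R a) - D (xs @ [E ys A]) A)" using evv proof eventually_elim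
				case (elim t)
				have "D (xs @ [v t + (-1) *\<^sub>R E ys A]) A = D (xs @ [v t]) A + D (xs @ [(-1) *\<^sub>R E ys A]) A"
					by (rule tower_add_last[OF D(4,1) elim _ as'(1,4)]) (intro in_F v0)
				also have "D (xs @ [(-1) *\<^sub>R E ys A]) A = (-1) *\<^sub>R D (xs @ [E ys A]) A" by (rule tower_scale_last[OF D(4,1) v0 as'(1,4)])
				finally have "D (xs @ [v t - E ys A]) A = D (xs @ [v t]) A - D (xs @ [E ys A]) A" by simp
				moreover have "D (xs @ [(1/t) *\<^sub>R (v t - E ys A)]) A = (1/t) *\<^sub>R D (xs @ [v t - E ys A]) A"
					by (rule tower_scale_last[OF D(4,1) _ as'(1,4)]) (intro in_F elim v0)
				ultimately have eq: "D (xs @ [(1/t) *\<^sub>R (v t - E ys A)]) A =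
						(1/t) *\<^sub>R (D (xs @ [v t]) A - D (xs @ [E ys A]) A)" by simp
				show ?case unfolding eq v_def[symmetric] scaleR_add_right[symmetric] by simp
			qed
		qed
	next
		fix "is" js :: "nat list" and m :: nat
		assume "is": "set is\<subseteq>{..<m}" and js: "set js\<subseteq>{..<m}"
		let ?Z = "jet_topology T U m"
		have c: "continuous_map ?Z T (\<lambda>z. E (map (snd z) js) (fst z))"
			using smooth_tower_continuous[OF E(4,2) js] by (simp add: case_prod_unfold)
		have "continuous_map ?Z T (\<lambda>z. D (map (snd z) is @ [E (map (snd z) js) (fst z)]) (fst z))" unfolding continuous_map_atin proof
			fix z assume z: "z\<in>topspace ?Z"
			have 1: "limitin (subtopology T U) fst (fst z) (atin ?Z z)" using limitin_continuous_map[OF continuous_map_fst z] by simp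
			have 2: "limitin (product_topology (\<lambda>_. T) {..<m}) snd (snd z) (atin ?Z z)"
				using limitin_continuous_map[OF continuous_map_snd z] by simp
			have 3: "limitin T (\<lambda>z. E (map (snd z) js) (fst z)) (E (map (snd z) js) (fst z)) (atin ?Z z)"
				using limitin_continuous_map[OF c z] by simp
			have "limitin T (\<lambda>w. D (map (\<lambda>x. x w) (map (\<lambda>i w. snd w i) is @ [\<lambda>w. E (map (snd w) js) (fst w)])) (fst w))
				(D (map (snd z) is @ [E (map (snd z) js) (fst z)]) (fst z)) (atin ?Z z)" proof (rule smooth_tower_limitin[OF D(4,2) 1])
				fix i assume i: "i < length (map (snd z) is @ [E (map (snd z) js) (fst z)])"
				consider "i < length is" | "i = length is" using i by (auto simp: less_Suc_eq)
				thus "limitin T ((map (\<lambda>i w. snd w i) is @ [\<lambda>w. E (map (snd w) js) (fst w)]) ! i)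
						((map (snd z) is @ [E (map (snd z) js) (fst z)]) ! i) (atin ?Z z)" proof cases
					case 1
					hence "is ! i\<in>set is" by simp
					hence "is ! i\<in>{..<m}" using "is" by blast
					thus ?thesis using 2 1 unfolding limitin_componentwise by (auto simp: nth_append)
				qed (use 3 in \<open>auto simp: nth_append\<close>)
			qed simp
			thus "limitin T (\<lambda>z. D (map (snd z) is @ [E (map (snd z) js) (fst z)]) (fst z))
					(D (map (snd z) is @ [E (map (snd z) js) (fst z)]) (fst z)) (atin ?Z z)" by (simp add: comp_def)
		qed
		thus "continuous_map ?Z T (\<lambda>(A, h). D (map h is @ [E (map h js) A]) A)" by (simp add: case_prod_unfold)
	qed
qed

lemma gsmooth_vf_bracket: assumes "gsmooth T U T V" "gsmooth T U T W" shows "gsmooth T U T (vf_bracket T V W)"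
	using gsmooth_diff[OF tvs tvs gsmooth_derivative_along[OF assms(2,1)] gsmooth_derivative_along[OF assms]]
	by (rule gsmooth_cong) (simp add: vf_bracket_def)

end

section \<open>Quotient topologies\<close>

locale quotient_tvs =
	fixes Z :: "'z::real_vector topology" and Y :: "'y::real_vector topology" and q :: "'z => 'y"
	assumes Z: "tvs Z" and q: "linear_on_set (topspace Z) q"
		and openin_iff: "\<And>W. openin Y W \<longleftrightarrow> W\<subseteq>q ` topspace Z \<and> openin Z {x\<in>topspace Z. q x\<in>W}"
begin

lemma topspace_Y: "topspace Y = q ` topspace Z" proof
	show "topspace Y\<subseteq>q ` topspace Z" using openin_topspace[of Y] openin_iff by blast
	have "{x\<in>topspace Z. q x\<in>q ` topspace Z} = topspace Z" by blast
	hence "openin Y (q ` topspace Z)" using openin_iff by simp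
	thus "q ` topspace Z\<subseteq>topspace Y" by (rule openin_subset)
qed

lemma quotient: "quotient_map Z Y q" unfolding quotient_map_def using topspace_Y openin_iff by auto

lemma continuous: "continuous_map Z Y q" using quotient quotient_imp_continuous_map by blast

lemma q_linear: "x\<in>topspace Z ==> y\<in>topspace Z ==> q (x + y) = q x + q y"
	"x\<in>topspace Z ==> q (r *\<^sub>R x) = r *\<^sub>R q x"
	"x\<in>topspace Z ==> y\<in>topspace Z ==> q (x - y) = q x - q y" using linear_on_setD[OF q tvs_subspace[OF Z]] by blast+

text \<open>The saturation of an open set \<open>W\<close> is open: around each of its points it
  contains the preimage of \<open>W\<close> under a translation by a kernel element
  \<open>w - x\<close>.\<close>

lemma open_q: "open_map Z Y q" unfolding open_map_def proof (intro allI impI)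
	fix W assume W: "openin Z W"
	hence sub: "W\<subseteq>topspace Z" by (rule openin_subset)
	have "openin Z {x\<in>topspace Z. q x\<in>q ` W}" unfolding openin_subopen[of Z "{x\<in>topspace Z. q x\<in>q ` W}"] proof
		fix x assume "x\<in>{x\<in>topspace Z. q x\<in>q ` W}"
		then obtain w where x: "x\<in>topspace Z" "q x = q w" "w\<in>W" by blast
		have w: "w\<in>topspace Z" using x sub by blast
		have "continuous_map Z Z (\<lambda>y. y + (w - x))" using w x by (intro continuous_map_tvs_add[OF Z]) (auto intro: tvs_diff[OF Z])
		hence "openin Z {y\<in>topspace Z. y + (w - x)\<in>W}" using W by (rule openin_continuous_map_preimage)
		moreover have "{y\<in>topspace Z. y + (w - x)\<in>W}\<subseteq>{x\<in>topspace Z. q x\<in>q ` W}" proof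
			fix y assume "y\<in>{y\<in>topspace Z. y + (w - x)\<in>W}"
			hence y: "y\<in>topspace Z" "y + (w - x)\<in>W" by auto
			have "q (y + (w - x)) = q y" using y x w by (simp add: q_linear tvs_diff[OF Z])
			hence "q y\<in>q ` W" using y by (metis imageI)
			thus "y\<in>{x\<in>topspace Z. q x\<in>q ` W}" using y by simp
		qed
		moreover have "x\<in>{y\<in>topspace Z. y + (w - x)\<in>W}" using x by simp
		ultimately show "\<exists>T. openin Z T \<and> x\<in>T \<and> T\<subseteq>{x\<in>topspace Z. q x\<in>q ` W}" by blast
	qed
	thus "openin Y (q ` W)" using openin_iff sub by blast
qed

text \<open>A product of quotient maps is a quotient map here because both factors are open. It lets
  addition and scaling, continuous upstairs, descend to \<open>Y\<close>.\<close>

lemma quotient_prod: assumes c: "continuous_map R R' f" and o: "open_map R R' f" and s: "f ` topspace R = topspace R'"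
	shows "quotient_map (prod_topology R Z) (prod_topology R' Y) (\<lambda>(x, y). (f x, q y))" proof (rule continuous_open_imp_quotient_map)
	let ?u = "\<lambda>x y. \<lambda>(x, y). (f x, q y)"
	let ?v = "prod_topology R' Y"
	let ?w = "prod_topology R Z"
	show "continuous_map ?w ?v (?u x y)"
		using continuous_map_compose[OF continuous_map_fst c] continuous_map_compose[OF continuous_map_snd continuous]
		by (auto simp: continuous_map_pairwise comp_def case_prod_unfold)
	show "(?u x y) ` topspace ?w = topspace ?v" unfolding topspace_prod_topology s[symmetric] topspace_Y by (auto simp: image_iff)
	show "open_map ?w ?v (?u x y)" unfolding open_map_def proof (intro allI impI)
		fix W assume W: "openin ?w W"
		show "openin ?v ((?u x y) ` W)" unfolding openin_prod_topology_alt[of R' Y] proof (intro allI impI)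
			fix x' y' assume "(x', y')\<in>(?u x y) ` W"
			then obtain x y where xy: "(x, y)\<in>W" "x' = f x" "y' = q y" by auto
			obtain A B where AB: "openin R A" "openin Z B" "x\<in>A" "y\<in>B" "A\<times>B\<subseteq>W"
				using W[unfolded openin_prod_topology_alt, rule_format, OF xy(1)] by blast
			have "openin R' (f ` A)" "openin Y (q ` B)" using AB o open_q unfolding open_map_def by auto
			moreover have "f ` A\<times>q ` B\<subseteq>(?u x y) ` W" using AB by force
			ultimately show "\<exists>U V. openin R' U \<and> openin Y V \<and> x'\<in>U \<and> y'\<in>V \<and> U\<times>V\<subseteq>(?u x y) ` W"
				using AB xy by blast
		qed
	qed
qed

lemma tvs: "tvs Y" unfolding tvs_def proof (intro conjI)
	show "subspace (topspace Y)" unfolding subspace_def topspace_Y proof (intro conjI ballI allI)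
		have "q (0 *\<^sub>R 0) = 0 *\<^sub>R q 0" using tvs_0[OF Z] by (rule q_linear)
		hence "q 0 = 0" by simp
		thus "0\<in>q ` topspace Z" using tvs_0[OF Z] by (metis imageI)
		fix x y :: 'y and r :: real
		assume x: "x\<in>q ` topspace Z"
		then obtain x' where x': "x = q x'" "x'\<in>topspace Z" by blast
		thus "r *\<^sub>R x\<in>q ` topspace Z" using q_linear(2)[of x' r] tvs_scale[OF Z] by (metis imageI)
		assume "y\<in>q ` topspace Z"
		then obtain y' where "y = q y'" "y'\<in>topspace Z" by blast
		thus "x + y\<in>q ` topspace Z" using x' q_linear(1)[of x' y'] tvs_add[OF Z] by (metis imageI)
	qed
	show "continuous_map (prod_topology Y Y) Y (\<lambda>(x, y). x + y)"
	proof (rule continuous_compose_quotient_map[OF quotient_prod[OF continuous open_q topspace_Y[symmetric]]])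
		have "continuous_map (prod_topology Z Z) Y (q \<circ> (\<lambda>(x, y). x + y))"
			using Z continuous unfolding tvs_def by (blast intro: continuous_map_compose)
		thus "continuous_map (prod_topology Z Z) Y ((\<lambda>(x, y). x + y) \<circ> (\<lambda>(x, y). (q x, q y)))"
			by (rule continuous_map_eq) (auto simp: q_linear)
	qed
	have "open_map euclideanreal euclideanreal (\<lambda>x. x)" by (simp add: open_map_def)
	hence "quotient_map (prod_topology euclideanreal Z) (prod_topology euclideanreal Y) (\<lambda>(x, y). (x, q y))"
		by (intro quotient_prod) auto
	thus "continuous_map (prod_topology euclideanreal Y) Y (\<lambda>(r, x). r *\<^sub>R x)" proof (rule continuous_compose_quotient_map)
		have "continuous_map (prod_topology euclideanreal Z) Y (q \<circ> (\<lambda>(r, x). r *\<^sub>R x))"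
			using Z continuous unfolding tvs_def by (blast intro: continuous_map_compose)
		thus "continuous_map (prod_topology euclideanreal Z) Y ((\<lambda>(r, x). r *\<^sub>R x) \<circ> (\<lambda>(x, y). (x, q y)))"
			by (rule continuous_map_eq) (auto simp: q_linear)
	qed
qed

lemma closedin_iff: "closedin Y C \<longleftrightarrow> C\<subseteq>topspace Y \<and> closedin Z {x\<in>topspace Z. q x\<in>C}" proof -
	have "{x\<in>topspace Z. q x\<in>topspace Y - C} = topspace Z - {x\<in>topspace Z. q x\<in>C}" using topspace_Y by blast
	thus ?thesis unfolding closedin_def openin_iff using topspace_Y by auto
qed

end

section \<open>Graphs of a totally antisymmetric trilinear form\<close>

lemma gsmooth_in_topspace: assumes "gsmooth X U Y f" "A\<in>U" shows "f A\<in>topspace Y" proof -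
	obtain D where D: "U\<subseteq>topspace X" "\<And>A. A\<in>U ==> D [] A = f A" "smooth_tower X U Y D"
		by (rule gsmoothE[OF assms(1)]) (rule that)
	from smooth_tower_topspace[OF D(3,1) _ assms(2), of "[]"] D(2)[OF assms(2)] show ?thesis by simp
qed

lemma closedin_prod_Times:
	"closedin X S ==> closedin Y T ==> closedin (prod_topology X Y) (S\<times>T)" by (simp add: closedin_prod_Times_iff)

text \<open>The trilinear form \<open>T A b c = q (w A b) c\<close> is totally antisymmetric.\<close>

locale trilinear_dirac = X: hausdorff_seminorm_topology F P X + Y: quotient_tvs Z Y q
	for F :: "'v::real_vector set" and P X and Z :: "'z::real_vector topology"
		and Y :: "('v => complex) topology" and q +
	fixes w :: "'v => 'v => 'z" assumes w_bilinear: "bilinear_on_sets F F w"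
		and w_continuous: "continuous_map (prod_topology X X) Z (\<lambda>(A, b). w A b)"
		and q_bilinear: "bilinear_on_sets (topspace Z) F q"
		and q_continuous: "continuous_map (prod_topology Z X) euclidean (\<lambda>(\<alpha>, a). q \<alpha> a)"
		and q_outside: "\<alpha>\<in>topspace Z ==> a\<notin>F ==> q \<alpha> a = 0"
		and w_swap: "A\<in>F ==> b\<in>F ==> c\<in>F ==> q (w A b) c = - q (w b A) c"
		and q_swap: "A\<in>F ==> b\<in>F ==> c\<in>F ==> q (w A b) c = - q (w A c) b"
begin

lemmas topspace_X = X.topspace_eq

lemma w_in: "A\<in>F ==> b\<in>F ==> w A b\<in>topspace Z" using continuous_map_funspace[OF w_continuous] topspace_X by (auto simp: Pi_iff)

lemma w_linear: assumes "A\<in>F" "b\<in>F" "c\<in>F"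
	shows "w A (b + c) = w A b + w A c" "w A (r *\<^sub>R b) = r *\<^sub>R w A b" "w A (b - c) = w A b - w A c"
	using linear_on_setD[OF _ X.subspace_F assms(2,3)] w_bilinear assms(1) unfolding bilinear_on_sets_def by blast+

lemma q_linear: assumes "\<alpha>\<in>topspace Z" "b\<in>F" "c\<in>F"
	shows "q \<alpha> (b + c) = q \<alpha> b + q \<alpha> c" "q \<alpha> (r *\<^sub>R b) = r *\<^sub>R q \<alpha> b" "q \<alpha> (b - c) = q \<alpha> b - q \<alpha> c"
	using linear_on_setD[OF _ X.subspace_F assms(2,3)] q_bilinear assms(1) unfolding bilinear_on_sets_def by blast+

lemma tvs_Y: "tvs Y" by (rule Y.tvs)

lemma qw_in: "A\<in>F ==> b\<in>F ==> q (w A b)\<in>topspace Y" using w_in Y.topspace_Y by blast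

lemma qw_linear: assumes "A\<in>F" "b\<in>F" "c\<in>F"
	shows "q (w A (b + c)) = q (w A b) + q (w A c)" "q (w A (r *\<^sub>R b)) = r *\<^sub>R q (w A b)"
		"q (w A (b - c)) = q (w A b) - q (w A c)" using assms by (simp_all add: w_linear[OF assms] Y.q_linear w_in)

text \<open>The kernel of \<open>q\<close> is the intersection of the kernels of the continuous
  functionals that evaluate at the vectors of \<open>F\<close>; values outside \<open>F\<close>
  vanish by \<open>q_outside\<close>. Closedness of \<open>F \<times> {0}\<close> in the local model
  of the subbundle rests on this.\<close>

lemma closedin_zero: "closedin Y {0}" unfolding Y.closedin_iff proof
	have q0: "q 0 = 0" using Y.q_linear(2)[of 0 0] tvs_0[OF Y.Z] by simp
	have Z0: "0\<in>topspace Z" by (rule tvs_0[OF Y.Z])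
	show "{0}\<subseteq>topspace Y" using q0 Z0 Y.topspace_Y by force
	have "closedin Z {\<alpha>\<in>topspace Z. q \<alpha> a = 0}" if "a\<in>F" for a proof -
		have "continuous_map Z euclidean (\<lambda>\<alpha>. q \<alpha> a)"
			by (rule continuous_map_compose2[OF q_continuous]) (use that topspace_X in auto)
		from closedin_continuous_map_preimage[OF this, of "{0}"] show ?thesis by simp
	qed
	moreover have "{\<alpha>\<in>topspace Z. q \<alpha>\<in>{0}} = (\<Inter>a\<in>F. {\<alpha>\<in>topspace Z. q \<alpha> a = 0})"
	proof (intro subset_antisym subsetI)
		fix \<alpha> assume a: "\<alpha>\<in>(\<Inter>a\<in>F. {\<alpha>\<in>topspace Z. q \<alpha> a = 0})"
		hence Z: "\<alpha>\<in>topspace Z" using X.in_F(4) by blast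
		have "q \<alpha> x = 0" for x using a q_outside[OF Z] by (cases "x\<in>F") auto
		thus "\<alpha>\<in>{\<alpha>\<in>topspace Z. q \<alpha>\<in>{0}}" using Z by (auto simp: fun_eq_iff)
	qed auto
	ultimately show "closedin Z {\<alpha>\<in>topspace Z. q \<alpha>\<in>{0}}" using X.in_F(4) by (simp only:) (intro closedin_INT, auto)
qed

definition graph :: "'v => ('v\<times>('v => complex)) set" where
	"graph A = {(a, q (w A a)) | a. a\<in>F}"

lemma graph_subset: "A\<in>F ==> graph A\<subseteq>topspace (prod_topology X Y)" unfolding graph_def using qw_in topspace_X by auto

lemma subspace_graph: assumes A: "A\<in>F" shows "subspace (graph A)" unfolding graph_def proof (rule subspaceI)
	have "q (w A 0) = 0" using qw_linear(2)[OF A X.in_F(4) X.in_F(4), of 0] by simp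
	thus "0\<in>{(a, q (w A a)) |a. a\<in>F}" using X.in_F(4) by (auto simp: zero_prod_def intro!: exI[of _ 0])
next
	fix x y assume "x\<in>{(a, q (w A a)) |a. a\<in>F}" "y\<in>{(a, q (w A a)) |a. a\<in>F}"
	then obtain a b where "x = (a, q (w A a))" "y = (b, q (w A b))" "a\<in>F" "b\<in>F" by blast
	hence "x + y = (a + b, q (w A (a + b)))" "a + b\<in>F" by (simp_all add: qw_linear(1)[OF A] X.in_F)
	thus "x + y\<in>{(a, q (w A a)) |a. a\<in>F}" by blast
next
	fix x r assume "x\<in>{(a, q (w A a)) |a. a\<in>F}"
	then obtain a where "x = (a, q (w A a))" "a\<in>F" by blast
	hence "r *\<^sub>R x = (r *\<^sub>R a, q (w A (r *\<^sub>R a)))" "r *\<^sub>R a\<in>F"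
		by (simp_all add: qw_linear(2)[OF A _ X.in_F(4)] X.in_F)
	thus "r *\<^sub>R x\<in>{(a, q (w A a)) |a. a\<in>F}" by blast
qed

text \<open>If an isotropic \<open>L\<close> contains the graph, each \<open>(b, \<beta>)\<close> in
  \<open>L\<close> is orthogonal to all \<open>(a, q (w A a))\<close>. This prescribes
  \<open>\<beta> a\<close>, and antisymmetry identifies the value with
  \<open>q (w A b) a\<close>.\<close>

lemma maximal_isotropic_graph: assumes A: "A\<in>F" shows "maximal_isotropic X Y (graph A)" unfolding maximal_isotropic_def
proof (intro conjI allI impI)
	show "subspace (graph A)" by (rule subspace_graph[OF A])
	show "graph A\<subseteq>topspace (prod_topology X Y)" by (rule graph_subset[OF A])
	show "isotropic (graph A)" proof -
		have "q (w A a) b + q (w A b) a = 0" if "a\<in>F" "b\<in>F" for a b by (subst q_swap[OF A that]) simp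
		thus ?thesis unfolding isotropic_def graph_def plus_form_def by auto
	qed
next
	fix L assume L: "subspace L \<and> L\<subseteq>topspace (prod_topology X Y) \<and> isotropic L \<and> graph A\<subseteq>L"
	have "x\<in>graph A" if x: "x\<in>L" for x proof -
		obtain b \<beta> where xb: "x = (b, \<beta>)" by (cases x)
		have b: "b\<in>F" and \<beta>: "\<beta>\<in>topspace Y" using L x xb topspace_X by auto
		then obtain \<alpha> where \<alpha>: "\<alpha>\<in>topspace Z" "\<beta> = q \<alpha>" using Y.topspace_Y by auto
		have "\<beta> a = q (w A b) a" for a proof (cases "a\<in>F")
			case True
			hence "(a, q (w A a))\<in>L" using L unfolding graph_def by blast
			hence "plus_form (a, q (w A a)) x = 0" using L x unfolding isotropic_def by blast
			hence "q (w A a) b + \<beta> a = 0" by (simp add: plus_form_def xb)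
			thus ?thesis by (subst q_swap[OF A b True]) (simp add: eq_neg_iff_add_eq_0 add.commute)
		next
			case False
			thus ?thesis using q_outside \<alpha> w_in[OF A b] by simp
		qed
		thus ?thesis unfolding graph_def xb using b by (auto simp: fun_eq_iff)
	qed
	thus "L = graph A" using L by blast
qed

lemma gsmooth_w: assumes "tvs R" "gsmooth R U X f" "gsmooth R U X g" shows "gsmooth R U Y (\<lambda>z. q (w (f z) (g z)))" proof -
	have "gsmooth R U Z (\<lambda>z. w (f z) (g z))"
		by (rule gsmooth_bilinear[OF assms(1) X.tvs X.tvs Y.Z assms(2,3)]) (use w_bilinear w_continuous topspace_X in auto)
	from gsmooth_linear_compose[OF assms(1) Y.Z this Y.continuous Y.q] show ?thesis .
qed

text \<open>The shear that subtracts \<open>q (w A a)\<close> from the cotangent component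
  straightens the graph to \<open>F \<times> {0}\<close>. It is defined over all of
  \<open>U\<close>, so one trivialisation serves every point.\<close>

lemma smooth_subbundle_graph: assumes U: "openin X U" shows "smooth_subbundle X U (prod_topology X Y) graph"
	unfolding smooth_subbundle_def proof (intro conjI ballI)
	fix A assume "A\<in>U"
	hence A: "A\<in>F" using openin_subset[OF U] topspace_X by auto
	show "subspace (graph A)" by (rule subspace_graph[OF A])
	show "graph A\<subseteq>topspace (prod_topology X Y)" by (rule graph_subset[OF A])
next
	let ?E = "prod_topology X Y"
	let ?R = "prod_topology X ?E"
	have UF: "U\<subseteq>F" using openin_subset[OF U] topspace_X by auto
	have tE: "tvs ?E" and tR: "tvs ?R" by (auto intro!: tvs_prod X.tvs tvs_Y)
	have V: "openin ?R (U\<times>topspace ?E)" using U by (simp add: openin_prod_Times_iff)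
	let ?V = "U\<times>topspace ?E"
	have p: "gsmooth ?R ?V X fst" "gsmooth ?R ?V ?E snd" by (rule gsmooth_linear[OF tR _ V];
				auto intro: X.tvs tE continuous_map_fst continuous_map_snd simp: linear_on_set_def)+
	note p2 = gsmooth_fst[OF tR X.tvs tvs_Y p(2)] gsmooth_snd[OF tR X.tvs tvs_Y p(2)]
	note wz = gsmooth_w[OF tR p(1) p2(1)]
	let ?\<Phi> = "\<lambda>A e. (fst e, snd e - q (w A (fst e)))"
	let ?\<Psi> = "\<lambda>A e. (fst e, snd e + q (w A (fst e)))"
	have "gsmooth ?R ?V ?E (\<lambda>z. ?\<Phi> (fst z) (snd z))" "gsmooth ?R ?V ?E (\<lambda>z. ?\<Psi> (fst z) (snd z))"
		by (intro gsmooth_Pair p2 gsmooth_diff[OF tR tvs_Y p2(2) wz] gsmooth_add[OF tR tvs_Y p2(2) wz])+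
	hence sm: "gsmooth ?R ?V ?E (\<lambda>(A, e). ?\<Phi> A e)" "gsmooth ?R ?V ?E (\<lambda>(A, e). ?\<Psi> A e)"
		by (simp_all only: case_prod_unfold)
	have SY: "subspace (topspace Y)" by (rule tvs_subspace[OF tvs_Y])
	fix A0 assume "A0\<in>U"
	show "\<exists>N \<Phi> \<Psi> F' G. openin X N \<and> A0\<in>N \<and> N\<subseteq>U \<and>
				gsmooth ?R (N\<times>topspace ?E) ?E (\<lambda>(A, e). \<Phi> A e) \<and>
				gsmooth ?R (N\<times>topspace ?E) ?E (\<lambda>(A, e). \<Psi> A e) \<and>
				(\<forall>A\<in>N. linear_on_set (topspace ?E) (\<Phi> A) \<and>
					 (\<forall>e\<in>topspace ?E. \<Psi> A (\<Phi> A e) = e \<and> \<Phi> A (\<Psi> A e) = e) \<and>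
					 \<Phi> A ` graph A = F') \<and>
				subspace F' \<and> closedin ?E F' \<and> subspace G \<and> closedin ?E G \<and>
				F' \<inter> G = {0} \<and> topspace ?E = {x + y | x y. x\<in>F' \<and> y\<in>G}"
	proof (rule exI[of _ U], rule exI[of _ ?\<Phi>], rule exI[of _ ?\<Psi>], rule exI[of _ "F\<times>{0}"],
			rule exI[of _ "{0}\<times>topspace Y"], intro conjI ballI)
		show "openin X U" "A0\<in>U" "U\<subseteq>U" by fact+ auto
		show "gsmooth ?R ?V ?E (\<lambda>(A, e). ?\<Phi> A e)" "gsmooth ?R ?V ?E (\<lambda>(A, e). ?\<Psi> A e)" by (fact sm)+
		show "subspace (F\<times>{0 :: 'v => complex})" "subspace ({0 :: 'v}\<times>topspace Y)"
			using X.subspace_F SY by (auto intro!: subspace_Times)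
		show "closedin ?E (F\<times>{0})" using closedin_prod_Times[OF closedin_topspace closedin_zero, of X] topspace_X by simp
		have "closedin X {0}" using closedin_Hausdorff_sing_eq[OF X.Hausdorff_T] X.in_F(4) topspace_X by simp
		thus "closedin ?E ({0}\<times>topspace Y)" by (rule closedin_prod_Times) simp
		have "(0 :: 'v => complex)\<in>topspace Y" by (rule subspace_0[OF SY])
		thus "(F\<times>{0}) \<inter> ({0}\<times>topspace Y) = {0}" using X.in_F(4) by (auto simp: zero_prod_def)
		show "topspace ?E = {x + y | x y. x\<in>F\<times>{0} \<and> y\<in>{0}\<times>topspace Y}" proof (intro subset_antisym subsetI)
			fix e assume "e\<in>topspace ?E"
			hence "e = (fst e, 0) + (0, snd e)" "(fst e, 0)\<in>F\<times>{0 :: 'v => complex}" "(0, snd e)\<in>{0 :: 'v}\<times>topspace Y"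
				using topspace_X by auto
			thus "e\<in>{x + y | x y. x\<in>F\<times>{0} \<and> y\<in>{0}\<times>topspace Y}" by blast
		qed (use topspace_X in auto)
		fix A assume "A\<in>U"
		hence A: "A\<in>F" using UF by blast
		show "linear_on_set (topspace ?E) (?\<Phi> A)"
			unfolding linear_on_set_def using qw_linear(1,2)[OF A] topspace_X by (auto simp: scaleR_diff_right)
		show "?\<Phi> A ` graph A = F\<times>{0}" unfolding graph_def by (auto simp: image_iff)
	qed auto
qed

text \<open>The contraction depends on the base point directly, through \<open>v\<close> and through
  \<open>W\<close>; the product rule, applied first to \<open>w\<close> and then to
  \<open>q\<close>, gives one term for each. The 1-form is known only on \<open>U\<close>, which
  suffices along short segments.\<close>

lemma dderiv_contract: assumes v: "gsmooth X U X v" and W: "gsmooth X U X W" and A: "A\<in>U" and d: "d\<in>F"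
		and \<beta>: "\<And>A. A\<in>U ==> \<beta> A = q (w A (v A))" shows "dderiv euclidean (contract \<beta> W) A d =
		q (w d (v A)) (W A) + q (w A (dderiv X v A d)) (W A) + q (w A (v A)) (dderiv X W A d)" proof -
	let ?u = "\<lambda>t R. A + t *\<^sub>R d"
	let ?v = "w d (v A) + w A (dderiv X v A d)"
	have U: "openin X U" by (rule gsmooth_openin[OF v])
	hence UF: "U\<subseteq>F" using openin_subset topspace_X by auto
	have AF: "A\<in>F" using A UF by blast
	have dX: "d\<in>topspace X" using d topspace_X by simp
	have ev: "eventually (\<lambda>t. A + t *\<^sub>R d\<in>U) (at (0::real))"
		by (rule eventually_line_open[OF X.tvs U A dX]) (rule tendsto_ident_at)
	have evF: "eventually (\<lambda>t. A + t *\<^sub>R d\<in>topspace X) (at (0::real))"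
		using ev by (rule eventually_mono) (use UF topspace_X in auto)
	have in_X: "u B\<in>topspace X" if "gsmooth X U X u" "B\<in>U" for u B using gsmooth_in_topspace[OF that] .
	have evu: "eventually (\<lambda>t. u (?u t R)\<in>topspace X) (at (0::real))" if "gsmooth X U X u" for u
		using ev by (rule eventually_mono) (rule in_X[OF that])
	note lim = gsmooth_limit[OF X.tvs _ A dX X.Hausdorff_T]
	have id: "limitin X (\<lambda>t. (1/t) *\<^sub>R (A + t *\<^sub>R d - A)) d (at (0::real))"
		by (rule limitin_eventually_eq[OF limitin_const[OF dX]]) (auto simp: eventually_at intro!: exI[of _ 1])
	have AX: "A\<in>topspace X" using AF topspace_X by simp
	have b: "bilinear_on_sets (topspace X) (topspace X) w" "bilinear_on_sets (topspace Z) (topspace X) q"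
		using w_bilinear q_bilinear topspace_X by auto
	have w: "limitin Z (\<lambda>t. (1/t) *\<^sub>R (w (?u t R) (v (?u t R)) - w A (v A)))
			?v (at 0)" by (rule bilinear_derivative[OF X.tvs X.tvs Y.Z b(1) w_continuous id AX evF lim[OF v] in_X[OF v A] evu[OF v]])
	have wZ: "w B (v B)\<in>topspace Z" if "B\<in>U" for B using w_in in_X[OF v that] UF that topspace_X by auto
	have evw: "eventually (\<lambda>t. w (?u t R) (v (?u t R))\<in>topspace Z) (at (0::real))" using ev by (rule eventually_mono) (rule wZ)
	have l: "limitin euclidean (\<lambda>t. (1/t) *\<^sub>R (q (w (?u t R) (v (?u t R))) (W (?u t R)) - q (w A (v A)) (W A)))
			(q ?v (W A) + q (w A (v A)) (dderiv X W A d)) (at 0)"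
		by (rule bilinear_derivative[OF Y.Z X.tvs tvs_euclidean b(2) q_continuous w wZ[OF A] evw lim[OF W] in_X[OF W A] evu[OF W]])
	have dv: "dderiv X v A d\<in>F" using limitin_topspace[OF lim[OF v]] topspace_X by simp
	have vA: "v A\<in>F" using in_X[OF v A] topspace_X by simp
	have "dderiv euclidean (contract \<beta> W) A d =
			q ?v (W A) + q (w A (v A)) (dderiv X W A d)" proof (rule dderiv_eqI[OF limitin_eventually_eq[OF l]])
		show "Hausdorff_space (euclidean :: complex topology)" by simp
		show "\<forall>\<^sub>F t in at 0. (1/t) *\<^sub>R (q (w (?u t R) (v (?u t R))) (W (?u t R)) - q (w A (v A)) (W A)) =
				(1/t) *\<^sub>R (contract \<beta> W (?u t R) - contract \<beta> W A)"
			using ev by (rule eventually_mono) (simp add: contract_def \<beta> A)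
	qed
	thus ?thesis using Y.q_linear(1)[OF w_in[OF d vA] w_in[OF AF dv]] by simp
qed

text \<open>The Lie and the exterior derivative each lose their derivatives of \<open>W\<close>
  against the bracket term. What remains beyond \<open>q (w A (v A)) (W A)\<close> are two terms
  with the derivative of \<open>a\<close> along \<open>W\<close>, which cancel by antisymmetry, and
  three undifferentiated terms, each equal to \<open>q (w (a A) (b A)) (W A)\<close>; these are
  removed by \<open>\<kappa>\<close>.\<close>

theorem twisted_dirac_structure_graph: assumes U: "openin X U"
		and \<kappa>: "\<And>A a b c. A\<in>U ==> a\<in>F ==> b\<in>F ==> c\<in>F ==> \<kappa> A a b c = 3 * q (w a b) c"
	shows "twisted_dirac_structure X U Y \<kappa> graph" unfolding twisted_dirac_structure_def proof (intro conjI ballI allI impI)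
	have UF: "U\<subseteq>F" using openin_subset[OF U] topspace_X by auto
	show "smooth_subbundle X U (prod_topology X Y) graph" by (rule smooth_subbundle_graph[OF U])
	show "maximal_isotropic X Y (graph A)" if "A\<in>U" for A using maximal_isotropic_graph that UF by blast
	fix e1 e2 assume s: "section_of X U (prod_topology X Y) graph e1 \<and> section_of X U (prod_topology X Y) graph e2"
	define a where "a A = fst (e1 A)" for A
	define b where "b A = fst (e2 A)" for A
	have a: "gsmooth X U X a" and b: "gsmooth X U X b"
		unfolding a_def b_def using s gsmooth_fst[OF X.tvs X.tvs tvs_Y] by (auto simp: section_of_def)
	have e1: "snd (e1 A) = q (w A (a A))" and e2: "snd (e2 A) = q (w A (b A))" if "A\<in>U" for A
		using s that unfolding section_of_def graph_def a_def b_def by fastforce+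
	define v where "v = vf_bracket X a b"
	have v: "gsmooth X U X v" unfolding v_def by (rule X.gsmooth_vf_bracket[OF a b])
	have in_F: "u A\<in>F" if "gsmooth X U X u" "A\<in>U" for u A using gsmooth_in_topspace[OF that] topspace_X by simp
	have dF: "dderiv X u A d\<in>F" if u: "gsmooth X U X u" and A: "A\<in>U" and d: "d\<in>F" for u A d
		using limitin_topspace[OF gsmooth_limit[OF X.tvs u A _ X.Hausdorff_T]] d topspace_X by simp
	show "\<exists>e3. section_of X U (prod_topology X Y) graph e3 \<and> is_courant_bracket X U \<kappa> e1 e2 e3"
	proof (intro exI[of _ "\<lambda>A. (v A, q (w A (v A)))"] conjI)
		have "gsmooth X U X (\<lambda>A. A)" by (rule gsmooth_linear[OF X.tvs X.tvs U]) (auto simp: linear_on_set_def)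
		from gsmooth_Pair[OF v gsmooth_w[OF X.tvs this v]]
		show "section_of X U (prod_topology X Y) graph (\<lambda>A. (v A, q (w A (v A))))"
			unfolding section_of_def graph_def using in_F[OF v] by auto
		show "is_courant_bracket X U \<kappa> e1 e2 (\<lambda>A. (v A, q (w A (v A))))"
			unfolding is_courant_bracket_def Let_def a_def[symmetric] b_def[symmetric] proof (intro ballI conjI allI impI)
			fix A assume A: "A\<in>U"
			have AF: "A\<in>F" using A UF by blast
			show "fst (v A, q (w A (v A))) = vf_bracket X a b A" by (simp add: v_def)
			fix W assume W: "gsmooth X U X W"
			have aF: "a A\<in>F" and bF: "b A\<in>F" and WF: "W A\<in>F" using in_F A a b W by auto
			note dab = dF[OF a A bF] and dba = dF[OF b A aF] and daW = dF[OF a A WF] and dbW = dF[OF b A WF]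
				and dWa = dF[OF W A aF] and dWb = dF[OF W A bF]
			have D: "dderiv euclidean (contract \<beta> V) A d =
					q (w d (u A)) (V A) + q (w A (dderiv X u A d)) (V A) + q (w A (u A)) (dderiv X V A d)"
				if "gsmooth X U X u" "gsmooth X U X V" "d\<in>F" "\<And>A. A\<in>U ==> \<beta> A = q (w A (u A))" for u V \<beta> d
				by (rule dderiv_contract[OF that(1,2) A that(3,4)])
			note De2 = D[where u = b and V = W and d = "a A" and \<beta> = "\<lambda>A. snd (e2 A)", OF b W aF e2, simplified]
			note De1 = D[where u = a and V = W and d = "b A" and \<beta> = "\<lambda>A. snd (e1 A)", OF a W bF e1, simplified]
				D[where u = a and V = b and d = "W A" and \<beta> = "\<lambda>A. snd (e1 A)", OF a b WF e1, simplified]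
			have lie: "lie_deriv X a (\<lambda>A. snd (e2 A)) W A = q (w (a A) (b A)) (W A) + q (w A (dderiv X b A (a A))) (W A)
					+ q (w A (b A)) (dderiv X a A (W A))" unfolding lie_deriv_def
				by (simp add: De2 contract_def e2[OF A] vf_bracket_def q_linear(3)[OF w_in[OF AF bF] dWa daW])
			have ext: "ext_deriv X (\<lambda>A. snd (e1 A)) b W A = q (w (b A) (a A)) (W A) + q (w A (dderiv X a A (b A))) (W A)
					- q (w (W A) (a A)) (b A) - q (w A (dderiv X a A (W A))) (b A)" unfolding ext_deriv_def
				by (simp add: De1 contract_def e1[OF A] vf_bracket_def q_linear(3)[OF w_in[OF AF aF] dWb dbW])
			have vA: "v A = dderiv X b A (a A) - dderiv X a A (b A)" by (simp add: v_def vf_bracket_def)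
			have "q (w A (v A)) (W A) = q (w A (dderiv X b A (a A))) (W A) - q (w A (dderiv X a A (b A))) (W A)"
				unfolding vA qw_linear(3)[OF AF dba dab] by simp
			\<comment> \<open>From here on antisymmetry brings the undifferentiated terms to the order a, b,
			  W and pairs off the derivatives of \<open>a\<close> along \<open>W\<close>.\<close>
			moreover have "q (w (b A) (a A)) (W A) = - q (w (a A) (b A)) (W A)" by (rule w_swap[OF bF aF WF])
			moreover have "q (w (W A) (a A)) (b A) = q (w (a A) (b A)) (W A)" by (subst w_swap[OF WF aF bF], subst q_swap[OF aF WF bF]) simp
			moreover have "q (w A (b A)) (dderiv X a A (W A)) = - q (w A (dderiv X a A (W A))) (b A)" by (rule q_swap[OF AF bF daW])
			ultimately show "snd (v A, q (w A (v A))) (W A) = lie_deriv X a (\<lambda>A. snd (e2 A)) W A -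
					ext_deriv X (\<lambda>A. snd (e1 A)) b W A - \<kappa> A (a A) (b A) (W A)" unfolding lie ext \<kappa>[OF A aF bF WF] by simp
		qed
	qed
qed

end

section \<open>Smooth functions and a mollifier on three-space\<close>

definition pd :: "3 => (real^3 => 'b::real_normed_vector) => real^3 => 'b" where
	"pd i f x = frechet_derivative f (at x) (axis i 1)"

lemma pd_eq: "(f has_derivative f') (at x) ==> pd i f x = f' (axis i 1)" unfolding pd_def using frechet_derivative_at by metis

lemma has_derivative_pd: assumes "f differentiable (at x)"
	shows "(f has_derivative (\<lambda>h. \<Sum>i\<in>UNIV. (h $ i) *\<^sub>R pd i f x)) (at x)" proof -
	have f: "(f has_derivative frechet_derivative f (at x)) (at x)" using assms frechet_derivative_works by blast
	then interpret bounded_linear "frechet_derivative f (at x)" by (rule has_derivative_bounded_linear)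
	have "frechet_derivative f (at x) = (\<lambda>h. \<Sum>i\<in>UNIV. (h $ i) *\<^sub>R pd i f x)" proof
		fix h :: "real^3"
		have "h = (\<Sum>i\<in>UNIV. (h $ i) *\<^sub>R axis i 1)"
			by (simp add: vec_eq_iff axis_def if_distrib[of "\<lambda>x. _ * x"] cong: if_cong)
		hence "frechet_derivative f (at x) h = frechet_derivative f (at x) (\<Sum>i\<in>UNIV. (h $ i) *\<^sub>R axis i 1)" by simp
		also have "\<dots> = (\<Sum>i\<in>UNIV. (h $ i) *\<^sub>R pd i f x)" by (simp add: sum scaleR pd_def)
		finally show "frechet_derivative f (at x) h = (\<Sum>i\<in>UNIV. (h $ i) *\<^sub>R pd i f x)" .
	qed
	thus ?thesis using f by simp
qed

lemma Ck_Suc: "Ck (Suc k) S f \<longleftrightarrow> (\<forall>x\<in>S. f differentiable (at x)) \<and> (\<forall>i. Ck k S (pd i f))"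
	unfolding pd_def[abs_def] by simp

declare Ck.simps(2)[simp del]

lemma Ck_continuous: "Ck k S f ==> continuous_on S f"
	by (cases k) (auto simp: Ck_Suc intro!: continuous_at_imp_continuous_on differentiable_imp_continuous_within)

lemma Ck_lower: "Ck (Suc k) S f ==> Ck k S f" proof (induction k arbitrary: f)
	case 0
	thus ?case using Ck_continuous[OF 0] by simp
next
	case (Suc k)
	thus ?case unfolding Ck_Suc[of "Suc k"] by (auto simp: Ck_Suc[of k])
qed

lemma smooth3_UNIV_iff: "smooth3 UNIV f \<longleftrightarrow> (\<forall>x. f differentiable (at x)) \<and> (\<forall>i. smooth3 UNIV (pd i f))"
proof
	assume f: "smooth3 UNIV f"
	hence "Ck (Suc k) UNIV f" for k unfolding smooth3_def by blast
	thus "(\<forall>x. f differentiable (at x)) \<and> (\<forall>i. smooth3 UNIV (pd i f))" unfolding smooth3_def Ck_Suc by blast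
next
	assume f: "(\<forall>x. f differentiable (at x)) \<and> (\<forall>i. smooth3 UNIV (pd i f))"
	hence s: "Ck (Suc k) UNIV f" for k unfolding smooth3_def Ck_Suc by blast
	have "Ck k UNIV f" for k using Ck_lower[OF s] .
	thus "smooth3 UNIV f" unfolding smooth3_def by blast
qed

lemma smooth3_differentiable: "smooth3 UNIV f ==> f differentiable (at x)" using smooth3_UNIV_iff by blast

lemma smooth3_pd: "smooth3 UNIV f ==> smooth3 UNIV (pd i f)" using smooth3_UNIV_iff by blast

lemma smooth3_continuous: "smooth3 UNIV f ==> continuous_on S f" unfolding smooth3_def using Ck_continuous continuous_on_subset by blast

lemma smooth3_borel: "smooth3 UNIV f ==> f\<in>borel_measurable borel"
	using smooth3_continuous[of f UNIV] by (rule borel_measurable_continuous_onI)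

lemma differentiable_has_derivative:
	"f differentiable (at x) ==> (f has_derivative frechet_derivative f (at x)) (at x)" using frechet_derivative_works by blast

lemma pd_add: "f differentiable (at x) ==> g differentiable (at x) ==> pd i (\<lambda>x. f x + g x) x = pd i f x + pd i g x"
	by (subst pd_eq[OF has_derivative_add[OF differentiable_has_derivative differentiable_has_derivative]])
		(auto simp: pd_def)

lemma pd_mult:
	fixes f g :: "real^3 => real"
	shows "f differentiable (at x) ==> g differentiable (at x) ==> pd i (\<lambda>x. f x * g x) x = pd i f x * g x + f x * pd i g x"
	by (subst pd_eq[OF has_derivative_mult[OF differentiable_has_derivative differentiable_has_derivative]])
		(auto simp: pd_def)

lemma pd_const [simp]: "pd i (\<lambda>x. c) x = 0" by (subst pd_eq[OF has_derivative_const]) auto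

lemma Ck_const: "Ck k S (\<lambda>x. c)" proof (induction k arbitrary: c)
	case (Suc k)
	have "pd i (\<lambda>x. c) = (\<lambda>x. 0)" for i by auto
	thus ?case unfolding Ck_Suc using Suc[of 0] by simp
qed simp

lemma Ck_add: "Ck k UNIV f ==> Ck k UNIV g ==> Ck k UNIV (\<lambda>x. f x + g x)" proof (induction k arbitrary: f g)
	case (Suc k)
	hence "pd i (\<lambda>x. f x + g x) = (\<lambda>x. pd i f x + pd i g x)" for i by (auto simp: Ck_Suc intro!: pd_add)
	with Suc show ?case unfolding Ck_Suc by (auto intro: differentiable_add)
qed (auto intro: continuous_intros)

lemma Ck_mult:
	fixes f g :: "real^3 => real" shows "Ck k UNIV f ==> Ck k UNIV g ==> Ck k UNIV (\<lambda>x. f x * g x)" proof (induction k arbitrary: f g)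
	case (Suc k)
	hence "pd i (\<lambda>x. f x * g x) = (\<lambda>x. pd i f x * g x + f x * pd i g x)" for i by (auto simp: Ck_Suc intro!: pd_mult)
	moreover have "Ck k UNIV f" "Ck k UNIV g" using Suc Ck_lower by blast+
	ultimately show ?case using Suc unfolding Ck_Suc by (auto intro!: differentiable_mult Ck_add)
qed (auto intro: continuous_intros)

lemma smooth3_mult: "smooth3 UNIV f ==> smooth3 UNIV g ==> smooth3 UNIV (\<lambda>x. f x * g x :: real)"
	unfolding smooth3_def using Ck_mult by blast

lemma smooth3_const: "smooth3 UNIV (\<lambda>x. c)" unfolding smooth3_def using Ck_const by blast

lemma pd_nth: "pd i (\<lambda>x. x $ j) = (\<lambda>x. if i = j then 1 else 0 :: real)" proof
	fix x :: "real^3"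
	have "((\<lambda>x::real^3. x $ j) has_derivative (\<lambda>h. h $ j)) (at x)"
		by (intro bounded_linear_imp_has_derivative bounded_linear_vec_nth)
	from pd_eq[OF this] show "pd i (\<lambda>x. x $ j) x = (if i = j then 1 else 0 :: real)" by (simp add: axis_def)
qed

lemma smooth3_nth: "smooth3 UNIV (\<lambda>x. x $ j)" unfolding smooth3_UNIV_iff[of "\<lambda>x. x $ j"] pd_nth
	by (auto intro!: smooth3_const bounded_linear_imp_differentiable bounded_linear_vec_nth)

text \<open>The scalar \<open>s\<close> takes part in the induction because every differentiation
  multiplies it by \<open>r\<close>.\<close>

lemma Ck_affine:
	fixes f :: "real^3 => 'b::real_normed_vector" shows "Ck k UNIV f ==> Ck k UNIV (\<lambda>y. s *\<^sub>R f (c + r *\<^sub>R y))"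
proof (induction k arbitrary: f s)
	case 0
	thus ?case by (auto intro!: continuous_intros continuous_on_compose2[of UNIV f])
next
	case (Suc k)
	have d: "((\<lambda>y. s *\<^sub>R f (c + r *\<^sub>R y)) has_derivative (\<lambda>h. s *\<^sub>R frechet_derivative f (at (c + r *\<^sub>R x)) (r *\<^sub>R h))) (at x)" for x
	proof -
		have "(f has_derivative frechet_derivative f (at (c + r *\<^sub>R x))) (at (c + r *\<^sub>R x))"
			using Suc(2) by (auto simp: Ck_Suc intro: differentiable_has_derivative)
		moreover have "((\<lambda>y. c + r *\<^sub>R y) has_derivative (\<lambda>h. r *\<^sub>R h)) (at x)" by (auto intro!: derivative_eq_intros)
		ultimately have "((\<lambda>y. f (c + r *\<^sub>R y)) has_derivative (\<lambda>h. frechet_derivative f (at (c + r *\<^sub>R x)) (r *\<^sub>R h))) (at x)"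
			using has_derivative_compose by blast
		thus ?thesis by (rule has_derivative_scaleR_right)
	qed
	have "pd i (\<lambda>y. s *\<^sub>R f (c + r *\<^sub>R y)) x = (s * r) *\<^sub>R pd i f (c + r *\<^sub>R x)" for i x proof -
		have "(f has_derivative frechet_derivative f (at (c + r *\<^sub>R x))) (at (c + r *\<^sub>R x))"
			using Suc(2) by (auto simp: Ck_Suc intro: differentiable_has_derivative)
		then interpret bounded_linear "frechet_derivative f (at (c + r *\<^sub>R x))" by (rule has_derivative_bounded_linear)
		show ?thesis using pd_eq[OF d] by (simp add: pd_def scaleR)
	qed
	hence "pd i (\<lambda>y. s *\<^sub>R f (c + r *\<^sub>R y)) = (\<lambda>x. (s * r) *\<^sub>R pd i f (c + r *\<^sub>R x))" for i by auto
	moreover have "Ck k UNIV (\<lambda>x. (s * r) *\<^sub>R pd i f (c + r *\<^sub>R x))" for i using Suc by (auto simp: Ck_Suc)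
	moreover have "(\<lambda>y. s *\<^sub>R f (c + r *\<^sub>R y)) differentiable (at x)" for x using d[of x] by (rule differentiableI)
	ultimately show ?case unfolding Ck_Suc by simp
qed

lemma smooth3_affine: "smooth3 UNIV f ==> smooth3 UNIV (\<lambda>y. s *\<^sub>R f (c + r *\<^sub>R y))"
	unfolding smooth3_def using Ck_affine by blast

lemma pd_affine: assumes "smooth3 UNIV f"
	shows "pd i (\<lambda>y. s *\<^sub>R f (c + r *\<^sub>R y)) x = (s * r) *\<^sub>R pd i f (c + r *\<^sub>R x)" proof -
	let ?u = "at (c + r *\<^sub>R x)"
	have f: "(f has_derivative frechet_derivative f ?u) ?u" using assms by (intro differentiable_has_derivative smooth3_differentiable)
	have "((\<lambda>y. c + r *\<^sub>R y) has_derivative (\<lambda>h. r *\<^sub>R h)) (at x)" by (auto intro!: derivative_eq_intros)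
	hence "((\<lambda>y. f (c + r *\<^sub>R y)) has_derivative (\<lambda>h. frechet_derivative f ?u (r *\<^sub>R h))) (at x)"
		using f has_derivative_compose by blast
	hence d: "((\<lambda>y. s *\<^sub>R f (c + r *\<^sub>R y)) has_derivative (\<lambda>h. s *\<^sub>R frechet_derivative f ?u (r *\<^sub>R h))) (at x)"
		by (rule has_derivative_scaleR_right)
	interpret bounded_linear "frechet_derivative f ?u" using f by (rule has_derivative_bounded_linear)
	show ?thesis using pd_eq[OF d] by (simp add: pd_def scaleR)
qed

text \<open>The functions \<open>t\<^sup>-\<^sup>m exp (-1/t)\<close>, extended by zero, are closed under differentiation up to linear
	combinations.\<close>

definition flat :: "nat => real => real" where
	"flat m t = (if t > 0 then inverse t^m * exp (- inverse t) else 0)"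

lemma flat_limit: "((\<lambda>t. flat m t) \<longlongrightarrow> 0) (at_right 0)" proof -
	have "((\<lambda>x::real. x^m/exp x) \<longlongrightarrow> 0) at_top" by (rule tendsto_power_div_exp_0)
	hence "((\<lambda>t::real. inverse t^m/exp (inverse t)) \<longlongrightarrow> 0) (at_right 0)"
		by (rule filterlim_compose[OF _ filterlim_inverse_at_top_right])
	thus ?thesis by (rule Lim_transform_eventually)
			(auto simp: flat_def eventually_at_right_field exp_minus field_simps intro: exI[of _ 1])
qed

lemma flat_DERIV: "(flat m has_real_derivative (flat (m + 2) t - real m * flat (m + 1) t)) (at t)" proof -
	let ?u = "(\<lambda>h. (flat m (0 + h) - flat m 0)/h) \<longlongrightarrow> 0"
	consider "t > 0" | "t < 0" | "t = 0" by linarith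
	thus ?thesis proof cases
		case 1
		have "((\<lambda>t. inverse t^m * exp (- inverse t)) has_real_derivative
				(flat (m + 2) t - real m * flat (m + 1) t)) (at t)" proof -
			have e: "real m * (inverse t^(m - Suc 0) * (inverse t * inverse t)) = real m * inverse t^(m + 1)" by (cases m) auto
			have i: "(inverse has_real_derivative - (inverse t * inverse t)) (at t)"
				using 1 by (auto intro!: derivative_eq_intros simp: power2_eq_square)
			have "((\<lambda>t. exp (- inverse t)) has_real_derivative exp (- inverse t) * (inverse t * inverse t)) (at t)"
				using DERIV_fun_exp[OF DERIV_minus[OF i]] by simp
			from DERIV_mult[OF DERIV_power[OF i, of m] this] e show ?thesis
				using 1 by (cases m) (simp_all add: flat_def algebra_simps power2_eq_square)
		qed
		thus ?thesis by (rule has_field_derivative_transform_within_open[where S = "{0<..}"]) (auto simp: flat_def 1)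
	next
		case 2
		have "((\<lambda>t. 0) has_real_derivative (flat (m + 2) t - real m * flat (m + 1) t)) (at t)" using 2 by (simp add: flat_def)
		thus ?thesis by (rule has_field_derivative_transform_within_open[where S = "{..<0}"]) (auto simp: flat_def 2)
	next
		\<comment> \<open>At 0 the right difference quotient of \<open>flat m\<close> is
		  \<open>flat (Suc m)\<close>, so \<open>flat_limit\<close> for the next exponent gives its limit;
		  the left quotient is zero.\<close>
		case 3
		have "?u (at 0)" proof (rule filterlim_split_at)
			show "?u (at_left 0)" by (rule Lim_transform_eventually[OF tendsto_const])
					(auto simp: flat_def eventually_at_left_field intro: exI[of _ "-1"])
			show "?u (at_right 0)" by (rule Lim_transform_eventually[OF flat_limit[of "Suc m"]])
					(auto simp: flat_def eventually_at_right_field field_simps intro: exI[of _ "1"])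
		qed
		thus ?thesis using 3 by (simp add: DERIV_def flat_def)
	qed
qed

text \<open>The coefficient \<open>P\<close> is an arbitrary smooth function so that the induction
  can absorb the coordinate factors from the chain rule; the exponents \<open>m + 1\<close> and
  \<open>m + 2\<close> come from \<open>flat_DERIV\<close>.\<close>

lemma Ck_flat: assumes "smooth3 UNIV P" shows "Ck k UNIV (\<lambda>x. P x * flat m (1 - x\<bullet>x))" using assms
proof (induction k arbitrary: P m)
	case 0
	have "continuous_on UNIV (flat m)" using flat_DERIV by (intro continuous_at_imp_continuous_on ballI DERIV_isCont) blast
	thus ?case using smooth3_continuous[OF 0, of UNIV] by (auto intro!: continuous_intros continuous_on_compose2[of UNIV "flat m"])
next
	case (Suc k)
	have d: "((\<lambda>x. P x * flat m (1 - x\<bullet>x)) has_derivative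
		(\<lambda>h. P x * ((flat (m + 2) (1 - x\<bullet>x) - real m * flat (m + 1) (1 - x\<bullet>x)) * (- 2 * (x\<bullet>h))) +
			frechet_derivative P (at x) h * flat m (1 - x\<bullet>x))) (at x)" for x proof -
		have "(flat m has_derivative (\<lambda>h. (flat (m + 2) (1 - x\<bullet>x) - real m * flat (m + 1) (1 - x\<bullet>x)) * h)) (at (1 - x\<bullet>x))"
			using flat_DERIV unfolding has_field_derivative_def by blast
		moreover have "((\<lambda>x. 1 - x\<bullet>x) has_derivative (\<lambda>h. - 2 * (x\<bullet>h))) (at x)"
			by (auto intro!: derivative_eq_intros simp: inner_commute)
		ultimately have "((\<lambda>x. flat m (1 - x\<bullet>x)) has_derivative
				(\<lambda>h. (flat (m + 2) (1 - x\<bullet>x) - real m * flat (m + 1) (1 - x\<bullet>x)) * (- 2 * (x\<bullet>h)))) (at x)"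
			using has_derivative_compose by blast
		moreover have "(P has_derivative frechet_derivative P (at x)) (at x)"
			using Suc(2) by (intro differentiable_has_derivative smooth3_differentiable)
		ultimately show ?thesis using has_derivative_mult by blast
	qed
	have "pd i (\<lambda>x. P x * flat m (1 - x\<bullet>x)) = (\<lambda>x. (pd i P x * flat m (1 - x\<bullet>x) +
			(-2 * (x $ i * P x)) * flat (m + 2) (1 - x\<bullet>x)) + (2 * real m * (x $ i * P x)) * flat (m + 1) (1 - x\<bullet>x))" for i
		using pd_eq[OF d] by (auto simp: pd_def inner_axis algebra_simps)
	moreover have "Ck k UNIV (\<lambda>x. (pd i P x * flat m (1 - x\<bullet>x) +
			(-2 * (x $ i * P x)) * flat (m + 2) (1 - x\<bullet>x)) + (2 * real m * (x $ i * P x)) * flat (m + 1) (1 - x\<bullet>x))" for i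
		by (intro Ck_add Suc.IH smooth3_mult smooth3_nth smooth3_const smooth3_pd Suc.prems)
	moreover have "(\<lambda>x. P x * flat m (1 - x\<bullet>x)) differentiable (at x)" for x using d[of x] by (rule differentiableI)
	ultimately show ?case unfolding Ck_Suc by simp
qed

lemma smooth3_flat: "smooth3 UNIV (\<lambda>x. flat 0 (1 - x\<bullet>x))" unfolding smooth3_def using Ck_flat[OF smooth3_const[of 1]] by simp

lemma integrable_continuous_compact_support:
	fixes f :: "'a::euclidean_space => 'b::euclidean_space"
	assumes "continuous_on UNIV f" "compact K" "\<And>x. x\<notin>K ==> f x = 0" shows "integrable lborel f" proof -
	have "integrable lborel (\<lambda>x. indicator K x *\<^sub>R f x)"
		using assms(1,2) by (intro borel_integrable_compact continuous_on_subset[OF assms(1)]) auto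
	moreover have "(\<lambda>x. indicator K x *\<^sub>R f x) = f" using assms(3) by (auto simp: indicator_def fun_eq_iff)
	ultimately show ?thesis by simp
qed

text \<open>The usual bump exp(-1/(1 - |x|^2)) on the unit ball, divided by its integral.\<close>

definition mollifier :: "real^3 => real" where
	"mollifier x = flat 0 (1 - x\<bullet>x)/(LINT x|lborel. flat 0 (1 - x\<bullet>(x::real^3)))"

lemma flat_bump_zero: "1 \<le> norm x ==> flat 0 (1 - x\<bullet>x) = 0"
	by (simp add: flat_def power2_norm_eq_inner[symmetric] not_less one_le_power)

lemma flat_bump_integrable: "integrable lborel (\<lambda>x::real^3. flat 0 (1 - x\<bullet>x))"
	by (rule integrable_continuous_compact_support[OF smooth3_continuous[OF smooth3_flat] compact_cball[of 0 1]])
		(auto intro!: flat_bump_zero)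

lemma flat_bump_pos: "0 < (LINT x|lborel. flat 0 (1 - x\<bullet>(x::real^3)))" proof -
	have nn: "0 \<le> flat 0 (1 - x\<bullet>x)" for x :: "real^3" by (simp add: flat_def)
	hence "0 \<le> (LINT x|lborel. flat 0 (1 - x\<bullet>(x::real^3)))" by simp
	moreover have "(LINT x|lborel. flat 0 (1 - x\<bullet>(x::real^3))) \<noteq> 0" proof
		assume "(LINT x|lborel. flat 0 (1 - x\<bullet>(x::real^3))) = 0"
		hence ae: "AE x in lborel. flat 0 (1 - x\<bullet>(x::real^3)) = 0" using integral_nonneg_eq_0_iff_AE[OF flat_bump_integrable] nn by simp
		have "AE x in lborel. x\<notin>ball (0::real^3) 1" using ae proof eventually_elim
			case (elim x)
			hence "\<not> 0 < 1 - x\<bullet>x" by (auto simp: flat_def split: if_splits)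
			moreover have "x\<bullet>x < 1" if "norm x < 1"
				using that power_less_one_iff[of "norm x" 2] by (simp only: power2_norm_eq_inner[symmetric]) simp
			ultimately show ?case by auto
		qed
		hence "ball (0::real^3) 1\<in>null_sets lborel" by (subst AE_iff_null_sets) auto
		hence "negligible (ball (0::real^3) 1)" using negligible_iff_null_sets null_sets_completionI by blast
		thus False using open_not_negligible[of "ball (0::real^3) 1"] by simp
	qed
	ultimately show ?thesis by simp
qed

lemma mollifier_smooth: "smooth3 UNIV mollifier"
	using smooth3_mult[OF smooth3_const[of "inverse (LINT x|lborel. flat 0 (1 - x\<bullet>(x::real^3)))"] smooth3_flat]
	by (simp add: mollifier_def[abs_def] field_simps)

lemma mollifier_nonneg: "0 \<le> mollifier x" using flat_bump_pos by (simp add: mollifier_def flat_def)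

lemma mollifier_zero: "1 \<le> norm x ==> mollifier x = 0" by (simp add: mollifier_def flat_bump_zero)

lemma mollifier_integrable: "integrable lborel mollifier" unfolding mollifier_def[abs_def] using flat_bump_integrable by simp

lemma mollifier_integral: "(LINT x|lborel. mollifier x) = 1" unfolding mollifier_def using flat_bump_pos by simp

section \<open>Square integrable functions and mollification\<close>

abbreviation cut :: "'a set => ('a => real) => 'a => real" where
	"cut K f \<equiv> \<lambda>x. indicat_real K x * f x"

definition L2 :: "('a::euclidean_space => real) => bool" where
	"L2 h \<longleftrightarrow> h\<in>borel_measurable borel \<and> integrable lborel (\<lambda>x. (h x)\<^sup>2)"

definition nsq :: "('a::euclidean_space => real) => real" where
	"nsq h = (LINT x|lborel. (h x)\<^sup>2)"

lemma L2_borel [measurable_dest]: "L2 h ==> h\<in>borel_measurable borel" by (simp add: L2_def)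

lemma nsq_nonneg [simp]: "0 \<le> nsq h" by (simp add: nsq_def)

lemma L2_add: assumes "L2 f" "L2 g" shows "L2 (\<lambda>x. f x + g x)" "nsq (\<lambda>x. f x + g x) \<le> 2 * nsq f + 2 * nsq g" proof -
	let ?u = "\<lambda>x. f x + g x"
	have i: "integrable lborel (\<lambda>x. 2 * (f x)\<^sup>2 + 2 * (g x)\<^sup>2)" using assms by (auto simp: L2_def)
	have b: "(f x + g x)\<^sup>2 \<le> 2 * (f x)\<^sup>2 + 2 * (g x)\<^sup>2" for x
		using sum_squares_bound[of "f x" "g x"] by (simp add: power2_sum)
	have "integrable lborel (\<lambda>x. (f x + g x)\<^sup>2)"
		using assms by (intro Bochner_Integration.integrable_bound[OF i]) (auto simp: L2_def b intro!: AE_I2 order_trans[OF b])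
	thus "L2 ?u" using assms by (auto simp: L2_def)
	have "nsq ?u \<le> (LINT x|lborel. 2 * (f x)\<^sup>2 + 2 * (g x)\<^sup>2)"
		unfolding nsq_def by (intro integral_mono i \<open>integrable lborel (\<lambda>x. (f x + g x)\<^sup>2)\<close> b)
	also have "\<dots> = 2 * nsq f + 2 * nsq g" using assms by (simp add: nsq_def L2_def)
	finally show "nsq ?u \<le> 2 * nsq f + 2 * nsq g" .
qed

lemma L2_cmult: assumes "L2 f" shows "L2 (\<lambda>x. c * f x)" "nsq (\<lambda>x. c * f x) = c\<^sup>2 * nsq f"
	using assms by (auto simp: L2_def nsq_def power_mult_distrib)

lemma L2_diff: assumes "L2 f" "L2 g" shows "L2 (\<lambda>x. f x - g x)" "nsq (\<lambda>x. f x - g x) \<le> 2 * nsq f + 2 * nsq g"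
	using L2_add[OF assms(1) L2_cmult(1)[OF assms(2), of "-1"]] L2_cmult(2)[OF assms(2), of "-1"] by simp_all

lemma L2_mult_bounded: assumes "L2 f" "b\<in>borel_measurable borel" "\<And>x. \<bar>b x\<bar> \<le> B"
	shows "L2 (\<lambda>x. b x * f x)" "nsq (\<lambda>x. b x * f x) \<le> B\<^sup>2 * nsq f" proof -
	have b: "(b x * f x)\<^sup>2 \<le> B\<^sup>2 * (f x)\<^sup>2" for x
		using power_mono[OF assms(3)[of x], of 2] by (simp add: power_mult_distrib mult_right_mono)
	have i: "integrable lborel (\<lambda>x. B\<^sup>2 * (f x)\<^sup>2)" using assms by (auto simp: L2_def)
	have i': "integrable lborel (\<lambda>x. (b x * f x)\<^sup>2)"
		using assms by (intro Bochner_Integration.integrable_bound[OF i]) (auto simp: L2_def intro!: AE_I2 b)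
	thus "L2 (\<lambda>x. b x * f x)" using assms by (auto simp: L2_def)
	show "nsq (\<lambda>x. b x * f x) \<le> B\<^sup>2 * nsq f" using integral_mono[OF i' i b] by (simp add: nsq_def)
qed

lemma L2_product: assumes "L2 f" "L2 g"
	shows "integrable lborel (\<lambda>x. f x * g x)" "(LINT x|lborel. f x * g x)\<^sup>2 \<le> nsq f * nsq g"
		"\<bar>LINT x|lborel. f x * g x\<bar> \<le> sqrt (nsq f) * sqrt (nsq g)" proof -
	have i: "integrable lborel (\<lambda>x. (f x)\<^sup>2 + (g x)\<^sup>2)" using assms by (auto simp: L2_def)
	have b: "\<bar>f x * g x\<bar> \<le> (f x)\<^sup>2 + (g x)\<^sup>2" for x proof -
		have "2 * \<bar>f x * g x\<bar> \<le> (f x)\<^sup>2 + (g x)\<^sup>2"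
			using sum_squares_bound[of "\<bar>f x\<bar>" "\<bar>g x\<bar>"] by (simp add: abs_mult mult.assoc)
		thus ?thesis using abs_ge_zero[of "f x * g x"] by linarith
	qed
	show ifg: "integrable lborel (\<lambda>x. f x * g x)"
		using assms by (intro Bochner_Integration.integrable_bound[OF i]) (auto simp: L2_def b intro!: AE_I2 order_trans[OF b])
	define C where "C = (LINT x|lborel. f x * g x)"
	\<comment> \<open>The squared norm of \<open>f + t g\<close> is nonnegative for every
	  \<open>t\<close>; Cauchy-Schwarz is the discriminant condition of this quadratic
	  polynomial.\<close>
	have q: "0 \<le> nsq f + 2 * t * C + t\<^sup>2 * nsq g" for t proof -
		have "0 \<le> nsq (\<lambda>x. f x + t * g x)" by simp
		also have "\<dots> = (LINT x|lborel. (f x)\<^sup>2 + 2 * t * (f x * g x) + t\<^sup>2 * (g x)\<^sup>2)"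
			unfolding nsq_def by (intro Bochner_Integration.integral_cong refl) (simp add: power2_sum power_mult_distrib algebra_simps)
		also have "\<dots> = nsq f + 2 * t * C + t\<^sup>2 * nsq g" using assms ifg by (simp add: nsq_def C_def L2_def)
		finally show ?thesis .
	qed
	have "C\<^sup>2 \<le> nsq f * nsq g" proof (cases "nsq g = 0")
		case True
		have "C = 0" proof (rule ccontr)
			assume "C \<noteq> 0"
			\<comment> \<open>For this \<open>t\<close> the polynomial, which has degree one when
			  \<open>nsq g = 0\<close>, takes the value -1.\<close>
			thus False using q[of "- (nsq f + 1)/(2 * C)"] True by (simp add: field_simps)
		qed
		thus ?thesis by simp
	next
		case False
		hence p: "0 < nsq g" using nsq_nonneg[of g] by linarith
		define t where "t = - C/nsq g"
		have t: "t * nsq g = - C" using p by (simp add: t_def)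
		hence "t\<^sup>2 * nsq g = - (t * C)" by (simp add: power2_eq_square mult.assoc)
		hence "0 \<le> nsq f + t * C" using q[of t] by (simp add: mult.commute[of t C] mult.assoc)
		hence "0 \<le> (nsq f + t * C) * nsq g" using p by (intro mult_nonneg_nonneg) auto
		also have "\<dots> = nsq f * nsq g + (t * nsq g) * C" by (simp add: algebra_simps)
		also have "\<dots> = nsq f * nsq g - C\<^sup>2" unfolding t by (simp add: power2_eq_square)
		finally show ?thesis by simp
	qed
	thus s: "(LINT x|lborel. f x * g x)\<^sup>2 \<le> nsq f * nsq g" by (simp add: C_def)
	thus "\<bar>LINT x|lborel. f x * g x\<bar> \<le> sqrt (nsq f) * sqrt (nsq g)" by (metis real_sqrt_abs real_sqrt_le_mono real_sqrt_mult)
qed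

lemma integral_translate:
	fixes f :: "'a::euclidean_space => 'b::{banach, second_countable_topology}" assumes "f\<in>borel_measurable borel"
	shows "(LINT x|lborel. f (x + v)) = (LINT x|lborel. f x)"
		"integrable lborel (\<lambda>x. f (x + v)) \<longleftrightarrow> integrable lborel f" proof -
	have l: "distr lborel borel ((+) v) = (lborel :: 'a measure)" by (rule lborel_distr_plus)
	have "(LINT x|lborel. f x) = (LINT x|distr lborel borel ((+) v). f x)" by (simp add: l)
	also have "\<dots> = (LINT x|lborel. f (v + x))" by (rule integral_distr) (use assms in auto)
	finally show "(LINT x|lborel. f (x + v)) = (LINT x|lborel. f x)" by (simp add: add.commute)
	have "integrable lborel f \<longleftrightarrow> integrable (distr lborel borel ((+) v)) f" by (simp add: l)
	also have "\<dots> \<longleftrightarrow> integrable lborel (\<lambda>x. f (v + x))" by (rule integrable_distr_eq) (use assms in auto)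
	finally show "integrable lborel (\<lambda>x. f (x + v)) \<longleftrightarrow> integrable lborel f" by (simp add: add.commute)
qed

lemma L2_translate: assumes "L2 h" shows "L2 (\<lambda>x. h (x + v))" "nsq (\<lambda>x. h (x + v)) = nsq h"
	using assms integral_translate[of "\<lambda>x. (h x)\<^sup>2" v] by (auto simp: L2_def nsq_def)

lemma L2_continuous_compact_support: assumes "continuous_on UNIV f" "compact K" "\<And>x. x\<notin>K ==> f x = 0"
	shows "L2 f" unfolding L2_def using assms integrable_continuous_compact_support[of "\<lambda>x. (f x)\<^sup>2" K]
	by (auto intro!: borel_measurable_continuous_onI continuous_intros)

lemma integrable_indicat_compact:
	"compact (K :: 'a::euclidean_space set) ==> integrable lborel (indicat_real K)"
	using borel_integrable_compact[of K "\<lambda>_. 1 :: real"] by simp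

text \<open>Measurability yields continuous functions converging to \<open>h\<close> almost
  everywhere. Clipping them at \<open>M\<close> and multiplying by the cutoff \<open>c\<close> makes
  them dominated and compactly supported without changing the limit.\<close>

lemma L2_dense_bounded:
	fixes h :: "'a::euclidean_space => real"
	assumes h: "h\<in>borel_measurable borel" and M: "\<And>x. \<bar>h x\<bar> \<le> M" and R: "\<And>x. R < norm x ==> h x = 0" and e: "0 < e"
	shows "\<exists>g K. continuous_on UNIV g \<and> compact K \<and> (\<forall>x. x\<notin>K \<longrightarrow> g x = 0) \<and> nsq (\<lambda>x. h x - g x) < e"
proof -
	let ?u = "cball 0 (R + 1)"
	have "h\<in>borel_measurable lebesgue" using h by (intro measurable_completion) simp
	hence "h measurable_on UNIV" by (simp add: measurable_on_iff_borel_measurable)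
	then obtain N g where N: "negligible N" and g: "\<And>n. continuous_on UNIV (g n)"
		and lim: "\<And>x. x\<notin>N ==> (\<lambda>n::nat. g n x) \<longlonglongrightarrow> h x" unfolding measurable_on_def by auto
	\<comment> \<open>Equal to 1 up to radius \<open>R\<close> and to 0 beyond
	  \<open>R + 1\<close>.\<close>
	define c where "c x = max 0 (min 1 (R + 1 - norm x))" for x :: 'a
	define f where "f n x = c x * max (- M) (min M (g n x))" for n x
	have M0: "0 \<le> M" using M[of 0] by linarith
	have cc: "continuous_on UNIV c" unfolding c_def by (intro continuous_intros)
	have fc: "continuous_on UNIV (f n)" for n unfolding f_def by (intro continuous_intros cc g)
	have f0: "f n x = 0" if "x\<notin>cball 0 (R + 1)" for n x using that by (simp add: f_def c_def)
	have fM: "\<bar>f n x\<bar> \<le> M" for n x proof -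
		have "\<bar>c x\<bar> \<le> 1" "\<bar>max (- M) (min M (g n x))\<bar> \<le> M" using M0 by (auto simp: c_def)
		thus ?thesis unfolding f_def abs_mult using mult_mono[of "\<bar>c x\<bar>" 1 "\<bar>max (- M) (min M (g n x))\<bar>" M] by simp
	qed
	have flim: "(\<lambda>n. f n x) \<longlonglongrightarrow> h x" if "x\<notin>N" for x proof -
		have "(\<lambda>n. f n x) \<longlonglongrightarrow> c x * max (- M) (min M (h x))" unfolding f_def by (intro tendsto_intros lim that)
		also have "c x * max (- M) (min M (h x)) = h x" using M[of x] R[of x] by (cases "R < norm x") (auto simp: c_def max_def min_def)
		finally show ?thesis .
	qed
	have "(\<lambda>n. LINT x|lborel. (h x - f n x)\<^sup>2) \<longlonglongrightarrow> (LINT x::'a|lborel. (0::real))"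
	proof (rule integral_dominated_convergence[where w = "\<lambda>x. indicator ?u x * (2 * M)\<^sup>2"])
		show "integrable lborel (\<lambda>x::'a. indicator ?u x * (2 * M)\<^sup>2)"
			by (intro integrable_mult_left integrable_indicat_compact compact_cball)
		show "AE x in lborel. (\<lambda>n. (h x - f n x)\<^sup>2) \<longlonglongrightarrow> 0" proof -
			have "N\<in>null_sets lebesgue" using N by (simp add: negligible_iff_null_sets)
			hence "AE x in lebesgue. x\<notin>N" by (rule AE_not_in)
			hence "AE x in lborel. x\<notin>N" by (simp add: AE_completion_iff)
			thus ?thesis proof eventually_elim
				case (elim x)
				have "(\<lambda>n. (h x - f n x)\<^sup>2) \<longlonglongrightarrow> (h x - h x)\<^sup>2" by (intro tendsto_intros flim elim)
				thus ?case by simp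
			qed
		qed
		show "AE x in lborel. norm ((h x - f n x)\<^sup>2) \<le> indicator ?u x * (2 * M)\<^sup>2" for n proof (rule AE_I2)
			fix x :: 'a
			show "norm ((h x - f n x)\<^sup>2) \<le> indicator ?u x * (2 * M)\<^sup>2" proof (cases "x\<in>cball 0 (R + 1)")
				case True
				have "\<bar>h x - f n x\<bar> \<le> 2 * M" using M[of x] fM[of n x] by linarith
				hence "(h x - f n x)\<^sup>2 \<le> (2 * M)\<^sup>2" by (metis abs_ge_zero power2_abs power_mono)
				thus ?thesis using True by simp
			next
				case False
				thus ?thesis using f0[OF False] R[of x] by simp
			qed
		qed
	qed (use h borel_measurable_continuous_onI[OF fc] in \<open>auto intro!: borel_measurable_power borel_measurable_diff\<close>)
	hence "(\<lambda>n. nsq (\<lambda>x. h x - f n x)) \<longlonglongrightarrow> 0" by (simp add: nsq_def)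
	hence "eventually (\<lambda>n. nsq (\<lambda>x. h x - f n x) < e) sequentially" using e by (rule order_tendstoD)
	then obtain n where "nsq (\<lambda>x. h x - f n x) < e" using eventually_happens'[OF sequentially_bot] by blast
	thus ?thesis using fc f0 by (intro exI[of _ "f n"] exI[of _ "cball 0 (R + 1)"]) auto
qed

lemma L2_dense:
	fixes h :: "'a::euclidean_space => real" assumes h: "L2 h" and e: "0 < e"
	shows "\<exists>g K. continuous_on UNIV g \<and> compact K \<and> (\<forall>x. x\<notin>K \<longrightarrow> g x = 0) \<and> nsq (\<lambda>x. h x - g x) < e"
proof -
	\<comment> \<open>Truncation in size and in space reduces the claim to
	  \<open>L2_dense_bounded\<close>; the errors are dominated by
	  \<open>(h x)\<^sup>2\<close>.\<close>
	define f where "f n x = (if \<bar>h x\<bar> \<le> real n \<and> norm x \<le> real n then h x else 0)" for n x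
	have fm: "f n\<in>borel_measurable borel" for n unfolding f_def using L2_borel[OF h] by measurable
	have "(\<lambda>n. LINT x|lborel. (h x - f n x)\<^sup>2) \<longlonglongrightarrow> (LINT x::'a|lborel. (0::real))"
	proof (rule integral_dominated_convergence[where w = "\<lambda>x. (h x)\<^sup>2"])
		show "AE x in lborel. (\<lambda>n. (h x - f n x)\<^sup>2) \<longlonglongrightarrow> 0" proof (rule AE_I2)
			fix x
			obtain n0 where n0: "max \<bar>h x\<bar> (norm x) \<le> real n0" using real_arch_simple by blast
			have "eventually (\<lambda>n. (h x - f n x)\<^sup>2 = 0) sequentially"
				using eventually_ge_at_top[of n0] by eventually_elim (use n0 in \<open>auto simp: f_def\<close>)
			thus "(\<lambda>n. (h x - f n x)\<^sup>2) \<longlonglongrightarrow> 0" by (simp add: tendsto_eventually)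
		qed
	qed (use h fm in \<open>auto simp: L2_def f_def intro!: AE_I2\<close>)
	hence "(\<lambda>n. nsq (\<lambda>x. h x - f n x)) \<longlonglongrightarrow> 0" by (simp add: nsq_def)
	hence "eventually (\<lambda>n. nsq (\<lambda>x. h x - f n x) < e/4) sequentially" using e by (intro order_tendstoD(2)[of _ 0]) auto
	then obtain n where n: "nsq (\<lambda>x. h x - f n x) < e/4" using eventually_happens'[OF sequentially_bot] by blast
	have "\<exists>g K. continuous_on UNIV g \<and> compact K \<and> (\<forall>x. x\<notin>K \<longrightarrow> g x = 0) \<and> nsq (\<lambda>x. f n x - g x) < e/4"
		using e by (intro L2_dense_bounded[where M = "real n" and R = "real n"] fm) (auto simp: f_def)
	then obtain g K where g: "continuous_on UNIV g" "compact K" "\<And>x. x\<notin>K ==> g x = 0" "nsq (\<lambda>x. f n x - g x) < e/4" by blast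
	have fL: "L2 (f n)" unfolding L2_def using fm h
		by (auto simp: L2_def f_def intro!: Bochner_Integration.integrable_bound[of lborel "\<lambda>x. (h x)\<^sup>2"])
	have gL: "L2 g" using L2_continuous_compact_support[OF g(1,2,3)] .
	have "nsq (\<lambda>x. (h x - f n x) + (f n x - g x)) \<le> 2 * nsq (\<lambda>x. h x - f n x) + 2 * nsq (\<lambda>x. f n x - g x)"
		by (intro L2_add L2_diff h fL gL)
	hence "nsq (\<lambda>x. h x - g x) < e" using n g(4) by simp
	thus ?thesis using g by blast
qed

text \<open>A compactly supported continuous approximant \<open>g\<close> is uniformly continuous,
  and translation preserves L2 norms, so the error \<open>h - g\<close> enters with the same size
  before and after the shift.\<close>

lemma L2_translation_continuous:
	fixes h :: "'a::euclidean_space => real" assumes h: "L2 h" and e: "0 < e"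
	shows "\<exists>d>0. \<forall>v. norm v < d \<longrightarrow> nsq (\<lambda>x. h (x + v) - h x) < e" proof -
	let ?u = "\<lambda>m. e/(8 * (m + 1))"
	\<comment> \<open>By \<open>L2_add\<close>, used twice, the approximation error is counted 8 times
	  and the shift of \<open>g\<close> twice: 8 * e/16 + 2 * e/8 is below \<open>e\<close>.\<close>
	obtain g K where g: "continuous_on UNIV g" "compact K" "\<And>x. x\<notin>K ==> g x = 0" "nsq (\<lambda>x. h x - g x) < e/16"
		using L2_dense[OF h, of "e/16"] e by auto
	have gL: "L2 g" using L2_continuous_compact_support[OF g(1,2,3)] .
	obtain R where R: "0 < R" "\<forall>x\<in>K. norm x \<le> R" using compact_imp_bounded[OF g(2)] bounded_pos by blast
	let ?B = "cball (0::'a) (R + 1)"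
	define m where "m = measure lborel ?B"
	have m0: "0 \<le> m" by (simp add: m_def)
	have "uniformly_continuous_on (cball 0 (R + 2)) g" by (intro compact_uniformly_continuous continuous_on_subset[OF g(1)]) auto
	moreover have "0 < sqrt (?u m)" using e by (simp add: m_def add_nonneg_pos)
	ultimately obtain d where d: "0 < d" "\<And>x y. x\<in>cball 0 (R + 2) ==> y\<in>cball 0 (R + 2) ==> dist y x < d ==>
			dist (g y) (g x) < sqrt (?u m)" unfolding uniformly_continuous_on_def by metis
	show ?thesis proof (intro exI[of _ "min d 1"] conjI allI impI)
		fix v :: 'a assume v: "norm v < min d 1"
		have b: "(g (x + v) - g x)\<^sup>2 \<le> indicator ?B x * (?u m)" for x proof (cases "x\<in>?B")
			case True
			hence "norm (x + v) \<le> R + 2" using v norm_triangle_ineq[of x v] by simp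
			hence "dist (g (x + v)) (g x) < sqrt (?u m)" using True v by (intro d(2)) (auto simp: dist_norm[of "x + v" x])
			hence "\<bar>g (x + v) - g x\<bar>\<^sup>2 \<le> (sqrt (?u m))\<^sup>2" by (intro power_mono) (auto simp: dist_real_def)
			thus ?thesis using True e by (simp add: m_def)
		next
			case False
			have "norm x \<le> norm (x + v) + norm v" by (metis add_diff_cancel_right' norm_triangle_ineq4)
			hence "x\<notin>K" "x + v\<notin>K" using False v R by auto
			thus ?thesis using g(3) e False by simp
		qed
		have i: "integrable lborel (\<lambda>x. indicator ?B x * (?u m))" by (intro integrable_mult_left integrable_indicat_compact compact_cball)
		have "nsq (\<lambda>x. g (x + v) - g x) \<le> (LINT x|lborel. indicator ?B x * (?u m))"
			unfolding nsq_def using L2_diff(1)[OF L2_translate(1)[OF gL, of v] gL] by (intro integral_mono i b) (auto simp: L2_def)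
		also have "\<dots> = m * (?u m)" by (simp add: m_def)
		also have "\<dots> = e/8 * (m/(m + 1))" by simp
		also have "\<dots> \<le> e/8 * 1" using e m0 by (intro mult_left_mono) auto
		also have "\<dots> = e/8" by simp
		finally have 1: "nsq (\<lambda>x. g (x + v) - g x) \<le> e/8" .
		have "nsq (\<lambda>x. h (x + v) - g (x + v)) = nsq (\<lambda>x. h x - g x)" using L2_translate(2)[OF L2_diff(1)[OF h gL], of v] .
		moreover have "nsq (\<lambda>x. g x - h x) = nsq (\<lambda>x. h x - g x)" by (simp add: nsq_def power2_commute)
		moreover have "nsq (\<lambda>x. (h (x + v) - g (x + v)) + (g x - h x)) \<le> 2 * nsq (\<lambda>x. h (x + v) - g (x + v)) + 2 * nsq (\<lambda>x. g x - h x)"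
			by (intro L2_add L2_diff L2_translate h gL)
		moreover have "nsq (\<lambda>x. (g (x + v) - g x) + ((h (x + v) - g (x + v)) + (g x - h x))) \<le>
				2 * nsq (\<lambda>x. g (x + v) - g x) + 2 * nsq (\<lambda>x. (h (x + v) - g (x + v)) + (g x - h x))"
			by (intro L2_add L2_diff L2_translate h gL)
		ultimately show "nsq (\<lambda>x. h (x + v) - h x) < e" using 1 g(4) e by (simp add: algebra_simps)
	qed (use d in auto)
qed

text \<open>Written with a fixed kernel and a scaled argument, so that the error is an average of
  translation errors of \<open>h\<close>. The equivalent \<open>conv (eta e) h\<close> is the form
  in which derivatives fall on the kernel.\<close>

definition moll :: "real => (real^3 => real) => real^3 => real" where
	"moll e h x = (LINT z|lborel. mollifier z * h (x - e *\<^sub>R z))"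

lemma mollifier_bounded: "\<exists>B>0. \<forall>x. \<bar>mollifier x\<bar> \<le> B" proof -
	have "compact (mollifier ` cball 0 1)" by (intro compact_continuous_image smooth3_continuous[OF mollifier_smooth]) auto
	then obtain B where B: "0 < B" "\<And>y. y\<in>mollifier ` cball 0 1 ==> \<bar>y\<bar> \<le> B"
		using compact_imp_bounded bounded_pos by (metis real_norm_def)
	have "\<bar>mollifier x\<bar> \<le> B" for x using B mollifier_zero[of x] by (cases "norm x \<le> 1") auto
	thus ?thesis using B(1) by blast
qed

lemma L2_mollifier: "L2 mollifier" by (rule L2_continuous_compact_support[OF smooth3_continuous[OF mollifier_smooth] compact_cball[of 0 1]])
		(auto intro!: mollifier_zero)

lemma integral_affine:
	fixes f :: "'a::euclidean_space => real" assumes "f\<in>borel_measurable borel" "c \<noteq> 0"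
	shows "integrable lborel (\<lambda>x. f (t + c *\<^sub>R x)) \<longleftrightarrow> integrable lborel f"
		"(LINT x|lborel. f x) = \<bar>c\<bar>^DIM('a) * (LINT x|lborel. f (t + c *\<^sub>R x))" proof -
	let ?u = "\<bar>c\<bar>^DIM('a)"
	have [measurable]: "f\<in>borel_measurable borel" by fact
	have l: "lborel = density (distr lborel borel (\<lambda>x::'a. t + c *\<^sub>R x)) (\<lambda>_. ennreal ?u)"
		using lborel_affine[OF assms(2), of t] by simp
	have "integrable lborel f \<longleftrightarrow> integrable (density (distr lborel borel (\<lambda>x::'a. t + c *\<^sub>R x)) (\<lambda>_. ennreal ?u)) f"
		using l by simp
	also have "\<dots> \<longleftrightarrow> integrable (distr lborel borel (\<lambda>x::'a. t + c *\<^sub>R x)) (\<lambda>x. ?u * f x)"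
		by (subst integrable_density) auto
	also have "\<dots> \<longleftrightarrow> integrable lborel (\<lambda>x. ?u * f (t + c *\<^sub>R x))" by (subst integrable_distr_eq) auto
	also have "\<dots> \<longleftrightarrow> integrable lborel (\<lambda>x. f (t + c *\<^sub>R x))" using assms(2) by simp
	finally show "integrable lborel (\<lambda>x. f (t + c *\<^sub>R x)) \<longleftrightarrow> integrable lborel f" by simp
	have "(LINT x|lborel. f x) = (LINT x|density (distr lborel borel (\<lambda>x::'a. t + c *\<^sub>R x)) (\<lambda>_. ennreal ?u). f x)"
		using l by simp
	also have "\<dots> = (LINT x|distr lborel borel (\<lambda>x::'a. t + c *\<^sub>R x). ?u * f x)" by (subst integral_density) auto
	also have "\<dots> = (LINT x|lborel. ?u * f (t + c *\<^sub>R x))" by (subst integral_distr) auto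
	finally show "(LINT x|lborel. f x) = \<bar>c\<bar>^DIM('a) * (LINT x|lborel. f (t + c *\<^sub>R x))" by simp
qed

lemma L2_affine: assumes "L2 (h :: 'a::euclidean_space => real)" "c \<noteq> 0"
	shows "L2 (\<lambda>x. h (t + c *\<^sub>R x))" "nsq h = \<bar>c\<bar>^DIM('a) * nsq (\<lambda>x. h (t + c *\<^sub>R x))"
	using assms integral_affine[of "\<lambda>x. (h x)\<^sup>2" c t] by (auto simp: L2_def nsq_def)

text \<open>The mollifier is a probability density, so by Cauchy-Schwarz the squared error is at
  most the average of \<open>(h (x - e *\<^sub>R z) - h x)\<^sup>2\<close>. Exchanging the integrals
  leaves translation errors by vectors shorter than \<open>e0\<close>, each below
  \<open>d\<close>.\<close>

lemma moll_L2_convergence: assumes h: "L2 h" and d: "0 < d"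
	shows "\<exists>e0>0. \<forall>e. 0 < e \<longrightarrow> e < e0 \<longrightarrow> L2 (\<lambda>x. moll e h x - h x) \<and> nsq (\<lambda>x. moll e h x - h x) \<le> d"
proof -
	let ?u = "\<lambda>x e R. \<integral>\<^sup>+z. ennreal (mollifier z * (h (x - e *\<^sub>R z) - h x)\<^sup>2) \<partial>lborel"
	let ?v = "\<lambda>z e R. \<integral>\<^sup>+x. ennreal (mollifier z * (h (x - e *\<^sub>R z) - h x)\<^sup>2) \<partial>lborel"
	let ?w = "\<lambda>x e R. LINT z|lborel. mollifier z * (h (x - e *\<^sub>R z) - h x)\<^sup>2"
	let ?a = "\<lambda>z. sqrt (mollifier z)"
	let ?b = "\<lambda>e x. moll e h x - h x"
	obtain e0 where e0: "0 < e0" "\<And>v. norm v < e0 ==> nsq (\<lambda>x. h (x + v) - h x) < d"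
		using L2_translation_continuous[OF h d] by blast
	have [measurable]: "h\<in>borel_measurable borel" "mollifier\<in>borel_measurable borel"
		using h by (auto intro!: smooth3_borel mollifier_smooth)
	show ?thesis proof (intro exI[of _ e0] conjI allI impI e0(1))
		fix e assume e: "0 < e" "e < e0"
		have hx: "L2 (\<lambda>z. h (x - e *\<^sub>R z))" for x using L2_affine(1)[OF h, of "- e" x] e by simp
		have sq: "L2 ?a" unfolding L2_def using mollifier_integrable mollifier_nonneg by simp
		obtain B where B: "0 < B" "\<And>x. \<bar>mollifier x\<bar> \<le> B" using mollifier_bounded by blast
		have Bs: "\<bar>sqrt (mollifier z)\<bar> \<le> sqrt B" for z using B(2)[of z] mollifier_nonneg[of z] by simp
		have sm: "?a\<in>borel_measurable borel" by measurable
		have d2: "L2 (\<lambda>z. sqrt (mollifier z) * (h (x - e *\<^sub>R z) - h x))" for x proof -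
			have "L2 (\<lambda>z. sqrt (mollifier z) * h (x - e *\<^sub>R z))" using L2_mult_bounded(1)[OF hx sm Bs] .
			moreover have "L2 (\<lambda>z. h x * sqrt (mollifier z))" using L2_cmult(1)[OF sq] .
			ultimately show ?thesis using L2_diff(1) by (fastforce simp: algebra_simps)
		qed
		have pt: "(?b e x)\<^sup>2 \<le> (?w x e R)"
			and pti: "integrable lborel (\<lambda>z. mollifier z * (h (x - e *\<^sub>R z) - h x)\<^sup>2)" for x proof -
			have ii: "integrable lborel (\<lambda>z. mollifier z * h (x - e *\<^sub>R z))" using L2_product(1)[OF L2_mollifier hx] .
			have "moll e h x - h x = (LINT z|lborel. mollifier z * h (x - e *\<^sub>R z)) - (LINT z|lborel. mollifier z * h x)"
				by (simp add: moll_def mollifier_integral)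
			also have "\<dots> = (LINT z|lborel. mollifier z * h (x - e *\<^sub>R z) - mollifier z * h x)"
				by (rule Bochner_Integration.integral_diff[symmetric, OF ii]) (simp add: mollifier_integrable)
			\<comment> \<open>The weight is split evenly so that one Cauchy-Schwarz factor is the total mass
			  1.\<close>
			also have "\<dots> = (LINT z|lborel. sqrt (mollifier z) * (sqrt (mollifier z) * (h (x - e *\<^sub>R z) - h x)))"
			proof (intro Bochner_Integration.integral_cong refl)
				fix z
				have "sqrt (mollifier z) * sqrt (mollifier z) = mollifier z" using mollifier_nonneg[of z] by simp
				thus "mollifier z * h (x - e *\<^sub>R z) - mollifier z * h x =
						sqrt (mollifier z) * (sqrt (mollifier z) * (h (x - e *\<^sub>R z) - h x))" by (simp only: mult.assoc[symmetric] right_diff_distrib)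
			qed
			finally have m: "moll e h x - h x = (LINT z|lborel. sqrt (mollifier z) * (sqrt (mollifier z) * (h (x - e *\<^sub>R z) - h x)))" .
			have s: "(sqrt (mollifier z) * (h (x - e *\<^sub>R z) - h x))\<^sup>2 = mollifier z * (h (x - e *\<^sub>R z) - h x)\<^sup>2" for z
				using mollifier_nonneg by (simp add: power_mult_distrib)
			have "nsq ?a = 1" using mollifier_nonneg by (simp add: nsq_def mollifier_integral)
			thus "(?b e x)\<^sup>2 \<le> (?w x e R)" using L2_product(2)[OF sq d2[of x]] unfolding m nsq_def s by simp
			show "integrable lborel (\<lambda>z. mollifier z * (h (x - e *\<^sub>R z) - h x)\<^sup>2)" using d2[of x] by (simp add: L2_def s)
		qed
		have meas: "(\<lambda>x. moll e h x - h x)\<in>borel_measurable borel" unfolding moll_def by measurable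
		have "(\<integral>\<^sup>+x. ennreal ((?b e x)\<^sup>2) \<partial>lborel)
				\<le> (\<integral>\<^sup>+x. (?u x e R) \<partial>lborel)" proof (intro nn_integral_mono)
			fix x
			have "ennreal ((?b e x)\<^sup>2) \<le> ennreal (?w x e R)" using pt by (intro ennreal_leI)
			also have "\<dots> = (?u x e R)" using mollifier_nonneg by (intro nn_integral_eq_integral[symmetric] pti) auto
			finally show "ennreal ((?b e x)\<^sup>2) \<le> (?u x e R)" .
		qed
		also have "\<dots> = (\<integral>\<^sup>+z. (?v z e R) \<partial>lborel)" by (rule lborel_pair.Fubini') measurable
		also have "\<dots> \<le> (\<integral>\<^sup>+z. ennreal (mollifier z) * ennreal d \<partial>lborel)" proof (intro nn_integral_mono)
			fix z :: "real^3"
			show "(?v z e R) \<le> ennreal (mollifier z) * ennreal d" proof (cases "1 \<le> norm z")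
				case True
				thus ?thesis by (simp add: mollifier_zero)
			next
				case False
				have L: "L2 (\<lambda>x. h (x - e *\<^sub>R z) - h x)" using L2_diff(1)[OF L2_translate(1)[OF h, of "- (e *\<^sub>R z)"] h] by simp
				have "e * norm z \<le> e * 1" using False e by (intro mult_left_mono) auto
				moreover have "norm (- (e *\<^sub>R z)) = e * norm z" using e by simp
				ultimately have "norm (- (e *\<^sub>R z)) < e0" using e by linarith
				hence "nsq (\<lambda>x. h (x - e *\<^sub>R z) - h x) < d" using e0(2)[of "- (e *\<^sub>R z)"] by simp
				moreover have "(\<integral>\<^sup>+x. ennreal ((h (x - e *\<^sub>R z) - h x)\<^sup>2) \<partial>lborel) = ennreal (nsq (\<lambda>x. h (x - e *\<^sub>R z) - h x))"
					unfolding nsq_def using L by (intro nn_integral_eq_integral) (auto simp: L2_def)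
				moreover have "(?v z e R)
						= ennreal (mollifier z) * (\<integral>\<^sup>+x. ennreal ((h (x - e *\<^sub>R z) - h x)\<^sup>2) \<partial>lborel)"
					using mollifier_nonneg by (simp add: ennreal_mult nn_integral_cmult)
				ultimately show ?thesis by (simp add: mult_left_mono ennreal_leI)
			qed
		qed
		also have "\<dots> = (\<integral>\<^sup>+z. ennreal (mollifier z) \<partial>lborel) * ennreal d" by (rule nn_integral_multc) measurable
		also have "(\<integral>\<^sup>+z. ennreal (mollifier z) \<partial>lborel) = ennreal 1"
			using nn_integral_eq_integral[OF mollifier_integrable] mollifier_nonneg by (simp add: mollifier_integral)
		finally have fin: "(\<integral>\<^sup>+x. ennreal ((?b e x)\<^sup>2) \<partial>lborel) \<le> ennreal d" by simp
		have i: "integrable lborel (\<lambda>x. (?b e x)\<^sup>2)"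
			using meas fin by (intro integrableI_bounded) (auto simp: less_top[symmetric] top_unique)
		thus "L2 (\<lambda>x. moll e h x - h x)" using meas by (simp add: L2_def)
		show "nsq (\<lambda>x. moll e h x - h x) \<le> d" using fin nn_integral_eq_integral[OF i] d by (simp add: nsq_def)
	qed
qed

definition conv :: "(real^3 => real) => (real^3 => real) => real^3 => real" where
	"conv \<phi> h x = (LINT y|lborel. \<phi> (x - y) * h y)"

lemma pd_zero_outside: assumes "closed K" "\<And>x. x\<notin>K ==> f x = 0" "x\<notin>K" shows "pd i f x = 0" proof -
	have "((\<lambda>x. 0) has_derivative (\<lambda>h. 0)) (at x)" by simp
	hence "(f has_derivative (\<lambda>h. 0)) (at x)" by (rule has_derivative_transform_within_open[of _ _ _ _ "- K"]) (use assms in auto)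
	thus ?thesis by (rule pd_eq)
qed

lemma continuous_compact_support_bounded:
	fixes f :: "'a::euclidean_space => real" assumes "continuous_on UNIV f" "compact K" "\<And>x. x\<notin>K ==> f x = 0"
	shows "\<exists>B>0. \<forall>x. \<bar>f x\<bar> \<le> B" proof -
	have "compact (f ` K)" using assms by (intro compact_continuous_image continuous_on_subset[OF assms(1)]) auto
	then obtain B where B: "0 < B" "\<And>y. y\<in>f ` K ==> \<bar>y\<bar> \<le> B"
		using compact_imp_bounded bounded_pos by (metis real_norm_def)
	have "\<bar>f x\<bar> \<le> B" for x using B assms(3)[of x] by (cases "x\<in>K") auto
	thus ?thesis using B(1) by blast
qed

lemma norm_nth_sum_le:
	fixes v :: "real^3" and w :: "3 => 'b::real_normed_vector" assumes "\<And>i. norm (w i) \<le> B"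
	shows "norm (\<Sum>i\<in>UNIV. (v $ i) *\<^sub>R w i) \<le> 3 * B * norm v" proof -
	have "norm (\<Sum>i\<in>UNIV. (v $ i) *\<^sub>R w i) \<le> (\<Sum>i\<in>(UNIV::3 set). norm v * B)"
		using assms norm_ge_zero[of "w _"] component_le_norm_cart[of v] by (intro sum_norm_le) (auto intro!: mult_mono)
	thus ?thesis by (simp add: mult_ac)
qed

lemma smooth3_lipschitz:
	fixes \<phi> :: "real^3 => real" assumes "smooth3 UNIV \<phi>" "compact K" "\<And>x. x\<notin>K ==> \<phi> x = 0"
	shows "\<exists>L>0. \<forall>x y. \<bar>\<phi> x - \<phi> y\<bar> \<le> L * norm (x - y)" proof -
	have "\<exists>B>0. \<forall>x. \<bar>pd i \<phi> x\<bar> \<le> B" for i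
		using assms by (intro continuous_compact_support_bounded[of _ K] smooth3_continuous smooth3_pd pd_zero_outside)
			(auto intro: compact_imp_closed)
	then obtain B where B: "\<And>i. B i > 0" "\<And>i x. \<bar>pd i \<phi> x\<bar> \<le> B i" by metis
	define M where "M = sum B UNIV"
	have M: "\<bar>pd i \<phi> x\<bar> \<le> M" for i x
		using B(2)[of i x] member_le_sum[of i UNIV B] B(1) unfolding M_def by (force intro: less_imp_le)
	have M0: "0 < M" unfolding M_def using B(1) by (intro sum_pos) auto
	have "\<bar>\<phi> x - \<phi> y\<bar> \<le> 3 * M * norm (x - y)" for x y proof -
		have "norm (\<phi> x - \<phi> y) \<le> 3 * M * norm (x - y)" proof (rule differentiable_bound[where S = UNIV])
			fix z
			show "(\<phi> has_derivative (\<lambda>h. \<Sum>i\<in>UNIV. (h $ i) *\<^sub>R pd i \<phi> z)) (at z within UNIV)"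
				using has_derivative_pd[OF smooth3_differentiable[OF assms(1)]] by simp
			show "onorm (\<lambda>h. \<Sum>i\<in>UNIV. (h $ i) *\<^sub>R pd i \<phi> z) \<le> 3 * M" using M by (intro onorm_le norm_nth_sum_le) auto
		qed auto
		thus ?thesis by simp
	qed
	thus ?thesis using M0 by (intro exI[of _ "3 * M"]) auto
qed

lemma conv_integrable:
	fixes \<phi> h :: "real^3 => real" assumes "continuous_on UNIV \<phi>" "\<And>x. \<bar>\<phi> x\<bar> \<le> B" "integrable lborel h"
	shows "integrable lborel (\<lambda>y. \<phi> (x - y) * h y)"
proof (rule Bochner_Integration.integrable_bound[where f = "\<lambda>y. B * \<bar>h y\<bar>"])
	have [measurable]: "\<phi>\<in>borel_measurable borel" using assms(1) by (rule borel_measurable_continuous_onI)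
	have [measurable]: "h\<in>borel_measurable borel" using assms(3) by simp
	show "(\<lambda>y. \<phi> (x - y) * h y)\<in>borel_measurable lborel" by measurable
	show "AE y in lborel. norm (\<phi> (x - y) * h y) \<le> norm (B * \<bar>h y\<bar>)"
		using assms(2) by (intro AE_I2) (auto simp: abs_mult intro!: mult_right_mono order_trans[OF assms(2)])
qed (use assms in auto)

text \<open>All smoothness comes from the kernel, \<open>h\<close> being only integrable. The
  remainder quotient of the kernel tends to 0 pointwise and is bounded by its Lipschitz constant
  plus a gradient bound, so a multiple of \<open>\<bar>h y\<bar>\<close> dominates.\<close>

lemma conv_has_derivative:
	fixes \<phi> h :: "real^3 => real"
	assumes \<phi>: "smooth3 UNIV \<phi>" "compact K" "\<And>x. x\<notin>K ==> \<phi> x = 0" and h: "integrable lborel h"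
	shows "(conv \<phi> h has_derivative (\<lambda>v. \<Sum>i\<in>UNIV. (v $ i) *\<^sub>R conv (pd i \<phi>) h x)) (at x)" proof -
	let ?u = "\<lambda>B'. \<Sum>i\<in>UNIV. \<bar>B' i\<bar>"
	let ?v = "\<lambda>x v. conv \<phi> h (x + v) - conv \<phi> h x - (\<Sum>i\<in>UNIV. (v $ i) *\<^sub>R conv (pd i \<phi>) h x)"
	obtain B where B: "\<And>x. \<bar>\<phi> x\<bar> \<le> B"
		using continuous_compact_support_bounded[OF smooth3_continuous[OF \<phi>(1)] \<phi>(2,3)] by blast
	have "\<exists>B>0. \<forall>x. \<bar>pd i \<phi> x\<bar> \<le> B" for i
		using \<phi> by (intro continuous_compact_support_bounded[of _ K] smooth3_continuous smooth3_pd pd_zero_outside)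
			(auto intro: compact_imp_closed)
	then obtain B' where B': "\<And>i x. \<bar>pd i \<phi> x\<bar> \<le> B' i" by metis
	obtain L where L: "0 < L" "\<And>x y. \<bar>\<phi> x - \<phi> y\<bar> \<le> L * norm (x - y)" using smooth3_lipschitz[OF \<phi>] by blast
	have i1: "integrable lborel (\<lambda>y. \<phi> (x - y) * h y)" for x by (rule conv_integrable[OF smooth3_continuous[OF \<phi>(1)] B h])
	have i2: "integrable lborel (\<lambda>y. pd i \<phi> (x - y) * h y)" for x i
		by (rule conv_integrable[OF smooth3_continuous[OF smooth3_pd[OF \<phi>(1)]] B' h])
	define D where "D z v = (\<Sum>i\<in>UNIV. (v $ i) *\<^sub>R pd i \<phi> z)" for z and v :: "real^3"
	have D: "(\<phi> has_derivative D z) (at z)" for z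
		using has_derivative_pd[OF smooth3_differentiable[OF \<phi>(1)]] unfolding D_def[abs_def] .
	have DL: "\<bar>D z v\<bar> \<le> 3 * (?u B') * norm v" for z v proof -
		have "norm (D z v) \<le> 3 * (?u B') * norm v" unfolding D_def proof (rule norm_nth_sum_le)
			fix i
			have "norm (pd i \<phi> z) \<le> \<bar>B' i\<bar>" using B'[of i z] by simp
			also have "\<dots> \<le> (?u B')" by (rule member_le_sum) auto
			finally show "norm (pd i \<phi> z) \<le> (?u B')" .
		qed
		thus ?thesis by simp
	qed
	have [measurable]: "h\<in>borel_measurable borel" using h by simp
	have [measurable]: "\<phi>\<in>borel_measurable borel" "\<And>i. pd i \<phi>\<in>borel_measurable borel"
		using \<phi>(1) by (auto intro!: smooth3_borel smooth3_pd)
	let ?q = "\<lambda>v y. ((\<phi> (x + v - y) - \<phi> (x - y) - D (x - y) v)/norm v) * h y"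
	have eq: "(?v x v)/norm v
			= (LINT y|lborel. ?q v y)" for v proof -
		have "(LINT y|lborel. (\<phi> (x + v - y) * h y - \<phi> (x - y) * h y) - (\<Sum>i\<in>UNIV. (v $ i) *\<^sub>R (pd i \<phi> (x - y) * h y))) =
			conv \<phi> h (x + v) - conv \<phi> h x - (\<Sum>i\<in>UNIV. (v $ i) *\<^sub>R conv (pd i \<phi>) h x)"
			unfolding conv_def using i1 i2 by (simp add: Bochner_Integration.integral_sum)
		moreover have "(LINT y|lborel. ?q v y) = (LINT y|lborel. ((\<phi> (x + v - y) * h y - \<phi> (x - y) * h y) - (\<Sum>i\<in>UNIV. (v $ i) *\<^sub>R (pd i \<phi> (x - y) * h y)))/norm v)"
			unfolding D_def by (intro Bochner_Integration.integral_cong refl) (simp add: field_simps sum_distrib_left)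
		ultimately show ?thesis by (simp only: integral_divide_zero)
	qed
	show ?thesis unfolding has_derivative_at proof
		show "bounded_linear (\<lambda>v. \<Sum>i\<in>UNIV. (v $ i) *\<^sub>R conv (pd i \<phi>) h x)"
			by (intro bounded_linear_sum bounded_linear_scaleR_const bounded_linear_vec_nth)
		\<comment> \<open>Dominated convergence speaks of sequences, so the limit is tested along
		  sequences tending to 0.\<close>
		have "((\<lambda>v. (LINT y|lborel. ?q v y)) \<longlongrightarrow> 0) (at 0)" unfolding tendsto_at_iff_sequentially proof (intro allI impI)
			fix X :: "nat => real^3" assume X: "\<forall>i. X i\<in>UNIV - {0}" "X \<longlonglongrightarrow> 0"
			have "(\<lambda>n. LINT y|lborel. ?q (X n) y) \<longlonglongrightarrow> (LINT y::real^3|lborel. (0::real))"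
			proof (rule integral_dominated_convergence[where w = "\<lambda>y. (L + 3 * (?u B')) * \<bar>h y\<bar>"])
				show "AE y in lborel. (\<lambda>n. ?q (X n) y) \<longlonglongrightarrow> 0" proof (rule AE_I2)
					fix y
					have "((\<lambda>v. norm (\<phi> (x - y + v) - \<phi> (x - y) - D (x - y) v)/norm v) \<longlongrightarrow> 0) (at 0)"
						using D[of "x - y"] unfolding has_derivative_at by blast
					hence "(\<lambda>n. norm (\<phi> (x - y + X n) - \<phi> (x - y) - D (x - y) (X n))/norm (X n)) \<longlonglongrightarrow> 0"
						using X unfolding tendsto_at_iff_sequentially by (auto simp: comp_def)
					hence "(\<lambda>n. norm ((\<phi> (x + X n - y) - \<phi> (x - y) - D (x - y) (X n))/norm (X n))) \<longlonglongrightarrow> 0"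
						by (simp add: algebra_simps)
					hence "(\<lambda>n. (\<phi> (x + X n - y) - \<phi> (x - y) - D (x - y) (X n))/norm (X n)) \<longlonglongrightarrow> 0"
						by (simp only: tendsto_norm_zero_iff)
					thus "(\<lambda>n. ?q (X n) y) \<longlonglongrightarrow> 0" by (rule tendsto_mult_left_zero)
				qed
				show "AE y in lborel. norm (?q (X n) y) \<le> (L + 3 * (?u B')) * \<bar>h y\<bar>" for n proof (rule AE_I2)
					fix y
					have n: "0 < norm (X n)" using X(1) by auto
					have "\<bar>\<phi> (x + X n - y) - \<phi> (x - y)\<bar> \<le> L * norm (X n)" using L(2)[of "x + X n - y" "x - y"] by simp
					hence "\<bar>\<phi> (x + X n - y) - \<phi> (x - y) - D (x - y) (X n)\<bar> \<le> (L + 3 * (?u B')) * norm (X n)"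
						using DL[of "x - y" "X n"] by (simp add: distrib_right)
					hence "\<bar>(\<phi> (x + X n - y) - \<phi> (x - y) - D (x - y) (X n))/norm (X n)\<bar> \<le> L + 3 * (?u B')"
						using n by (simp add: pos_divide_le_eq)
					thus "norm (?q (X n) y) \<le> (L + 3 * (?u B')) * \<bar>h y\<bar>" unfolding real_norm_def abs_mult by (intro mult_right_mono) auto
				qed
				show "(\<lambda>y. ?q (X n) y)\<in>borel_measurable lborel" for n unfolding D_def by measurable
			qed (use h in auto)
			thus "((\<lambda>v. (LINT y|lborel. ?q v y)) \<circ> X) \<longlonglongrightarrow> 0" by (simp add: comp_def)
		qed
		hence "((\<lambda>v. norm ((?v x v)/norm v)) \<longlongrightarrow> 0) (at 0)" unfolding eq by (rule tendsto_norm_zero)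
		thus "((\<lambda>v. norm (?v x v)/norm v) \<longlongrightarrow> 0) (at 0)" by simp
	qed
qed

lemma pd_conv: assumes "smooth3 UNIV \<phi>" "compact K" "\<And>x. x\<notin>K ==> \<phi> x = 0" "integrable lborel h"
	shows "pd i (conv \<phi> h) = conv (pd i \<phi>) h" proof
	fix x
	show "pd i (conv \<phi> h) x = conv (pd i \<phi>) h x" using pd_eq[OF conv_has_derivative[OF assms], where i = i]
		by (simp add: axis_def if_distrib[of "\<lambda>x. x * _"] cong: if_cong)
qed

lemma smooth3_conv: assumes "smooth3 UNIV \<phi>" "compact K" "\<And>x. x\<notin>K ==> \<phi> x = 0" "integrable lborel h"
	shows "smooth3 UNIV (conv \<phi> h)" proof -
	have "Ck k UNIV (conv \<phi> h)" for k using assms(1,3) proof (induction k arbitrary: \<phi>)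
		case 0
		have "conv \<phi> h differentiable (at x)" for x
			using conv_has_derivative[OF 0(1) assms(2) 0(2) assms(4)] by (auto simp: differentiable_def)
		thus ?case by (auto intro!: continuous_at_imp_continuous_on differentiable_imp_continuous_within)
	next
		case (Suc k)
		have "conv \<phi> h differentiable (at x)" for x
			using conv_has_derivative[OF Suc(2) assms(2) Suc(3) assms(4)] by (auto simp: differentiable_def)
		moreover have "Ck k UNIV (conv (pd i \<phi>) h)" for i
			using Suc assms(2) by (intro Suc.IH smooth3_pd pd_zero_outside[of K]) (auto intro: compact_imp_closed)
		moreover have "pd i (conv \<phi> h) = conv (pd i \<phi>) h" for i by (rule pd_conv[OF Suc(2) assms(2) Suc(3) assms(4)])
		ultimately show ?case unfolding Ck_Suc by simp
	qed
	thus ?thesis unfolding smooth3_def by blast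
qed

text \<open>The rescaled kernel of mass 1. The summand \<open>0 +\<close> and the scalar
  multiplications give it the shape of \<open>smooth3_affine\<close>.\<close>

definition eta :: "real => real^3 => real" where
	"eta e w = (1/e^3) *\<^sub>R mollifier (0 + (1/e) *\<^sub>R w)"

lemma eta_smooth: "smooth3 UNIV (eta e)" unfolding eta_def[abs_def] by (rule smooth3_affine[OF mollifier_smooth])

lemma eta_zero: "0 < e ==> e \<le> norm w ==> eta e w = 0" by (simp add: eta_def mollifier_zero)

lemma eta_zero_cball: "0 < e ==> w\<notin>cball 0 e ==> eta e w = 0" by (rule eta_zero) auto

lemma moll_eq_conv: assumes [measurable]: "h\<in>borel_measurable borel" and "0 < e" shows "moll e h = conv (eta e) h" proof
	fix x
	have [measurable]: "mollifier\<in>borel_measurable borel" by (rule smooth3_borel[OF mollifier_smooth])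
	let ?f = "\<lambda>y. mollifier ((1/e) *\<^sub>R (x - y)) * h y"
	have "conv (eta e) h x = (1/e^3) * (LINT y|lborel. ?f y)" by (simp add: conv_def eta_def)
	also have "(LINT y|lborel. ?f y) = \<bar>- e\<bar>^3 * (LINT y|lborel. ?f (x + (- e) *\<^sub>R y))"
		using integral_affine(2)[of ?f "- e" x] assms(2) by simp
	also have "(LINT y|lborel. ?f (x + (- e) *\<^sub>R y)) = moll e h x" using assms(2) by (simp add: moll_def)
	finally show "moll e h x = conv (eta e) h x" using assms(2) by simp
qed

lemma moll_tendsto: assumes h: "L2 h" shows "(\<lambda>n. nsq (\<lambda>x. moll (1/real (Suc n)) h x - h x)) \<longlonglongrightarrow> 0"
		"eventually (\<lambda>n. L2 (\<lambda>x. moll (1/real (Suc n)) h x - h x)) sequentially" proof -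
	let ?u = "\<lambda>n. \<lambda>x. moll (1/real (Suc n)) h x - h x"
	have ev: "eventually (\<lambda>n. L2 (?u n) \<and>
			nsq (?u n) \<le> d) sequentially" if d: "0 < d" for d proof -
		obtain e0 where e0: "0 < e0" "\<And>e. 0 < e ==> e < e0 ==> L2 (\<lambda>x. moll e h x - h x) \<and> nsq (\<lambda>x. moll e h x - h x) \<le> d"
			using moll_L2_convergence[OF h d] by blast
		have "eventually (\<lambda>n. 1/real (Suc n) < e0) sequentially"
			using order_tendstoD(2)[OF LIMSEQ_inverse_real_of_nat e0(1)] by (simp add: inverse_eq_divide)
		thus ?thesis by eventually_elim (use e0 in simp)
	qed
	show "(\<lambda>n. nsq (?u n)) \<longlonglongrightarrow> 0" proof (rule tendstoI)
		fix d :: real assume "0 < d"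
		hence "0 < d/2" by simp
		from ev[OF this] show "eventually (\<lambda>n. dist (nsq (?u n)) 0 < d) sequentially"
			by eventually_elim (use \<open>0 < d\<close> in \<open>simp add: dist_real_def\<close>)
	qed
	show "eventually (\<lambda>n. L2 (?u n)) sequentially" using ev[of 1] by (auto elim: eventually_mono)
qed

section \<open>Weak derivatives\<close>

lemma test_functionE: assumes "test_function S \<phi>"
	obtains K where "smooth3 UNIV \<phi>" "compact K" "K\<subseteq>S" "\<And>x. x\<notin>K ==> \<phi> x = 0" "\<And>x i. x\<notin>K ==> pd i \<phi> x = 0"
	using assms pd_zero_outside[OF compact_imp_closed, of _ \<phi>] unfolding test_function_def by metis

lemma weak_pd_iff:
	"weak_pd S i f g \<longleftrightarrow> (\<forall>\<phi>. test_function S \<phi> \<longrightarrow>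
		 (LINT x:S|lborel. pd i \<phi> x *\<^sub>R f x) = - (LINT x:S|lborel. \<phi> x *\<^sub>R g x))" by (simp add: weak_pd_def pd_def)

lemma test_function_mult: assumes "test_function S \<phi>" "smooth3 UNIV F" shows "test_function S (\<lambda>x. \<phi> x * F x)"
	using assms unfolding test_function_def by (auto intro!: smooth3_mult)

lemma L2_indicat: assumes "compact K" shows "L2 (indicat_real K)" proof -
	have "(\<lambda>x. (indicat_real K x)\<^sup>2) = indicat_real K" by (auto simp: indicator_def)
	thus ?thesis unfolding L2_def using assms integrable_indicat_compact[of K] by (simp add: compact_imp_closed borel_closed)
qed

lemma L2_loc_restrict: assumes f: "L2_loc S f" and K: "compact K" "K\<subseteq>S" shows "L2 (cut K f)" "integrable lborel (cut K f)" proof -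
	have [measurable]: "K\<in>sets borel" using K(1) by (simp add: compact_imp_closed borel_closed)
	have [measurable]: "(cut S f)\<in>borel_measurable borel" using f by (simp add: L2_loc_def set_borel_measurable_def)
	have "(cut K (\<lambda>x. indicat_real S x * f x))\<in>borel_measurable borel" by measurable
	moreover have "(cut K (\<lambda>x. indicat_real S x * f x)) = (cut K f)" using K(2) by (fastforce simp: indicator_def fun_eq_iff)
	ultimately have m: "(cut K f)\<in>borel_measurable borel" by simp
	have "(cut K (\<lambda>x. (f x)\<^sup>2)) = (\<lambda>x. (indicat_real K x * f x)\<^sup>2)" by (auto simp: indicator_def)
	moreover have "integrable lborel (cut K (\<lambda>x. (f x)\<^sup>2))" using f K unfolding L2_loc_def set_integrable_def by simp
	ultimately show L: "L2 (cut K f)" using m by (simp add: L2_def)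
	have "(cut K (\<lambda>x. indicat_real K x * f x)) = (cut K f)" by (auto simp: indicator_def)
	thus "integrable lborel (cut K f)" using L2_product(1)[OF L2_indicat[OF K(1)] L] by simp
qed

lemma smooth3_conv_eta: "0 < e ==> integrable lborel h ==> smooth3 UNIV (conv (eta e) h)"
	by (rule smooth3_conv[OF eta_smooth compact_cball eta_zero_cball])

lemma pd_conv_eta: "0 < e ==> integrable lborel h ==> pd i (conv (eta e) h) = conv (pd i (eta e)) h"
	by (rule pd_conv[OF eta_smooth compact_cball eta_zero_cball])

lemma smooth3_moll: assumes "integrable lborel h" "0 < e" shows "smooth3 UNIV (moll e h)"
	using smooth3_conv_eta[OF assms(2,1)] moll_eq_conv[OF borel_measurable_integrable[OF assms(1), simplified] assms(2)] by simp

text \<open>The kernel \<open>eta e (x - y)\<close>, as a function of \<open>y\<close>, is a test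
  function supported in \<open>cball x e\<close> and hence in \<open>K\<close>, so the cut at
  \<open>K\<close> goes unnoticed. Reflection and weak derivative each contribute a sign.\<close>

lemma pd_moll:
	fixes f g :: "real^3 => real" assumes w: "weak_pd S i f g" and f: "L2_loc S f" and g: "L2_loc S g"
		and K: "compact K" "K\<subseteq>S" and e: "0 < e" and x: "cball x e\<subseteq>K"
	shows "pd i (moll e (cut K f)) x = moll e (cut K g) x" proof -
	have fi: "integrable lborel (cut K f)" and gi: "integrable lborel (cut K g)" using L2_loc_restrict f g K by blast+
	define \<phi> where "\<phi> y = eta e (x - y)" for y
	have \<phi>': "\<phi> = (\<lambda>y. 1 *\<^sub>R eta e (x + (-1) *\<^sub>R y))" by (simp add: \<phi>_def fun_eq_iff)
	have sm: "smooth3 UNIV \<phi>" unfolding \<phi>' by (rule smooth3_affine[OF eta_smooth])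
	have z: "\<phi> y = 0" if "y\<notin>cball x e" for y using that e unfolding \<phi>_def by (intro eta_zero) (auto simp: dist_norm)
	have zd: "pd i \<phi> y = 0" if "y\<notin>cball x e" for y by (rule pd_zero_outside[OF closed_cball z that])
	have zK: "\<phi> y = 0" "pd i \<phi> y = 0" if "y\<notin>K" for y using that z zd x by blast+
	have t: "test_function S \<phi>" unfolding test_function_def using sm z x K(2) by (intro conjI exI[of _ "cball x e"]) auto
	have pd\<phi>: "pd i \<phi> y = - pd i (eta e) (x - y)" for y unfolding \<phi>' using pd_affine[OF eta_smooth, of i 1 e x "-1" y] by simp
	have "pd i (moll e (cut K f)) x = conv (pd i (eta e)) (cut K f) x" using moll_eq_conv[OF borel_measurable_integrable[OF fi, simplified] e]
			pd_conv_eta[OF e fi] by simp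
	also have "\<dots> = - (LINT y|lborel. pd i \<phi> y * (indicat_real K y * f y))" by (simp add: conv_def pd\<phi>)
	also have "(LINT y|lborel. pd i \<phi> y * (indicat_real K y * f y)) = (LINT y:S|lborel. pd i \<phi> y *\<^sub>R f y)"
		unfolding set_lebesgue_integral_def using zK K(2) by (intro Bochner_Integration.integral_cong refl) (auto simp: indicator_def)
	also have "\<dots> = - (LINT y:S|lborel. \<phi> y *\<^sub>R g y)" using w t unfolding weak_pd_iff by blast
	also have "(LINT y:S|lborel. \<phi> y *\<^sub>R g y) = (LINT y|lborel. \<phi> y * (indicat_real K y * g y))"
		unfolding set_lebesgue_integral_def using zK K(2) by (intro Bochner_Integration.integral_cong refl) (auto simp: indicator_def)
	also have "\<dots> = moll e (cut K g) x" unfolding moll_eq_conv[OF borel_measurable_integrable[OF gi, simplified] e]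
		by (simp add: conv_def \<phi>_def)
	finally show ?thesis by simp
qed

text \<open>Provides the room that mollification needs around \<open>K\<close> without leaving the
  open set.\<close>

lemma compact_thicken:
	fixes K :: "'a::euclidean_space set" assumes "open S" "compact K" "K\<subseteq>S"
	obtains e K' where "0 < e" "compact K'" "K\<subseteq>K'" "K'\<subseteq>S" "\<And>x. x\<in>K ==> cball x e\<subseteq>K'" proof -
	obtain e where e: "0 < e" "(\<Union>x\<in>K. cball x e)\<subseteq>S"
		using compact_subset_open_imp_cball_epsilon_subset[OF assms(2,1,3)] by blast
	show ?thesis by (rule that[OF e(1) compact_minkowski_sum_cball[OF assms(2)] _ e(2)]) (use e(1) in auto)
qed

lemma L2_diffD: "L2 (\<lambda>x. v x - u x) ==> L2 u ==> L2 v" using L2_add(1)[of "\<lambda>x. v x - u x" u] by simp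

lemma L2_limit: assumes "L2 u" "L2 w" "eventually (\<lambda>n. L2 (\<lambda>x. v n x - u x)) sequentially"
		and "(\<lambda>n. nsq (\<lambda>x. v n x - u x)) \<longlonglongrightarrow> 0"
	shows "(\<lambda>n. LINT x|lborel. v n x * w x) \<longlonglongrightarrow> (LINT x|lborel. u x * w x)" proof (rule LIM_zero_cancel)
	let ?u = "LINT x|lborel. u x * w x"
	have "(\<lambda>n. sqrt (nsq (\<lambda>x. v n x - u x)) * sqrt (nsq w)) \<longlonglongrightarrow> sqrt 0 * sqrt (nsq w)"
		by (intro tendsto_intros assms(4))
	hence lim: "(\<lambda>n. sqrt (nsq (\<lambda>x. v n x - u x)) * sqrt (nsq w)) \<longlonglongrightarrow> 0" by simp
	show "(\<lambda>n. (LINT x|lborel. v n x * w x) - ?u) \<longlonglongrightarrow> 0" proof (rule Lim_null_comparison[OF _ lim])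
		show "eventually (\<lambda>n. norm ((LINT x|lborel. v n x * w x) - ?u) \<le>
				sqrt (nsq (\<lambda>x. v n x - u x)) * sqrt (nsq w)) sequentially" using assms(3) proof eventually_elim
			case (elim n)
			have "L2 (v n)" using L2_add(1)[OF elim assms(1)] by simp
			hence "(LINT x|lborel. v n x * w x) - ?u = (LINT x|lborel. (v n x - u x) * w x)"
				using L2_product(1)[OF assms(1,2)] L2_product(1)[OF _ assms(2), of "v n"] by (simp add: left_diff_distrib)
			thus ?case using L2_product(3)[OF elim assms(2)] by simp
		qed
	qed
qed

text \<open>A test function times \<open>f\<close> is not smooth, so \<open>f\<close> is mollified
  to \<open>F n\<close>; then \<open>\<phi> * F n\<close> can be tested against \<open>g\<close>.
  The resulting integrals pass to the limit by L2 convergence of \<open>F n\<close> and of the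
  mollified derivative \<open>F' n\<close>.\<close>

lemma weak_pd_mult:
	fixes f g :: "real^3 => real" assumes S: "open S" and f: "weak_pd S i f f'" "L2_loc S f" "L2_loc S f'"
		and g: "weak_pd S i g g'" "L2_loc S g" "L2_loc S g'"
	shows "weak_pd S i (\<lambda>x. f x * g x) (\<lambda>x. f' x * g x + f x * g' x)" unfolding weak_pd_iff proof (intro allI impI)
	let ?u = "\<lambda>K x. indicat_real K x * g x"
	fix \<phi> assume t: "test_function S \<phi>"
	obtain K where K: "smooth3 UNIV \<phi>" "compact K" "K\<subseteq>S" "\<And>x. x\<notin>K ==> \<phi> x = 0" "\<And>x i. x\<notin>K ==> pd i \<phi> x = 0"
		by (rule test_functionE[OF t]) (rule that)
	obtain e K' where K': "0 < e" "compact K'" "K\<subseteq>K'" "K'\<subseteq>S" "\<And>x. x\<in>K ==> cball x e\<subseteq>K'"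
		using compact_thicken[OF S K(2,3)] by blast
	define F where "F n = moll (1/real (Suc n)) (cut K' f)" for n
	define F' where "F' n = moll (1/real (Suc n)) (cut K' f')" for n
	have fL: "L2 (cut K' f)" "integrable lborel (cut K' f)" using L2_loc_restrict[OF f(2) K'(2,4)] .
	have f'L: "L2 (cut K' f')" using L2_loc_restrict[OF f(3) K'(2,4)] by blast
	have gL: "L2 (cut K g)" using L2_loc_restrict[OF g(2) K(2,3)] by blast
	have g'L: "L2 (cut K g')" using L2_loc_restrict[OF g(3) K(2,3)] by blast
	have Fs: "smooth3 UNIV (F n)" for n unfolding F_def by (rule smooth3_moll[OF fL(2)]) simp
	obtain B where B: "\<And>x. \<bar>\<phi> x\<bar> \<le> B"
		using continuous_compact_support_bounded[OF smooth3_continuous[OF K(1)] K(2,4)] by blast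
	obtain B' where B': "\<And>x. \<bar>pd i \<phi> x\<bar> \<le> B'"
		using continuous_compact_support_bounded[OF smooth3_continuous[OF smooth3_pd[OF K(1)]] K(2,5)] by blast
	have b: "\<phi>\<in>borel_measurable borel" "pd i \<phi>\<in>borel_measurable borel" using K(1) by (auto intro: smooth3_borel smooth3_pd)
	have w1: "L2 (\<lambda>x. pd i \<phi> x * (?u K x))" by (rule L2_mult_bounded(1)[OF gL b(2) B'])
	have w2: "L2 (\<lambda>x. \<phi> x * (?u K x))" by (rule L2_mult_bounded(1)[OF gL b(1) B])
	have w3: "L2 (\<lambda>x. \<phi> x * (indicat_real K x * g' x))" by (rule L2_mult_bounded(1)[OF g'L b(1) B])
	\<comment> \<open>The Leibniz identity tested with \<open>\<phi>\<close> says that this vanishes.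
	  For large \<open>n\<close> it holds for \<open>F n\<close> and \<open>F' n\<close>, because on
	  \<open>K\<close> the mollified derivative is the derivative of the mollification.\<close>
	let ?I = "\<lambda>u u'. (LINT x|lborel. u x * (pd i \<phi> x * (?u K x))) +
			(LINT x|lborel. u' x * (\<phi> x * (?u K x))) + (LINT x|lborel. u x * (\<phi> x * (indicat_real K x * g' x)))"
	have lim: "(\<lambda>n. ?I (F n) (F' n)) \<longlonglongrightarrow> ?I (cut K' f) (cut K' f')" unfolding F_def F'_def
		by (intro tendsto_add L2_limit fL f'L w1 w2 w3 moll_tendsto)
	have "eventually (\<lambda>n. 1/real (Suc n) < e) sequentially"
		using order_tendstoD(2)[OF LIMSEQ_inverse_real_of_nat K'(1)] by (simp add: inverse_eq_divide)
	moreover have "eventually (\<lambda>n. L2 (F n)) sequentially"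
		using moll_tendsto(2)[OF fL(1)] unfolding F_def by (rule eventually_mono) (rule L2_diffD[OF _ fL(1)])
	moreover have "eventually (\<lambda>n. L2 (F' n)) sequentially"
		using moll_tendsto(2)[OF f'L] unfolding F'_def by (rule eventually_mono) (rule L2_diffD[OF _ f'L])
	ultimately have "eventually (\<lambda>n. ?I (F n) (F' n) = 0) sequentially" proof eventually_elim
		case (elim n)
		have pdF: "pd i (F n) x = F' n x" if "x\<in>K" for x unfolding F_def F'_def proof (rule pd_moll[OF f K'(2,4)])
			show "cball x (1/real (Suc n))\<subseteq>K'" using K'(5)[OF that] elim by (auto intro: order_trans)
		qed simp
		have pdm: "pd i (\<lambda>x. \<phi> x * F n x) x = pd i \<phi> x * F n x + \<phi> x * pd i (F n) x" for x
			using K(1) Fs by (intro pd_mult smooth3_differentiable)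
		have "(LINT x:S|lborel. pd i (\<lambda>x. \<phi> x * F n x) x *\<^sub>R g x) = - (LINT x:S|lborel. (\<phi> x * F n x) *\<^sub>R g' x)"
			using g(1) test_function_mult[OF t Fs] unfolding weak_pd_iff by blast
		moreover have "(LINT x:S|lborel. pd i (\<lambda>x. \<phi> x * F n x) x *\<^sub>R g x) =
				(LINT x|lborel. F n x * (pd i \<phi> x * (?u K x)) + F' n x * (\<phi> x * (?u K x)))"
			unfolding set_lebesgue_integral_def pdm using pdF K(3,4,5)
			by (intro Bochner_Integration.integral_cong refl) (auto simp: indicator_def algebra_simps)
		moreover have "(LINT x:S|lborel. (\<phi> x * F n x) *\<^sub>R g' x) = (LINT x|lborel. F n x * (\<phi> x * (indicat_real K x * g' x)))"
			unfolding set_lebesgue_integral_def using K(3,4) by (intro Bochner_Integration.integral_cong refl) (auto simp: indicator_def algebra_simps)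
		ultimately show ?case using L2_product(1)[OF elim(2) w1] L2_product(1)[OF elim(3) w2] by simp
	qed
	hence "(\<lambda>n. ?I (F n) (F' n)) \<longlonglongrightarrow> 0" by (rule tendsto_eventually)
	with lim have I0: "?I (cut K' f) (cut K' f') = 0" by (rule LIMSEQ_unique)
	have "(LINT x:S|lborel. pd i \<phi> x *\<^sub>R (f x * g x)) = (LINT x|lborel. (indicat_real K' x * f x) * (pd i \<phi> x * (?u K x)))"
		unfolding set_lebesgue_integral_def using K(3,4,5) K'(3,4) by (intro Bochner_Integration.integral_cong refl) (auto simp: indicator_def)
	moreover have "(LINT x:S|lborel. \<phi> x *\<^sub>R (f' x * g x + f x * g' x)) =
			(LINT x|lborel. (indicat_real K' x * f' x) * (\<phi> x * (?u K x)) + (indicat_real K' x * f x) * (\<phi> x * (indicat_real K x * g' x)))"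
		unfolding set_lebesgue_integral_def using K(3,4,5) K'(3,4)
		by (intro Bochner_Integration.integral_cong refl) (auto simp: indicator_def algebra_simps)
	ultimately show "(LINT x:S|lborel. pd i \<phi> x *\<^sub>R (f x * g x)) = - (LINT x:S|lborel. \<phi> x *\<^sub>R (f' x * g x + f x * g' x))"
		using I0 L2_product(1)[OF f'L w2] L2_product(1)[OF fL(1) w3] by simp
qed

text \<open>Mollifications of \<open>h\<close> at points of \<open>K\<close> are integrals against
  test functions and vanish for small radius, yet they converge to \<open>h\<close> in L2; so the
  norm of \<open>h\<close> over \<open>K\<close> is bounded by a null sequence.\<close>

lemma weak_zero_real:
	fixes h :: "real^3 => real" assumes S: "open S" and h: "L2_loc S h"
		and z: "\<And>\<phi>. test_function S \<phi> ==> (LINT x:S|lborel. \<phi> x *\<^sub>R h x) = 0"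
	shows "AE x in lborel. x\<in>S \<longrightarrow> h x = 0" proof -
	have K: "AE x in lborel. x\<in>K \<longrightarrow> h x = 0" if K: "compact K" "K\<subseteq>S" for K proof -
		obtain e K' where K': "0 < e" "compact K'" "K\<subseteq>K'" "K'\<subseteq>S" "\<And>x. x\<in>K ==> cball x e\<subseteq>K'"
			using compact_thicken[OF S K] by blast
		let ?h = "\<lambda>x. indicat_real K' x * h x"
		have hL: "L2 ?h" "integrable lborel ?h" using L2_loc_restrict[OF h K'(2,4)] .
		have hK: "L2 (cut K h)" using L2_loc_restrict[OF h K] by blast
		have m0: "moll d ?h x = 0" if d: "0 < d" "d \<le> e" and x: "x\<in>K" for d x proof -
			define \<phi> where "\<phi> y = eta d (x - y)" for y
			have \<phi>': "\<phi> = (\<lambda>y. 1 *\<^sub>R eta d (x + (-1) *\<^sub>R y))" by (simp add: \<phi>_def fun_eq_iff)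
			have sm: "smooth3 UNIV \<phi>" unfolding \<phi>' by (rule smooth3_affine[OF eta_smooth])
			have zz: "\<phi> y = 0" if "y\<notin>cball x d" for y using that d unfolding \<phi>_def by (intro eta_zero) (auto simp: dist_norm)
			have sub: "cball x d\<subseteq>K'" using K'(5)[OF x] d by (auto intro: order_trans)
			hence zK: "\<phi> y = 0" if "y\<notin>K'" for y using that zz by blast
			have "test_function S \<phi>" unfolding test_function_def using sm zK K'(2,4) by (intro conjI exI[of _ K']) auto
			hence "0 = (LINT y:S|lborel. \<phi> y *\<^sub>R h y)" using z by simp
			also have "\<dots> = (LINT y|lborel. \<phi> y * ?h y)" unfolding set_lebesgue_integral_def
				using zK K'(4) by (intro Bochner_Integration.integral_cong refl) (auto simp: indicator_def)
			also have "\<dots> = moll d ?h x"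
				unfolding moll_eq_conv[OF borel_measurable_integrable[OF hL(2), simplified] d(1)] by (simp add: conv_def \<phi>_def)
			finally show ?thesis by simp
		qed
		have le: "eventually (\<lambda>n. nsq (cut K h) \<le> nsq (\<lambda>x. moll (1/real (Suc n)) ?h x - ?h x)) sequentially" proof -
			have "eventually (\<lambda>n. 1/real (Suc n) < e) sequentially"
				using order_tendstoD(2)[OF LIMSEQ_inverse_real_of_nat K'(1)] by (simp add: inverse_eq_divide)
			with moll_tendsto(2)[OF hL(1)] show ?thesis proof eventually_elim
				case (elim n)
				show ?case unfolding nsq_def proof (rule integral_mono)
					show "(indicat_real K x * h x)\<^sup>2 \<le> (moll (1/real (Suc n)) ?h x - ?h x)\<^sup>2" for x
						using m0[of "1/real (Suc n)" x] elim K'(3) by (auto simp: indicator_def)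
				qed (use elim hK in \<open>auto simp: L2_def\<close>)
			qed
		qed
		have "nsq (cut K h) \<le> 0" by (rule tendsto_lowerbound[OF moll_tendsto(1)[OF hL(1)] le]) simp
		hence "nsq (cut K h) = 0" using nsq_nonneg[of "\<lambda>x. indicat_real K x * h x"] by linarith
		hence "(LINT x|lborel. (indicat_real K x * h x)\<^sup>2) = 0" unfolding nsq_def .
		hence "AE x in lborel. (indicat_real K x * h x)\<^sup>2 = 0" using hK by (subst (asm) integral_nonneg_eq_0_iff_AE) (auto simp: L2_def)
		thus ?thesis by eventually_elim (auto simp: indicator_def)
	qed
	\<comment> \<open>Countably many compact boxes exhaust \<open>S\<close>, so the exceptional sets
	  combine to a null set.\<close>
	obtain D where D: "countable D" "D\<subseteq>Pow S" "\<And>X. X\<in>D ==> \<exists>a b. X = cbox a b" "\<Union>D = S"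
		using open_countable_Union_open_cbox[OF S] by metis
	have "AE x in lborel. \<forall>X\<in>D. x\<in>X \<longrightarrow> h x = 0" unfolding AE_ball_countable[OF D(1)] proof
		fix X assume "X\<in>D"
		hence "compact X" "X\<subseteq>S" using D(2,3) compact_cbox by blast+
		thus "AE x in lborel. x\<in>X \<longrightarrow> h x = 0" by (rule K)
	qed
	thus ?thesis by eventually_elim (use D(4) in blast)
qed

lemma pd_cong_open: assumes "open U" "x\<in>U" "\<And>y. y\<in>U ==> f y = g y" "f differentiable (at x)" shows "pd i f x = pd i g x" proof -
	have f: "(f has_derivative frechet_derivative f (at x)) (at x)" using assms(4) by (rule differentiable_has_derivative)
	hence "(g has_derivative frechet_derivative f (at x)) (at x)" by (rule has_derivative_transform_within_open[OF _ assms(1,2)]) (rule assms(3))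
	thus ?thesis using pd_eq[OF f, of i] pd_eq[of g _ x i] by simp
qed

text \<open>Convolving with the indicator function of a large ball gives a function that is constant near 0.\<close>

lemma integral_pd_zero:
	fixes \<Psi> :: "real^3 => real" assumes \<Psi>: "smooth3 UNIV \<Psi>" "compact K" "\<And>x. x\<notin>K ==> \<Psi> x = 0"
	shows "(LINT x|lborel. pd i \<Psi> x) = 0" proof -
	obtain R where R: "0 < R" "\<forall>x\<in>K. norm x \<le> R" using compact_imp_bounded[OF \<Psi>(2)] bounded_pos by blast
	let ?h = "indicat_real (cball (0 :: real^3) (R + 1))"
	\<comment> \<open>For \<open>x\<close> in the unit ball the indicator equals 1 wherever
	  \<open>f (x - y)\<close> can be nonzero, so the convolution is the whole integral.\<close>
	have c: "conv f ?h x = (LINT y|lborel. f y)" if x: "x\<in>ball 0 1" and f: "smooth3 UNIV f" "\<And>x. x\<notin>K ==> f x = 0" for f x proof -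
		have "(\<lambda>y. f (x - y) * ?h y) = (\<lambda>y. f (x + (-1) *\<^sub>R y))" (is "?l = _") proof
			fix y show "?l y = f (x + (-1) *\<^sub>R y)"
				using f(2)[of "x - y"] R x norm_triangle_sub[of y x] by (cases "x - y\<in>K") (force simp: indicator_def norm_minus_commute)+
		qed
		thus ?thesis unfolding conv_def using integral_affine(2)[OF smooth3_borel[OF f(1)], of "-1" x] by simp
	qed
	have h: "integrable lborel ?h" by (rule integrable_indicat_compact[OF compact_cball])
	have z: "pd i \<Psi> x = 0" if "x\<notin>K" for x by (rule pd_zero_outside[OF compact_imp_closed[OF \<Psi>(2)] \<Psi>(3) that])
	have "(conv \<Psi> ?h has_derivative (\<lambda>_. 0)) (at 0)"
		by (rule has_derivative_transform_within_open[OF has_derivative_const[of "LINT y|lborel. \<Psi> y"] open_ball[of 0 1]])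
			(simp_all add: c \<Psi>)
	hence "0 = conv (pd i \<Psi>) ?h 0" using pd_conv[OF \<Psi> h, of i] pd_eq by metis
	thus ?thesis using c[of 0 "pd i \<Psi>", OF _ smooth3_pd[OF \<Psi>(1)] z] by simp
qed

lemma cutoff_exists: assumes S: "open S" and K: "compact K" "K\<subseteq>S"
	obtains \<zeta> K' where "smooth3 UNIV \<zeta>" "compact K'" "K\<subseteq>K'" "K'\<subseteq>S" "\<And>x. x\<notin>K' ==> \<zeta> x = 0" "\<And>x. x\<in>K ==> \<zeta> x = (1::real)"
proof -
	obtain e1 K1 where K1: "0 < e1" "compact K1" "K\<subseteq>K1" "K1\<subseteq>S" "\<And>x. x\<in>K ==> cball x e1\<subseteq>K1"
		using compact_thicken[OF S K] by blast
	obtain e2 K2 where K2: "0 < e2" "compact K2" "K1\<subseteq>K2" "K2\<subseteq>S" "\<And>x. x\<in>K1 ==> cball x e2\<subseteq>K2"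
		using compact_thicken[OF S K1(2,4)] by blast
	\<comment> \<open>A radius up to \<open>e1\<close> makes the mollified indicator of
	  \<open>K1\<close> equal to 1 on \<open>K\<close>; a radius up to \<open>e2\<close> keeps it zero
	  outside \<open>K2\<close>.\<close>
	define d where "d = min e1 e2"
	have d: "0 < d" "d \<le> e1" "d \<le> e2" using K1 K2 by (auto simp: d_def)
	define \<zeta> where "\<zeta> = moll d (indicat_real K1)"
	have sm: "smooth3 UNIV \<zeta>" unfolding \<zeta>_def by (rule smooth3_moll[OF integrable_indicat_compact[OF K1(2)] d(1)])
	have near: "x - d *\<^sub>R z\<in>cball x d" if "norm z < 1" for x z :: "real^3" proof -
		have "d * norm z \<le> d * 1" using that d by (intro mult_left_mono) auto
		thus ?thesis using d(1) by (simp add: dist_norm)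
	qed
	have one: "\<zeta> x = 1" if x: "x\<in>K" for x proof -
		have "mollifier z * indicat_real K1 (x - d *\<^sub>R z) = mollifier z" for z proof (cases "1 \<le> norm z")
			case False
			hence "x - d *\<^sub>R z\<in>cball x e1" using near[of z x] d(2) by auto
			hence "x - d *\<^sub>R z\<in>K1" using K1(5)[OF x] by blast
			thus ?thesis by simp
		qed (simp add: mollifier_zero)
		thus ?thesis unfolding \<zeta>_def moll_def by (simp only: mollifier_integral)
	qed
	have zero: "\<zeta> x = 0" if x: "x\<notin>K2" for x proof -
		have "mollifier z * indicat_real K1 (x - d *\<^sub>R z) = 0" for z proof (cases "1 \<le> norm z")
			case False
			have "x - d *\<^sub>R z\<notin>K1" proof
				assume a: "x - d *\<^sub>R z\<in>K1"
				have "x\<in>cball (x - d *\<^sub>R z) e2" using near[of z x] False d(3) by (auto simp: dist_commute)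
				thus False using K2(5)[OF a] x by blast
			qed
			thus ?thesis by simp
		qed (simp add: mollifier_zero)
		thus ?thesis unfolding \<zeta>_def moll_def by (simp only: integral_zero)
	qed
	show ?thesis by (rule that[of \<zeta> K2]) (use sm one zero K1 K2 in auto)
qed

section \<open>Sobolev inequalities in dimension three\<close>

text \<open>The function \<open>G t - t G' t\<close> has the derivative \<open>- t G'' t\<close>, which is integrable at 0.\<close>

lemma second_derivative_estimate:
	fixes G G' G'' :: "real => real"
	assumes G: "\<And>t. (G has_real_derivative G' t) (at t)" and G': "\<And>t. (G' has_real_derivative G'' t) (at t)"
		and b: "\<And>t. 0 < t ==> t \<le> 1 ==> \<bar>G'' t\<bar> \<le> M/(t * sqrt t)"
	shows "\<bar>G 0\<bar> \<le> \<bar>G 1\<bar> + \<bar>G' 1\<bar> + 2 * M" proof -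
	\<comment> \<open>The sign \<open>c\<close> treats both bounds at once; adding
	  \<open>2 * M * sqrt t\<close>, whose derivative is \<open>M/sqrt t\<close>, makes the function
	  increasing.\<close>
	have mono: "G 0 * c \<le> (G 1 - G' 1) * c + 2 * M" if c: "\<bar>c\<bar> = 1" for c proof -
		let ?H = "\<lambda>t. (G t - t * G' t) * c + 2 * M * sqrt t"
		have "?H 0 \<le> ?H 1" proof (rule DERIV_nonneg_imp_increasing_open[where f = ?H])
			fix t :: real assume t: "0 < t" "t < 1"
			have "(?H has_real_derivative - (t * G'' t) * c + M/sqrt t) (at t)" using t by (auto intro!: derivative_eq_intros G G' simp: field_simps)
			moreover have "\<bar>(t * G'' t) * c\<bar> \<le> M/sqrt t" using mult_left_mono[OF b, of t t] t c by (simp add: abs_mult)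
			ultimately show "\<exists>y. (?H has_real_derivative y) (at t) \<and> 0 \<le> y" by force
		next
			have "continuous_on {0..1} G" "continuous_on {0..1} G'" using G G' by (auto intro!: continuous_at_imp_continuous_on DERIV_isCont)
			thus "continuous_on {0..1} ?H" by (intro continuous_intros)
		qed simp
		thus ?thesis by simp
	qed
	show ?thesis using mono[of 1] mono[of "-1"] by auto
qed

text \<open>A cube rather than a ball, because the parameter integrals below are differentiated over
  boxes.\<close>

definition rbox :: "real => (real^3) set" where
	"rbox r = cbox (\<chi> i. - r) (\<chi> i. r)"

lemma rbox_nth: "y\<in>rbox r ==> \<bar>y $ i\<bar> \<le> r" by (auto simp: rbox_def mem_box_cart abs_le_iff) (metis minus_le_iff)

lemma rbox_norm: assumes "y\<in>rbox r" shows "norm y \<le> 3 * r" proof -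
	have "norm y \<le> (\<Sum>i\<in>UNIV. \<bar>y $ i\<bar>)" by (rule norm_le_l1_cart)
	also have "\<dots> \<le> (\<Sum>i\<in>(UNIV::3 set). r)" using rbox_nth[OF assms] by (intro sum_mono) auto
	finally show ?thesis by simp
qed

text \<open>Cauchy-Schwarz on the cube, then the substitution \<open>x + t *\<^sub>R y\<close>: it
  divides the squared norm by \<open>t^3\<close>, whence \<open>t * sqrt t\<close>. This is the
  singularity that \<open>second_derivative_estimate\<close> admits, and it is where dimension three
  enters.\<close>

lemma rbox_integral_bound:
	assumes u: "continuous_on UNIV u" and w: "continuous_on UNIV w" and wB: "\<And>y. y\<in>rbox r ==> \<bar>w y\<bar> \<le> B"
		and t: "0 < t" "t \<le> 1" and r: "0 < r" shows "\<bar>integral (rbox r) (\<lambda>y. w y * u (x + t *\<^sub>R y))\<bar> \<le>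
		B * sqrt (measure lborel (rbox r)) * sqrt (nsq (cut (cball x (3 * r)) u))/(t * sqrt t)" proof -
	let ?u = "\<lambda>y. x + t *\<^sub>R y"
	let ?Q = "rbox r" let ?B = "cball x (3 * r)"
	have cQ: "compact ?Q" unfolding rbox_def by (rule compact_cbox)
	have cont: "continuous_on S (\<lambda>y. w y * u (?u y))" for S
		by (intro continuous_intros continuous_on_compose2[OF u] continuous_on_subset[OF w]) auto
	have si: "set_integrable lborel ?Q (\<lambda>y. w y * u (?u y))" unfolding set_integrable_def by (intro borel_integrable_compact cQ cont)
	have eq: "integral ?Q (\<lambda>y. w y * u (?u y)) = (LINT y|lborel. (indicat_real ?Q y * w y) * (indicat_real ?Q y * u (?u y)))"
		unfolding set_borel_integral_eq_integral(2)[OF si, symmetric] set_lebesgue_integral_def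
		by (intro Bochner_Integration.integral_cong refl) (auto simp: indicator_def)
	have B0: "0 \<le> B" using wB[of 0] r by (force simp: rbox_def mem_box_cart)
	have Lc: "L2 (cut K v)" if "compact K" "continuous_on UNIV v" for K :: "(real^3) set" and v proof -
		have "integrable lborel (\<lambda>y. indicat_real K y *\<^sub>R (v y)\<^sup>2)"
			by (intro borel_integrable_compact that(1) continuous_intros continuous_on_subset[OF that(2)]) auto
		moreover have "(\<lambda>y. indicat_real K y *\<^sub>R (v y)\<^sup>2) = (\<lambda>y. (indicat_real K y * v y)\<^sup>2)"
			by (auto simp: indicator_def)
		ultimately show ?thesis using that compact_imp_closed[OF that(1)] borel_measurable_continuous_onI[OF that(2)]
			by (simp add: L2_def borel_closed)
	qed
	have L1: "L2 (cut ?Q w)" by (rule Lc[OF cQ w])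
	have L3: "L2 (cut ?Q (\<lambda>y. u (?u y)))" by (rule Lc[OF cQ]) (intro continuous_intros continuous_on_compose2[OF u], auto)
	have L4: "L2 (cut ?B u)" by (rule Lc[OF compact_cball u])
	have n1: "nsq (cut ?Q w) \<le> B\<^sup>2 * measure lborel ?Q" proof -
		have "nsq (cut ?Q w) \<le> (LINT y|lborel. B\<^sup>2 * indicat_real ?Q y)" unfolding nsq_def proof (rule integral_mono)
			show "(indicat_real ?Q y * w y)\<^sup>2 \<le> B\<^sup>2 * indicat_real ?Q y" for y proof (cases "y\<in>?Q")
				case True
				have "\<bar>w y\<bar>\<^sup>2 \<le> B\<^sup>2" by (intro power_mono wB True) simp
				thus ?thesis using True by simp
			qed simp
			show "integrable lborel (\<lambda>y. B\<^sup>2 * indicat_real ?Q y)" using integrable_indicat_compact[OF cQ] by simp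
		qed (use L1 in \<open>simp add: L2_def\<close>)
		thus ?thesis by simp
	qed
	have n2: "nsq (cut ?Q (\<lambda>y. u (?u y))) \<le> nsq (cut ?B u)/t^3" proof -
		have L5: "L2 (\<lambda>y. indicat_real ?B (?u y) * u (?u y))"
			"nsq (cut ?B u) = t^3 * nsq (\<lambda>y. indicat_real ?B (?u y) * u (?u y))" using L2_affine[OF L4, of t x] t by auto
		have "nsq (cut ?Q (\<lambda>y. u (?u y))) \<le> nsq (\<lambda>y. indicat_real ?B (?u y) * u (?u y))" unfolding nsq_def
		proof (rule integral_mono)
			show "(indicat_real ?Q y * u (?u y))\<^sup>2 \<le> (indicat_real ?B (?u y) * u (?u y))\<^sup>2" for y proof (cases "y\<in>?Q")
				case True
				have "t * norm y \<le> 1 * (3 * r)" using rbox_norm[OF True] t by (intro mult_mono) auto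
				hence "x + t *\<^sub>R y\<in>?B" using t by (simp add: dist_norm)
				thus ?thesis using True by simp
			qed simp
		qed (use L3 L5 in \<open>auto simp: L2_def\<close>)
		thus ?thesis using L5(2) t by (simp add: field_simps)
	qed
	have "\<bar>integral ?Q (\<lambda>y. w y * u (?u y))\<bar> \<le>
			sqrt (nsq (cut ?Q w)) * sqrt (nsq (cut ?Q (\<lambda>y. u (?u y))))" unfolding eq by (rule L2_product(3)[OF L1 L3])
	also have "\<dots> \<le> sqrt (B\<^sup>2 * measure lborel ?Q) * sqrt (nsq (cut ?B u)/t^3)"
		using n1 n2 by (intro mult_mono real_sqrt_le_mono) auto
	also have "\<dots> = B * sqrt (measure lborel ?Q) * sqrt (nsq (cut ?B u))/(t * sqrt t)"
		using B0 t by (simp add: real_sqrt_mult real_sqrt_divide power3_eq_cube)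
	finally show ?thesis .
qed

text \<open>The derivatives are arguments of their own because weak derivatives are determined only
  almost everywhere.\<close>

definition jet_norm :: "(real^3) set => (real^3 => real) => (3 => real^3 => real) => (3 => 3 => real^3 => real) => real" where
	"jet_norm K f g h = sqrt (nsq (cut K f)) + (\<Sum>i\<in>UNIV. sqrt (nsq (cut K (g i)))) +
		 (\<Sum>i\<in>UNIV. \<Sum>j\<in>UNIV. sqrt (nsq (cut K (h i j))))"

text \<open>Let G t be the integral of \<open>F (x + t *\<^sub>R y)\<close> over the cube. Then G 0
  is the volume times \<open>F x\<close>, and the second derivative of G integrates second
  derivatives of \<open>F\<close> against products of coordinates, which
  \<open>rbox_integral_bound\<close> controls; \<open>second_derivative_estimate\<close> then bounds
  G 0.\<close>

lemma sup_bound_smooth: assumes r: "0 < r" shows "\<exists>C\<ge>0. \<forall>F x. smooth3 UNIV F \<longrightarrow>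
		\<bar>F x\<bar> \<le> C * jet_norm (cball x (3 * r)) F (\<lambda>i. pd i F) (\<lambda>i j. pd j (pd i F))" proof -
	define V where "V = measure lborel (rbox r)"
	have "(0 :: real^3)\<in>cbox (\<chi> i. - r) (\<chi> i. r)" using r by (simp add: mem_box_cart)
	hence "cbox (\<chi> i. - r) ((\<chi> i. r) :: real^3) \<noteq> {}" by blast
	hence "V = (2 * r)^3" unfolding V_def rbox_def by (simp add: content_cbox_cart)
	hence V0: "0 < V" using r by simp
	\<comment> \<open>The weights 1, r and r^2 bound 1, \<open>y $ i\<close> and
	  \<open>y $ i * y $ j\<close> on the cube; the 2 is that of
	  \<open>second_derivative_estimate\<close>, and \<open>sqrt V/V\<close> comes from Cauchy-Schwarz
	  and the division by the volume.\<close>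
	define C where "C = (1 + r + 2 * r\<^sup>2) * sqrt V/V"
	have C0: "0 \<le> C" using r V0 by (simp add: C_def)
	have "\<bar>F x\<bar> \<le> C * jet_norm (cball x (3 * r)) F (\<lambda>i. pd i F) (\<lambda>i j. pd j (pd i F))" if F: "smooth3 UNIV F" for F x
	proof -
		let ?A = "\<lambda>u. sqrt (nsq (cut (cball x (3 * r)) u))"
		define I where "I w u t = integral (rbox r) (\<lambda>y. w y * u (x + t *\<^sub>R y))" for w u :: "real^3 => real" and t
		have int: "(\<lambda>y. w y * u (x + t *\<^sub>R y)) integrable_on rbox r" if "continuous_on UNIV w" "smooth3 UNIV u" for w u :: "real^3 => real" and t
			unfolding rbox_def by (intro integrable_continuous continuous_intros continuous_on_subset[OF that(1)]
					continuous_on_compose2[OF smooth3_continuous[OF that(2)]]) auto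
		have D: "(I w u has_real_derivative (\<Sum>i\<in>UNIV. I (\<lambda>y. w y * y $ i) (pd i u) t)) (at t)"
			if w: "continuous_on UNIV w" and u: "smooth3 UNIV u" for w u t proof -
			have line: "((\<lambda>t. u (x + t *\<^sub>R y)) has_real_derivative (\<Sum>i\<in>UNIV. y $ i * pd i u (x + t *\<^sub>R y))) (at t)" for y t
			proof -
				have "((\<lambda>t. x + t *\<^sub>R y) has_derivative (\<lambda>t. t *\<^sub>R y)) (at t)" by (auto intro!: derivative_eq_intros)
				from has_derivative_compose[OF this has_derivative_pd[OF smooth3_differentiable[OF u]]]
				show ?thesis unfolding has_field_derivative_def by (rule has_derivative_eq_rhs) (simp add: fun_eq_iff sum_distrib_left ac_simps)
			qed
			have "(I w u has_field_derivative integral (rbox r) (\<lambda>y. w y * (\<Sum>i\<in>UNIV. y $ i * pd i u (x + t *\<^sub>R y)))) (at t within UNIV)"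
				unfolding I_def[abs_def] rbox_def proof (rule leibniz_rule_field_derivative)
				show "((\<lambda>t. w y * u (x + t *\<^sub>R y)) has_field_derivative w y * (\<Sum>i\<in>UNIV. y $ i * pd i u (x + s *\<^sub>R y))) (at s within UNIV)" for s y
					using DERIV_cmult[OF line] by simp
				show "continuous_on (UNIV\<times>cbox (\<chi> i. - r) (\<chi> i. r)) (\<lambda>(s, y). w y * (\<Sum>i\<in>UNIV. y $ i * pd i u (x + s *\<^sub>R y)))"
					unfolding case_prod_unfold
					by (intro continuous_intros continuous_on_compose2[OF w] continuous_on_compose2[OF smooth3_continuous[OF smooth3_pd[OF u]]]) auto
			qed (use int[OF w u] in \<open>auto simp: rbox_def\<close>)
			also have "integral (rbox r) (\<lambda>y. w y * (\<Sum>i\<in>UNIV. y $ i * pd i u (x + t *\<^sub>R y))) = (\<Sum>i\<in>UNIV. I (\<lambda>y. w y * y $ i) (pd i u) t)"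
				unfolding I_def sum_distrib_left mult.assoc[symmetric] by (rule integral_sum) (simp, intro int continuous_intros w smooth3_pd u)
			finally show ?thesis by simp
		qed
		have b: "\<bar>I w u t\<bar> \<le> B * sqrt V * ?A u/(t * sqrt t)"
			if "continuous_on UNIV w" "smooth3 UNIV u" "\<And>y. y\<in>rbox r ==> \<bar>w y\<bar> \<le> B" "0 < t" "t \<le> 1" for w u t B
			unfolding I_def V_def by (rule rbox_integral_bound[OF smooth3_continuous that(1,3-5) r]) (rule that)
		have y: "\<bar>1 * y $ i * y $ j\<bar> \<le> r\<^sup>2" if "y\<in>rbox r" for y i j
			using mult_mono[OF rbox_nth[OF that, of i] rbox_nth[OF that, of j]] r by (simp add: abs_mult power2_eq_square)
		have s: "smooth3 UNIV (pd i F)" "smooth3 UNIV (pd j (pd i F))" for i j by (intro smooth3_pd F)+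
		have d1: "(I (\<lambda>_. 1) F has_real_derivative (\<Sum>i\<in>UNIV. I (\<lambda>y. 1 * y $ i) (pd i F) t)) (at t)" for t
			by (intro D F continuous_intros)
		have d2: "((\<lambda>t. \<Sum>i\<in>UNIV. I (\<lambda>y. 1 * y $ i) (pd i F) t) has_real_derivative
				(\<Sum>i\<in>UNIV. \<Sum>j\<in>UNIV. I (\<lambda>y. 1 * y $ i * y $ j) (pd j (pd i F)) t)) (at t)" for t
			by (intro DERIV_sum D s continuous_intros)
		have "\<bar>\<Sum>i\<in>UNIV. \<Sum>j\<in>UNIV. I (\<lambda>y. 1 * y $ i * y $ j) (pd j (pd i F)) t\<bar>
				\<le> (\<Sum>i\<in>UNIV. \<Sum>j\<in>UNIV. r\<^sup>2 * sqrt V * ?A (pd j (pd i F)))/(t * sqrt t)" if "0 < t" "t \<le> 1" for t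
			unfolding sum_divide_distrib by (intro order_trans[OF sum_abs] sum_mono b that s y continuous_intros)
		note second_derivative_estimate[OF d1 d2 this]
		moreover have "I (\<lambda>_. 1) F 0 = V * F x" by (simp add: I_def V_def rbox_def)
		moreover have "\<bar>I (\<lambda>_. 1) F 1\<bar> \<le> sqrt V * ?A F" using b[of "\<lambda>_. 1" F 1 1] F by simp
		moreover have "\<bar>\<Sum>i\<in>UNIV. I (\<lambda>y. 1 * y $ i) (pd i F) 1\<bar> \<le> (\<Sum>i\<in>UNIV. r * sqrt V * ?A (pd i F))"
		proof (intro order_trans[OF sum_abs] sum_mono)
			show "\<bar>I (\<lambda>y. 1 * y $ i) (pd i F) 1\<bar> \<le> r * sqrt V * ?A (pd i F)" for i
				using b[of "\<lambda>y. 1 * y $ i" "pd i F" r 1] s(1) rbox_nth by (simp add: continuous_intros)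
		qed
		ultimately have le: "V * \<bar>F x\<bar> \<le> sqrt V * ?A F + (\<Sum>i\<in>UNIV. r * sqrt V * ?A (pd i F)) +
				2 * (\<Sum>i\<in>UNIV. \<Sum>j\<in>UNIV. r\<^sup>2 * sqrt V * ?A (pd j (pd i F)))" using V0 by (simp add: abs_mult)
		let ?k = "1 + r + 2 * r\<^sup>2"
		have n: "0 \<le> ?A F" "0 \<le> (\<Sum>i\<in>UNIV. ?A (pd i F))" "0 \<le> (\<Sum>i\<in>UNIV. \<Sum>j\<in>UNIV. ?A (pd j (pd i F)))"
			by (auto intro!: sum_nonneg)
		have "V * \<bar>F x\<bar> \<le> sqrt V * (1 * ?A F + r * (\<Sum>i\<in>UNIV. ?A (pd i F)) + (2 * r\<^sup>2) * (\<Sum>i\<in>UNIV. \<Sum>j\<in>UNIV. ?A (pd j (pd i F))))"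
			using le by (simp add: sum_distrib_left algebra_simps)
		also have "\<dots> \<le> sqrt V * (?k * ?A F + ?k * (\<Sum>i\<in>UNIV. ?A (pd i F)) + ?k * (\<Sum>i\<in>UNIV. \<Sum>j\<in>UNIV. ?A (pd j (pd i F))))"
			using r n V0 by (intro mult_left_mono add_mono mult_right_mono) auto
		also have "\<dots> = sqrt V * ?k * jet_norm (cball x (3 * r)) F (\<lambda>i. pd i F) (\<lambda>i j. pd j (pd i F))"
			by (simp add: jet_norm_def algebra_simps)
		finally show ?thesis using V0 unfolding C_def by (simp add: field_simps)
	qed
	thus ?thesis using C0 by blast
qed

lemma L2_dominated: assumes "L2 v" "u\<in>borel_measurable borel" "\<And>x. \<bar>u x\<bar> \<le> \<bar>v x\<bar>"
	shows "L2 u" "nsq u \<le> nsq v" proof -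
	have b: "(u x)\<^sup>2 \<le> (v x)\<^sup>2" for x using assms(3)[of x] by (simp add: abs_le_square_iff)
	have i: "integrable lborel (\<lambda>x. (v x)\<^sup>2)" using assms(1) by (simp add: L2_def)
	have i': "integrable lborel (\<lambda>x. (u x)\<^sup>2)" using assms(2) b by (intro Bochner_Integration.integrable_bound[OF i]) auto
	thus "L2 u" using assms(2) by (simp add: L2_def)
	show "nsq u \<le> nsq v" unfolding nsq_def by (rule integral_mono[OF i' i b])
qed

lemma L2_continuous_indicat: assumes "compact K" "continuous_on UNIV (f :: 'a::euclidean_space => real)" shows "L2 (cut K f)" proof -
	have "integrable lborel (\<lambda>y. indicat_real K y *\<^sub>R (f y)\<^sup>2)"
		by (intro borel_integrable_compact assms(1) continuous_intros continuous_on_subset[OF assms(2)]) auto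
	moreover have "(\<lambda>y. indicat_real K y *\<^sub>R (f y)\<^sup>2) = (\<lambda>y. (indicat_real K y * f y)\<^sup>2)"
		by (auto simp: indicator_def)
	ultimately show ?thesis using assms compact_imp_closed[OF assms(1)] borel_measurable_continuous_onI[OF assms(2)]
		by (simp add: L2_def borel_closed)
qed

lemma L2_convergence_nsq: assumes u: "L2 u" and v: "eventually (\<lambda>n. L2 (\<lambda>x. v n x - u x)) sequentially"
		and lim: "(\<lambda>n. nsq (\<lambda>x. v n x - u x)) \<longlonglongrightarrow> 0"
	shows "(\<lambda>n. nsq (v n)) \<longlonglongrightarrow> nsq u" proof -
	let ?u = "\<lambda>n. LINT x|lborel. v n x * u x"
	let ?v = "\<lambda>n. \<lambda>x. v n x - u x"
	\<comment> \<open>This expression is \<open>nsq (v n)\<close>, as expanding the square of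
	  \<open>v n x - u x\<close> shows.\<close>
	have "(\<lambda>n. 2 * ((?u n) - nsq u) + nsq (?v n) + nsq u) \<longlonglongrightarrow>
			2 * ((LINT x|lborel. u x * u x) - nsq u) + 0 + nsq u" by (intro tendsto_intros L2_limit u v lim)
	hence "(\<lambda>n. 2 * ((?u n) - nsq u) + nsq (?v n) + nsq u) \<longlonglongrightarrow> nsq u" by (simp add: nsq_def power2_eq_square)
	moreover have "eventually (\<lambda>n. 2 * ((?u n) - nsq u) + nsq (?v n) + nsq u = nsq (v n)) sequentially" using v proof eventually_elim
		case (elim n)
		have vL: "L2 (v n)" using L2_diffD[OF elim u] .
		have "nsq (?v n) = (LINT x|lborel. (v n x)\<^sup>2 - 2 * (v n x * u x) + (u x)\<^sup>2)"
			unfolding nsq_def by (intro Bochner_Integration.integral_cong refl) (simp add: power2_diff)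
		also have "\<dots> = nsq (v n) - 2 * (?u n) + nsq u" using vL u L2_product(1)[OF vL u] by (simp add: nsq_def L2_def)
		finally show ?case by simp
	qed
	ultimately show ?thesis by (rule Lim_transform_eventually)
qed

lemma L2_AE_subsequence: assumes v: "eventually (\<lambda>n. L2 (\<lambda>x. v n x - u x)) sequentially"
		and lim: "(\<lambda>n. nsq (\<lambda>x. v n x - u x)) \<longlonglongrightarrow> 0"
	shows "\<exists>r. strict_mono r \<and> (AE x in lborel. (\<lambda>n. v (r n) x) \<longlonglongrightarrow> u x)" proof -
	obtain N where N: "\<And>n. N \<le> n ==> L2 (\<lambda>x. v n x - u x)" using v unfolding eventually_sequentially by blast
	have "\<exists>r. strict_mono r \<and> (AE x in lborel. (\<lambda>n. (v (r n + N) x - u x)\<^sup>2) \<longlonglongrightarrow> 0)"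
	proof (rule tendsto_L1_AE_subseq)
		show "integrable lborel (\<lambda>x. (v (n + N) x - u x)\<^sup>2)" for n using N[of "n + N"] by (simp add: L2_def)
		show "(\<lambda>n. LINT x|lborel. norm ((v (n + N) x - u x)\<^sup>2)) \<longlonglongrightarrow> 0"
			using LIMSEQ_ignore_initial_segment[OF lim, of N] by (simp add: nsq_def)
	qed
	then obtain r where r: "strict_mono r" "AE x in lborel. (\<lambda>n. (v (r n + N) x - u x)\<^sup>2) \<longlonglongrightarrow> 0" by blast
	have "AE x in lborel. (\<lambda>n. v (r n + N) x) \<longlonglongrightarrow> u x" using r(2) proof eventually_elim
		case (elim x)
		have "(\<lambda>n. sqrt ((v (r n + N) x - u x)\<^sup>2)) \<longlonglongrightarrow> sqrt 0" by (intro tendsto_intros elim)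
		hence "(\<lambda>n. v (r n + N) x - u x) \<longlonglongrightarrow> 0" by (simp add: tendsto_rabs_zero_iff)
		thus ?case by (rule LIM_zero_cancel)
	qed
	moreover have "strict_mono (\<lambda>n. r n + N)" using r(1) by (auto simp: strict_mono_def)
	ultimately show ?thesis by (intro exI[of _ "\<lambda>n. r n + N"]) auto
qed

text \<open>Integrating \<open>\<zeta>\<^sup>2 (\<partial>\<^sub>i F)\<^sup>4\<close> by parts trades two of the first derivatives for \<open>F\<close> and a second
	derivative.\<close>

lemma L4_bound_smooth: assumes \<zeta>: "smooth3 UNIV \<zeta>" "compact K" "\<And>x. x\<notin>K ==> \<zeta> x = 0"
	shows "\<exists>C\<ge>0. \<forall>F m i. smooth3 UNIV F \<longrightarrow> (\<forall>x\<in>K. \<bar>F x\<bar> \<le> m) \<longrightarrow>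
		nsq (\<lambda>x. \<zeta> x * (pd i F x)\<^sup>2) \<le> C * m\<^sup>2 * (nsq (cut K (pd i F)) + nsq (cut K (pd i (pd i F))))" proof -
	have z': "pd i \<zeta> x = 0" if "x\<notin>K" for i x by (rule pd_zero_outside[OF compact_imp_closed[OF \<zeta>(2)] \<zeta>(3) that])
	obtain B where B: "0 < B" "\<And>x. \<bar>\<zeta> x\<bar> \<le> B"
		using continuous_compact_support_bounded[OF smooth3_continuous[OF \<zeta>(1)] \<zeta>(2,3)] by blast
	have "\<exists>B'>0. \<forall>x. \<bar>pd i \<zeta> x\<bar> \<le> B'" for i
		using continuous_compact_support_bounded[OF smooth3_continuous[OF smooth3_pd[OF \<zeta>(1)]] \<zeta>(2) z'] by blast
	then obtain B' where B': "\<And>i. 0 < B' i" "\<And>i x. \<bar>pd i \<zeta> x\<bar> \<le> B' i" by metis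
	define D where "D = sum B' UNIV"
	have D: "\<bar>pd i \<zeta> x\<bar> \<le> D" for i x
		using B'(2)[of i x] member_le_sum[of i UNIV B'] B'(1) unfolding D_def by (force intro: less_imp_le)
	have D0: "0 < D" unfolding D_def using B'(1) by (intro sum_pos) auto
	\<comment> \<open>Below, \<open>v1\<close> and \<open>v2\<close> carry the factors
	  \<open>2 * pd i \<zeta> x * F x\<close> and \<open>3 * \<zeta> x * F x\<close>; the outer 2 is
	  that of \<open>L2_add\<close>.\<close>
	define C where "C = 2 * (2 * D)\<^sup>2 + 2 * (3 * B)\<^sup>2"
	have "nsq (\<lambda>x. \<zeta> x * (pd i F x)\<^sup>2) \<le> C * m\<^sup>2 * (nsq (cut K (pd i F)) + nsq (cut K (pd i (pd i F))))"
		if F: "smooth3 UNIV F" and m: "\<And>x. x\<in>K ==> \<bar>F x\<bar> \<le> m" for F m i proof -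
		define w where "w = pd i F"
		define w' where "w' = pd i w"
		have w: "smooth3 UNIV w" "smooth3 UNIV w'" unfolding w_def w'_def using F by (auto intro: smooth3_pd)
		\<comment> \<open>Its derivative integrates to zero. Differentiating \<open>F\<close> produces the
		  fourth power of \<open>w\<close>, and all other terms contain the factor
		  \<open>\<zeta> x * (w x)\<^sup>2\<close>, so the fourth power is bounded through Cauchy-Schwarz
		  by the root of itself.\<close>
		define \<Psi> where "\<Psi> x = (\<zeta> x * \<zeta> x) * (F x * (w x * (w x * w x)))" for x
		have \<Psi>s: "smooth3 UNIV \<Psi>" unfolding \<Psi>_def by (intro smooth3_mult \<zeta> F w)
		have d: "\<zeta> differentiable (at x)" "F differentiable (at x)" "w differentiable (at x)" for x
			using \<zeta>(1) F w by (auto intro: smooth3_differentiable)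
		have pd: "pd i \<Psi> x = (\<zeta> x * (w x)\<^sup>2) * (2 * pd i \<zeta> x * F x * w x + 3 * \<zeta> x * F x * w' x) + (\<zeta> x * (w x)\<^sup>2)\<^sup>2" for x
		proof -
			have "pd i \<Psi> x = pd i (\<lambda>x. \<zeta> x * \<zeta> x) x * (F x * (w x * (w x * w x))) + (\<zeta> x * \<zeta> x) * pd i (\<lambda>x. F x * (w x * (w x * w x))) x"
				unfolding \<Psi>_def by (intro pd_mult differentiable_mult d)
			also have "pd i (\<lambda>x. F x * (w x * (w x * w x))) x = w x * (w x * (w x * w x)) + F x * pd i (\<lambda>x. w x * (w x * w x)) x"
				unfolding w_def[symmetric] by (subst pd_mult) (auto intro!: differentiable_mult d simp: w_def[symmetric])
			also have "pd i (\<lambda>x. w x * (w x * w x)) x = w' x * (w x * w x) + w x * pd i (\<lambda>x. w x * w x) x"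
				by (subst pd_mult) (auto intro!: differentiable_mult d simp: w'_def)
			also have "pd i (\<lambda>x. w x * w x) x = w' x * w x + w x * w' x" by (subst pd_mult) (auto intro!: d simp: w'_def)
			also have "pd i (\<lambda>x. \<zeta> x * \<zeta> x) x = pd i \<zeta> x * \<zeta> x + \<zeta> x * pd i \<zeta> x" by (intro pd_mult d)
			finally show ?thesis by (simp add: algebra_simps power2_eq_square)
		qed
		define u where "u x = \<zeta> x * (w x)\<^sup>2" for x
		define v1 where "v1 x = (2 * pd i \<zeta> x * F x) * (indicat_real K x * w x)" for x
		define v2 where "v2 x = (3 * \<zeta> x * F x) * (indicat_real K x * w' x)" for x
		have c: "continuous_on UNIV \<zeta>" "continuous_on UNIV (pd i \<zeta>)" "continuous_on UNIV F" "continuous_on UNIV w" "continuous_on UNIV w'"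
			using \<zeta>(1) F w by (auto intro: smooth3_continuous smooth3_pd)
		have uL: "L2 u"
			unfolding u_def by (rule L2_continuous_compact_support[OF _ \<zeta>(2)]) (use \<zeta>(3) in \<open>auto intro!: continuous_intros c\<close>)
		have m0: "0 \<le> m \<or> K = {}" using m abs_ge_zero by (metis equals0I order_trans)
		have b1: "\<bar>2 * pd i \<zeta> x * F x\<bar> \<le> 2 * D * \<bar>m\<bar>" for x proof (cases "x\<in>K")
			case True
			thus ?thesis using D[of i x] m[OF True] D0 by (auto simp: abs_mult intro!: mult_mono)
		qed (use z' D0 in auto)
		have b2: "\<bar>3 * \<zeta> x * F x\<bar> \<le> 3 * B * \<bar>m\<bar>" for x proof (cases "x\<in>K")
			case True
			thus ?thesis using B(2)[of x] m[OF True] B(1) by (auto simp: abs_mult intro!: mult_mono)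
		qed (use \<zeta>(3) B(1) in auto)
		have m1: "(\<lambda>x. 2 * pd i \<zeta> x * F x)\<in>borel_measurable borel" "(\<lambda>x. 3 * \<zeta> x * F x)\<in>borel_measurable borel"
			by (intro borel_measurable_continuous_onI continuous_intros c)+
		have wL: "L2 (cut K w)" "L2 (cut K w')" by (intro L2_continuous_indicat \<zeta> c)+
		have v1L: "L2 v1" "nsq v1 \<le> (2 * D * \<bar>m\<bar>)\<^sup>2 * nsq (cut K w)" using L2_mult_bounded[OF wL(1) m1(1) b1] unfolding v1_def .
		have v2L: "L2 v2" "nsq v2 \<le> (3 * B * \<bar>m\<bar>)\<^sup>2 * nsq (cut K w')"
			using L2_mult_bounded[OF wL(2) m1(2) b2] unfolding v2_def .
		have vL: "L2 (\<lambda>x. v1 x + v2 x)" by (rule L2_add(1)[OF v1L(1) v2L(1)])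
		have "(LINT x|lborel. pd i \<Psi> x) = 0" by (rule integral_pd_zero[OF \<Psi>s \<zeta>(2)]) (simp add: \<Psi>_def \<zeta>(3))
		moreover have "pd i \<Psi> x = u x * (v1 x + v2 x) + (u x)\<^sup>2" for x
			using \<zeta>(3)[of x] unfolding pd u_def v1_def v2_def by (auto simp: indicator_def)
		ultimately have "(LINT x|lborel. u x * (v1 x + v2 x) + (u x)\<^sup>2) = 0" by simp
		hence "nsq u = - (LINT x|lborel. u x * (v1 x + v2 x))" using L2_product(1)[OF uL vL] uL by (simp add: nsq_def L2_def)
		hence "nsq u \<le> sqrt (nsq u) * sqrt (nsq (\<lambda>x. v1 x + v2 x))" using L2_product(3)[OF uL vL] by linarith
		hence le: "sqrt (nsq u) * sqrt (nsq u) \<le> sqrt (nsq u) * sqrt (nsq (\<lambda>x. v1 x + v2 x))" by simp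
		have "nsq u \<le> nsq (\<lambda>x. v1 x + v2 x)" proof (cases "nsq u = 0")
			case False
			hence "0 < nsq u" using nsq_nonneg[of u] by linarith
			hence "0 < sqrt (nsq u)" by simp
			from mult_left_le_imp_le[OF le this] show ?thesis by simp
		qed simp
		also have "\<dots> \<le> 2 * nsq v1 + 2 * nsq v2" by (rule L2_add(2)[OF v1L(1) v2L(1)])
		also have "\<dots> \<le> 2 * ((2 * D * \<bar>m\<bar>)\<^sup>2 * nsq (cut K w)) + 2 * ((3 * B * \<bar>m\<bar>)\<^sup>2 * nsq (cut K w'))"
			using v1L(2) v2L(2) by simp
		also have "\<dots> = 2 * (2 * D)\<^sup>2 * m\<^sup>2 * nsq (cut K w) + 2 * (3 * B)\<^sup>2 * m\<^sup>2 * nsq (cut K w')"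
			by (simp add: power_mult_distrib)
		also have "\<dots> \<le> C * m\<^sup>2 * nsq (cut K w) + C * m\<^sup>2 * nsq (cut K w')"
			unfolding C_def by (intro add_mono mult_right_mono) auto
		finally show ?thesis unfolding u_def w'_def w_def by (simp add: distrib_left)
	qed
	moreover have "0 \<le> C" unfolding C_def by simp
	ultimately show ?thesis by blast
qed

text \<open>Explicit weak derivatives of first and second order, in place of those selected by
  choice inside \<open>sobolev_sq\<close>.\<close>

definition jet2 :: "(real^3) set => (real^3 => real) => (3 => real^3 => real) => (3 => 3 => real^3 => real) => bool" where
	"jet2 S f g h \<longleftrightarrow> L2_loc S f \<and> (\<forall>i. L2_loc S (g i)) \<and> (\<forall>i j. L2_loc S (h i j)) \<and>
		 (\<forall>i. weak_pd S i f (g i)) \<and> (\<forall>i j. weak_pd S j (g i) (h i j))"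

text \<open>The smooth estimates are applied to mollifications and passed to the limit: along an
  almost everywhere convergent subsequence for the supremum, by Fatou for the fourth powers. Of the
  nested compact sets, \<open>K1\<close> carries the cutoff, \<open>K2\<close> the balls of
  \<open>sup_bound_smooth\<close>, and \<open>K3\<close> the data being mollified, so that on
  \<open>K2\<close> mollified weak derivatives are derivatives of mollifications.\<close>

lemma sobolev_inequalities: assumes S: "open S" and K: "compact K" "K\<subseteq>S"
	shows "\<exists>C K'. 0 \<le> C \<and> compact K' \<and> K'\<subseteq>S \<and> (\<forall>f g h. jet2 S f g h \<longrightarrow>
		(AE x in lborel. x\<in>K \<longrightarrow> \<bar>f x\<bar> \<le> C * jet_norm K' f g h) \<and>
		(\<forall>i. integrable lborel (cut K (\<lambda>x. (g i x)^4)) \<and>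
			 (LINT x|lborel. indicat_real K x * (g i x)^4) \<le> C * jet_norm K' f g h^4))" proof -
	let ?u = "\<lambda>x g i. indicat_real K x * (g i x)^4"
	obtain \<zeta> K1 where \<zeta>: "smooth3 UNIV \<zeta>" "compact K1" "K\<subseteq>K1" "K1\<subseteq>S" "\<And>x. x\<notin>K1 ==> \<zeta> x = 0"
			"\<And>x. x\<in>K ==> \<zeta> x = (1::real)" using cutoff_exists[OF S K] by blast
	obtain e2 K2 where K2: "0 < e2" "compact K2" "K1\<subseteq>K2" "K2\<subseteq>S" "\<And>x. x\<in>K1 ==> cball x e2\<subseteq>K2"
		using compact_thicken[OF S \<zeta>(2,4)] by blast
	obtain e3 K3 where K3: "0 < e3" "compact K3" "K2\<subseteq>K3" "K3\<subseteq>S" "\<And>x. x\<in>K2 ==> cball x e3\<subseteq>K3"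
		using compact_thicken[OF S K2(2,4)] by blast
	\<comment> \<open>\<open>sup_bound_smooth\<close> looks at balls of radius 3 times its
	  parameter.\<close>
	have "0 < e2/3" using K2(1) by simp
	from sup_bound_smooth[OF this] obtain C1 where C1: "0 \<le> C1"
		"\<And>F x. smooth3 UNIV F ==> \<bar>F x\<bar> \<le> C1 * jet_norm (cball x (3 * (e2/3))) F (\<lambda>i. pd i F) (\<lambda>i j. pd j (pd i F))"
		by blast
	from L4_bound_smooth[OF \<zeta>(1,2,5)] obtain C2 where C2: "0 \<le> C2"
		"\<And>F m i. smooth3 UNIV F ==> (\<And>x. x\<in>K1 ==> \<bar>F x\<bar> \<le> m) ==>
			nsq (\<lambda>x. \<zeta> x * (pd i F x)\<^sup>2) \<le> C2 * m\<^sup>2 * (nsq (cut K1 (pd i F)) + nsq (cut K1 (pd i (pd i F))))" by blast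
	\<comment> \<open>The quartic bound inserts the square of the supremum bound
	  \<open>C1 * J n\<close> and two squared norms, each at most \<open>(J n)\<^sup>2\<close>.\<close>
	define C where "C = max C1 (C2 * C1\<^sup>2 * 2)"
	have C0: "0 \<le> C" using C1 by (simp add: C_def)
	show ?thesis proof (intro exI[of _ C] exI[of _ K3] conjI C0 K3(2,4) allI impI)
		fix f g h assume j: "jet2 S f g h"
		let ?e = "\<lambda>n. 1/real (Suc n)"
		define F where "F n = moll (?e n) (cut K3 f)" for n
		define W where "W i n = moll (?e n) (cut K3 (g i))" for i n
		define Z where "Z i j n = moll (?e n) (cut K3 (h i j))" for i j n
		have loc: "L2_loc S f" "\<And>i. L2_loc S (g i)" "\<And>i j. L2_loc S (h i j)"
			and wk: "\<And>i. weak_pd S i f (g i)" "\<And>i j. weak_pd S j (g i) (h i j)" using j unfolding jet2_def by blast+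
		note fL = L2_loc_restrict[OF loc(1) K3(2,4)] and gL = L2_loc_restrict[OF loc(2) K3(2,4)]
			and hL = L2_loc_restrict[OF loc(3) K3(2,4)]
		have Fs: "smooth3 UNIV (F n)" for n unfolding F_def by (rule smooth3_moll[OF fL(2)]) simp
		have Ws: "smooth3 UNIV (W i n)" for i n unfolding W_def by (rule smooth3_moll[OF gL(2)]) simp
		have Zs: "smooth3 UNIV (Z i j n)" for i j n unfolding Z_def by (rule smooth3_moll[OF hL(2)]) simp
		define J where "J n = sqrt (nsq (F n)) + (\<Sum>i\<in>UNIV. sqrt (nsq (W i n))) + (\<Sum>i\<in>UNIV. \<Sum>j\<in>UNIV. sqrt (nsq (Z i j n)))" for n
		let ?J = "jet_norm K3 f g h"
		have Jlim: "J \<longlonglongrightarrow> ?J" unfolding J_def[abs_def] jet_norm_def F_def W_def Z_def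
			by (intro tendsto_add tendsto_sum tendsto_real_sqrt L2_convergence_nsq moll_tendsto fL gL hL)
		have J0: "0 \<le> J n" for n unfolding J_def by (intro add_nonneg_nonneg sum_nonneg) auto
		have small: "eventually (\<lambda>n. ?e n < e3/2) sequentially"
			using order_tendstoD(2)[OF LIMSEQ_inverse_real_of_nat, of "e3/2"] K3(1) by (simp add: inverse_eq_divide)
		have evL: "eventually (\<lambda>n. L2 (F n) \<and> (\<forall>i\<in>UNIV. L2 (W i n)) \<and> (\<forall>i\<in>UNIV. \<forall>j\<in>UNIV. L2 (Z i j n))) sequentially"
			unfolding F_def W_def Z_def by (intro eventually_conj eventually_ball_finite finite ballI eventually_mono[OF moll_tendsto(2)[OF fL(1)]]
					eventually_mono[OF moll_tendsto(2)[OF gL(1)]] eventually_mono[OF moll_tendsto(2)[OF hL(1)]])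
				(erule L2_diffD[OF _ fL(1)] L2_diffD[OF _ gL(1)] L2_diffD[OF _ hL(1)])+
		have pdFW: "pd i (F n) x = W i n x" if "?e n < e3/2" and b: "cball x (e3/2)\<subseteq>K3" for n i x
			unfolding F_def W_def proof (rule pd_moll[OF wk(1) loc(1,2) K3(2,4)])
			show "cball x (?e n)\<subseteq>K3" using that by (auto intro: order_trans)
		qed simp
		\<comment> \<open>Only half of the margin is spent on the first derivative, so that the identity
		  for it holds on a ball around each point of \<open>K2\<close> and may be differentiated
		  again.\<close>
		have half: "cball y (e3/2)\<subseteq>K3" if "x\<in>K2" "y\<in>ball x (e3/2)" for x y proof
			fix z assume "z\<in>cball y (e3/2)"
			hence "z\<in>cball x e3" using that dist_triangle[of x z y] by simp
			thus "z\<in>K3" using K3(5)[OF that(1)] by blast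
		qed
		have pd1: "pd i (F n) x = W i n x" if "?e n < e3/2" "x\<in>K2" for n i x using pdFW[OF that(1) half[OF that(2)]] K3(1) by simp
		have pd2: "pd j (pd i (F n)) x = Z i j n x" if e: "?e n < e3/2" and x: "x\<in>K2" for n i j x proof -
			have "pd j (pd i (F n)) x = pd j (W i n) x" by (rule pd_cong_open[of "ball x (e3/2)"])
					(use K3(1) pdFW[OF e half[OF x]] smooth3_differentiable[OF smooth3_pd[OF Fs]] in auto)
			also have "\<dots> = Z i j n x" unfolding W_def Z_def proof (rule pd_moll[OF wk(2) loc(2,3) K3(2,4)])
				show "cball x (?e n)\<subseteq>K3" using K3(5)[OF x] e K3(1) by (auto intro: order_trans)
			qed simp
			finally show ?thesis .
		qed
		have restr: "nsq (cut A u) \<le> nsq v" if "compact A" "L2 v" "smooth3 UNIV u" "\<And>x. x\<in>A ==> u x = v x"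
			for A u v
			using L2_dominated(2)[OF that(2), of "\<lambda>x. indicat_real A x * u x"] L2_borel[OF L2_continuous_indicat[OF that(1) smooth3_continuous[OF that(3)]]] that(4)
			by (auto simp: indicator_def)
		have sup: "eventually (\<lambda>n. \<forall>x\<in>K1. \<bar>F n x\<bar> \<le> C1 * J n) sequentially" using small evL proof eventually_elim
			case (elim n)
			show ?case proof
				fix x assume x: "x\<in>K1"
				have sub: "y\<in>K2" if "y\<in>cball x (3 * (e2/3))" for y using K2(5)[OF x] that by auto
				have "\<bar>F n x\<bar> \<le> C1 * jet_norm (cball x (3 * (e2/3))) (F n) (\<lambda>i. pd i (F n)) (\<lambda>i j. pd j (pd i (F n)))"
					by (rule C1(2)[OF Fs])
				also have "\<dots> \<le> C1 * J n" unfolding jet_norm_def J_def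
					by (intro mult_left_mono C1(1) add_mono sum_mono real_sqrt_le_mono restr compact_cball Fs smooth3_pd)
						(use elim pd1[OF elim(1) sub] pd2[OF elim(1) sub] in auto)
				finally show "\<bar>F n x\<bar> \<le> C1 * J n" .
			qed
		qed
		obtain r where r: "strict_mono r" "AE x in lborel. (\<lambda>n. F (r n) x) \<longlonglongrightarrow> indicat_real K3 x * f x"
			using L2_AE_subsequence[OF moll_tendsto(2)[OF fL(1)] moll_tendsto(1)[OF fL(1)]] unfolding F_def by blast
		have sub: "filterlim r sequentially sequentially" using r(1) by (rule filterlim_subseq)
		show "AE x in lborel. x\<in>K \<longrightarrow> \<bar>f x\<bar> \<le> C * ?J" using r(2) proof eventually_elim
			case (elim x)
			show ?case proof
				assume x: "x\<in>K"
				hence xx: "x\<in>K1" "x\<in>K3" using \<zeta>(3) K2(3) K3(3) by auto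
				have "eventually (\<lambda>n. \<bar>F (r n) x\<bar> \<le> C1 * J (r n)) sequentially"
					using eventually_compose_filterlim[OF sup sub] by eventually_elim (use xx in blast)
				moreover have "(\<lambda>n. \<bar>F (r n) x\<bar>) \<longlonglongrightarrow> \<bar>f x\<bar>" using tendsto_rabs[OF elim] xx by simp
				moreover have "(\<lambda>n. C1 * J (r n)) \<longlonglongrightarrow> C1 * ?J" by (intro tendsto_intros filterlim_compose[OF Jlim sub])
				ultimately have "\<bar>f x\<bar> \<le> C1 * ?J" by (intro tendsto_le[OF sequentially_bot]) auto
				also have "\<dots> \<le> C * ?J" using tendsto_lowerbound[OF Jlim] J0 by (intro mult_right_mono) (auto simp: C_def)
				finally show "\<bar>f x\<bar> \<le> C * ?J" .
			qed
		qed
		fix i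
		obtain q where q: "strict_mono q" "AE x in lborel. (\<lambda>n. W i (q n) x) \<longlonglongrightarrow> indicat_real K3 x * g i x"
			using L2_AE_subsequence[OF moll_tendsto(2)[OF gL(1)] moll_tendsto(1)[OF gL(1)]] unfolding W_def by blast
		have subq: "filterlim q sequentially sequentially" using q(1) by (rule filterlim_subseq)
		have mK: "K\<in>sets borel" using K(1) by (simp add: compact_imp_closed borel_closed)
		have bound: "eventually (\<lambda>n. (\<integral>\<^sup>+x. ennreal (indicat_real K x * (W i n x)^4) \<partial>lborel) \<le> ennreal (C * J n^4)) sequentially"
			using small evL sup proof eventually_elim
			case (elim n)
			have "nsq (\<lambda>x. \<zeta> x * (pd i (F n) x)\<^sup>2) \<le> C2 * (C1 * J n)\<^sup>2 * (nsq (cut K1 (pd i (F n))) + nsq (cut K1 (pd i (pd i (F n)))))"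
				by (rule C2(2)[OF Fs]) (use elim in auto)
			also have "\<dots> \<le> C2 * (C1 * J n)\<^sup>2 * ((J n)\<^sup>2 + (J n)\<^sup>2)" proof (intro mult_left_mono add_mono)
				have "sqrt (nsq (W i n)) \<le> (\<Sum>i\<in>UNIV. sqrt (nsq (W i n)))" by (rule member_le_sum) auto
				also have "\<dots> \<le> J n" unfolding J_def using sum_nonneg[of UNIV "\<lambda>i. \<Sum>j\<in>UNIV. sqrt (nsq (Z i j n))"]
					by (simp add: sum_nonneg)
				finally have "(sqrt (nsq (W i n)))\<^sup>2 \<le> (J n)\<^sup>2" by (intro power_mono) auto
				moreover have "nsq (cut K1 (pd i (F n))) \<le> nsq (W i n)"
					by (rule restr[OF \<zeta>(2)]) (use elim pd1[OF elim(1)] K2(3) Fs in \<open>auto intro: smooth3_pd\<close>)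
				ultimately show "nsq (cut K1 (pd i (F n))) \<le> (J n)\<^sup>2" by simp
				have "sqrt (nsq (Z i i n)) \<le> (\<Sum>j\<in>UNIV. sqrt (nsq (Z i j n)))" by (rule member_le_sum) auto
				also have "\<dots> \<le> (\<Sum>i\<in>UNIV. \<Sum>j\<in>UNIV. sqrt (nsq (Z i j n)))" by (rule member_le_sum) (auto intro: sum_nonneg)
				also have "\<dots> \<le> J n" unfolding J_def by (simp add: sum_nonneg)
				finally have "(sqrt (nsq (Z i i n)))\<^sup>2 \<le> (J n)\<^sup>2" by (intro power_mono) auto
				moreover have "nsq (cut K1 (pd i (pd i (F n)))) \<le> nsq (Z i i n)"
					by (rule restr[OF \<zeta>(2)]) (use elim pd2[OF elim(1)] K2(3) Fs in \<open>auto intro!: smooth3_pd\<close>)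
				ultimately show "nsq (cut K1 (pd i (pd i (F n)))) \<le> (J n)\<^sup>2" by simp
			qed (use C2 in auto)
			also have "\<dots> = (C2 * C1\<^sup>2 * 2) * J n^4" by (simp add: power_mult_distrib power2_eq_square power4_eq_xxxx)
			also have "\<dots> \<le> C * J n^4" by (intro mult_right_mono) (auto simp: C_def)
			finally have n: "nsq (\<lambda>x. \<zeta> x * (pd i (F n) x)\<^sup>2) \<le> C * J n^4" .
			have L: "L2 (\<lambda>x. \<zeta> x * (pd i (F n) x)\<^sup>2)" proof (rule L2_continuous_compact_support[OF _ \<zeta>(2)])
				have "smooth3 UNIV (\<lambda>x. \<zeta> x * (pd i (F n) x)\<^sup>2)"
					unfolding power2_eq_square by (intro smooth3_mult \<zeta>(1) smooth3_pd Fs)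
				thus "continuous_on UNIV (\<lambda>x. \<zeta> x * (pd i (F n) x)\<^sup>2)" by (rule smooth3_continuous)
			qed (simp add: \<zeta>(5))
			have "(\<integral>\<^sup>+x. ennreal (indicat_real K x * (W i n x)^4) \<partial>lborel) \<le> (\<integral>\<^sup>+x. ennreal ((\<zeta> x * (pd i (F n) x)\<^sup>2)\<^sup>2) \<partial>lborel)"
			proof (intro nn_integral_mono ennreal_leI)
				fix x
				show "indicat_real K x * (W i n x)^4 \<le> (\<zeta> x * (pd i (F n) x)\<^sup>2)\<^sup>2" proof (cases "x\<in>K")
					case True
					hence "x\<in>K2" using \<zeta>(3) K2(3) by auto
					hence "pd i (F n) x = W i n x" using pd1[OF elim(1)] by simp
					thus ?thesis using True \<zeta>(6)[OF True] by simp
				qed simp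
			qed
			also have "\<dots> = ennreal (nsq (\<lambda>x. \<zeta> x * (pd i (F n) x)\<^sup>2))"
				unfolding nsq_def using L by (intro nn_integral_eq_integral) (auto simp: L2_def)
			also have "\<dots> \<le> ennreal (C * J n^4)" using n by (rule ennreal_leI)
			finally show ?case .
		qed
		have gm: "(cut K (\<lambda>x. (g i x)^4))\<in>borel_measurable borel" proof -
			have "(cut K (\<lambda>x. (indicat_real K3 x * g i x)^4))\<in>borel_measurable borel"
				by (intro borel_measurable_times borel_measurable_power L2_borel[OF gL(1)] borel_measurable_indicator mK)
			moreover have "(cut K (\<lambda>x. (indicat_real K3 x * g i x)^4)) = (cut K (\<lambda>x. (g i x)^4))"
				using \<zeta>(3) K2(3) K3(3) by (fastforce simp: indicator_def)
			ultimately show ?thesis by simp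
		qed
		have Wm: "W i n\<in>borel_measurable borel" for n by (rule smooth3_borel[OF Ws])
		have "(\<integral>\<^sup>+x. ennreal (?u x g i) \<partial>lborel) \<le>
				(\<integral>\<^sup>+x. liminf (\<lambda>n. ennreal (indicat_real K x * (W i (q n) x)^4)) \<partial>lborel)"
		proof (rule nn_integral_mono_AE)
			show "AE x in lborel. ennreal (?u x g i) \<le> liminf (\<lambda>n. ennreal (indicat_real K x * (W i (q n) x)^4))"
				using q(2) proof eventually_elim
				case (elim x)
				have "(\<lambda>n. ennreal (indicat_real K x * (W i (q n) x)^4)) \<longlonglongrightarrow> ennreal (indicat_real K x * (indicat_real K3 x * g i x)^4)"
					by (intro tendsto_ennrealI tendsto_intros elim)
				moreover have "indicat_real K x * (indicat_real K3 x * g i x)^4 = indicat_real K x * (g i x)^4"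
					using \<zeta>(3) K2(3) K3(3) by (fastforce simp: indicator_def)
				ultimately have "liminf (\<lambda>n. ennreal (indicat_real K x * (W i (q n) x)^4)) = ennreal (?u x g i)" by (intro lim_imp_Liminf) auto
				thus ?case by simp
			qed
		qed
		also have "\<dots> \<le> liminf (\<lambda>n. \<integral>\<^sup>+x. ennreal (indicat_real K x * (W i (q n) x)^4) \<partial>lborel)"
			using mK Wm by (intro nn_integral_liminf) simp
		also have "\<dots> \<le> liminf (\<lambda>n. ennreal (C * J (q n)^4))" by (intro Liminf_mono eventually_compose_filterlim[OF bound subq])
		also have "\<dots> = ennreal (C * ?J^4)" by (intro lim_imp_Liminf tendsto_ennrealI tendsto_intros filterlim_compose[OF Jlim subq]) simp
		finally have fin: "(\<integral>\<^sup>+x. ennreal (?u x g i) \<partial>lborel) \<le> ennreal (C * ?J^4)" .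
		have Jn: "0 \<le> C * ?J^4" using C0 by simp
		show int: "integrable lborel (cut K (\<lambda>x. (g i x)^4))"
			using gm fin by (intro integrableI_bounded) (auto simp: less_top[symmetric] top_unique)
		show "(LINT x|lborel. indicat_real K x * (g i x)^4) \<le> C * ?J^4" using fin nn_integral_eq_integral[OF int] Jn by simp
	qed
qed

section \<open>Local Sobolev spaces of vector-valued functions\<close>

lemma L2_loc_norm: assumes "L2_loc S f" shows "L2_loc S (\<lambda>x. norm (f x))" proof -
	have "(\<lambda>x. indicat_real S x *\<^sub>R f x)\<in>borel_measurable borel" using assms by (simp add: L2_loc_def set_borel_measurable_def)
	hence "(\<lambda>x. norm (indicat_real S x *\<^sub>R f x))\<in>borel_measurable borel" by measurable
	moreover have "(\<lambda>x. norm (indicat_real S x *\<^sub>R f x)) = (\<lambda>x. indicat_real S x *\<^sub>R norm (f x))"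
		by (auto simp: indicator_def)
	ultimately show ?thesis using assms unfolding L2_loc_def set_borel_measurable_def by simp
qed

lemma L2_loc_indicat_borel: assumes "L2_loc S f" "compact K" "K\<subseteq>S"
	shows "(\<lambda>x. indicat_real K x *\<^sub>R f x)\<in>borel_measurable borel" proof -
	have [measurable]: "K\<in>sets borel" using assms(2) by (simp add: compact_imp_closed borel_closed)
	have [measurable]: "(\<lambda>x. indicat_real S x *\<^sub>R f x)\<in>borel_measurable borel"
		using assms(1) by (simp add: L2_loc_def set_borel_measurable_def)
	have "(\<lambda>x. indicat_real K x *\<^sub>R (indicat_real S x *\<^sub>R f x))\<in>borel_measurable borel" by measurable
	moreover have "(\<lambda>x. indicat_real K x *\<^sub>R (indicat_real S x *\<^sub>R f x)) = (\<lambda>x. indicat_real K x *\<^sub>R f x)"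
		using assms(3) by (fastforce simp: indicator_def fun_eq_iff)
	ultimately show ?thesis by simp
qed

lemma L2_loc_integrable: assumes "L2_loc S f" "compact K" "K\<subseteq>S"
	shows "integrable lborel (\<lambda>x. indicat_real K x *\<^sub>R f x)" proof (rule Bochner_Integration.integrable_bound)
	show "integrable lborel (cut K (\<lambda>x. norm (f x)))" by (rule L2_loc_restrict(2)[OF L2_loc_norm[OF assms(1)] assms(2,3)])
qed (use L2_loc_indicat_borel[OF assms] in \<open>auto simp: indicator_def\<close>)

lemma L2_loc_square_integrable: assumes "L2_loc S f" "compact K" "K\<subseteq>S"
	shows "integrable lborel (cut K (\<lambda>x. (norm (f x))\<^sup>2))" using assms unfolding L2_loc_def set_integrable_def by simp

lemma test_function_integrable:
	assumes f: "L2_loc S f" and \<phi>: "continuous_on UNIV \<phi>" "compact K" "K\<subseteq>S" "\<And>x. x\<notin>K ==> \<phi> x = 0"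
	shows "integrable lborel (\<lambda>x. indicat_real S x *\<^sub>R (\<phi> x *\<^sub>R f x))" proof -
	let ?u = "\<lambda>x. indicat_real K x *\<^sub>R f x"
	obtain B where B: "\<And>x. \<bar>\<phi> x\<bar> \<le> B" using continuous_compact_support_bounded[OF \<phi>(1,2,4)] by blast
	have [measurable]: "\<phi>\<in>borel_measurable borel" using \<phi>(1) by (rule borel_measurable_continuous_onI)
	have [measurable]: "(\<lambda>x. indicat_real K x *\<^sub>R f x)\<in>borel_measurable borel" by (rule L2_loc_indicat_borel[OF f \<phi>(2,3)])
	have "integrable lborel (\<lambda>x. \<phi> x *\<^sub>R (?u x))" proof (rule Bochner_Integration.integrable_bound)
		show "integrable lborel (\<lambda>x. B *\<^sub>R (?u x))" by (rule integrable_scaleR_right) (rule L2_loc_integrable[OF f \<phi>(2,3)])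
		show "AE x in lborel. norm (\<phi> x *\<^sub>R (?u x)) \<le> norm (B *\<^sub>R (?u x))"
			by (intro AE_I2) (auto simp: indicator_def intro!: mult_right_mono order_trans[OF B abs_ge_self])
	qed measurable
	moreover have "(\<lambda>x. \<phi> x *\<^sub>R (?u x)) = (\<lambda>x. indicat_real S x *\<^sub>R (\<phi> x *\<^sub>R f x))"
		using \<phi>(3,4) by (fastforce simp: indicator_def fun_eq_iff)
	ultimately show ?thesis by simp
qed

lemma test_function_integrable': assumes f: "L2_loc S f" and t: "test_function S \<phi>"
	shows "integrable lborel (\<lambda>x. indicat_real S x *\<^sub>R (\<phi> x *\<^sub>R f x))"
		"integrable lborel (\<lambda>x. indicat_real S x *\<^sub>R (pd i \<phi> x *\<^sub>R f x))" proof -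
	obtain K where K: "smooth3 UNIV \<phi>" "compact K" "K\<subseteq>S" "\<And>x. x\<notin>K ==> \<phi> x = 0" "\<And>x i. x\<notin>K ==> pd i \<phi> x = 0"
		by (rule test_functionE[OF t]) (rule that)
	show "integrable lborel (\<lambda>x. indicat_real S x *\<^sub>R (\<phi> x *\<^sub>R f x))"
		by (rule test_function_integrable[OF f smooth3_continuous[OF K(1)] K(2,3,4)])
	show "integrable lborel (\<lambda>x. indicat_real S x *\<^sub>R (pd i \<phi> x *\<^sub>R f x))"
		by (rule test_function_integrable[OF f smooth3_continuous[OF smooth3_pd[OF K(1)]] K(2,3,5)])
qed

lemma L2_loc_linear: assumes f: "L2_loc S f" and L: "bounded_linear L" shows "L2_loc S (\<lambda>x. L (f x))" unfolding L2_loc_def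
proof (intro conjI allI impI)
	interpret L: bounded_linear L by fact
	obtain B where B: "\<And>x. norm (L x) \<le> norm x * B" using L.bounded by blast
	have "(\<lambda>x. L (indicat_real S x *\<^sub>R f x))\<in>borel_measurable lborel"
		using f linear_continuous_on[OF L, of UNIV] unfolding L2_loc_def set_borel_measurable_def
		by (intro borel_measurable_continuous_on[where f = L]) auto
	thus "set_borel_measurable lborel S (\<lambda>x. L (f x))" by (simp add: set_borel_measurable_def L.scaleR)
	fix K assume K: "compact K \<and> K\<subseteq>S"
	have b: "(norm (L x))\<^sup>2 \<le> B\<^sup>2 * (norm x)\<^sup>2" for x
		using power_mono[OF B[of x], of 2] by (simp add: power_mult_distrib mult.commute)
	have "(\<lambda>x. L (indicat_real K x *\<^sub>R f x))\<in>borel_measurable borel"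
		using L2_loc_indicat_borel[OF f] K linear_continuous_on[OF L, of UNIV] by (intro borel_measurable_continuous_on[where f = L]) auto
	hence m: "(\<lambda>x. (norm (L (indicat_real K x *\<^sub>R f x)))\<^sup>2)\<in>borel_measurable borel" by measurable
	have eq: "(\<lambda>x. (norm (L (indicat_real K x *\<^sub>R f x)))\<^sup>2) = (\<lambda>x. indicat_real K x *\<^sub>R (norm (L (f x)))\<^sup>2)"
		by (auto simp: indicator_def L.scaleR L.zero)
	have "integrable lborel (\<lambda>x. B\<^sup>2 * (indicat_real K x * (norm (f x))\<^sup>2))" using L2_loc_square_integrable[OF f] K by simp
	thus "set_integrable lborel K (\<lambda>x. (norm (L (f x)))\<^sup>2)" unfolding set_integrable_def
	proof (rule Bochner_Integration.integrable_bound)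
		show "(\<lambda>x. indicat_real K x *\<^sub>R (norm (L (f x)))\<^sup>2)\<in>borel_measurable lborel" using m unfolding eq by simp
	qed (use b in \<open>auto simp: indicator_def\<close>)
qed

lemma L2_loc_add:
	fixes f g :: "real^3 => 'b::euclidean_space" assumes f: "L2_loc S f" and g: "L2_loc S g"
	shows "L2_loc S (\<lambda>x. f x + g x)" unfolding L2_loc_def proof (intro conjI allI impI)
	have "(\<lambda>x. indicat_real S x *\<^sub>R f x + indicat_real S x *\<^sub>R g x)\<in>borel_measurable lborel"
		using f g unfolding L2_loc_def set_borel_measurable_def by (intro borel_measurable_add) auto
	thus "set_borel_measurable lborel S (\<lambda>x. f x + g x)" by (simp add: set_borel_measurable_def scaleR_add_right)
	fix K assume K: "compact K \<and> K\<subseteq>S"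
	have b: "(norm (x + y))\<^sup>2 \<le> 2 * (norm x)\<^sup>2 + 2 * (norm y)\<^sup>2" for x y :: 'b
		using power_mono[OF norm_triangle_ineq[of x y], of 2] sum_squares_bound[of "norm x" "norm y"] by (simp add: power2_sum)
	have "(\<lambda>x. indicat_real K x *\<^sub>R f x + indicat_real K x *\<^sub>R g x)\<in>borel_measurable borel"
		using L2_loc_indicat_borel[OF f] L2_loc_indicat_borel[OF g] K by (intro borel_measurable_add) auto
	hence m: "(\<lambda>x. (norm (indicat_real K x *\<^sub>R f x + indicat_real K x *\<^sub>R g x))\<^sup>2)\<in>borel_measurable borel" by measurable
	have eq: "(\<lambda>x. (norm (indicat_real K x *\<^sub>R f x + indicat_real K x *\<^sub>R g x))\<^sup>2) = (\<lambda>x. indicat_real K x *\<^sub>R (norm (f x + g x))\<^sup>2)"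
		by (auto simp: indicator_def)
	have "integrable lborel (\<lambda>x. 2 * (indicat_real K x * (norm (f x))\<^sup>2) + 2 * (indicat_real K x * (norm (g x))\<^sup>2))"
		using L2_loc_square_integrable[OF f] L2_loc_square_integrable[OF g] K by simp
	thus "set_integrable lborel K (\<lambda>x. (norm (f x + g x))\<^sup>2)" unfolding set_integrable_def
	proof (rule Bochner_Integration.integrable_bound)
		show "(\<lambda>x. indicat_real K x *\<^sub>R (norm (f x + g x))\<^sup>2)\<in>borel_measurable lborel" using m unfolding eq by simp
	qed (use b in \<open>auto simp: indicator_def\<close>)
qed

lemma L2_loc_scaleR: "L2_loc S f ==> L2_loc S (\<lambda>x. r *\<^sub>R f x)" by (rule L2_loc_linear[OF _ bounded_linear_scaleR_right])

lemma L2_loc_diff: "L2_loc S f ==> L2_loc S g ==> L2_loc S (\<lambda>x. f x - g x)"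
	using L2_loc_add[of S f "\<lambda>x. (-1) *\<^sub>R g x"] L2_loc_scaleR[of S g "-1"] by simp

lemma weak_pd_linear: assumes w: "weak_pd S i f g" and f: "L2_loc S f" and g: "L2_loc S g" and L: "bounded_linear L"
	shows "weak_pd S i (\<lambda>x. L (f x)) (\<lambda>x. L (g x))" unfolding weak_pd_iff proof (intro allI impI)
	interpret L: bounded_linear L by fact
	fix \<phi> assume t: "test_function S \<phi>"
	have "(LINT x:S|lborel. pd i \<phi> x *\<^sub>R L (f x)) = L (LINT x:S|lborel. pd i \<phi> x *\<^sub>R f x)"
		unfolding set_lebesgue_integral_def using integral_bounded_linear[OF L test_function_integrable'(2)[OF f t, of i]] by (simp add: L.scaleR)
	moreover have "(LINT x:S|lborel. \<phi> x *\<^sub>R L (g x)) = L (LINT x:S|lborel. \<phi> x *\<^sub>R g x)"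
		unfolding set_lebesgue_integral_def using integral_bounded_linear[OF L test_function_integrable'(1)[OF g t]] by (simp add: L.scaleR)
	moreover have "(LINT x:S|lborel. pd i \<phi> x *\<^sub>R f x) = - (LINT x:S|lborel. \<phi> x *\<^sub>R g x)"
		using w t unfolding weak_pd_iff by blast
	ultimately show "(LINT x:S|lborel. pd i \<phi> x *\<^sub>R L (f x)) = - (LINT x:S|lborel. \<phi> x *\<^sub>R L (g x))" by (simp add: L.neg)
qed

lemma weak_pd_add: assumes w: "weak_pd S i f g" "weak_pd S i f' g'" and L: "L2_loc S f" "L2_loc S g" "L2_loc S f'" "L2_loc S g'"
	shows "weak_pd S i (\<lambda>x. f x + f' x) (\<lambda>x. g x + g' x)" unfolding weak_pd_iff proof (intro allI impI)
	fix \<phi> assume t: "test_function S \<phi>"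
	have "(LINT x:S|lborel. pd i \<phi> x *\<^sub>R (f x + f' x)) = (LINT x:S|lborel. pd i \<phi> x *\<^sub>R f x) + (LINT x:S|lborel. pd i \<phi> x *\<^sub>R f' x)"
		unfolding set_lebesgue_integral_def using test_function_integrable'(2)[OF L(1) t, of i] test_function_integrable'(2)[OF L(3) t, of i]
		by (simp add: scaleR_add_right)
	moreover have "(LINT x:S|lborel. \<phi> x *\<^sub>R (g x + g' x)) = (LINT x:S|lborel. \<phi> x *\<^sub>R g x) + (LINT x:S|lborel. \<phi> x *\<^sub>R g' x)"
		unfolding set_lebesgue_integral_def using test_function_integrable'(1)[OF L(2) t] test_function_integrable'(1)[OF L(4) t]
		by (simp add: scaleR_add_right)
	ultimately show "(LINT x:S|lborel. pd i \<phi> x *\<^sub>R (f x + f' x)) = - (LINT x:S|lborel. \<phi> x *\<^sub>R (g x + g' x))"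
		using w t unfolding weak_pd_iff by simp
qed

text \<open>Paired with a fixed vector, the difference of two weak derivatives integrates to zero
  against every test function, which is the situation of \<open>weak_zero_real\<close>.\<close>

lemma weak_pd_unique: assumes S: "open S" and w: "weak_pd S i f g" "weak_pd S i f g'" and L: "L2_loc S g" "L2_loc S g'"
	shows "AE x in lborel. x\<in>S \<longrightarrow> g x = g' x" proof -
	have "AE x in lborel. x\<in>S \<longrightarrow> (g x - g' x)\<bullet>b = 0" for b proof (rule weak_zero_real[OF S])
		note lin = bounded_linear_inner_left[of b]
		show L': "L2_loc S (\<lambda>x. (g x - g' x)\<bullet>b)" by (rule L2_loc_linear[OF L2_loc_diff[OF L] lin])
		fix \<phi> assume t: "test_function S \<phi>"
		have "(LINT x:S|lborel. \<phi> x *\<^sub>R (g x - g' x)) = (LINT x:S|lborel. \<phi> x *\<^sub>R g x) - (LINT x:S|lborel. \<phi> x *\<^sub>R g' x)"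
			unfolding set_lebesgue_integral_def using test_function_integrable'(1)[OF L(1) t] test_function_integrable'(1)[OF L(2) t]
			by (simp add: scaleR_diff_right)
		also have "\<dots> = 0" using w t unfolding weak_pd_iff by (metis diff_self neg_equal_iff_equal)
		finally have "(LINT x|lborel. indicat_real S x *\<^sub>R (\<phi> x *\<^sub>R (g x - g' x)))\<bullet>b = 0"
			by (simp add: set_lebesgue_integral_def)
		thus "(LINT x:S|lborel. \<phi> x *\<^sub>R ((g x - g' x)\<bullet>b)) = 0" unfolding set_lebesgue_integral_def
			using integral_bounded_linear[OF lin test_function_integrable'(1)[OF L2_loc_diff[OF L] t]] by (simp add: mult.assoc)
	qed
	hence "AE x in lborel. \<forall>b\<in>Basis. x\<in>S \<longrightarrow> (g x - g' x)\<bullet>b = 0" by (intro AE_finite_allI finite_Basis)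
	thus ?thesis proof eventually_elim
		case (elim x)
		show ?case proof
			assume "x\<in>S"
			hence "(g x - g' x)\<bullet>b = 0" if "b\<in>Basis" for b using elim that by blast
			hence "g x - g' x = 0" using euclidean_all_zero_iff by blast
			thus "g x = g' x" by (rule eq_iff_diff_eq_0[THEN iffD2])
		qed
	qed
qed

lemma set_integral_cong_AE:
	fixes f g :: "real^3 => 'b::{banach, second_countable_topology}" assumes "AE x in lborel. x\<in>S \<longrightarrow> f x = g x"
		and "(\<lambda>x. indicat_real S x *\<^sub>R f x)\<in>borel_measurable lborel" "(\<lambda>x. indicat_real S x *\<^sub>R g x)\<in>borel_measurable lborel"
	shows "(LINT x:S|lborel. f x) = (LINT x:S|lborel. g x)" unfolding set_lebesgue_integral_def
	by (rule integral_cong_AE[OF assms(2,3)]) (use assms(1) in \<open>auto elim!: eventually_mono simp: indicator_def\<close>)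

lemma weak_pd_cong_AE: assumes ae: "AE x in lborel. x\<in>S \<longrightarrow> f x = f' x" and L: "L2_loc S f" "L2_loc S f'"
	shows "weak_pd S i f g \<longleftrightarrow> weak_pd S i f' g" proof -
	have "(LINT x:S|lborel. pd i \<phi> x *\<^sub>R f x) = (LINT x:S|lborel. pd i \<phi> x *\<^sub>R f' x)" if t: "test_function S \<phi>" for \<phi>
	proof (rule set_integral_cong_AE)
		show "AE x in lborel. x\<in>S \<longrightarrow> pd i \<phi> x *\<^sub>R f x = pd i \<phi> x *\<^sub>R f' x" using ae by eventually_elim simp
	qed (use test_function_integrable'(2)[OF L(1) t, of i] test_function_integrable'(2)[OF L(2) t, of i] in auto)
	thus ?thesis unfolding weak_pd_iff by auto
qed

lemma sobolev_loc_L2: "sobolev_loc k S f ==> L2_loc S f" by (cases k) auto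

text \<open>The values of \<open>f\<close> enter the zeroth integral; at higher order
  \<open>f\<close> occurs otherwise only in the predicate under \<open>SOME\<close>, and this
  predicate is unchanged by null sets.\<close>

lemma sobolev_sq_cong_AE:
	assumes ae: "AE x in lborel. x\<in>S \<longrightarrow> f x = f' x" and L: "L2_loc S f" "L2_loc S f'" and K: "compact K" "K\<subseteq>S"
	shows "sobolev_sq k S K f = sobolev_sq k S K f'" proof -
	have "(LINT x:K|lborel. (norm (f x))\<^sup>2) = (LINT x:K|lborel. (norm (f' x))\<^sup>2)" proof (rule set_integral_cong_AE)
		show "AE x in lborel. x\<in>K \<longrightarrow> (norm (f x))\<^sup>2 = (norm (f' x))\<^sup>2" using ae by eventually_elim (use K in auto)
	qed (use L2_loc_square_integrable[OF L(1) K] L2_loc_square_integrable[OF L(2) K] in auto)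
	thus ?thesis by (cases k) (simp_all add: weak_pd_cong_AE[OF ae L])
qed

text \<open>Replaces the choice in the definition by any given family of weak derivatives, since two
  of them agree almost everywhere.\<close>

lemma sobolev_sq_Suc: assumes S: "open S" and K: "compact K" "K\<subseteq>S"
		and g: "\<And>i. weak_pd S i f (g i)" "\<And>i. sobolev_loc k S (g i)"
	shows "sobolev_sq (Suc k) S K f = (LINT x:K|lborel. (norm (f x))\<^sup>2) + (\<Sum>i\<in>UNIV. sobolev_sq k S K (g i))" proof -
	let ?u = "\<lambda>i. SOME g. weak_pd S i f g \<and> sobolev_loc k S g"
	have "sobolev_sq k S K (?u i) = sobolev_sq k S K (g i)" for i proof -
		have s: "weak_pd S i f (?u i) \<and> sobolev_loc k S (?u i)" by (rule someI[of _ "g i"]) (use g in blast)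
		thus ?thesis using sobolev_loc_L2 g by (intro sobolev_sq_cong_AE K weak_pd_unique[OF S, of i f]) blast+
	qed
	thus ?thesis by simp
qed

lemma sobolev_locE: assumes "sobolev_loc (Suc k) S f"
	obtains g where "L2_loc S f" "\<And>i. weak_pd S i f (g i)" "\<And>i. sobolev_loc k S (g i)" proof -
	have "\<forall>i. \<exists>g. weak_pd S i f g \<and> sobolev_loc k S g" using assms by simp
	then obtain g where "\<And>i. weak_pd S i f (g i) \<and> sobolev_loc k S (g i)" by metis
	thus ?thesis using that[of g] assms by auto
qed

lemma sobolev_sq_0_nonneg: "0 \<le> (LINT x:K|lborel. (norm (f x))\<^sup>2)" by (simp add: set_lebesgue_integral_def)

lemma sobolev_sq_nonneg: "0 \<le> sobolev_sq k S K f"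
	by (induction k arbitrary: f) (auto intro!: add_nonneg_nonneg sum_nonneg simp: sobolev_sq_0_nonneg)

lemma sobolev_loc_linear: assumes L: "bounded_linear L" and f: "sobolev_loc k S f" shows "sobolev_loc k S (\<lambda>x. L (f x))"
	using f proof (induction k arbitrary: f)
	case 0
	thus ?case using L2_loc_linear[OF _ L] by simp
next
	case (Suc k)
	obtain g where g: "L2_loc S f" "\<And>i. weak_pd S i f (g i)" "\<And>i. sobolev_loc k S (g i)" using sobolev_locE[OF Suc(2)] by blast
	have "weak_pd S i (\<lambda>x. L (f x)) (\<lambda>x. L (g i x)) \<and> sobolev_loc k S (\<lambda>x. L (g i x))" for i
		using weak_pd_linear[OF g(2,1) sobolev_loc_L2[OF g(3)] L] Suc(1)[OF g(3)] by blast
	thus ?case using L2_loc_linear[OF g(1) L] by auto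
qed

lemma sobolev_sq_linear:
	assumes L: "bounded_linear L" and B: "\<And>x. norm (L x) \<le> B * norm x" and S: "open S" and K: "compact K" "K\<subseteq>S"
		and f: "sobolev_loc k S f" shows "sobolev_sq k S K (\<lambda>x. L (f x)) \<le> B\<^sup>2 * sobolev_sq k S K f" proof -
	let ?u = "\<lambda>f. LINT x:K|lborel. (norm (L (f x)))\<^sup>2"
	let ?v = "\<lambda>x f. indicat_real K x * (norm (f x))\<^sup>2"
	have i: "(?u f) \<le> B\<^sup>2 * (LINT x:K|lborel. (norm (f x))\<^sup>2)" if f: "L2_loc S f" for f proof -
		have "(?u f) \<le> (LINT x|lborel. B\<^sup>2 * (?v x f))" unfolding set_lebesgue_integral_def proof (rule integral_mono)
			show "integrable lborel (\<lambda>x. indicat_real K x *\<^sub>R (norm (L (f x)))\<^sup>2)"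
				using L2_loc_square_integrable[OF L2_loc_linear[OF f L] K] by simp
			show "integrable lborel (\<lambda>x. B\<^sup>2 * (?v x f))" using L2_loc_square_integrable[OF f K] by simp
			show "indicat_real K x *\<^sub>R (norm (L (f x)))\<^sup>2 \<le> B\<^sup>2 * (?v x f)" for x
				using power_mono[OF B[of "f x"], of 2] by (auto simp: power_mult_distrib indicator_def)
		qed
		thus ?thesis by (simp add: set_lebesgue_integral_def)
	qed
	show ?thesis using f proof (induction k arbitrary: f)
		case 0
		thus ?case using i[of f] by simp
	next
		case (Suc k)
		obtain g where g: "L2_loc S f" "\<And>i. weak_pd S i f (g i)" "\<And>i. sobolev_loc k S (g i)" using sobolev_locE[OF Suc(2)] by blast
		have g': "weak_pd S i (\<lambda>x. L (f x)) (\<lambda>x. L (g i x))" "sobolev_loc k S (\<lambda>x. L (g i x))" for i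
			using weak_pd_linear[OF g(2,1) sobolev_loc_L2[OF g(3)] L] sobolev_loc_linear[OF L g(3)] by blast+
		have "sobolev_sq (Suc k) S K (\<lambda>x. L (f x)) = (?u f) + (\<Sum>i\<in>UNIV. sobolev_sq k S K (\<lambda>x. L (g i x)))"
			by (rule sobolev_sq_Suc[OF S K g'])
		also have "\<dots> \<le> B\<^sup>2 * (LINT x:K|lborel. (norm (f x))\<^sup>2) + (\<Sum>i\<in>UNIV. B\<^sup>2 * sobolev_sq k S K (g i))"
			by (intro add_mono sum_mono i g Suc(1))
		also have "\<dots> = B\<^sup>2 * sobolev_sq (Suc k) S K f"
			unfolding sobolev_sq_Suc[OF S K g(2,3)] by (simp add: sum_distrib_left distrib_left)
		finally show ?case .
	qed
qed

lemma sobolev_loc_add: assumes "sobolev_loc k S f" "sobolev_loc k S g" shows "sobolev_loc k S (\<lambda>x. f x + g x)" using assms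
proof (induction k arbitrary: f g)
	case 0
	thus ?case by (simp add: L2_loc_add)
next
	case (Suc k)
	obtain f' where f: "L2_loc S f" "\<And>i. weak_pd S i f (f' i)" "\<And>i. sobolev_loc k S (f' i)" using sobolev_locE[OF Suc(2)] by blast
	obtain g' where g: "L2_loc S g" "\<And>i. weak_pd S i g (g' i)" "\<And>i. sobolev_loc k S (g' i)" using sobolev_locE[OF Suc(3)] by blast
	have "weak_pd S i (\<lambda>x. f x + g x) (\<lambda>x. f' i x + g' i x) \<and> sobolev_loc k S (\<lambda>x. f' i x + g' i x)" for i
		using weak_pd_add[OF f(2) g(2) f(1) sobolev_loc_L2[OF f(3)] g(1) sobolev_loc_L2[OF g(3)]] Suc(1)[OF f(3) g(3)] by blast
	thus ?case using L2_loc_add[OF f(1) g(1)] by auto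
qed

text \<open>The weights come from Young's inequality. Keeping \<open>d\<close> free allows the
  triangle inequality for the square root to be recovered later, while \<open>d = 1\<close> gives
  the usual factor 2.\<close>

lemma sobolev_sq_add:
	fixes f g :: "real^3 => 'b::euclidean_space" assumes S: "open S" and K: "compact K" "K\<subseteq>S" and d: "0 < d"
		and f: "sobolev_loc k S f" and g: "sobolev_loc k S g"
	shows "sobolev_sq k S K (\<lambda>x. f x + g x) \<le> (1 + d) * sobolev_sq k S K f + (1 + 1/d) * sobolev_sq k S K g" proof -
	let ?u = "\<lambda>f g. LINT x:K|lborel. (norm (f x + g x))\<^sup>2"
	let ?v = "\<lambda>f. LINT x:K|lborel. (norm (f x))\<^sup>2"
	let ?w = "\<lambda>g. LINT x:K|lborel. (norm (g x))\<^sup>2"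
	let ?a = "\<lambda>x f. indicat_real K x * (norm (f x))\<^sup>2"
	let ?b = "\<lambda>x g. indicat_real K x * (norm (g x))\<^sup>2"
	have b: "(norm (x + y))\<^sup>2 \<le> (1 + d) * (norm x)\<^sup>2 + (1 + 1/d) * (norm y)\<^sup>2" for x y :: 'b proof -
		have "0 \<le> (d * norm x - norm y)\<^sup>2/d" using d by simp
		also have "\<dots> = d * (norm x)\<^sup>2 + (norm y)\<^sup>2/d - 2 * norm x * norm y"
			using d by (simp add: power2_diff field_simps power2_eq_square)
		finally have "2 * norm x * norm y \<le> d * (norm x)\<^sup>2 + (norm y)\<^sup>2/d" by simp
		moreover have "(norm (x + y))\<^sup>2 \<le> (norm x + norm y)\<^sup>2" by (intro power_mono norm_triangle_ineq) simp
		ultimately show ?thesis by (simp add: power2_sum algebra_simps)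
	qed
	have i: "(?u f g) \<le> (1 + d) * (?v f) + (1 + 1/d) * (?w g)"
		if f: "L2_loc S f" and g: "L2_loc S g" for f g :: "real^3 => 'b" proof -
		note si = L2_loc_square_integrable[OF f K] L2_loc_square_integrable[OF g K]
		have "(?u f g) \<le>
				(LINT x|lborel. (1 + d) * (?a x f) + (1 + 1/d) * (?b x g))" unfolding set_lebesgue_integral_def proof (rule integral_mono)
			show "integrable lborel (\<lambda>x. indicat_real K x *\<^sub>R (norm (f x + g x))\<^sup>2)"
				using L2_loc_square_integrable[OF L2_loc_add[OF f g] K] by simp
			show "integrable lborel (\<lambda>x. (1 + d) * (?a x f) + (1 + 1/d) * (?b x g))" using si by simp
			show "indicat_real K x *\<^sub>R (norm (f x + g x))\<^sup>2 \<le> (1 + d) * (?a x f) + (1 + 1/d) * (?b x g)" for x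
				using b[of "f x" "g x"] by (auto simp: indicator_def)
		qed
		also have "\<dots> = (1 + d) * (?v f) + (1 + 1/d) * (?w g)" using si by (simp add: set_lebesgue_integral_def)
		finally show ?thesis .
	qed
	show ?thesis using f g proof (induction k arbitrary: f g)
		case 0
		thus ?case using i[of f g] by simp
	next
		case (Suc k)
		obtain f' where f: "L2_loc S f" "\<And>i. weak_pd S i f (f' i)" "\<And>i. sobolev_loc k S (f' i)" using sobolev_locE[OF Suc(2)] by blast
		obtain g' where g: "L2_loc S g" "\<And>i. weak_pd S i g (g' i)" "\<And>i. sobolev_loc k S (g' i)" using sobolev_locE[OF Suc(3)] by blast
		have fg: "weak_pd S i (\<lambda>x. f x + g x) (\<lambda>x. f' i x + g' i x)" "sobolev_loc k S (\<lambda>x. f' i x + g' i x)" for i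
			using weak_pd_add[OF f(2) g(2) f(1) sobolev_loc_L2[OF f(3)] g(1) sobolev_loc_L2[OF g(3)]] sobolev_loc_add[OF f(3) g(3)] by blast+
		have "sobolev_sq (Suc k) S K (\<lambda>x. f x + g x) = (?u f g) + (\<Sum>i\<in>UNIV. sobolev_sq k S K (\<lambda>x. f' i x + g' i x))"
			by (rule sobolev_sq_Suc[OF S K fg])
		also have "\<dots> \<le> ((1 + d) * (?v f) + (1 + 1/d) * (?w g)) +
				(\<Sum>i\<in>UNIV. (1 + d) * sobolev_sq k S K (f' i) + (1 + 1/d) * sobolev_sq k S K (g' i))" by (intro add_mono sum_mono i f g Suc(1))
		also have "\<dots> = (1 + d) * sobolev_sq (Suc k) S K f + (1 + 1/d) * sobolev_sq (Suc k) S K g"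
			unfolding sobolev_sq_Suc[OF S K f(2,3)] sobolev_sq_Suc[OF S K g(2,3)] by (simp add: sum_distrib_left sum.distrib distrib_left)
		finally show ?case .
	qed
qed

text \<open>The inequality of \<open>sobolev_sq_linear\<close> for the factor \<open>r\<close> and
  for its inverse.\<close>

lemma sobolev_sq_scaleR: assumes S: "open S" and K: "compact K" "K\<subseteq>S" and f: "sobolev_loc k S f"
	shows "sobolev_sq k S K (\<lambda>x. r *\<^sub>R f x) = r\<^sup>2 * sobolev_sq k S K f" proof -
	have le: "sobolev_sq k S K (\<lambda>x. r *\<^sub>R f x) \<le> r\<^sup>2 * sobolev_sq k S K f" if "sobolev_loc k S f" for r f
		using sobolev_sq_linear[OF bounded_linear_scaleR_right[of r] _ S K that, of "\<bar>r\<bar>"] by simp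
	show ?thesis proof (cases "r = 0")
		case True
		thus ?thesis using le[OF f, of 0] sobolev_sq_nonneg[of k S K "\<lambda>x. 0"] by (auto intro: antisym)
	next
		case False
		have "sobolev_loc k S (\<lambda>x. r *\<^sub>R f x)" by (rule sobolev_loc_linear[OF bounded_linear_scaleR_right f])
		from le[OF this, of "1/r"] have "r\<^sup>2 * sobolev_sq k S K f \<le> sobolev_sq k S K (\<lambda>x. r *\<^sub>R f x)"
			using False by (simp add: field_simps power_divide)
		thus ?thesis using le[OF f, of r] by simp
	qed
qed

lemma sobolev_loc_lower: "sobolev_loc (Suc k) S f ==> sobolev_loc k S f" proof (induction k arbitrary: f)
	case 0
	thus ?case using sobolev_loc_L2[OF 0] by simp
next
	case (Suc k)
	obtain g where g: "L2_loc S f" "\<And>i. weak_pd S i f (g i)" "\<And>i. sobolev_loc (Suc k) S (g i)" using sobolev_locE[OF Suc(2)] by blast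
	hence "weak_pd S i f (g i) \<and> sobolev_loc k S (g i)" for i using Suc(1) by blast
	thus ?case using g(1) by auto
qed

lemma sobolev_loc_mono: "j \<le> k ==> sobolev_loc k S f ==> sobolev_loc j S f" proof (induction k rule: dec_induct)
	case (step n)
	thus ?case using sobolev_loc_lower by blast
qed

lemma sobolev_sq_lower: assumes S: "open S" and K: "compact K" "K\<subseteq>S"
	shows "sobolev_loc (Suc k) S f ==> sobolev_sq k S K f \<le> sobolev_sq (Suc k) S K f" proof (induction k arbitrary: f)
	case 0
	thus ?case by (auto intro!: sum_nonneg simp: sobolev_sq_0_nonneg)
next
	case (Suc k)
	obtain g where g: "L2_loc S f" "\<And>i. weak_pd S i f (g i)" "\<And>i. sobolev_loc (Suc k) S (g i)" using sobolev_locE[OF Suc(2)] by blast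
	show ?case unfolding sobolev_sq_Suc[OF S K g(2,3)] sobolev_sq_Suc[OF S K g(2) sobolev_loc_lower[OF g(3)]]
		by (intro add_mono sum_mono Suc(1) g order_refl)
qed

lemma sobolev_sq_mono_order: assumes S: "open S" and K: "compact K" "K\<subseteq>S" and "j \<le> k" "sobolev_loc k S f"
	shows "sobolev_sq j S K f \<le> sobolev_sq k S K f" using assms(4,5) proof (induction k rule: dec_induct)
	case (step n)
	thus ?case using sobolev_sq_lower[OF S K step(4)] sobolev_loc_lower[OF step(4)] by linarith
qed simp

lemma sobolev_sq_mono_set:
	fixes f :: "real^3 => 'b::euclidean_space"
	assumes S: "open S" and K: "compact K" "K\<subseteq>K'" "compact K'" "K'\<subseteq>S" and f: "sobolev_loc k S f"
	shows "sobolev_sq k S K f \<le> sobolev_sq k S K' f" proof -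
	have KS: "K\<subseteq>S" using K by blast
	have i: "(LINT x:K|lborel. (norm (f x))\<^sup>2) \<le> (LINT x:K'|lborel. (norm (f x))\<^sup>2)" if f: "L2_loc S f" for f :: "real^3 => 'b"
		unfolding set_lebesgue_integral_def proof (rule integral_mono)
		show "indicat_real K x *\<^sub>R (norm (f x))\<^sup>2 \<le> indicat_real K' x *\<^sub>R (norm (f x))\<^sup>2" for x
			using K(2) by (auto simp: indicator_def)
	qed (use L2_loc_square_integrable[OF f K(1) KS] L2_loc_square_integrable[OF f K(3,4)] in auto)
	show ?thesis using f proof (induction k arbitrary: f)
		case 0
		thus ?case using i[of f] by simp
	next
		case (Suc k)
		obtain g where g: "L2_loc S f" "\<And>i. weak_pd S i f (g i)" "\<And>i. sobolev_loc k S (g i)" using sobolev_locE[OF Suc(2)] by blast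
		show ?case unfolding sobolev_sq_Suc[OF S K(1) KS g(2,3)] sobolev_sq_Suc[OF S K(3,4) g(2,3)] by (intro add_mono sum_mono i Suc(1) g)
	qed
qed

section \<open>Multiplication in local Sobolev spaces of order at least two\<close>

lemma sobolev_sq_0_real: "sobolev_sq 0 S K f = nsq (cut K (\<lambda>x. f x :: real))" proof -
	have "(\<lambda>x. indicat_real K x *\<^sub>R (norm (f x))\<^sup>2) = (\<lambda>x. (indicat_real K x * f x)\<^sup>2)"
		by (auto simp: indicator_def)
	thus ?thesis by (simp add: set_lebesgue_integral_def nsq_def)
qed

lemma L2_locI_real: assumes "(cut S f)\<in>borel_measurable borel"
		and "\<And>K. compact K ==> K\<subseteq>S ==> L2 (cut K f)" shows "L2_loc S f" proof -
	have "(\<lambda>x. indicat_real K x *\<^sub>R (norm (f x))\<^sup>2) = (\<lambda>x. (indicat_real K x * f x)\<^sup>2)" for K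
		by (auto simp: indicator_def)
	thus ?thesis using assms by (simp add: L2_loc_def set_borel_measurable_def set_integrable_def L2_def)
qed

lemma indicat_mult_borel: assumes "(cut S f)\<in>borel_measurable borel" "(cut S g)\<in>borel_measurable borel"
	shows "(cut S (\<lambda>x. f x * g x))\<in>borel_measurable borel" proof -
	have "(\<lambda>x. (indicat_real S x * f x) * (indicat_real S x * g x))\<in>borel_measurable borel"
		using assms by (rule borel_measurable_times)
	moreover have "(\<lambda>x. (indicat_real S x * f x) * (indicat_real S x * g x)) = (cut S (\<lambda>x. f x * g x))"
		by (auto simp: indicator_def)
	ultimately show ?thesis by simp
qed

lemma L2_loc_borel_real: "L2_loc S f ==> (cut S f)\<in>borel_measurable borel" by (simp add: L2_loc_def set_borel_measurable_def)

lemma L2_mult_Linf: assumes f: "L2_loc S f" and g: "L2_loc S g" and K: "compact K" "K\<subseteq>S"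
		and b: "AE x in lborel. x\<in>K \<longrightarrow> \<bar>f x\<bar> \<le> m" shows "L2 (cut K (\<lambda>x. f x * g x))"
		"nsq (cut K (\<lambda>x. f x * g x)) \<le> m\<^sup>2 * nsq (cut K g)" proof -
	let ?u = "cut K (\<lambda>x. f x * g x)"
	have fL: "L2 (cut K f)" and gL: "L2 (cut K g)" using L2_loc_restrict[OF f K] L2_loc_restrict[OF g K] by auto
	have m: "?u\<in>borel_measurable borel" by (rule indicat_mult_borel[OF L2_borel[OF fL] L2_borel[OF gL]])
	have i: "integrable lborel (\<lambda>x. m\<^sup>2 * (indicat_real K x * g x)\<^sup>2)" using gL by (simp add: L2_def)
	have ae: "AE x in lborel. (indicat_real K x * (f x * g x))\<^sup>2 \<le> m\<^sup>2 * (indicat_real K x * g x)\<^sup>2" using b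
	proof eventually_elim
		case (elim x)
		show ?case proof (cases "x\<in>K")
			case True
			hence "\<bar>f x\<bar>\<^sup>2 \<le> m\<^sup>2" using elim by (intro power_mono) auto
			thus ?thesis using True by (simp add: power_mult_distrib mult_right_mono)
		qed simp
	qed
	have i': "integrable lborel (\<lambda>x. (indicat_real K x * (f x * g x))\<^sup>2)"
		by (rule Bochner_Integration.integrable_bound[OF i]) (use m ae in auto)
	thus "L2 ?u" using m by (simp add: L2_def)
	show "nsq ?u \<le> m\<^sup>2 * nsq (cut K g)" using integral_mono_AE[OF i' i ae] by (simp add: nsq_def)
qed

text \<open>Cauchy-Schwarz for the squares of \<open>f\<close> and \<open>g\<close>; the hypotheses
  are written with \<open>a\<^sup>2\<close> and \<open>b\<^sup>2\<close> so that the square roots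
  come out.\<close>

lemma L2_mult_L4: assumes f: "L2_loc S f" and g: "L2_loc S g" and K: "compact K" "K\<subseteq>S"
		and f4: "integrable lborel (cut K (\<lambda>x. (f x)^4))" "(LINT x|lborel. indicat_real K x * (f x)^4) \<le> C * a\<^sup>2"
		and g4: "integrable lborel (cut K (\<lambda>x. (g x)^4))" "(LINT x|lborel. indicat_real K x * (g x)^4) \<le> C * b\<^sup>2"
		and nn: "0 \<le> C" "0 \<le> a" "0 \<le> b" shows "L2 (cut K (\<lambda>x. f x * g x))"
		"nsq (cut K (\<lambda>x. f x * g x)) \<le> C * (a * b)" proof -
	let ?u = "\<lambda>x. (indicat_real K x * f x)\<^sup>2"
	let ?v = "\<lambda>x. (indicat_real K x * g x)\<^sup>2"
	let ?w = "cut K (\<lambda>x. f x * g x)"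
	have fL: "L2 (cut K f)" and gL: "L2 (cut K g)" using L2_loc_restrict[OF f K] L2_loc_restrict[OF g K] by auto
	have m: "?w\<in>borel_measurable borel" by (rule indicat_mult_borel[OF L2_borel[OF fL] L2_borel[OF gL]])
	have e: "(\<lambda>x. ((indicat_real K x * f x)\<^sup>2)\<^sup>2) = (cut K (\<lambda>x. (f x)^4))"
		"(\<lambda>x. ((indicat_real K x * g x)\<^sup>2)\<^sup>2) = (cut K (\<lambda>x. (g x)^4))" by (auto simp: indicator_def)
	have sL: "L2 ?u" "L2 ?v" unfolding L2_def e using L2_borel[OF fL] L2_borel[OF gL] f4(1) g4(1) by auto
	have p: "(\<lambda>x. (indicat_real K x * f x)\<^sup>2 * (indicat_real K x * g x)\<^sup>2) = (\<lambda>x. (indicat_real K x * (f x * g x))\<^sup>2)"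
		by (auto simp: indicator_def power_mult_distrib)
	have i: "integrable lborel (\<lambda>x. (indicat_real K x * (f x * g x))\<^sup>2)" using L2_product(1)[OF sL] unfolding p .
	thus "L2 ?w" using m by (simp add: L2_def)
	have nf: "nsq ?u \<le> C * a\<^sup>2" unfolding nsq_def e by (rule f4(2))
	have ng: "nsq ?v \<le> C * b\<^sup>2" unfolding nsq_def e by (rule g4(2))
	have "nsq ?w \<le>
			sqrt (nsq ?u) * sqrt (nsq ?v)" using L2_product(3)[OF sL] unfolding p by (simp add: nsq_def)
	also have "\<dots> \<le> sqrt (C * a\<^sup>2) * sqrt (C * b\<^sup>2)" by (intro mult_mono real_sqrt_le_mono nf ng) (auto simp: nn)
	also have "\<dots> = C * (a * b)" using nn by (simp add: real_sqrt_mult)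
	finally show "nsq ?w \<le> C * (a * b)" .
qed

lemma sobolev_locI: assumes "L2_loc S f" "\<And>i. weak_pd S i f (g i)" "\<And>i. sobolev_loc k S (g i)"
	shows "sobolev_loc (Suc k) S f" using assms by auto

lemma jet2D: assumes "jet2 S f g h" shows "L2_loc S f" "L2_loc S (g i)" "L2_loc S (h i j)" "weak_pd S i f (g i)" "weak_pd S j (g i) (h i j)"
		"sobolev_loc (Suc 0) S (g i)" "sobolev_loc 2 S f" proof -
	show 1: "L2_loc S f" "L2_loc S (g i)" "L2_loc S (h i j)" "weak_pd S i f (g i)" "weak_pd S j (g i) (h i j)" for i j
		using assms unfolding jet2_def by blast+
	show g: "sobolev_loc (Suc 0) S (g i)" for i by (rule sobolev_locI[of S "g i" "h i", OF 1(2) 1(5)]) (simp add: 1(3))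
	show "sobolev_loc 2 S f" unfolding numeral_2_eq_2 by (rule sobolev_locI[OF 1(1,4) g])
qed

lemma jet2_le_sobolev_sq: assumes S: "open S" and K: "compact K" "K\<subseteq>S" and j: "jet2 S f g h"
	shows "sobolev_sq 0 S K f \<le> sobolev_sq 2 S K f" "sobolev_sq 0 S K (g i) \<le> sobolev_sq 2 S K f"
		"sobolev_sq 0 S K (h i l) \<le> sobolev_sq 2 S K f" proof -
	let ?u = "\<lambda>i. \<Sum>j\<in>UNIV. sobolev_sq 0 S K (h i j)"
	note j' = jet2D(2,3,4,5,1)[OF j] and g1 = jet2D(6)[OF j]
	have s1: "sobolev_sq (Suc 0) S K (g i) = sobolev_sq 0 S K (g i) + (?u i)" for i
		using sobolev_sq_Suc[where f = "g i" and g = "h i" and k = 0, OF S K j'(4)] j' by simp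
	have s2: "sobolev_sq 2 S K f = sobolev_sq 0 S K f + (\<Sum>i\<in>UNIV. sobolev_sq 0 S K (g i) + (?u i))"
		using sobolev_sq_Suc[OF S K j'(3) g1] unfolding s1 by (simp add: numeral_2_eq_2)
	let ?N = "sobolev_sq 2 S K f"
	have nn: "0 \<le> sobolev_sq 0 S K u" for u :: "real^3 => real" by (rule sobolev_sq_nonneg)
	show "sobolev_sq 0 S K f \<le> ?N" unfolding s2 by (simp add: nn sum_nonneg del: sobolev_sq.simps)
	have b': "sobolev_sq 0 S K (g i) + (?u i) \<le> ?N" for i proof -
		have "sobolev_sq 0 S K (g i) + (?u i) \<le> (\<Sum>i\<in>UNIV. sobolev_sq 0 S K (g i) + (?u i))"
			by (rule member_le_sum[where f = "\<lambda>i. sobolev_sq 0 S K (g i) + (?u i)"])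
				(auto simp: nn sum_nonneg simp del: sobolev_sq.simps)
		thus ?thesis unfolding s2 using nn[of f] by linarith
	qed
	show "sobolev_sq 0 S K (g i) \<le> ?N" using b'[of i] sum_nonneg[of UNIV "\<lambda>j. sobolev_sq 0 S K (h i j)"] nn by fastforce
	have "sobolev_sq 0 S K (h i l) \<le> (?u i)" by (rule member_le_sum) (auto simp: nn simp del: sobolev_sq.simps)
	thus "sobolev_sq 0 S K (h i l) \<le> ?N" using b'[of i] nn[of "g i"] by linarith
qed

text \<open>The 13 counts the 1 + 3 + 9 derivatives of order at most two in three variables, mixed
  ones in both orders.\<close>

lemma jet_norm_le_sobolev_sq: assumes "open S" "compact K" "K\<subseteq>S" "jet2 S f g h"
	shows "jet_norm K f g h \<le> 13 * sqrt (sobolev_sq 2 S K f)" proof -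
	let ?N = "sobolev_sq 2 S K f"
	have "jet_norm K f g h \<le> sqrt ?N + (\<Sum>i\<in>(UNIV::3 set). sqrt ?N) + (\<Sum>i\<in>(UNIV::3 set). \<Sum>j\<in>(UNIV::3 set). sqrt ?N)"
		unfolding jet_norm_def by (intro add_mono sum_mono real_sqrt_le_mono) (use jet2_le_sobolev_sq[OF assms] in \<open>simp_all add: sobolev_sq_0_real del: sobolev_sq.simps\<close>)
	thus ?thesis by simp
qed

lemma sobolev_loc_2E: assumes "sobolev_loc 2 S f"
	obtains g h where "jet2 S f g h" proof -
	have "sobolev_loc (Suc (Suc 0)) S f" using assms by (simp add: numeral_2_eq_2)
	then obtain g where g: "L2_loc S f" "\<And>i. weak_pd S i f (g i)" "\<And>i. sobolev_loc (Suc 0) S (g i)" using sobolev_locE by blast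
	hence "\<forall>i. \<forall>j. \<exists>u. weak_pd S j (g i) u \<and> L2_loc S u" by simp
	then obtain h where "\<And>i j. weak_pd S j (g i) (h i j) \<and> L2_loc S (h i j)" by metis
	hence "jet2 S f g h" unfolding jet2_def using g sobolev_loc_L2 by blast
	thus ?thesis by (rule that)
qed

lemma sobolev_2_inequalities: assumes S: "open S" and K: "compact K" "K\<subseteq>S"
	shows "\<exists>C K'. 0 \<le> C \<and> compact K' \<and> K\<subseteq>K' \<and> K'\<subseteq>S \<and> (\<forall>f g h. jet2 S f g h \<longrightarrow>
		(AE x in lborel. x\<in>K \<longrightarrow> \<bar>f x\<bar> \<le> C * sqrt (sobolev_sq 2 S K' f)) \<and>
		(\<forall>i. integrable lborel (cut K (\<lambda>x. (g i x)^4)) \<and>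
			 (LINT x|lborel. indicat_real K x * (g i x)^4) \<le> C * (sobolev_sq 2 S K' f)\<^sup>2))" proof -
	let ?u = "\<lambda>g i. LINT x|lborel. indicat_real K x * (g i x)^4"
	obtain C K1 where C: "0 \<le> C" "compact K1" "K1\<subseteq>S" and
		ae: "\<And>f g h. jet2 S f g h ==> AE x in lborel. x\<in>K \<longrightarrow> \<bar>f x\<bar> \<le> C * jet_norm K1 f g h" and
		l4: "\<And>f g h i. jet2 S f g h ==> integrable lborel (cut K (\<lambda>x. (g i x)^4)) \<and>
			 (?u g i) \<le> C * jet_norm K1 f g h^4" using sobolev_inequalities[OF S K] by blast
	\<comment> \<open>Adding \<open>K\<close> secures that it lies in the set of the estimate, which
	  the product estimate uses to compare norms over the two sets.\<close>
	let ?K = "K1 \<union> K"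
	have K': "compact ?K" "K\<subseteq>?K" "?K\<subseteq>S" using C K by auto
	have jn: "jet_norm K1 f g h \<le> 13 * sqrt (sobolev_sq 2 S ?K f)" if "jet2 S f g h" for f g h proof -
		have "sobolev_loc 2 S f" by (rule jet2D(7)[OF that])
		hence "sobolev_sq 2 S K1 f \<le> sobolev_sq 2 S ?K f" using K' C by (intro sobolev_sq_mono_set S) auto
		hence "sqrt (sobolev_sq 2 S K1 f) \<le> sqrt (sobolev_sq 2 S ?K f)" by (rule real_sqrt_le_mono)
		thus ?thesis using jet_norm_le_sobolev_sq[OF S C(2,3) that] by linarith
	qed
	have jn0: "0 \<le> jet_norm K1 f g h" for f g h unfolding jet_norm_def by (intro add_nonneg_nonneg sum_nonneg) auto
	\<comment> \<open>The power \<open>13^4\<close> arises in the quartic bound and exceeds the 13 of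
	  the supremum bound.\<close>
	show ?thesis proof (intro exI[of _ "C * 13^4"] exI[of _ ?K] conjI allI impI K')
		show "0 \<le> C * 13^4" using C by simp
		fix f g h assume j: "jet2 S f g h"
		have "C * jet_norm K1 f g h \<le> C * 13^4 * sqrt (sobolev_sq 2 S ?K f)" proof -
			have "C * jet_norm K1 f g h \<le> C * (13 * sqrt (sobolev_sq 2 S ?K f))" by (intro mult_left_mono jn j C)
			also have "\<dots> \<le> C * (13^4 * sqrt (sobolev_sq 2 S ?K f))"
				using C(1) by (intro mult_left_mono mult_right_mono) (auto simp: sobolev_sq_nonneg)
			finally show ?thesis by simp
		qed
		with ae[OF j] show "AE x in lborel. x\<in>K \<longrightarrow> \<bar>f x\<bar> \<le> C * 13^4 * sqrt (sobolev_sq 2 S ?K f)"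
			by (auto elim!: eventually_mono)
		fix i
		show "integrable lborel (cut K (\<lambda>x. (g i x)^4))" using l4[OF j] by blast
		have "(?u g i) \<le> C * jet_norm K1 f g h^4" using l4[OF j] by blast
		also have "\<dots> \<le> C * (13 * sqrt (sobolev_sq 2 S ?K f))^4" by (intro mult_left_mono power_mono jn j C jn0)
		also have "\<dots> = C * 13^4 * (sobolev_sq 2 S ?K f)\<^sup>2"
			using real_sqrt_pow2[OF sobolev_sq_nonneg[of 2 S ?K f]] by (simp add: power_mult_distrib power4_eq_xxxx power2_eq_square)
		finally show "(?u g i) \<le> C * 13^4 * (sobolev_sq 2 S ?K f)\<^sup>2" .
	qed
qed

text \<open>The estimate may pass to another compact set, so \<open>C\<close> and \<open>K'\<close>
  are chosen after \<open>K\<close>, but uniformly in \<open>f\<close> and \<open>g\<close>.\<close>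

definition mult_bounded_on :: "(real^3) set => nat => bool" where
	"mult_bounded_on S k \<longleftrightarrow> (\<forall>K. compact K \<and> K\<subseteq>S \<longrightarrow> (\<exists>C K'. 0 \<le> C \<and> compact K' \<and> K'\<subseteq>S \<and>
		 (\<forall>f g :: real^3 => real. sobolev_loc k S f \<longrightarrow> sobolev_loc k S g \<longrightarrow>
			 sobolev_loc k S (\<lambda>x. f x * g x) \<and> sobolev_sq k S K (\<lambda>x. f x * g x) \<le> C * (sobolev_sq k S K' f * sobolev_sq k S K' g))))"

text \<open>The pairs of factors occurring in the derivatives of a product up to order two. Each
  pair contains \<open>f\<close> or \<open>g\<close> itself, which is locally essentially bounded,
  or consists of two first derivatives, which are locally in L4.\<close>

definition jet_products ::
		"'a => ('i => 'a) => ('i => 'j => 'a) => 'a => ('i => 'a) => ('i => 'j => 'a) => ('a\<times>'a) set" where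
	"jet_products f f1 f2 g g1 g2 =
		 {(f, g), (g, f)} \<union> (\<Union>i. {(f, g1 i), (g, f1 i), (f1 i, g), (g1 i, f)}) \<union>
		 (\<Union>i. \<Union>j. {(f, g2 i j), (f2 i j, g)}) \<union> (\<Union>i. \<Union>j. {(f1 i, g1 j)})"

lemma mult_bounded_on_2: assumes S: "open S" shows "mult_bounded_on S 2" unfolding mult_bounded_on_def proof (intro allI impI)
	let ?u = "\<lambda>K' f g. sobolev_sq 2 S K' f * sobolev_sq 2 S K' g"
	let ?v = "\<lambda>u v. \<lambda>x. u x * v x"
	let ?w = "\<lambda>f g. \<lambda>x. f x * g x"
	let ?a = "\<lambda>K' f. sobolev_sq 2 S K' f"
	let ?B = "\<lambda>K C K'. \<forall>f f1 f2 g g1 g2. jet2 S f f1 f2 \<longrightarrow> jet2 S g g1 g2 \<longrightarrow>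
		(\<forall>u v. (u, v)\<in>jet_products f f1 f2 g g1 g2 \<longrightarrow>
		L2 (cut K (?v u v)) \<and>
		nsq (cut K (?v u v)) \<le> C * (?u K' f g))"
	fix K0 assume K0: "compact K0 \<and> K0\<subseteq>S"
	have key: "\<exists>C K'. 0 \<le> C \<and> compact K' \<and> K'\<subseteq>S \<and> ?B K C K'"
		if K: "compact K" "K\<subseteq>S" for K proof -
		obtain C K' where *: "0 \<le> C \<and> compact K' \<and> K\<subseteq>K' \<and> K'\<subseteq>S \<and> (\<forall>f g h. jet2 S f g h \<longrightarrow>
				(AE x in lborel. x\<in>K \<longrightarrow> \<bar>f x\<bar> \<le> C * sqrt (?a K' f)) \<and>
				(\<forall>i. integrable lborel (cut K (\<lambda>x. (g i x)^4)) \<and>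
					(LINT x|lborel. indicat_real K x * (g i x)^4) \<le> C * (?a K' f)\<^sup>2))"
			using sobolev_2_inequalities[OF S K] by (elim exE) (rule that)
		note C = *[THEN conjunct1] *[THEN conjunct2, THEN conjunct1] *[THEN conjunct2, THEN conjunct2, THEN conjunct1]
			*[THEN conjunct2, THEN conjunct2, THEN conjunct2, THEN conjunct1]
		note ** = *[THEN conjunct2, THEN conjunct2, THEN conjunct2, THEN conjunct2, rule_format]
		have ae: "\<And>f g h. jet2 S f g h ==> AE x in lborel. x\<in>K \<longrightarrow> \<bar>f x\<bar> \<le> C * sqrt (?a K' f)"
			by (rule **[THEN conjunct1])
		have l4: "\<And>f g h i. jet2 S f g h ==> integrable lborel (cut K (\<lambda>x. (g i x)^4)) \<and>
				 (LINT x|lborel. indicat_real K x * (g i x)^4) \<le> C * (?a K' f)\<^sup>2" by (rule **[THEN conjunct2, THEN spec])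
		\<comment> \<open>A bounded factor contributes its constant squared, the quartic estimate
		  contributes it once.\<close>
		define D where "D = max C (C\<^sup>2)"
		have D: "0 \<le> D" "C \<le> D" "C\<^sup>2 \<le> D" using C by (auto simp: D_def)
		have nn: "0 \<le> sobolev_sq 2 S K' u" for u :: "real^3 => real" by (rule sobolev_sq_nonneg)
		have comp: "nsq (cut K u) \<le> sobolev_sq 2 S K' f"
			if j: "jet2 S f f1 f2" and u: "u = f \<or> (\<exists>i. u = f1 i) \<or> (\<exists>i j. u = f2 i j)" for f f1 f2 u proof -
			have "sobolev_sq 0 S K u \<le> sobolev_sq 2 S K f" using u jet2_le_sobolev_sq[OF S K j] by blast
			also have "\<dots> \<le> sobolev_sq 2 S K' f" by (rule sobolev_sq_mono_set[OF S K(1) C(3,2,4) jet2D(7)[OF j]])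
			finally show ?thesis by (simp only: sobolev_sq_0_real)
		qed
		have inf: "L2 (cut K (\<lambda>x. f x * u x)) \<and>
				nsq (cut K (\<lambda>x. f x * u x)) \<le> D * (?u K' f g)"
			if f: "jet2 S f f1 f2" and g: "jet2 S g g1 g2" and u: "u = g \<or> (\<exists>i. u = g1 i) \<or> (\<exists>i j. u = g2 i j)"
			for f f1 f2 g g1 g2 u proof -
			have fL: "L2_loc S f" using f unfolding jet2_def by blast
			have uL: "L2_loc S u" using g u unfolding jet2_def by blast
			have "nsq (cut K (\<lambda>x. f x * u x)) \<le> (C * sqrt (?a K' f))\<^sup>2 * nsq (cut K u)"
				by (rule L2_mult_Linf(2)[OF fL uL K ae[OF f]])
			also have "\<dots> \<le> (C * sqrt (?a K' f))\<^sup>2 * sobolev_sq 2 S K' g" by (intro mult_left_mono comp[OF g u]) auto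
			also have "\<dots> = C\<^sup>2 * (?u K' f g)" using nn[of f] by (simp add: power_mult_distrib)
			also have "\<dots> \<le> D * (?u K' f g)" using nn by (intro mult_right_mono D mult_nonneg_nonneg)
			finally show ?thesis using L2_mult_Linf(1)[OF fL uL K ae[OF f]] by blast
		qed
		have quart: "L2 (cut K (\<lambda>x. f1 i x * g1 j x)) \<and>
				nsq (cut K (\<lambda>x. f1 i x * g1 j x)) \<le> D * (?u K' f g)"
			if f: "jet2 S f f1 f2" and g: "jet2 S g g1 g2" for f f1 f2 g g1 g2 i j proof -
			have L: "L2_loc S (f1 i)" "L2_loc S (g1 j)" using f g unfolding jet2_def by blast+
			have 4: "integrable lborel (cut K (\<lambda>x. (f1 i x)^4))" "(LINT x|lborel. indicat_real K x * (f1 i x)^4) \<le> C * (?a K' f)\<^sup>2"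
				"integrable lborel (cut K (\<lambda>x. (g1 j x)^4))" "(LINT x|lborel. indicat_real K x * (g1 j x)^4) \<le> C * (sobolev_sq 2 S K' g)\<^sup>2"
				using l4[OF f] l4[OF g] by blast+
			have "nsq (cut K (\<lambda>x. f1 i x * g1 j x)) \<le> C * (?u K' f g)" by (rule L2_mult_L4(2)[OF L K 4 C(1) nn nn])
			also have "\<dots> \<le> D * (?u K' f g)" using nn by (intro mult_right_mono D mult_nonneg_nonneg)
			finally show ?thesis using L2_mult_L4(1)[OF L K 4 C(1) nn nn] by blast
		qed
		show ?thesis proof (intro exI[of _ D] exI[of _ K'] conjI D C allI impI)
			fix f f1 f2 g g1 g2 u v
			assume f: "jet2 S f f1 f2" and g: "jet2 S g g1 g2"
				and uv: "(u, v)\<in>jet_products f f1 f2 g g1 g2"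
			have "L2 (cut K (?v u v)) \<and>
				nsq (cut K (?v u v)) \<le> D * (?u K' f g)" proof -
				consider "u = f" "v = g \<or> (\<exists>i. v = g1 i) \<or> (\<exists>i j. v = g2 i j)"
					| "v = f" "u = g \<or> (\<exists>i. u = g1 i) \<or> (\<exists>i j. u = g2 i j)"
					| "u = g" "v = f \<or> (\<exists>i. v = f1 i) \<or> (\<exists>i j. v = f2 i j)"
					| "v = g" "u = f \<or> (\<exists>i. u = f1 i) \<or> (\<exists>i j. u = f2 i j)"
					| i j where "u = f1 i" "v = g1 j" using uv unfolding jet_products_def by blast
				thus ?thesis proof cases
					case 1
					thus ?thesis using inf[OF f g, of v] by simp
				next
					case 2
					thus ?thesis using inf[OF f g, of u] by (simp add: mult.commute)
				next
					case 3
					thus ?thesis using inf[OF g f, of v] by (simp add: mult.commute[of "sobolev_sq 2 S K' g"])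
				next
					case 4
					thus ?thesis using inf[OF g f, of u] by (simp add: mult.commute[of "sobolev_sq 2 S K' g"] mult.commute[of "u _"])
				next
					case 5
					thus ?thesis using quart[OF f g] by simp
				qed
			qed
			thus "L2 (cut K (?v u v))"
				"nsq (cut K (?v u v)) \<le> D * (?u K' f g)" by blast+
		qed
	qed
	obtain C K' where *: "0 \<le> C \<and> compact K' \<and> K'\<subseteq>S \<and> ?B K0 C K'"
		using key[OF K0[THEN conjunct1] K0[THEN conjunct2]] by (elim exE) (rule that)
	note C = *[THEN conjunct1] *[THEN conjunct2, THEN conjunct1] *[THEN conjunct2, THEN conjunct2, THEN conjunct1]
	note bd = *[THEN conjunct2, THEN conjunct2, THEN conjunct2, rule_format, THEN conjunct2]
	show "\<exists>C K'. 0 \<le> C \<and> compact K' \<and> K'\<subseteq>S \<and>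
		 (\<forall>f g :: real^3 => real. sobolev_loc 2 S f \<longrightarrow> sobolev_loc 2 S g \<longrightarrow>
			 sobolev_loc 2 S (?w f g) \<and> sobolev_sq 2 S K0 (?w f g) \<le> C * (?u K' f g))"
	\<comment> \<open>157 = 1 + 3 * 4 + 9 * 16: the product itself, three first derivatives of two
	  terms each, nine second derivatives of four terms each, where every level of addition costs a
	  factor 2.\<close>
	proof (intro exI[of _ "157 * C"] exI[of _ K'] conjI allI impI C)
		show "0 \<le> 157 * C" using C by simp
		fix f g :: "real^3 => real" assume "sobolev_loc 2 S f" "sobolev_loc 2 S g"
		then obtain f1 f2 g1 g2 where f: "jet2 S f f1 f2" and g: "jet2 S g g1 g2" by (metis sobolev_loc_2E)
		note fd = jet2D(2,3,4,5,1)[OF f] and gd = jet2D(2,3,4,5,1)[OF g]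
		have loc: "L2_loc S (?v u v)"
			if uv: "(u, v)\<in>jet_products f f1 f2 g g1 g2" for u v proof (rule L2_locI_real)
			have "L2_loc S u" "L2_loc S v" using uv fd gd by (auto simp: jet_products_def)
			thus "(cut S (?v u v))\<in>borel_measurable borel" by (intro indicat_mult_borel L2_loc_borel_real)
			show "L2 (cut K (?v u v))" if cK: "compact K" "K\<subseteq>S" for K proof -
				obtain C K' where "\<forall>f f1 f2 g g1 g2. jet2 S f f1 f2 \<longrightarrow> jet2 S g g1 g2 \<longrightarrow>
					(\<forall>u v. (u, v)\<in>jet_products f f1 f2 g g1 g2 \<longrightarrow>
						L2 (cut K (?v u v)) \<and>
						nsq (cut K (?v u v)) \<le> C * (?u K' f g))" using key[OF cK] by (elim exE conjE) (rule that)
				from this[rule_format, OF f g uv] show ?thesis by blast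
			qed
		qed
		define p where "p i x = f1 i x * g x + f x * g1 i x" for i x
		define q where "q i j x = (f2 i j x * g x + f1 i x * g1 j x) + (f1 j x * g1 i x + f x * g2 i j x)" for i j x
		have pL: "L2_loc S (p i)" for i unfolding p_def by (intro L2_loc_add loc) (auto simp: jet_products_def)
		have qL: "L2_loc S (q i j)" for i j unfolding q_def by (intro L2_loc_add loc) (auto simp: jet_products_def)
		have wp: "weak_pd S i (?w f g) (p i)" for i unfolding p_def by (rule weak_pd_mult[OF S fd(3,5,1) gd(3,5,1)])
		have wq: "weak_pd S j (p i) (q i j)" for i j unfolding p_def q_def proof (rule weak_pd_add)
			show "weak_pd S j (\<lambda>x. f1 i x * g x) (\<lambda>x. f2 i j x * g x + f1 i x * g1 j x)"
				by (rule weak_pd_mult[OF S fd(4,1,2) gd(3,5,1)])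
			show "weak_pd S j (\<lambda>x. f x * g1 i x) (\<lambda>x. f1 j x * g1 i x + f x * g2 i j x)"
				by (rule weak_pd_mult[OF S fd(3,5,1) gd(4,1,2)])
		qed (intro L2_loc_add loc; auto simp: jet_products_def)+
		have fgL: "L2_loc S (?w f g)" by (rule loc) (simp add: jet_products_def)
		have p1: "sobolev_loc (Suc 0) S (p i)" for i by (rule sobolev_locI[OF pL wq]) (simp add: qL)
		show "sobolev_loc 2 S (?w f g)" unfolding numeral_2_eq_2 by (rule sobolev_locI[OF fgL wp p1])
		let ?M = "C * (?u K' f g)"
		have b0: "sobolev_sq 0 S K0 (?v u v) \<le> ?M"
			if "(u, v)\<in>jet_products f f1 f2 g g1 g2" for u v unfolding sobolev_sq_0_real by (rule bd[OF f g that])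
		have KK: "compact K0" "K0\<subseteq>S" using K0 by auto
		have add: "sobolev_sq 0 S K0 (\<lambda>x. u x + v x) \<le> 2 * a + 2 * b"
			if "L2_loc S u" "L2_loc S v" "sobolev_sq 0 S K0 u \<le> a" "sobolev_sq 0 S K0 v \<le> b" for u v :: "real^3 => real" and a b
			using sobolev_sq_add[OF S KK, of 1 0 u v] that by simp
		have bp: "sobolev_sq 0 S K0 (p i) \<le> 2 * ?M + 2 * ?M" for i unfolding p_def by (intro add loc b0) (auto simp: jet_products_def)
		have bq: "sobolev_sq 0 S K0 (q i j) \<le> 2 * (2 * ?M + 2 * ?M) + 2 * (2 * ?M + 2 * ?M)" for i j
			unfolding q_def by (intro add loc b0 L2_loc_add) (auto simp: jet_products_def)
		have "sobolev_sq (Suc (Suc 0)) S K0 (?w f g) = sobolev_sq 0 S K0 (?w f g) + (\<Sum>i\<in>UNIV. sobolev_sq (Suc 0) S K0 (p i))"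
			using sobolev_sq_Suc[OF S KK wp p1] by simp
		also have "\<dots> = sobolev_sq 0 S K0 (?w f g) + (\<Sum>i\<in>UNIV. sobolev_sq 0 S K0 (p i) + (\<Sum>j\<in>UNIV. sobolev_sq 0 S K0 (q i j)))"
			using sobolev_sq_Suc[where k = 0, OF S KK wq] qL by simp
		also have "\<dots> \<le> ?M + (\<Sum>i\<in>(UNIV::3 set). (2 * ?M + 2 * ?M) + (\<Sum>j\<in>(UNIV::3 set). 2 * (2 * ?M + 2 * ?M) + 2 * (2 * ?M + 2 * ?M)))"
			by (intro add_mono sum_mono b0 bp bq) (simp add: jet_products_def)
		also have "\<dots> = 157 * C * (?u K' f g)" by simp
		finally show "sobolev_sq 2 S K0 (?w f g) \<le> 157 * C * (?u K' f g)" by (simp add: numeral_2_eq_2)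
	qed
qed

text \<open>By the Leibniz rule each first derivative of the product is a sum of two products of
  order \<open>k\<close>, to which the hypothesis applies with the same \<open>K'\<close>.\<close>

lemma mult_bounded_on_Suc: assumes S: "open S" and k: "mult_bounded_on S k" shows "mult_bounded_on S (Suc k)"
	unfolding mult_bounded_on_def proof (intro allI impI)
	let ?u = "\<lambda>f g. \<lambda>x. f x * g x"
	fix K assume K0: "compact K \<and> K\<subseteq>S"
	hence K: "compact K" "K\<subseteq>S" by auto
	obtain C K' where C: "0 \<le> C" "compact K'" "K'\<subseteq>S" and
		bd': "\<forall>f g :: real^3 => real. sobolev_loc k S f \<longrightarrow> sobolev_loc k S g \<longrightarrow>
			 sobolev_loc k S (?u f g) \<and> sobolev_sq k S K (?u f g) \<le> C * (sobolev_sq k S K' f * sobolev_sq k S K' g)"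
		using k[unfolded mult_bounded_on_def, THEN spec, THEN mp, OF K0] by (elim exE conjE) (rule that)
	note bd = bd'[rule_format]
	show "\<exists>C K'. 0 \<le> C \<and> compact K' \<and> K'\<subseteq>S \<and>
		 (\<forall>f g :: real^3 => real. sobolev_loc (Suc k) S f \<longrightarrow> sobolev_loc (Suc k) S g \<longrightarrow>
			 sobolev_loc (Suc k) S (?u f g) \<and> sobolev_sq (Suc k) S K (?u f g) \<le> C * (sobolev_sq (Suc k) S K' f * sobolev_sq (Suc k) S K' g))"
	\<comment> \<open>13 = 1 + 3 * 4: the product in order zero and three derivatives, each a sum of
	  two products.\<close>
	proof (intro exI[of _ "13 * C"] exI[of _ K'] conjI allI impI C)
		show "0 \<le> 13 * C" using C by simp
		fix f g :: "real^3 => real" assume f0: "sobolev_loc (Suc k) S f" and g0: "sobolev_loc (Suc k) S g"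
		obtain f1 where f: "L2_loc S f" "\<And>i. weak_pd S i f (f1 i)" "\<And>i. sobolev_loc k S (f1 i)" using sobolev_locE[OF f0] by blast
		obtain g1 where g: "L2_loc S g" "\<And>i. weak_pd S i g (g1 i)" "\<And>i. sobolev_loc k S (g1 i)" using sobolev_locE[OF g0] by blast
		note fk = sobolev_loc_lower[OF f0] and gk = sobolev_loc_lower[OF g0]
		define p where "p i x = f1 i x * g x + f x * g1 i x" for i x
		have t1: "sobolev_loc k S (\<lambda>x. f1 i x * g x)" and t2: "sobolev_loc k S (\<lambda>x. f x * g1 i x)" for i
			using bd[OF f(3) gk] bd[OF fk g(3)] by blast+
		have wp: "weak_pd S i (?u f g) (p i)" for i
			unfolding p_def by (rule weak_pd_mult[OF S f(2,1) sobolev_loc_L2[OF f(3)] g(2,1) sobolev_loc_L2[OF g(3)]])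
		have pk: "sobolev_loc k S (p i)" for i unfolding p_def by (rule sobolev_loc_add[OF t1 t2])
		have fgk: "sobolev_loc k S (?u f g)" using bd[OF fk gk] by blast
		show "sobolev_loc (Suc k) S (?u f g)" by (rule sobolev_locI[OF sobolev_loc_L2[OF fgk] wp pk])
		let ?F = "sobolev_sq (Suc k) S K' f" and ?G = "sobolev_sq (Suc k) S K' g"
		have n: "0 \<le> sobolev_sq j S K' u" for j and u :: "real^3 => real" by (rule sobolev_sq_nonneg)
		have fF: "sobolev_sq k S K' f \<le> ?F" and gG: "sobolev_sq k S K' g \<le> ?G" by (rule sobolev_sq_lower[OF S C(2,3)], fact)+
		have f1F: "sobolev_sq k S K' (f1 i) \<le> ?F" for i unfolding sobolev_sq_Suc[OF S C(2,3) f(2,3)]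
			using member_le_sum[of i UNIV "\<lambda>i. sobolev_sq k S K' (f1 i)"] n sobolev_sq_0_nonneg[of K' f] by fastforce
		have g1G: "sobolev_sq k S K' (g1 i) \<le> ?G" for i unfolding sobolev_sq_Suc[OF S C(2,3) g(2,3)]
			using member_le_sum[of i UNIV "\<lambda>i. sobolev_sq k S K' (g1 i)"] n sobolev_sq_0_nonneg[of K' g] by fastforce
		have le: "C * (a * b) \<le> C * (?F * ?G)" if "0 \<le> a" "0 \<le> b" "a \<le> ?F" "b \<le> ?G" for a b
			using that C n by (intro mult_left_mono mult_mono) auto
		have b0: "sobolev_sq 0 S K (?u f g) \<le> C * (?F * ?G)" proof -
			have "sobolev_sq 0 S K (?u f g) \<le> sobolev_sq k S K (?u f g)" by (rule sobolev_sq_mono_order[OF S K _ fgk]) simp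
			also have "\<dots> \<le> C * (sobolev_sq k S K' f * sobolev_sq k S K' g)" using bd[OF fk gk] by blast
			also have "\<dots> \<le> C * (?F * ?G)" by (rule le[OF n n fF gG])
			finally show ?thesis .
		qed
		have b1: "sobolev_sq k S K (p i) \<le> 4 * (C * (?F * ?G))" for i proof -
			have "sobolev_sq k S K (\<lambda>x. f1 i x * g x) \<le> C * (sobolev_sq k S K' (f1 i) * sobolev_sq k S K' g)" using bd[OF f(3) gk] by blast
			also have "\<dots> \<le> C * (?F * ?G)" by (rule le[OF n n f1F gG])
			finally have 1: "sobolev_sq k S K (\<lambda>x. f1 i x * g x) \<le> C * (?F * ?G)" .
			have "sobolev_sq k S K (\<lambda>x. f x * g1 i x) \<le> C * (sobolev_sq k S K' f * sobolev_sq k S K' (g1 i))" using bd[OF fk g(3)] by blast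
			also have "\<dots> \<le> C * (?F * ?G)" by (rule le[OF n n fF g1G])
			finally have 2: "sobolev_sq k S K (\<lambda>x. f x * g1 i x) \<le> C * (?F * ?G)" .
			have "sobolev_sq k S K (p i) \<le> (1 + 1) * sobolev_sq k S K (\<lambda>x. f1 i x * g x) + (1 + 1/1) * sobolev_sq k S K (\<lambda>x. f x * g1 i x)"
				unfolding p_def by (rule sobolev_sq_add[OF S K _ t1 t2]) simp
			thus ?thesis using 1 2 by simp
		qed
		have "sobolev_sq (Suc k) S K (?u f g) = sobolev_sq 0 S K (?u f g) + (\<Sum>i\<in>UNIV. sobolev_sq k S K (p i))"
			using sobolev_sq_Suc[OF S K wp pk] by simp
		also have "\<dots> \<le> C * (?F * ?G) + (\<Sum>i\<in>(UNIV::3 set). 4 * (C * (?F * ?G)))" by (intro add_mono sum_mono b0 b1)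
		also have "\<dots> = 13 * C * (?F * ?G)" by simp
		finally show "sobolev_sq (Suc k) S K (?u f g) \<le> 13 * C * (?F * ?G)" .
	qed
qed

lemma mult_bounded_on: assumes "open S" "2 \<le> k" shows "mult_bounded_on S k"
	using assms(2) by (induction k rule: dec_induct) (auto intro: mult_bounded_on_2 mult_bounded_on_Suc assms(1))

lemma L2_loc_continuous: assumes "open S" "continuous_on S f" shows "L2_loc S f" unfolding L2_loc_def proof (intro conjI allI impI)
	show "set_borel_measurable lborel S f" using borel_measurable_continuous_on_indicator[of S f] assms by (simp add: set_borel_measurable_def)
	fix K assume K: "compact K \<and> K\<subseteq>S"
	thus "set_integrable lborel K (\<lambda>x. (norm (f x))\<^sup>2)" unfolding set_integrable_def
		by (intro borel_integrable_compact continuous_intros continuous_on_subset[OF assms(2)]) auto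
qed

lemma sobolev_loc_zero: "open S ==> sobolev_loc k S (\<lambda>x. 0 :: 'b::euclidean_space)" proof (induction k)
	case 0
	thus ?case by (simp add: L2_loc_continuous)
next
	case (Suc k)
	have "weak_pd S i (\<lambda>x. 0 :: 'b) (\<lambda>x. 0)" for i by (simp add: weak_pd_iff)
	from sobolev_locI[OF L2_loc_continuous[OF Suc.prems continuous_on_const] this Suc.IH[OF Suc.prems]]
	show ?case .
qed

lemma sobolev_sq_zero: "open S ==> compact K ==> K\<subseteq>S ==> sobolev_sq k S K (\<lambda>x. 0 :: 'b::euclidean_space) = 0"
	using sobolev_sq_scaleR[of S K k "\<lambda>x. 0 :: 'b" 0] sobolev_loc_zero[of S k, where 'b = 'b] by simp

text \<open>The power of 2 accumulates from \<open>sobolev_sq_add\<close> with \<open>d = 1\<close>,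
  once for each summand.\<close>

lemma sobolev_sum: assumes S: "open S" and K: "compact K" "K\<subseteq>S"
		and I: "finite I" and f: "\<And>i. i\<in>I ==> sobolev_loc k S (f i)" shows "sobolev_loc k S (\<lambda>x. \<Sum>i\<in>I. f i x) \<and>
		sobolev_sq k S K (\<lambda>x. \<Sum>i\<in>I. f i x) \<le> 2^card I * (\<Sum>i\<in>I. sobolev_sq k S K (f i))" using I f
proof (induction I rule: finite_induct)
	case empty
	thus ?case using sobolev_loc_zero[OF S, of k, where 'b = 'b] sobolev_sq_zero[OF S K, of k, where 'b = 'b] by simp
next
	case (insert i I)
	have l: "sobolev_loc k S (f i)" "sobolev_loc k S (\<lambda>x. \<Sum>i\<in>I. f i x)"
		and b: "sobolev_sq k S K (\<lambda>x. \<Sum>i\<in>I. f i x) \<le> 2^card I * (\<Sum>i\<in>I. sobolev_sq k S K (f i))" using insert by auto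
	have "sobolev_sq k S K (\<lambda>x. f i x + (\<Sum>i\<in>I. f i x)) \<le> (1 + 1) * sobolev_sq k S K (f i) + (1 + 1/1) * sobolev_sq k S K (\<lambda>x. \<Sum>i\<in>I. f i x)"
		by (rule sobolev_sq_add[OF S K _ l]) simp
	also have "\<dots> \<le> 2 * 2^card I * sobolev_sq k S K (f i) + 2 * (2^card I * (\<Sum>i\<in>I. sobolev_sq k S K (f i)))"
		using b mult_right_mono[of 1 "2^card I :: real" "sobolev_sq k S K (f i)"] sobolev_sq_nonneg[of k S K "f i"] by simp
	also have "\<dots> = 2^card (insert i I) * (\<Sum>i\<in>insert i I. sobolev_sq k S K (f i))" using insert by (simp add: algebra_simps)
	finally show ?case using sobolev_loc_add[OF l] insert by simp
qed

lemma bilinear_expansion: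
	fixes prod :: "'a::euclidean_space => 'b::euclidean_space => 'c::real_normed_vector" assumes "bounded_bilinear prod"
	shows "prod x y = (\<Sum>p\<in>Basis\<times>Basis. ((x\<bullet>fst p) * (y\<bullet>snd p)) *\<^sub>R prod (fst p) (snd p))" proof -
	interpret bounded_bilinear prod by fact
	have "prod x y = prod (\<Sum>b\<in>Basis. (x\<bullet>b) *\<^sub>R b) (\<Sum>c\<in>Basis. (y\<bullet>c) *\<^sub>R c)"
		by (simp only: euclidean_representation)
	also have "\<dots> = (\<Sum>b\<in>Basis. \<Sum>c\<in>Basis. ((x\<bullet>b) * (y\<bullet>c)) *\<^sub>R prod b c)"
		unfolding sum_left scaleR_left unfolding sum_right scaleR_right by (simp add: scaleR_sum_right)
	also have "\<dots> = (\<Sum>p\<in>Basis\<times>Basis. ((x\<bullet>fst p) * (y\<bullet>snd p)) *\<^sub>R prod (fst p) (snd p))"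
		by (simp add: sum.cartesian_product case_prod_unfold)
	finally show ?thesis .
qed

text \<open>Expansion in bases reduces a bilinear map of Euclidean spaces to finitely many products
  of real components.\<close>

lemma bilinear_sobolev:
	fixes prod :: "'a::euclidean_space => 'b::euclidean_space => 'c::euclidean_space"
	assumes P: "bounded_bilinear prod" and S: "open S" and K: "compact K" "K\<subseteq>S" and k: "2 \<le> k"
	shows "\<exists>C K'. 0 \<le> C \<and> compact K' \<and> K'\<subseteq>S \<and> (\<forall>f g. sobolev_loc k S f \<longrightarrow> sobolev_loc k S g \<longrightarrow>
		sobolev_loc k S (\<lambda>x. prod (f x) (g x)) \<and>
		sobolev_sq k S K (\<lambda>x. prod (f x) (g x)) \<le> C * (sobolev_sq k S K' f * sobolev_sq k S K' g))" proof -
	let ?u = "\<lambda>K' f g. sobolev_sq k S K' f * sobolev_sq k S K' g"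
	let ?v = "\<lambda>p. norm (prod (fst p) (snd p))"
	let ?w = "\<lambda>f g. \<lambda>x. prod (f x) (g x)"
	interpret bounded_bilinear prod by fact
	let ?B = "Basis\<times>Basis :: ('a\<times>'b) set"
	obtain C K' where C: "0 \<le> C" "compact K'" "K'\<subseteq>S" and
		bd': "\<forall>f g :: real^3 => real. sobolev_loc k S f \<longrightarrow> sobolev_loc k S g \<longrightarrow>
			 sobolev_loc k S (\<lambda>x. f x * g x) \<and> sobolev_sq k S K (\<lambda>x. f x * g x) \<le> C * (?u K' f g)"
		using mult_bounded_on[OF S k, unfolded mult_bounded_on_def, THEN spec, THEN mp, OF conjI[OF K]] by (elim exE conjE) (rule that)
	note bd = bd'[rule_format]
	define D where "D = 2^card ?B * (\<Sum>p\<in>?B. (?v p)\<^sup>2 * C)"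
	have D: "0 \<le> D" unfolding D_def using C by (intro mult_nonneg_nonneg sum_nonneg) auto
	show ?thesis proof (intro exI[of _ D] exI[of _ K'] conjI allI impI D C)
		fix f :: "real^3 => 'a" and g :: "real^3 => 'b"
		assume f: "sobolev_loc k S f" and g: "sobolev_loc k S g"
		define t where "t p x = ((f x\<bullet>fst p) * (g x\<bullet>snd p)) *\<^sub>R prod (fst p) (snd p)" for p x
		have eq: "(?w f g) = (\<lambda>x. \<Sum>p\<in>?B. t p x)" unfolding t_def using bilinear_expansion[OF P] by blast
		have fin: "finite ?B" by simp
		have t: "sobolev_loc k S (t p)" "sobolev_sq k S K (t p) \<le> (?v p)\<^sup>2 * C * (?u K' f g)"
			if p: "p\<in>?B" for p proof -
			have fb: "sobolev_loc k S (\<lambda>x. f x\<bullet>fst p)" "sobolev_sq k S K' (\<lambda>x. f x\<bullet>fst p) \<le> sobolev_sq k S K' f"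
				using sobolev_loc_linear[OF bounded_linear_inner_left f] p
					sobolev_sq_linear[OF bounded_linear_inner_left[of "fst p"] _ S C(2,3) f, of 1] by (auto simp: Basis_le_norm)
			have gb: "sobolev_loc k S (\<lambda>x. g x\<bullet>snd p)" "sobolev_sq k S K' (\<lambda>x. g x\<bullet>snd p) \<le> sobolev_sq k S K' g"
				using sobolev_loc_linear[OF bounded_linear_inner_left g] p
					sobolev_sq_linear[OF bounded_linear_inner_left[of "snd p"] _ S C(2,3) g, of 1] by (auto simp: Basis_le_norm)
			have m: "sobolev_loc k S (\<lambda>x. (f x\<bullet>fst p) * (g x\<bullet>snd p))" using bd[OF fb(1) gb(1)] by blast
			note lin = bounded_linear_scaleR_left[of "prod (fst p) (snd p)"]
			show "sobolev_loc k S (t p)" unfolding t_def by (rule sobolev_loc_linear[OF lin m])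
			have "sobolev_sq k S K (t p) \<le> (?v p)\<^sup>2 * sobolev_sq k S K (\<lambda>x. (f x\<bullet>fst p) * (g x\<bullet>snd p))"
				unfolding t_def by (rule sobolev_sq_linear[OF lin _ S K m]) simp
			also have "\<dots> \<le> (?v p)\<^sup>2 * (C * (sobolev_sq k S K' (\<lambda>x. f x\<bullet>fst p) * sobolev_sq k S K' (\<lambda>x. g x\<bullet>snd p)))"
				using bd[OF fb(1) gb(1)] by (intro mult_left_mono) auto
			also have "\<dots> \<le> (?v p)\<^sup>2 * (C * (?u K' f g))" by (intro mult_left_mono mult_mono fb gb C sobolev_sq_nonneg) auto
			finally show "sobolev_sq k S K (t p) \<le> (?v p)\<^sup>2 * C * (?u K' f g)" by (simp add: mult.assoc)
		qed
		note s = sobolev_sum[of S K ?B k t, OF S K fin t(1)]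
		show "sobolev_loc k S (?w f g)" unfolding eq by (rule s[THEN conjunct1])
		have "sobolev_sq k S K (?w f g) \<le> 2^card ?B * (\<Sum>p\<in>?B. sobolev_sq k S K (t p))" unfolding eq by (rule s[THEN conjunct2])
		also have "\<dots> \<le> 2^card ?B * (\<Sum>p\<in>?B. (?v p)\<^sup>2 * C * (?u K' f g))" by (intro mult_left_mono sum_mono t) auto
		also have "\<dots> = D * (?u K' f g)" unfolding D_def by (simp add: sum_distrib_right mult.assoc)
		finally show "sobolev_sq k S K (?w f g) \<le> D * (?u K' f g)" .
	qed
qed

section \<open>Continuous representatives: pointwise bounds and classical derivatives\<close>

lemma AE_le_open_imp_le:
	fixes u :: "'a::euclidean_space => real"
	assumes U: "open U" and c: "continuous_on U u" and ae: "AE x in lborel. x\<in>U \<longrightarrow> u x \<le> m" and x: "x\<in>U"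
	shows "u x \<le> m" proof (rule ccontr)
	assume n: "\<not> u x \<le> m"
	let ?V = "U \<inter> u -` {m<..}"
	have o: "open ?V" using continuous_open_preimage[OF c U open_greaterThan] .
	have "AE y in lborel. y\<notin>?V" using ae by eventually_elim auto
	hence "?V\<in>null_sets lborel" using o by (subst AE_iff_null_sets) auto
	hence "negligible ?V" using negligible_iff_null_sets null_sets_completionI by blast
	moreover have "?V \<noteq> {}" using x n by auto
	ultimately show False using open_not_negligible[OF o] by blast
qed

text \<open>Enlarging \<open>K\<close> to \<open>K1\<close> makes the almost everywhere bound hold
  on a whole ball around each point of \<open>K\<close>, where continuity turns it into a bound at
  that point. Vectors are treated by components, hence the factor \<open>DIM('b)\<close>.\<close>

lemma sobolev_sup_bound: assumes S: "open S" and K: "compact K" "K\<subseteq>S"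
	shows "\<exists>C K'. 0 \<le> C \<and> compact K' \<and> K'\<subseteq>S \<and> (\<forall>f :: real^3 => 'b::euclidean_space.
		sobolev_loc 2 S f \<longrightarrow> continuous_on S f \<longrightarrow> (\<forall>x\<in>K. norm (f x) \<le> C * sqrt (sobolev_sq 2 S K' f)))"
proof -
	let ?u = "\<lambda>f b. \<lambda>x. f x\<bullet>b"
	obtain e K1 where K1: "0 < e" "compact K1" "K\<subseteq>K1" "K1\<subseteq>S" "\<And>x. x\<in>K ==> cball x e\<subseteq>K1"
		using compact_thicken[OF S K] by blast
	obtain C K' where C: "0 \<le> C" "compact K'" "K1\<subseteq>K'" "K'\<subseteq>S" and
		ae: "\<forall>f g h. jet2 S f g h \<longrightarrow>
			(AE x in lborel. x\<in>K1 \<longrightarrow> \<bar>f x\<bar> \<le> C * sqrt (sobolev_sq 2 S K' f)) \<and>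
			(\<forall>i. integrable lborel (cut K1 (\<lambda>x. (g i x)^4)) \<and>
				 (LINT x|lborel. indicat_real K1 x * (g i x)^4) \<le> C * (sobolev_sq 2 S K' f)\<^sup>2)"
		using sobolev_2_inequalities[OF S K1(2,4)] by (elim exE conjE) (rule that)
	show ?thesis proof (intro exI[of _ "real DIM('b) * C"] exI[of _ K'] conjI allI impI ballI C)
		show "0 \<le> real DIM('b) * C" using C by simp
		fix f :: "real^3 => 'b" and x assume f: "sobolev_loc 2 S f" "continuous_on S f" and x: "x\<in>K"
		have b: "\<bar>f x\<bullet>b\<bar> \<le> C * sqrt (sobolev_sq 2 S K' f)" if b: "b\<in>Basis" for b proof -
			have fb: "sobolev_loc 2 S (?u f b)" "sobolev_sq 2 S K' (?u f b) \<le> sobolev_sq 2 S K' f"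
				using sobolev_loc_linear[OF bounded_linear_inner_left f(1)] b
					sobolev_sq_linear[OF bounded_linear_inner_left[of b] _ S C(2,4) f(1), of 1] by (auto simp: Basis_le_norm)
			obtain g h where j: "jet2 S (?u f b) g h" by (rule sobolev_loc_2E[OF fb(1)])
			have a: "AE y in lborel. y\<in>ball x e \<longrightarrow> \<bar>f y\<bullet>b\<bar> \<le> C * sqrt (sobolev_sq 2 S K' (?u f b))"
				using ae[rule_format, OF j, THEN conjunct1] by eventually_elim (use K1(5)[OF x] in \<open>auto simp: subset_iff\<close>)
			have sub: "ball x e\<subseteq>S" using K1(4) K1(5)[OF x] ball_subset_cball by blast
			have "\<bar>f x\<bullet>b\<bar> \<le> C * sqrt (sobolev_sq 2 S K' (?u f b))" by (rule AE_le_open_imp_le[OF open_ball _ a])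
					(use K1(1) in \<open>auto intro!: continuous_intros continuous_on_subset[OF f(2) sub]\<close>)
			also have "\<dots> \<le> C * sqrt (sobolev_sq 2 S K' f)" using fb(2) C by (intro mult_left_mono real_sqrt_le_mono) auto
			finally show ?thesis .
		qed
		have "norm (f x) \<le> (\<Sum>b\<in>Basis. \<bar>f x\<bullet>b\<bar>)" by (rule norm_le_l1)
		also have "\<dots> \<le> (\<Sum>b\<in>(Basis::'b set). C * sqrt (sobolev_sq 2 S K' f))" by (intro sum_mono b)
		finally show "norm (f x) \<le> real DIM('b) * C * sqrt (sobolev_sq 2 S K' f)" by simp
	qed
qed

text \<open>The mollifier has mass 1 and vanishes outside the unit ball, so the error at a point of
  \<open>K\<close> is an average of differences of \<open>f\<close> over distances below
  \<open>e\<close>, all taken inside \<open>K'\<close>, where \<open>f\<close> is uniformly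
  continuous.\<close>

lemma moll_uniform: assumes f: "continuous_on K' f" "compact K'" and K: "\<And>x. x\<in>K ==> cball x e0\<subseteq>K'" "0 < e0" and d: "0 < d"
	shows "\<exists>e1>0. \<forall>e. 0 < e \<longrightarrow> e < e1 \<longrightarrow> (\<forall>x\<in>K. \<bar>moll e (cut K' f) x - f x\<bar> \<le> d)"
proof -
	have "uniformly_continuous_on K' f" using f by (rule compact_uniformly_continuous)
	then obtain e2 where e2: "0 < e2" "\<And>x y. x\<in>K' ==> y\<in>K' ==> dist y x < e2 ==> dist (f y) (f x) < d"
		unfolding uniformly_continuous_on_def using d by metis
	let ?h = "\<lambda>y. indicat_real K' y * f y"
	have mm: "mollifier\<in>borel_measurable borel" by (rule smooth3_borel[OF mollifier_smooth])
	have hm: "?h\<in>borel_measurable borel"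
		using borel_measurable_continuous_on_indicator[of K' f] f compact_imp_closed[OF f(2)] by (simp add: borel_closed)
	obtain B where B: "\<And>y. \<bar>?h y\<bar> \<le> B" proof -
		have "compact (f ` K')" by (rule compact_continuous_image[OF f])
		then obtain B where "0 < B" "\<forall>z\<in>f ` K'. norm z \<le> B" using compact_imp_bounded bounded_pos by blast
		hence "\<bar>?h y\<bar> \<le> B" for y by (auto simp: indicator_def)
		thus ?thesis by (rule that)
	qed
	show ?thesis proof (intro exI[of _ "min e0 e2"] conjI allI impI ballI)
		fix e x assume e: "0 < e" "e < min e0 e2" and x: "x\<in>K"
		have cx: "x\<in>K'" using K(1)[OF x] K(2) by auto
		have close: "\<bar>?h (x - e *\<^sub>R z) - f x\<bar> \<le> d" if z: "norm z < 1" for z proof -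
			have "e * norm z \<le> e * 1" using z e by (intro mult_left_mono) auto
			hence n: "norm (e *\<^sub>R z) < min e0 e2" using e le_less_trans[of "e * norm z" e "min e0 e2"] by simp
			hence "x - e *\<^sub>R z\<in>cball x e0" by (simp add: dist_norm)
			hence k: "x - e *\<^sub>R z\<in>K'" using K(1)[OF x] by blast
			thus ?thesis using e2(2)[OF cx k] n by (simp add: dist_norm)
		qed
		have pt: "\<bar>mollifier z * (?h (x - e *\<^sub>R z) - f x)\<bar> \<le> d * mollifier z" for z proof (cases "1 \<le> norm z")
			case False
			thus ?thesis using close[of z] mollifier_nonneg[of z] mult_right_mono[of "\<bar>?h (x - e *\<^sub>R z) - f x\<bar>" d "mollifier z"]
				by (simp add: abs_mult mult.commute)
		qed (simp add: mollifier_zero)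
		have "integrable lborel (\<lambda>z. mollifier z * ?h (x - e *\<^sub>R z))" proof (rule Bochner_Integration.integrable_bound)
			show "integrable lborel (\<lambda>z. B * mollifier z)" using mollifier_integrable by simp
			show "(\<lambda>z. mollifier z * ?h (x - e *\<^sub>R z))\<in>borel_measurable lborel"
				using mm measurable_compose[OF _ hm, of "\<lambda>z. x - e *\<^sub>R z" lborel] by simp
			show "AE z in lborel. norm (mollifier z * ?h (x - e *\<^sub>R z)) \<le> norm (B * mollifier z)" proof (rule AE_I2)
				fix z
				have "\<bar>mollifier z\<bar> * \<bar>?h (x - e *\<^sub>R z)\<bar> \<le> \<bar>mollifier z\<bar> * \<bar>B\<bar>"
					by (intro mult_left_mono order_trans[OF B abs_ge_self] abs_ge_zero)
				thus "norm (mollifier z * ?h (x - e *\<^sub>R z)) \<le> norm (B * mollifier z)"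
					by (simp only: real_norm_def abs_mult mult.commute[of "\<bar>B\<bar>"])
			qed
		qed
		hence i: "integrable lborel (\<lambda>z. mollifier z * ?h (x - e *\<^sub>R z))" "integrable lborel (\<lambda>z. mollifier z * f x)"
			using mollifier_integrable by auto
		have "moll e ?h x - f x = (LINT z|lborel. mollifier z * ?h (x - e *\<^sub>R z)) - (LINT z|lborel. mollifier z * f x)"
			by (simp add: moll_def mollifier_integral)
		also have "\<dots> = (LINT z|lborel. mollifier z * (?h (x - e *\<^sub>R z) - f x))"
			using Bochner_Integration.integral_diff[OF i] by (simp add: right_diff_distrib)
		finally have eq: "moll e ?h x - f x = (LINT z|lborel. mollifier z * (?h (x - e *\<^sub>R z) - f x))" .
		have "norm (LINT z|lborel. mollifier z * (?h (x - e *\<^sub>R z) - f x)) \<le> (LINT z|lborel. d * mollifier z)"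
			by (rule Bochner_Integration.integral_norm_bound_integral)
				(use i pt mollifier_integrable in \<open>auto simp: right_diff_distrib\<close>)
		thus "\<bar>moll e ?h x - f x\<bar> \<le> d" unfolding eq by (simp add: mollifier_integral)
	qed (use K e2 in auto)
qed

text \<open>On a small ball the mollifications converge to \<open>f\<close>, and their gradients
  uniformly to \<open>g\<close>, so the limit is differentiable with the limiting gradient. The
  shift by \<open>N\<close> waits until mollification commutes with the weak derivative on that
  ball.\<close>

lemma weak_C1_real:
	fixes f :: "real^3 => real" assumes S: "open S" and f: "continuous_on S f" and g: "\<And>i. continuous_on S (g i)"
		and w: "\<And>i. weak_pd S i f (g i)" and x: "x\<in>S"
	shows "(f has_derivative (\<lambda>h. \<Sum>i\<in>UNIV. (h $ i) *\<^sub>R g i x)) (at x)" proof -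
	obtain r where r: "0 < r" "cball x r\<subseteq>S" using S x open_contains_cball by blast
	let ?K = "cball x r"
	obtain e K' where K': "0 < e" "compact K'" "?K\<subseteq>K'" "K'\<subseteq>S" "\<And>y. y\<in>?K ==> cball y e\<subseteq>K'"
		using compact_thicken[OF S compact_cball r(2)] by blast
	have fL: "L2_loc S f" and gL: "L2_loc S (g i)" for i by (auto intro: L2_loc_continuous S f g)
	define F where "F n = moll (1/real (Suc n)) (cut K' f)" for n
	define G where "G i n = moll (1/real (Suc n)) (cut K' (g i))" for i n
	have Fs: "smooth3 UNIV (F n)" for n unfolding F_def by (rule smooth3_moll[OF L2_loc_restrict(2)[OF fL K'(2,4)]]) simp
	have small: "eventually (\<lambda>n. 1/real (Suc n) < d) sequentially" if "0 < d" for d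
		using order_tendstoD(2)[OF LIMSEQ_inverse_real_of_nat that] by (simp add: inverse_eq_divide)
	obtain N where N: "\<And>n. N \<le> n ==> 1/real (Suc n) < e" using small[OF K'(1)] unfolding eventually_sequentially by blast
	have pdF: "pd i (F n) y = G i n y" if "N \<le> n" "y\<in>?K" for i n y unfolding F_def G_def proof (rule pd_moll[OF w fL gL K'(2,4)])
		show "cball y (1/real (Suc n))\<subseteq>K'" using K'(5)[OF that(2)] N[OF that(1)] by (auto intro: order_trans)
	qed simp
	have conv: "eventually (\<lambda>n. \<forall>y\<in>?K. \<bar>moll (1/real (Suc n)) (cut K' u) y - u y\<bar> \<le> d) sequentially"
		if u: "continuous_on S u" and d: "0 < d" for u d proof -
		have "\<exists>e1>0. \<forall>e. 0 < e \<longrightarrow> e < e1 \<longrightarrow> (\<forall>y\<in>?K. \<bar>moll e (cut K' u) y - u y\<bar> \<le> d)"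
			by (rule moll_uniform[OF continuous_on_subset[OF u K'(4)] K'(2) _ K'(1) d]) (rule K'(5))
		then obtain e1 where e: "0 < e1 \<and> (\<forall>e. 0 < e \<longrightarrow> e < e1 \<longrightarrow> (\<forall>y\<in>?K. \<bar>moll e (cut K' u) y - u y\<bar> \<le> d))" ..
		note e1 = e[THEN conjunct1] e[THEN conjunct2, THEN spec, THEN mp, THEN mp]
		show ?thesis using small[OF e1(1)] by (rule eventually_mono) (rule e1(2), simp_all)
	qed
	have Fconv: "(\<lambda>n. F n y) \<longlonglongrightarrow> f y" if y: "y\<in>?K" for y proof (rule tendstoI)
		fix d :: real assume d: "0 < d"
		hence "0 < d/2" by simp
		from conv[OF f this] show "\<forall>\<^sub>F n in sequentially. dist (F n y) (f y) < d" proof eventually_elim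
			case (elim n)
			hence "\<bar>F n y - f y\<bar> \<le> d/2" unfolding F_def using y by (rule bspec)
			thus ?case using d by (simp add: dist_real_def)
		qed
	qed
	have "\<exists>L. \<forall>y\<in>?K. (\<lambda>n. F (n + N) y) \<longlonglongrightarrow> L y \<and> (L has_derivative (\<lambda>h. \<Sum>i\<in>UNIV. (h $ i) *\<^sub>R g i y)) (at y within ?K)"
	proof (rule has_derivative_sequence)
		show "convex ?K" by simp
		show "(F (n + N) has_derivative (\<lambda>h. \<Sum>i\<in>UNIV. (h $ i) *\<^sub>R G i (n + N) y)) (at y within ?K)" if y: "y\<in>?K" for n y
		proof (rule has_derivative_at_withinI)
			have "pd i (F (n + N)) y = G i (n + N) y" for i using pdF[of "n + N" y i] y by simp
			with has_derivative_pd[OF smooth3_differentiable[OF Fs[of "n + N"]], of y]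
			show "(F (n + N) has_derivative (\<lambda>h. \<Sum>i\<in>UNIV. (h $ i) *\<^sub>R G i (n + N) y)) (at y)" by (simp only:)
		qed
		show "\<forall>\<^sub>F n in sequentially. \<forall>y\<in>?K. \<forall>h. norm ((\<Sum>i\<in>UNIV. (h $ i) *\<^sub>R G i (n + N) y) - (\<Sum>i\<in>UNIV. (h $ i) *\<^sub>R g i y)) \<le> d * norm h"
			if d: "0 < d" for d proof -
			have "eventually (\<lambda>n. \<forall>i\<in>UNIV. \<forall>y\<in>?K. \<bar>G i n y - g i y\<bar> \<le> d/3) sequentially"
				unfolding G_def using d by (intro eventually_ball_finite ballI conv g) auto
			from eventually_compose_filterlim[OF this filterlim_add_const_nat_at_top[of N]]
			show ?thesis proof eventually_elim
				case (elim n)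
				show ?case proof (intro ballI allI)
					fix y h assume y: "y\<in>?K"
					have "norm (\<Sum>i\<in>UNIV. (h $ i) *\<^sub>R (G i (n + N) y - g i y)) \<le> 3 * (d/3) * norm h"
						using elim y by (intro norm_nth_sum_le) auto
					thus "norm ((\<Sum>i\<in>UNIV. (h $ i) *\<^sub>R G i (n + N) y) - (\<Sum>i\<in>UNIV. (h $ i) *\<^sub>R g i y)) \<le> d * norm h"
						by (simp add: sum_subtractf right_diff_distrib)
				qed
			qed
		qed
		show "x\<in>?K" using r by simp
		show "(\<lambda>n. F (n + N) x) \<longlonglongrightarrow> f x" using r by (intro LIMSEQ_ignore_initial_segment Fconv) simp
	qed
	then obtain L where L: "\<And>y. y\<in>?K ==> (\<lambda>n. F (n + N) y) \<longlonglongrightarrow> L y"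
		"\<And>y. y\<in>?K ==> (L has_derivative (\<lambda>h. \<Sum>i\<in>UNIV. (h $ i) *\<^sub>R g i y)) (at y within ?K)" by blast
	have Lf: "L y = f y" if y: "y\<in>?K" for y proof -
		have "(\<lambda>n. F (n + N) y) \<longlonglongrightarrow> f y" using y by (intro LIMSEQ_ignore_initial_segment Fconv)
		with L(1)[OF y] show ?thesis by (rule LIMSEQ_unique)
	qed
	have "(L has_derivative (\<lambda>h. \<Sum>i\<in>UNIV. (h $ i) *\<^sub>R g i x)) (at x within ball x r)"
		using L(2)[of x] r has_derivative_subset[of L _ x ?K "ball x r"] by auto
	hence "(L has_derivative (\<lambda>h. \<Sum>i\<in>UNIV. (h $ i) *\<^sub>R g i x)) (at x)" using at_within_open[of x "ball x r"] r by simp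
	thus ?thesis by (rule has_derivative_transform_within_open[of _ _ _ _ "ball x r"]) (use r Lf in auto)
qed

lemma weak_C1:
	fixes f :: "real^3 => 'b::euclidean_space" assumes S: "open S" and f: "continuous_on S f" and g: "\<And>i. continuous_on S (g i)"
		and w: "\<And>i. weak_pd S i f (g i)" and x: "x\<in>S"
	shows "(f has_derivative (\<lambda>h. \<Sum>i\<in>UNIV. (h $ i) *\<^sub>R g i x)) (at x)"
	unfolding has_derivative_componentwise_within[of f _ x UNIV] proof
	fix b :: 'b assume "b\<in>Basis"
	have "((\<lambda>x. f x\<bullet>b) has_derivative (\<lambda>h. \<Sum>i\<in>UNIV. (h $ i) *\<^sub>R (g i x\<bullet>b))) (at x)"
		by (rule weak_C1_real[OF S _ _ _ x])
			(auto intro!: continuous_intros f g weak_pd_linear[OF w] L2_loc_continuous S bounded_linear_inner_left)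
	thus "((\<lambda>x. f x\<bullet>b) has_derivative (\<lambda>h. (\<Sum>i\<in>UNIV. (h $ i) *\<^sub>R g i x)\<bullet>b)) (at x)"
		by (simp add: inner_sum_left)
qed

section \<open>Sobolev topologies on families of chart representatives\<close>

lemma sqrt_triangle_from_weights:
	assumes le: "\<And>d::real. 0 < d ==> a \<le> (1 + d) * b + (1 + 1/d) * c" and b: "0 \<le> b" and c: "0 \<le> c"
	shows "sqrt a \<le> sqrt b + sqrt c" proof (rule field_le_epsilon)
	fix e :: real assume e: "0 < e"
	\<comment> \<open>The weight \<open>d = v/u\<close> turns the weighted sum into a square; the
	  summand \<open>e/2\<close> keeps \<open>u\<close> and \<open>v\<close> positive.\<close>
	define u v where "u = sqrt b + e/2" and "v = sqrt c + e/2"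
	have u: "0 < u" "b \<le> u\<^sup>2" and v: "0 < v" "c \<le> v\<^sup>2" using b c e by (auto simp: u_def v_def add_nonneg_pos power2_sum)
	have "a \<le> (1 + v/u) * b + (1 + 1/(v/u)) * c" using u v by (intro le) simp
	also have "\<dots> \<le> (1 + v/u) * u\<^sup>2 + (1 + u/v) * v\<^sup>2"
		using u v by (intro add_mono mult_mono) (use b c in \<open>auto intro: less_imp_le\<close>)
	also have "\<dots> = (u + v)\<^sup>2" using u v by (simp add: field_simps power2_eq_square)
	finally have "sqrt a \<le> u + v" using u v by (intro real_le_lsqrt) auto
	thus "sqrt a \<le> sqrt b + sqrt c + e" by (simp add: u_def v_def)
qed

definition local_rep :: "'m chart => ('m chart => 'm => 'b) => real^3 => 'b" where
	"local_rep c \<omega> x = \<omega> c (cinv c x)"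

definition sobolev_seminorm ::
		"nat => 'm chart => (real^3) set => ('m chart => 'm => 'b::euclidean_space) => real" where
	"sobolev_seminorm k c K \<omega> = sqrt (sobolev_sq k (cimg c) K (local_rep c \<omega>))"

definition sobolev_seminorms ::
		"'m chart set => nat => (('m chart => 'm => 'b::euclidean_space) => real) set" where
	"sobolev_seminorms At k = {sobolev_seminorm k c K | c K. c\<in>At \<and> compact K \<and> K\<subseteq>cimg c}"

lemma sobolev_seminormsI: "c\<in>At ==> compact K ==> K\<subseteq>cimg c ==> sobolev_seminorm k c K\<in>sobolev_seminorms At k"
	unfolding sobolev_seminorms_def by blast

lemma local_rep_add: "local_rep c (\<omega> + \<eta>) = (\<lambda>x. local_rep c \<omega> x + local_rep c \<eta> x)"
	and local_rep_diff: "local_rep c (\<omega> - \<eta>) = (\<lambda>x. local_rep c \<omega> x - local_rep c \<eta> x)"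
	and local_rep_scaleR: "local_rep c (r *\<^sub>R \<omega>) = (\<lambda>x. r *\<^sub>R local_rep c \<omega> x)"
	by (auto simp: local_rep_def scaleR_fun_def)

text \<open>The generating sets are defined by squared norms; a radius \<open>r\<close> there is the
  radius \<open>sqrt r\<close> of the seminorm.\<close>

lemma sobolev_topology_eq:
	fixes F :: "('m chart => 'm => 'b::euclidean_space) set" shows "sobolev_topology At k F = topology_generated_by
		{{y\<in>F. p (y - x) < r} | p x r. p\<in>sobolev_seminorms At k \<and> x\<in>F \<and> 0 < r}" proof -
	let ?L = "{{\<eta>\<in>F. sobolev_sq k (cimg c) K (\<lambda>x. (\<eta> - \<omega>) c (cinv c x)) < r} | \<omega> c K r.
				\<omega>\<in>F \<and> c\<in>At \<and> compact K \<and> K\<subseteq>cimg c \<and> 0 < r}"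
	let ?R = "{{y\<in>F. p (y - x) < r} | p x r. p\<in>sobolev_seminorms At k \<and> x\<in>F \<and> 0 < r}"
	have 1: "B\<in>?R" if "B\<in>?L" for B proof -
		obtain \<omega> c K r where B: "B = {\<eta>\<in>F. sobolev_sq k (cimg c) K (\<lambda>x. (\<eta> - \<omega>) c (cinv c x)) < r}"
			and w: "\<omega>\<in>F" "c\<in>At" "compact K" "K\<subseteq>cimg c" "0 < r" using \<open>B\<in>?L\<close> by blast
		have "B = {y\<in>F. sobolev_seminorm k c K (y - \<omega>) < sqrt r}" unfolding B sobolev_seminorm_def real_sqrt_less_iff local_rep_def ..
		moreover have "0 < sqrt r" using w by simp
		ultimately show ?thesis using w(1) sobolev_seminormsI[OF w(2-4), where 'b = 'b] by blast
	qed
	have 2: "B\<in>?L" if "B\<in>?R" for B proof -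
		obtain p x r where B: "B = {y\<in>F. p (y - x) < r}" and w: "p\<in>sobolev_seminorms At k" "x\<in>F" "0 < r"
			using \<open>B\<in>?R\<close> by blast
		obtain c K where p: "p = sobolev_seminorm k c K" "c\<in>At" "compact K" "K\<subseteq>cimg c"
			using w(1) unfolding sobolev_seminorms_def by blast
		have "sqrt u < r \<longleftrightarrow> u < r\<^sup>2" for u using real_sqrt_less_iff[of u "r\<^sup>2"] w(3) by simp
		hence "B = {\<eta>\<in>F. sobolev_sq k (cimg c) K (\<lambda>y. (\<eta> - x) c (cinv c y)) < r\<^sup>2}"
			unfolding B p sobolev_seminorm_def local_rep_def by simp
		moreover have "0 < r\<^sup>2" using w by simp
		ultimately show ?thesis using w(2) p(2-4) by (intro CollectI exI[of _ x] exI[of _ c] exI[of _ K] exI[of _ "r\<^sup>2"] conjI)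
	qed
	have "?L = ?R" by (intro subset_antisym subsetI) (erule 1, erule 2)
	thus ?thesis unfolding sobolev_topology_def by (rule arg_cong)
qed

locale charted =
	fixes At :: "'m::t2_space chart set" assumes atlas: "oriented_atlas At"
begin

lemmas atlasD = atlas[unfolded oriented_atlas_def]

lemma open_cdom: "c\<in>At ==> open (cdom c)" and open_cimg: "c\<in>At ==> open (cimg c)"
	and homeo: "c\<in>At ==> homeomorphism (cdom c) (cimg c) (cmap c) (cinv c)" by (simp_all only: atlasD[THEN conjunct1, THEN bspec])

lemma chart_ex: "\<exists>c\<in>At. p\<in>cdom c" proof -
	have "p\<in>(\<Union>c\<in>At. cdom c)" using atlasD[THEN conjunct2, THEN conjunct1] by simp
	thus ?thesis by (simp only: UN_iff)
qed

lemma chart_simps: assumes "c\<in>At" shows "p\<in>cdom c ==> cinv c (cmap c p) = p" "x\<in>cimg c ==> cmap c (cinv c x) = x"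
		"p\<in>cdom c ==> cmap c p\<in>cimg c" "x\<in>cimg c ==> cinv c x\<in>cdom c" using homeo[OF assms] unfolding homeomorphism_def by auto

lemma continuous_cinv: "c\<in>At ==> continuous_on (cimg c) (cinv c)"
	and continuous_cmap: "c\<in>At ==> continuous_on (cdom c) (cmap c)" using homeo unfolding homeomorphism_def by auto

lemma local_rep_continuous: assumes "c\<in>At" "continuous_on (cdom c) (\<omega> c)"
	shows "continuous_on (cimg c) (local_rep c \<omega>)" unfolding local_rep_def
	by (rule continuous_on_compose2[OF assms(2) continuous_cinv[OF assms(1)]]) (use chart_simps[OF assms(1)] in auto)

lemma sobolev_family_iff:
	"sobolev_family At k \<omega> \<longleftrightarrow> (\<forall>c\<in>At. continuous_on (cdom c) (\<omega> c) \<and> sobolev_loc k (cimg c) (local_rep c \<omega>))"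
	by (simp add: sobolev_family_def local_rep_def[abs_def])

lemma sobolev_family_add: "sobolev_family At k \<omega> ==> sobolev_family At k \<eta> ==> sobolev_family At k (\<omega> + \<eta>)"
	unfolding sobolev_family_iff local_rep_add by (auto intro!: continuous_intros sobolev_loc_add simp: plus_fun_def)

lemma sobolev_family_scaleR: "sobolev_family At k \<omega> ==> sobolev_family At k (r *\<^sub>R \<omega>)"
	unfolding sobolev_family_iff local_rep_scaleR
	by (auto intro!: continuous_intros sobolev_loc_linear[OF bounded_linear_scaleR_right] simp: scaleR_fun_def)

lemma sobolev_family_zero: "sobolev_family At k 0"
	unfolding sobolev_family_iff local_rep_def[abs_def] by (auto intro: sobolev_loc_zero open_cimg simp: zero_fun_def)

lemma seminorm_locale:
	fixes F :: "('m chart => 'm => 'b::euclidean_space) set"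
	assumes sub: "subspace F" and F: "\<And>\<omega>. \<omega>\<in>F ==> supported_on_charts At \<omega> \<and> sobolev_family At k \<omega>"
	shows "hausdorff_seminorm_topology F (sobolev_seminorms At k) (sobolev_topology At k F)" proof
	obtain c where "c\<in>At" using chart_ex by blast
	thus "sobolev_seminorms At k \<noteq> ({} :: (('m chart => 'm => 'b) => real) set)"
		using sobolev_seminormsI[of c At "{}" k] by (metis compact_empty empty_iff empty_subsetI)
	have loc: "sobolev_loc k (cimg c) (local_rep c \<omega>)" if "\<omega>\<in>F" "c\<in>At" for \<omega> c
		using F[OF that(1)] that(2) by (simp add: sobolev_family_iff)
	show "p (x + y) \<le> p x + p y" if p: "p\<in>sobolev_seminorms At k" and x: "x\<in>F" and y: "y\<in>F" for p x y proof -
		obtain c K where p: "p = sobolev_seminorm k c K" "c\<in>At" "compact K" "K\<subseteq>cimg c"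
			using p unfolding sobolev_seminorms_def by blast
		show ?thesis unfolding p sobolev_seminorm_def local_rep_add by (rule sqrt_triangle_from_weights sobolev_sq_nonneg
				sobolev_sq_add[OF open_cimg[OF p(2)] p(3,4) _ loc[OF x p(2)] loc[OF y p(2)]] | assumption)+
	qed
	show "p (r *\<^sub>R x) = \<bar>r\<bar> * p x" if p: "p\<in>sobolev_seminorms At k" and x: "x\<in>F" for p x r proof -
		obtain c K where p: "p = sobolev_seminorm k c K" "c\<in>At" "compact K" "K\<subseteq>cimg c"
			using p unfolding sobolev_seminorms_def by blast
		show ?thesis unfolding p sobolev_seminorm_def local_rep_scaleR
			sobolev_sq_scaleR[OF open_cimg[OF p(2)] p(3,4) loc[OF x p(2)]] by (simp add: real_sqrt_mult)
	qed
	show "sobolev_topology At k F = topology_generated_by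
		{{y\<in>F. p (y - x) < r} | p x r. p\<in>sobolev_seminorms At k \<and> x\<in>F \<and> 0 < r}" by (rule sobolev_topology_eq)
	show "subspace F" by fact
	\<comment> \<open>Separation: vanishing norms on a ball force the continuous representative to
	  vanish at its centre, and off the charts the forms are zero by convention.\<close>
	fix \<omega> assume w: "\<omega>\<in>F" and z: "\<And>p. p\<in>sobolev_seminorms At k ==> p \<omega> = 0"
	have "\<omega> c p = 0" for c p proof (cases "c\<in>At \<and> p\<in>cdom c")
		case False
		thus ?thesis using F[OF w] unfolding supported_on_charts_def by blast
	next
		case True
		hence c: "c\<in>At" and p: "p\<in>cdom c" by auto
		let ?f = "local_rep c \<omega>"
		have cont: "continuous_on (cimg c) ?f" using F[OF w] c by (auto simp: sobolev_family_iff intro: local_rep_continuous)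
		obtain e where e: "0 < e" "cball (cmap c p) e\<subseteq>cimg c" using open_cimg[OF c] chart_simps(3)[OF c p] open_contains_cball by blast
		let ?K = "cball (cmap c p) e"
		have "sobolev_sq k (cimg c) ?K ?f = 0" using z[OF sobolev_seminormsI[OF c compact_cball e(2)]] sobolev_sq_nonneg[of k "cimg c" ?K ?f]
			by (simp add: sobolev_seminorm_def)
		hence "(LINT x:?K|lborel. (norm (?f x))\<^sup>2) \<le> 0"
			using sobolev_sq_mono_order[OF open_cimg[OF c] compact_cball e(2) le0 loc[OF w c]] by simp
		hence "(LINT x|lborel. indicat_real ?K x * (norm (?f x))\<^sup>2) = 0" by (intro antisym) (simp_all add: set_lebesgue_integral_def)
		moreover have "integrable lborel (cut ?K (\<lambda>x. (norm (?f x))\<^sup>2))"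
			by (rule L2_loc_square_integrable[OF sobolev_loc_L2[OF loc[OF w c]] compact_cball e(2)])
		ultimately have "AE x in lborel. indicat_real ?K x * (norm (?f x))\<^sup>2 = 0" by (subst (asm) integral_nonneg_eq_0_iff_AE) auto
		hence ae: "AE x in lborel. x\<in>ball (cmap c p) e \<longrightarrow> norm (?f x) \<le> 0" by eventually_elim (auto simp: indicator_def)
		have "norm (?f (cmap c p)) \<le> 0" by (rule AE_le_open_imp_le[OF open_ball _ ae])
				(use e ball_subset_cball in \<open>auto intro!: continuous_intros continuous_on_subset[OF cont]\<close>)
		thus ?thesis using chart_simps(1)[OF c p] by (simp add: local_rep_def)
	qed
	thus "\<omega> = 0" by (simp add: fun_eq_iff)
qed

end

text \<open>The increment is split into \<open>B (x - x0) y\<close> and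
  \<open>B x0 (y - y0)\<close>, with \<open>p2 y\<close> bounded by
  \<open>p2 (y - y0) + p2 y0\<close>. The function \<open>p\<close> is abstract so that it can be a
  seminorm of the target or the norm of a normed space.\<close>

lemma bilinear_seminorm_tendsto: assumes "seminorm_topology F1 P1 T1" and "seminorm_topology F2 P2 T2"
		and B: "bilinear_on_sets F1 F2 B" and mem: "\<And>x y. x\<in>F1 ==> y\<in>F2 ==> B x y\<in>G"
		and p: "\<And>u v. u\<in>G ==> v\<in>G ==> p (u + v) \<le> p u + p v" "\<And>u. u\<in>G ==> 0 \<le> p u"
		and bd: "\<And>x y. x\<in>F1 ==> y\<in>F2 ==> p (B x y) \<le> C * (p1 x * p2 y)" and C: "0 \<le> C"
		and p12: "p1\<in>P1" "p2\<in>P2" and x0: "x0\<in>F1" and y0: "y0\<in>F2" and sub: "subspace G"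
	shows "((\<lambda>z. p (B (fst z) (snd z) - B x0 y0)) \<longlongrightarrow> 0) (atin (prod_topology T1 T2) (x0, y0))" proof -
	interpret S1: seminorm_topology F1 P1 T1 by fact
	interpret S2: seminorm_topology F2 P2 T2 by fact
	let ?at = "atin (prod_topology T1 T2) (x0, y0)"
	have z0: "(x0, y0)\<in>topspace (prod_topology T1 T2)" using x0 y0 S1.topspace_eq S2.topspace_eq by simp
	have l1: "limitin T1 fst x0 ?at" and l2: "limitin T2 snd y0 ?at"
		using continuous_map_fst[of T1 T2] continuous_map_snd[of T1 T2] z0 unfolding continuous_map_atin by force+
	have t1: "((\<lambda>z. p1 (fst z - x0)) \<longlongrightarrow> 0) ?at" and e1: "eventually (\<lambda>z. fst z\<in>F1) ?at"
		using l1 p12 unfolding S1.limitin_iff by blast+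
	have t2: "((\<lambda>z. p2 (snd z - y0)) \<longlongrightarrow> 0) ?at" and e2: "eventually (\<lambda>z. snd z\<in>F2) ?at"
		using l2 p12 unfolding S2.limitin_iff by blast+
	let ?b = "\<lambda>z. C * (p1 (fst z - x0) * (p2 (snd z - y0) + p2 y0)) + C * (p1 x0 * p2 (snd z - y0))"
	have "(?b \<longlongrightarrow> C * (0 * (0 + p2 y0)) + C * (p1 x0 * 0)) ?at" by (intro tendsto_intros t1 t2)
	hence lim: "(?b \<longlongrightarrow> 0) ?at" by simp
	have bL: "B (x - x') y = B x y - B x' y" if "x\<in>F1" "x'\<in>F1" "y\<in>F2" for x x' y
		using linear_on_setD(3)[OF _ S1.subspace_F that(1,2), of "\<lambda>x. B x y"] B that(3) unfolding bilinear_on_sets_def by blast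
	have bR: "B x (y - y') = B x y - B x y'" if "y\<in>F2" "y'\<in>F2" "x\<in>F1" for x y y'
		using linear_on_setD(3)[OF _ S2.subspace_F that(1,2), of "B x"] B that(3) unfolding bilinear_on_sets_def by blast
	have le: "p (B x y - B x0 y0) \<le> C * (p1 (x - x0) * (p2 (y - y0) + p2 y0)) + C * (p1 x0 * p2 (y - y0))"
		if x: "x\<in>F1" and y: "y\<in>F2" for x y proof -
		note d = S1.in_F(2)[OF x x0] S2.in_F(2)[OF y y0]
		have "B x y - B x0 y0 = B (x - x0) y + B x0 (y - y0)" using bL[OF x x0 y] bR[OF y y0 x0] by simp
		hence "p (B x y - B x0 y0) \<le> p (B (x - x0) y) + p (B x0 (y - y0))" using p(1)[OF mem[OF d(1) y] mem[OF x0 d(2)]] by simp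
		also have "\<dots> \<le> C * (p1 (x - x0) * p2 y) + C * (p1 x0 * p2 (y - y0))" by (intro add_mono bd d x0 y)
		also have "\<dots> \<le> C * (p1 (x - x0) * (p2 (y - y0) + p2 y0)) + C * (p1 x0 * p2 (y - y0))"
			using S2.triangle[OF p12(2) d(2) y0] S1.seminorm_nonneg[OF p12(1) d(1)] C by (intro add_mono mult_left_mono order_refl) auto
		finally show ?thesis .
	qed
	show ?thesis proof (rule tendsto_sandwich[OF _ _ tendsto_const lim])
		show "\<forall>\<^sub>F z in ?at. 0 \<le> p (B (fst z) (snd z) - B x0 y0)"
			using e1 e2 by eventually_elim (intro p(2) subspace_diff[OF sub] mem x0 y0)
		show "\<forall>\<^sub>F z in ?at. p (B (fst z) (snd z) - B x0 y0) \<le> ?b z" using e1 e2 by eventually_elim (rule le)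
	qed
qed

lemma continuous_map_bilinear_seminorms:
	assumes S1: "seminorm_topology F1 P1 T1" and S2: "seminorm_topology F2 P2 T2" and S3: "seminorm_topology F3 P3 T3"
		and B: "bilinear_on_sets F1 F2 B" and mem: "\<And>x y. x\<in>F1 ==> y\<in>F2 ==> B x y\<in>F3"
		and bd: "\<And>p. p\<in>P3 ==> \<exists>C p1 p2. 0 \<le> C \<and> p1\<in>P1 \<and> p2\<in>P2 \<and> (\<forall>x\<in>F1. \<forall>y\<in>F2. p (B x y) \<le> C * (p1 x * p2 y))"
	shows "continuous_map (prod_topology T1 T2) T3 (\<lambda>(x, y). B x y)" unfolding continuous_map_atin proof
	let ?u = "prod_topology T1 T2"
	interpret S1: seminorm_topology F1 P1 T1 by fact
	interpret S2: seminorm_topology F2 P2 T2 by fact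
	interpret S3: seminorm_topology F3 P3 T3 by fact
	fix z assume z: "z\<in>topspace ?u"
	obtain x0 y0 where z0: "z = (x0, y0)" by (cases z)
	hence x0: "x0\<in>F1" and y0: "y0\<in>F2" using z S1.topspace_eq S2.topspace_eq by auto
	have "eventually (\<lambda>z. z\<in>topspace ?u) (atin ?u z)"
		unfolding eventually_atin by (intro disjI2 exI[of _ "topspace ?u"] conjI openin_topspace) (use z in auto)
	hence ev: "eventually (\<lambda>z. B (fst z) (snd z)\<in>F3) (atin ?u z)"
		by (rule eventually_mono) (use S1.topspace_eq S2.topspace_eq mem in auto)
	have "((\<lambda>z. p (B (fst z) (snd z) - B x0 y0)) \<longlongrightarrow> 0) (atin ?u z)" if p: "p\<in>P3" for p proof -
		obtain C p1 p2 where C: "0 \<le> C" "p1\<in>P1" "p2\<in>P2" "\<forall>x\<in>F1. \<forall>y\<in>F2. p (B x y) \<le> C * (p1 x * p2 y)"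
			using bd[OF p] by (elim exE conjE) (rule that)
		show ?thesis unfolding z0 by (rule bilinear_seminorm_tendsto[OF S1 S2 B mem S3.triangle[OF p] S3.seminorm_nonneg[OF p]
					C(4)[THEN bspec, THEN bspec] C(1-3) x0 y0 S3.subspace_F])
	qed
	thus "limitin T3 (\<lambda>(x, y). B x y) (case z of (x, y) => B x y) (atin ?u z)"
		unfolding S3.limitin_iff using ev mem[OF x0 y0] by (simp add: z0 case_prod_unfold)
qed

lemma continuous_map_bilinear_euclidean:
	fixes B :: "'x::real_vector => 'y::real_vector => 'b::real_normed_vector"
	assumes S1: "seminorm_topology F1 P1 T1" and S2: "seminorm_topology F2 P2 T2"
		and B: "bilinear_on_sets F1 F2 B" and C: "0 \<le> C" and p12: "p1\<in>P1" "p2\<in>P2"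
		and bd: "\<And>x y. x\<in>F1 ==> y\<in>F2 ==> norm (B x y) \<le> C * (p1 x * p2 y)"
	shows "continuous_map (prod_topology T1 T2) euclidean (\<lambda>(x, y). B x y)" unfolding continuous_map_atin proof
	interpret S1: seminorm_topology F1 P1 T1 by fact
	interpret S2: seminorm_topology F2 P2 T2 by fact
	fix z assume z: "z\<in>topspace (prod_topology T1 T2)"
	obtain x0 y0 where z0: "z = (x0, y0)" by (cases z)
	hence x0: "x0\<in>F1" and y0: "y0\<in>F2" using z S1.topspace_eq S2.topspace_eq by auto
	have "((\<lambda>z. norm (B (fst z) (snd z) - B x0 y0)) \<longlongrightarrow> 0) (atin (prod_topology T1 T2) z)"
		unfolding z0 by (rule bilinear_seminorm_tendsto[OF S1 S2 B _ norm_triangle_ineq norm_ge_zero bd C p12 x0 y0 subspace_UNIV]) auto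
	thus "limitin euclidean (\<lambda>(x, y). B x y) (case z of (x, y) => B x y) (atin (prod_topology T1 T2) z)"
		by (simp add: z0 case_prod_unfold tendsto_norm_zero_iff LIM_zero_iff)
qed

section \<open>Fibrewise algebra of matrix-valued forms\<close>

lemma matrix_scaleR_left: "(r *\<^sub>R X) ** (Y :: 'n::finite cmat) = r *\<^sub>R (X ** Y)"
	and matrix_scaleR_right: "(X :: 'n::finite cmat) ** (r *\<^sub>R Y) = r *\<^sub>R (X ** Y)"
	by (simp_all add: vec_eq_iff matrix_matrix_mult_def scaleR_sum_right)

lemma trace_scaleR: "trace (r *\<^sub>R (X :: 'n::finite cmat)) = r *\<^sub>R trace X" by (simp add: trace_def scaleR_sum_right)

lemma matrix_add_rdistrib: "(X + Y) ** (Z :: 'n::finite cmat) = X ** Z + Y ** Z"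
	by (simp add: vec_eq_iff matrix_matrix_mult_def distrib_right sum.distrib)

lemma bounded_bilinear_matrix: "bounded_bilinear ((**) :: 'n::finite cmat => 'n cmat => 'n cmat)"
	unfolding bilinear_conv_bounded_bilinear[symmetric] bilinear_def
	by (auto intro!: linearI simp: matrix_add_ldistrib matrix_add_rdistrib matrix_scaleR_left matrix_scaleR_right)

lemmas matrix_bilinear_simps =
	matrix_add_ldistrib matrix_add_rdistrib matrix_scaleR_left matrix_scaleR_right
	bounded_bilinear.diff_left[OF bounded_bilinear_matrix] bounded_bilinear.diff_right[OF bounded_bilinear_matrix]
	bounded_bilinear.minus_left[OF bounded_bilinear_matrix] bounded_bilinear.minus_right[OF bounded_bilinear_matrix]

definition wedge_fibre :: "('n::finite cmat)^3 => ('n cmat)^3 => ('n cmat)^3^3" where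
	"wedge_fibre u v = (\<chi> i j. u $ i ** v $ j - u $ j ** v $ i)"

definition trace_fibre :: "('n::finite cmat)^3^3 => ('n cmat)^3 => complex" where
	"trace_fibre \<alpha> v = trace (\<alpha> $ 1 $ 2 ** v $ 3 + \<alpha> $ 2 $ 3 ** v $ 1 + \<alpha> $ 3 $ 1 ** v $ 2)"

lemma bounded_bilinear_wedge_fibre: "bounded_bilinear (wedge_fibre :: ('n::finite cmat)^3 => _ => _)"
	unfolding bilinear_conv_bounded_bilinear[symmetric] bilinear_def
	by (auto intro!: linearI simp: wedge_fibre_def vec_eq_iff matrix_bilinear_simps scaleR_diff_right right_diff_distrib)

lemma bounded_bilinear_trace_fibre: "bounded_bilinear (trace_fibre :: ('n::finite cmat)^3^3 => _ => _)"
	unfolding bilinear_conv_bounded_bilinear[symmetric] bilinear_def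
	by (auto intro!: linearI simp: trace_fibre_def matrix_bilinear_simps trace_add trace_scaleR scaleR_add_right)

lemma wedge11_fibre: "wedge11 a b c p = wedge_fibre (a c p) (b c p)" by (simp add: wedge11_def wedge_fibre_def)

lemma trace_wedge21: "trace (wedge21 \<alpha> a c p) = trace_fibre (\<alpha> c p) (a c p)" by (simp add: wedge21_def trace_fibre_def)

text \<open>Cyclicity of the trace: products with \<open>u\<close> in the middle are rotated until
  \<open>u\<close> stands first, and then both sides contain the same words.\<close>

lemma trace_fibre_swap:
	fixes u v w :: "('n::finite cmat)^3"
	shows "trace_fibre (wedge_fibre u v - wedge_fibre v u) w = - trace_fibre (wedge_fibre u w - wedge_fibre w u) v" proof -
	have c: "trace (X ** Y ** Z) = trace (Y ** Z ** X)" for X Y Z :: "'n cmat" by (metis matrix_mul_assoc trace_mul_sym)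
	have r: "trace (v $ i ** u $ j ** w $ k) = trace (u $ j ** w $ k ** v $ i)"
		"trace (w $ i ** u $ j ** v $ k) = trace (u $ j ** v $ k ** w $ i)" for i j k by (rule c)+
	show ?thesis by (simp add: trace_fibre_def wedge_fibre_def matrix_bilinear_simps trace_add trace_sub r)
qed

lemma bilinear_sobolev_loc:
	fixes prod :: "'a::euclidean_space => 'b::euclidean_space => 'c::euclidean_space"
	assumes P: "bounded_bilinear prod" and S: "open S" and k: "2 \<le> k"
		and f: "sobolev_loc k S f" and g: "sobolev_loc k S g" shows "sobolev_loc k S (\<lambda>x. prod (f x) (g x))" proof -
	\<comment> \<open>The empty compact set serves to extract the membership part alone.\<close>
	obtain C K' where "\<forall>f g. sobolev_loc k S f \<longrightarrow> sobolev_loc k S g \<longrightarrow> sobolev_loc k S (\<lambda>x. prod (f x) (g x)) \<and>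
		sobolev_sq k S {} (\<lambda>x. prod (f x) (g x)) \<le> C * (sobolev_sq k S K' f * sobolev_sq k S K' g)"
		using bilinear_sobolev[OF P S compact_empty empty_subsetI k] by (elim exE conjE) (rule that)
	from this[THEN spec, THEN spec, THEN mp, THEN mp, OF f g] show ?thesis by (rule conjunct1)
qed

lemma integral_bilinear_bound:
	fixes B :: "'a::euclidean_space => 'b::euclidean_space => 'c::euclidean_space"
	assumes B: "bounded_bilinear B" and K: "0 \<le> K" "\<And>a b. norm (B a b) \<le> norm a * norm b * K"
		and S: "open S" and L: "compact L" "L\<subseteq>S" and Q: "Q\<in>sets borel" "Q\<subseteq>L"
		and f: "continuous_on S f" and g: "continuous_on S g" shows "set_integrable lborel Q (\<lambda>x. B (f x) (g x))"
		"norm (LINT x:Q|lborel. B (f x) (g x)) \<le> K * (sqrt (sobolev_sq 0 S L f) * sqrt (sobolev_sq 0 S L g))" proof -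
	have "set_integrable lborel L (\<lambda>x. B (f x) (g x))" unfolding set_integrable_def
		by (intro borel_integrable_compact L(1) bounded_bilinear.continuous_on[OF B] continuous_on_subset[OF f L(2)] continuous_on_subset[OF g L(2)])
	thus i: "set_integrable lborel Q (\<lambda>x. B (f x) (g x))" by (rule set_integrable_subset) (use Q in auto)
	let ?F = "\<lambda>x. indicat_real L x * norm (f x)" and ?G = "\<lambda>x. indicat_real L x * norm (g x)"
	have FG: "L2 ?F" "L2 ?G"
		using L2_loc_restrict(1)[OF L2_loc_norm[OF L2_loc_continuous[OF S f]] L] L2_loc_restrict(1)[OF L2_loc_norm[OF L2_loc_continuous[OF S g]] L] .
	have "norm (LINT x:Q|lborel. B (f x) (g x)) \<le> (LINT x|lborel. K * (?F x * ?G x))" unfolding set_lebesgue_integral_def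
	proof (rule Bochner_Integration.integral_norm_bound_integral)
		show "integrable lborel (\<lambda>x. indicat_real Q x *\<^sub>R B (f x) (g x))" using i by (simp add: set_integrable_def)
		show "integrable lborel (\<lambda>x. K * (?F x * ?G x))" using L2_product(1)[OF FG] by simp
		show "norm (indicat_real Q x *\<^sub>R B (f x) (g x)) \<le> K * (?F x * ?G x)" for x
			using K(2)[of "f x" "g x"] K(1) Q(2) by (cases "x\<in>Q") (auto simp: mult.commute)
	qed
	also have "\<dots> = K * (LINT x|lborel. ?F x * ?G x)" by simp
	also have "\<dots> \<le> K * (sqrt (nsq ?F) * sqrt (nsq ?G))" using L2_product(3)[OF FG] K(1) by (intro mult_left_mono) auto
	moreover have "nsq ?F = sobolev_sq 0 S L f" "nsq ?G = sobolev_sq 0 S L g"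
		by (auto simp: nsq_def set_lebesgue_integral_def indicator_def intro!: Bochner_Integration.integral_cong)
	ultimately show "norm (LINT x:Q|lborel. B (f x) (g x)) \<le> K * (sqrt (sobolev_sq 0 S L f) * sqrt (sobolev_sq 0 S L g))" by (simp only:)
qed

text \<open>\<open>topology\<close> inverts \<open>openin\<close> on families that satisfy the
  axioms of a topology; here they hold because preimages commute with intersections and
  unions.\<close>

lemma openin_quotient_topology: assumes "q ` topspace Z = R"
	shows "openin (topology (\<lambda>W. W\<subseteq>R \<and> openin Z {x\<in>topspace Z. q x\<in>W})) W \<longleftrightarrow>
		W\<subseteq>R \<and> openin Z {x\<in>topspace Z. q x\<in>W}" proof (subst topology_inverse', unfold istopology_def, intro conjI allI impI)
	fix S T assume "S\<subseteq>R \<and> openin Z {x\<in>topspace Z. q x\<in>S}" "T\<subseteq>R \<and> openin Z {x\<in>topspace Z. q x\<in>T}"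
	hence "S \<inter> T\<subseteq>R" and o: "openin Z ({x\<in>topspace Z. q x\<in>S} \<inter> {x\<in>topspace Z. q x\<in>T})" by auto
	thus "S \<inter> T\<subseteq>R" by blast
	have "{x\<in>topspace Z. q x\<in>S \<inter> T} = {x\<in>topspace Z. q x\<in>S} \<inter> {x\<in>topspace Z. q x\<in>T}" by blast
	thus "openin Z {x\<in>topspace Z. q x\<in>S \<inter> T}" using o by simp
next
	fix \<K> assume K: "\<forall>S\<in>\<K>. S\<subseteq>R \<and> openin Z {x\<in>topspace Z. q x\<in>S}"
	thus "\<Union> \<K>\<subseteq>R" by blast
	have "{x\<in>topspace Z. q x\<in>\<Union> \<K>} = (\<Union>S\<in>\<K>. {x\<in>topspace Z. q x\<in>S})" by blast
	thus "openin Z {x\<in>topspace Z. q x\<in>\<Union> \<K>}" using K by (simp only:) (rule openin_Union, blast)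
qed (rule refl)

lemma subspace_combI: assumes "0\<in>S" and comb: "\<And>x y r. x\<in>S ==> y\<in>S ==> x + r *\<^sub>R y\<in>S"
	shows "subspace S" using assms(1) comb[of _ _ 1] comb[of 0] by (auto intro!: subspaceI)

lemma subspace_su: "subspace (su :: 'n::finite cmat set)"
	by (rule subspaceI) (auto simp: su_def trace_add trace_scaleR trace_0[unfolded mat_0])

section \<open>The spaces of 1-forms and 2-forms and the wedge product between them\<close>

context charted
begin

lemma Omega1D: assumes "a\<in>Omega1 At k V" shows "supported_on_charts At a" "sobolev_family At k a"
		"c\<in>At ==> p\<in>cdom c ==> a c p $ i\<in>V"
		"c\<in>At ==> d\<in>At ==> p\<in>cdom c ==> p\<in>cdom d ==>
			a c p $ i = (\<Sum>k\<in>UNIV. (jac c d p $ k $ i) *\<^sub>R (a d p $ k))"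
		"c\<in>At ==> continuous_on (cdom c) (a c)" "c\<in>At ==> sobolev_loc k (cimg c) (local_rep c a)"
		"c\<in>At ==> continuous_on (cimg c) (local_rep c a)"
	using assms local_rep_continuous[of c a] unfolding Omega1_def sobolev_family_iff by blast+

lemma Omega2D: assumes "a\<in>Omega2 At k V" shows "supported_on_charts At a" "sobolev_family At k a"
		"c\<in>At ==> continuous_on (cimg c) (local_rep c a)" "c\<in>At ==> sobolev_loc k (cimg c) (local_rep c a)"
		"c\<in>At ==> p\<in>cdom c ==> a c p $ i $ j\<in>V" "c\<in>At ==> p\<in>cdom c ==> a c p $ i $ j = - (a c p $ j $ i)"
		"c\<in>At ==> d\<in>At ==> p\<in>cdom c ==> p\<in>cdom d ==> a c p $ i $ j =
			(\<Sum>k\<in>UNIV. \<Sum>l\<in>UNIV. (jac c d p $ k $ i * jac c d p $ l $ j) *\<^sub>R (a d p $ k $ l))"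
	using assms local_rep_continuous[of c a] unfolding Omega2_def sobolev_family_iff by blast+

lemma Omega1_subspace:
	fixes V :: "'n::finite cmat set" assumes V: "subspace V" shows "subspace (Omega1 At k V)" proof (rule subspace_combI)
	show "0\<in>Omega1 At k V" unfolding Omega1_def using sobolev_family_zero subspace_0[OF V] by (simp add: supported_on_charts_def)
	fix x y :: "('m, 'n) form1" and r :: real assume x: "x\<in>Omega1 At k V" and y: "y\<in>Omega1 At k V"
	have e: "(x + r *\<^sub>R y) c p = x c p + r *\<^sub>R y c p" for c p by (simp add: scaleR_fun_def)
	show "x + r *\<^sub>R y\<in>Omega1 At k V" unfolding Omega1_def mem_Collect_eq
	proof (intro conjI ballI allI sobolev_family_add sobolev_family_scaleR Omega1D(2)[OF x] Omega1D(2)[OF y])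
		show "supported_on_charts At (x + r *\<^sub>R y)" using Omega1D(1)[OF x] Omega1D(1)[OF y] unfolding supported_on_charts_def e by simp
		fix c d p i assume c: "c\<in>At"
		show "(x + r *\<^sub>R y) c p $ i\<in>V" if "p\<in>cdom c"
			unfolding e using subspace_add[OF V Omega1D(3)[OF x c that] subspace_scale[OF V Omega1D(3)[OF y c that]]] by simp
		show "(x + r *\<^sub>R y) c p $ i = (\<Sum>k\<in>UNIV. (jac c d p $ k $ i) *\<^sub>R ((x + r *\<^sub>R y) d p $ k))" if "d\<in>At" "p\<in>cdom c \<inter> cdom d"
			unfolding e using Omega1D(4)[OF x c that(1), of p i] Omega1D(4)[OF y c that(1), of p i] that(2)
			by (simp only: Int_iff vector_add_component vector_scaleR_component)
				(simp add: scaleR_add_right sum.distrib scaleR_sum_right mult.commute)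
	qed
qed

lemma Omega2_subspace:
	fixes V :: "'n::finite cmat set" assumes V: "subspace V" shows "subspace (Omega2 At k V)" proof (rule subspace_combI)
	show "0\<in>Omega2 At k V" unfolding Omega2_def using sobolev_family_zero subspace_0[OF V] by (simp add: supported_on_charts_def)
	fix x y :: "('m, 'n) form2" and r :: real assume x: "x\<in>Omega2 At k V" and y: "y\<in>Omega2 At k V"
	have e: "(x + r *\<^sub>R y) c p = x c p + r *\<^sub>R y c p" for c p by (simp add: scaleR_fun_def)
	show "x + r *\<^sub>R y\<in>Omega2 At k V" unfolding Omega2_def mem_Collect_eq
	proof (intro conjI ballI allI sobolev_family_add sobolev_family_scaleR Omega2D(2)[OF x] Omega2D(2)[OF y])
		show "supported_on_charts At (x + r *\<^sub>R y)" using Omega2D(1)[OF x] Omega2D(1)[OF y] unfolding supported_on_charts_def e by simp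
		fix c d p i j assume c: "c\<in>At"
		show "(x + r *\<^sub>R y) c p $ i $ j\<in>V" if "p\<in>cdom c"
			unfolding e using subspace_add[OF V Omega2D(5)[OF x c that] subspace_scale[OF V Omega2D(5)[OF y c that]]] by simp
		show "(x + r *\<^sub>R y) c p $ i $ j = - ((x + r *\<^sub>R y) c p $ j $ i)" if "p\<in>cdom c"
			unfolding e using Omega2D(6)[OF x c that, of i j] Omega2D(6)[OF y c that, of i j]
			by (simp only: vector_add_component vector_scaleR_component) simp
		show "(x + r *\<^sub>R y) c p $ i $ j = (\<Sum>k\<in>UNIV. \<Sum>l\<in>UNIV. (jac c d p $ k $ i * jac c d p $ l $ j) *\<^sub>R ((x + r *\<^sub>R y) d p $ k $ l))"
			if "d\<in>At" "p\<in>cdom c \<inter> cdom d"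
			unfolding e using Omega2D(7)[OF x c that(1), of p i j] Omega2D(7)[OF y c that(1), of p i j] that(2)
			by (simp only: Int_iff vector_add_component vector_scaleR_component)
				(simp add: scaleR_add_right sum.distrib scaleR_sum_right mult.commute[of r])
	qed
qed

lemma local_rep_wedge11: "local_rep c (wedge11 a b) = (\<lambda>x. wedge_fibre (local_rep c a x) (local_rep c b x))"
	by (simp add: local_rep_def fun_eq_iff wedge11_fibre)

text \<open>Order at least two admits products, which preserves the Sobolev class. The values are
  claimed to lie in \<open>UNIV\<close>, since a product of matrices in \<open>V\<close> may leave
  \<open>V\<close>.\<close>

lemma wedge11_Omega2:
	fixes a b :: "('m, 'n::finite) form1" assumes k: "2 \<le> k" and a: "a\<in>Omega1 At k V" and b: "b\<in>Omega1 At k V"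
	shows "wedge11 a b\<in>Omega2 At k UNIV" unfolding Omega2_def mem_Collect_eq proof (intro conjI ballI allI)
	interpret w: bounded_bilinear "wedge_fibre :: ('n cmat)^3 => _ => _" by (rule bounded_bilinear_wedge_fibre)
	interpret m: bounded_bilinear "(**) :: 'n cmat => 'n cmat => 'n cmat" by (rule bounded_bilinear_matrix)
	show "supported_on_charts At (wedge11 a b)"
		using Omega1D(1)[OF a] Omega1D(1)[OF b] unfolding supported_on_charts_def wedge11_fibre by (metis w.zero_left)
	show "sobolev_family At k (wedge11 a b)" unfolding sobolev_family_iff local_rep_wedge11 proof (intro ballI conjI)
		fix c assume c: "c\<in>At"
		have "wedge11 a b c = (\<lambda>p. wedge_fibre (a c p) (b c p))" by (simp add: fun_eq_iff wedge11_fibre)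
		thus "continuous_on (cdom c) (wedge11 a b c)" using w.continuous_on[OF Omega1D(5)[OF a c] Omega1D(5)[OF b c]] by simp
		show "sobolev_loc k (cimg c) (\<lambda>x. wedge_fibre (local_rep c a x) (local_rep c b x))"
			by (rule bilinear_sobolev_loc[OF bounded_bilinear_wedge_fibre open_cimg[OF c] k Omega1D(6)[OF a c] Omega1D(6)[OF b c]])
	qed
	fix c d p i j assume c: "c\<in>At" and d: "d\<in>At" and p: "p\<in>cdom c \<inter> cdom d"
	note ta = Omega1D(4)[OF a c d, of p] and tb = Omega1D(4)[OF b c d, of p]
	have 1: "a c p $ i ** b c p $ j = (\<Sum>k\<in>UNIV. \<Sum>l\<in>UNIV. (jac c d p $ k $ i * jac c d p $ l $ j) *\<^sub>R (a d p $ k ** b d p $ l))" for i j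
	proof -
		have p': "p\<in>cdom c" "p\<in>cdom d" using p by auto
		show ?thesis unfolding ta[OF p', of i] tb[OF p', of j] m.sum_left m.scaleR_left unfolding m.sum_right m.scaleR_right
			by (simp add: scaleR_sum_right)
	qed
	have "a c p $ j ** b c p $ i = (\<Sum>k\<in>UNIV. \<Sum>l\<in>UNIV. (jac c d p $ k $ i * jac c d p $ l $ j) *\<^sub>R (a d p $ l ** b d p $ k))"
		unfolding 1 by (subst sum.swap) (simp add: mult.commute)
	thus "wedge11 a b c p $ i $ j = (\<Sum>k\<in>UNIV. \<Sum>l\<in>UNIV. (jac c d p $ k $ i * jac c d p $ l $ j) *\<^sub>R wedge11 a b d p $ k $ l)"
		using 1[of i j] by (simp add: wedge11_def scaleR_diff_right sum_subtractf)
qed (auto simp: wedge11_def)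

lemma open_cinv_image: assumes "c\<in>At" "open V" "V\<subseteq>cimg c" shows "open (cinv c ` V)" proof -
	have "cinv c ` V = cdom c \<inter> cmap c -` V" proof (intro subset_antisym subsetI)
		fix p assume "p\<in>cdom c \<inter> cmap c -` V"
		thus "p\<in>cinv c ` V" using chart_simps(1)[OF assms(1), of p] by (intro image_eqI[of _ _ "cmap c p"]) auto
	qed (use assms(3) chart_simps[OF assms(1)] in auto)
	thus ?thesis using continuous_open_preimage[OF continuous_cmap[OF assms(1)] open_cdom[OF assms(1)] assms(2)] by simp
qed

end

section \<open>Finite covers by coordinate balls and the integral pairing\<close>

locale compact_charted = charted At for At :: "'m::t2_space chart set" + assumes compact_M: "compact (UNIV :: 'm set)"
begin

abbreviation chart_ball :: "'m chart\<times>(real^3)\<times>real => (real^3) set" where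
	"chart_ball t \<equiv> ball (fst (snd t)) (snd (snd t))"

abbreviation chart_cball :: "'m chart\<times>(real^3)\<times>real => (real^3) set" where
	"chart_cball t \<equiv> cball (fst (snd t)) (snd (snd t))"

abbreviation patch :: "'m chart\<times>(real^3)\<times>real => 'm set" where
	"patch t \<equiv> cinv (fst t) ` chart_ball t"

lemma finite_patches_ex:
	"\<exists>I. finite I \<and> (\<forall>t\<in>I. fst t\<in>At \<and> 0 < snd (snd t) \<and> chart_cball t\<subseteq>cimg (fst t)) \<and> (\<Union>t\<in>I. patch t) = UNIV"
proof -
	let ?C = "{t. fst t\<in>At \<and> 0 < snd (snd t) \<and> chart_cball t\<subseteq>cimg (fst t)}"
	have op: "open (patch t)" if "t\<in>?C" for t using that by (intro open_cinv_image) (auto intro: order_trans[OF ball_subset_cball])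
	have cov: "UNIV\<subseteq>(\<Union>t\<in>?C. patch t)" proof
		fix p :: 'm
		obtain c where c: "c\<in>At" "p\<in>cdom c" using chart_ex by blast
		obtain e where e: "0 < e" "cball (cmap c p) e\<subseteq>cimg c" using open_cimg[OF c(1)] chart_simps(3)[OF c] open_contains_cball by blast
		have "(c, cmap c p, e)\<in>?C" using c e by simp
		moreover have "p\<in>patch (c, cmap c p, e)" using c e chart_simps(1)[OF c] by (auto intro!: image_eqI[of _ _ "cmap c p"])
		ultimately show "p\<in>(\<Union>t\<in>?C. patch t)" by blast
	qed
	obtain I where "I\<subseteq>?C" "finite I" "UNIV\<subseteq>(\<Union>t\<in>I. patch t)" using compactE_image[OF compact_M op cov] by blast
	thus ?thesis by (intro exI[of _ I]) blast
qed

text \<open>Coordinate balls, encoded as chart, centre and radius, fixed once so that later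
  constants can be taken uniform over them. They are chosen separately from the pieces of the
  integral.\<close>

definition patches :: "('m chart\<times>(real^3)\<times>real) set" where
	"patches = (SOME I. finite I \<and> (\<forall>t\<in>I. fst t\<in>At \<and> 0 < snd (snd t) \<and> chart_cball t\<subseteq>cimg (fst t)) \<and>
		(\<Union>t\<in>I. patch t) = UNIV)"

lemma patches_props: "finite patches \<and> (\<forall>t\<in>patches. fst t\<in>At \<and> 0 < snd (snd t) \<and> chart_cball t\<subseteq>cimg (fst t)) \<and>
		(\<Union>t\<in>patches. patch t) = UNIV" unfolding patches_def by (rule someI_ex[OF finite_patches_ex])

lemma finite_patches: "finite patches" by (rule conjunct1[OF patches_props])

lemma patchesD: assumes "t\<in>patches"
	shows "fst t\<in>At" "0 < snd (snd t)" "chart_cball t\<subseteq>cimg (fst t)" "chart_ball t\<subseteq>cimg (fst t)"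
		"compact (cinv (fst t) ` chart_cball t)" "cinv (fst t) ` chart_cball t\<subseteq>cdom (fst t)" "open (patch t)" proof -
	show t: "fst t\<in>At" "0 < snd (snd t)" "chart_cball t\<subseteq>cimg (fst t)"
		using bspec[OF conjunct1[OF conjunct2[OF patches_props]] assms] by simp_all
	thus b: "chart_ball t\<subseteq>cimg (fst t)" by (intro order_trans[OF ball_subset_cball])
	show "compact (cinv (fst t) ` chart_cball t)"
		by (intro compact_continuous_image continuous_on_subset[OF continuous_cinv[OF t(1)] t(3)] compact_cball)
	show "cinv (fst t) ` chart_cball t\<subseteq>cdom (fst t)" using chart_simps(4)[OF t(1)] t(3) by blast
	show "open (patch t)" by (rule open_cinv_image[OF t(1) open_ball b])
qed

lemma patch_ex: "\<exists>t\<in>patches. p\<in>patch t" proof -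
	have "p\<in>(\<Union>t\<in>patches. patch t)" using patches_props by simp
	thus ?thesis by (simp only: UN_iff)
qed

lemma compact_cover_ex: "\<exists>cs. compact_cover At cs" proof -
	obtain ts where ts: "set ts = patches" using finite_list[OF finite_patches] by blast
	let ?g = "\<lambda>t. (fst t, cinv (fst t) ` chart_cball t)"
	have "compact_cover At (map ?g ts)" unfolding compact_cover_def proof (intro conjI ballI)
		fix u assume "u\<in>set (map ?g ts)"
		then obtain t where u: "u = ?g t" and t: "t\<in>patches" using ts by auto
		show "case u of (c, K) => c\<in>At \<and> compact K \<and> K\<subseteq>cdom c" using patchesD(1,5,6)[OF t] by (simp add: u)
	next
		have "\<exists>u\<in>set (map ?g ts). p\<in>(case u of (c, K) => K)" for p proof -
			obtain t where t: "t\<in>patches" "p\<in>patch t" using patch_ex by blast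
			have "p\<in>cinv (fst t) ` chart_cball t" by (rule subsetD[OF image_mono[OF ball_subset_cball] t(2)])
			thus ?thesis using t(1) ts by (intro bexI[of _ "?g t"]) auto
		qed
		thus "(\<Union>(c, K)\<in>set (map ?g ts). K) = UNIV" by blast
	qed
	thus ?thesis ..
qed

text \<open>The same choice as in \<open>integral3\<close>, so that \<open>pairing_eq\<close> is
  mere unfolding.\<close>

definition cover :: "('m chart\<times>'m set) list" where "cover = (SOME cs. compact_cover At cs)"

definition piece :: "nat => (real^3) set" where
	"piece j = cmap (fst (cover ! j)) ` (snd (cover ! j) - (\<Union>i<j. snd (cover ! i)))"

definition cell :: "nat => (real^3) set" where "cell j = cmap (fst (cover ! j)) ` snd (cover ! j)"

lemma cover_props: assumes "j < length cover"
	shows "fst (cover ! j)\<in>At" "compact (snd (cover ! j))" "snd (cover ! j)\<subseteq>cdom (fst (cover ! j))" proof -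
	have c: "compact_cover At cover" unfolding cover_def using compact_cover_ex by (rule someI_ex)
	have "case cover ! j of (c, K) => c\<in>At \<and> compact K \<and> K\<subseteq>cdom c"
		by (rule bspec[OF conjunct1[OF c[unfolded compact_cover_def]] nth_mem[OF assms]])
	thus "fst (cover ! j)\<in>At" "compact (snd (cover ! j))" "snd (cover ! j)\<subseteq>cdom (fst (cover ! j))"
		by (simp_all add: case_prod_unfold)
qed

lemma cell: assumes j: "j < length cover"
	shows "compact (cell j)" "cell j\<subseteq>cimg (fst (cover ! j))" "piece j\<subseteq>cell j" "piece j\<in>sets borel" proof -
	let ?c = "fst (cover ! j)"
	note c = cover_props[OF j]
	have im: "compact (cmap ?c ` K)" if "compact K" "K\<subseteq>cdom ?c" for K
		using that by (intro compact_continuous_image continuous_on_subset[OF continuous_cmap[OF c(1)]])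
	show "compact (cell j)" unfolding cell_def by (rule im[OF c(2,3)])
	show "cell j\<subseteq>cimg ?c" unfolding cell_def cimg_def using c(3) by blast
	show "piece j\<subseteq>cell j" unfolding cell_def piece_def by blast
	have inj: "inj_on (cmap ?c) (cdom ?c)" using chart_simps(1)[OF c(1)] by (rule inj_on_inverseI)
	\<comment> \<open>Injectivity of the chart carries the set difference over to coordinates,
	  exhibiting the piece as a compact set minus finitely many compact sets, hence Borel.\<close>
	have "piece j = cell j - (\<Union>i<j. cmap ?c ` (snd (cover ! j) \<inter> snd (cover ! i)))"
		unfolding piece_def cell_def using c(3) inj by (auto dest!: inj_onD[OF inj])
	moreover have "compact (cmap ?c ` (snd (cover ! j) \<inter> snd (cover ! i)))" if "i < j" for i
		using c cover_props(2)[of i] that j by (intro im compact_Int) auto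
	ultimately show "piece j\<in>sets borel" using \<open>compact (cell j)\<close>
		by (simp only:) (intro sets.Diff sets.finite_UN finite_lessThan borel_closed compact_imp_closed; simp)
qed

definition local_pairing :: "nat => ('m, 'n::finite) form2 => ('m, 'n) form1 => complex" where
	"local_pairing j \<alpha> a = (LINT x:piece j|lborel. trace_fibre (local_rep (fst (cover ! j)) \<alpha> x) (local_rep (fst (cover ! j)) a x))"

lemma pairing_eq:
	"pairing At \<alpha> a = complex_of_real (1/(24 * pi^3)) * (\<Sum>j<length cover. local_pairing j \<alpha> a)"
	unfolding pairing_def integral_tr_def integral3_def Let_def cover_def[symmetric] trace_wedge21 local_pairing_def piece_def local_rep_def ..

lemma local_pairing_bilinear: assumes j: "j < length cover"
	shows "bilinear_on_sets (Omega2 At k (UNIV :: 'n::finite cmat set)) (Omega1 At k V) (local_pairing j)" proof -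
	let ?c = "fst (cover ! j)"
	interpret t: bounded_bilinear "trace_fibre :: ('n cmat)^3^3 => _ => _" by (rule bounded_bilinear_trace_fibre)
	obtain K where K: "0 \<le> K" "\<And>u v. norm (trace_fibre u v) \<le> norm (u :: ('n cmat)^3^3) * norm v * K" using t.nonneg_bounded by blast
	note c = cover_props(1)[OF j]
	have i: "set_integrable lborel (piece j) (\<lambda>x. trace_fibre (local_rep ?c \<alpha> x) (local_rep ?c a x))"
		if "\<alpha>\<in>Omega2 At k (UNIV :: 'n cmat set)" "a\<in>Omega1 At k V" for \<alpha> a
		by (rule integral_bilinear_bound(1)[OF bounded_bilinear_trace_fibre K open_cimg[OF c] cell(1,2,4,3)[OF j]
					Omega2D(3)[OF that(1) c] Omega1D(7)[OF that(2) c]])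
	show ?thesis unfolding bilinear_on_sets_def linear_on_set_def local_pairing_def local_rep_add local_rep_scaleR
			t.add_left t.add_right t.scaleR_left t.scaleR_right by (simp add: set_integral_add i)
qed

text \<open>Cauchy-Schwarz bounds the integral by L2 norms over the compact cell, and these are
  dominated by the norms of order \<open>k\<close>.\<close>

lemma local_pairing_bound: assumes j: "j < length cover"
	shows "\<exists>K\<ge>0. \<forall>\<alpha>\<in>Omega2 At k (UNIV :: 'n::finite cmat set). \<forall>a\<in>Omega1 At k V. norm (local_pairing j \<alpha> a) \<le>
		K * (sobolev_seminorm k (fst (cover ! j)) (cell j) \<alpha> * sobolev_seminorm k (fst (cover ! j)) (cell j) a)" proof -
	let ?c = "fst (cover ! j)"
	obtain K where K: "0 \<le> K" "\<And>u v. norm (trace_fibre u v) \<le> norm (u :: ('n cmat)^3^3) * norm v * K"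
		using bounded_bilinear.nonneg_bounded[OF bounded_bilinear_trace_fibre] by blast
	note c = cover_props(1)[OF j]
	show ?thesis proof (intro exI[of _ K] conjI ballI K(1))
		fix \<alpha> :: "('m, 'n) form2" and a :: "('m, 'n) form1" assume al: "\<alpha>\<in>Omega2 At k UNIV" and a: "a\<in>Omega1 At k V"
		have "norm (local_pairing j \<alpha> a) \<le> K * (sqrt (sobolev_sq 0 (cimg ?c) (cell j) (local_rep ?c \<alpha>)) * sqrt (sobolev_sq 0 (cimg ?c) (cell j) (local_rep ?c a)))"
			unfolding local_pairing_def by (rule integral_bilinear_bound(2)[OF bounded_bilinear_trace_fibre K open_cimg[OF c] cell(1,2,4,3)[OF j]
					Omega2D(3)[OF al c] Omega1D(7)[OF a c]])
		also have "\<dots> \<le> K * (sobolev_seminorm k ?c (cell j) \<alpha> * sobolev_seminorm k ?c (cell j) a)" unfolding sobolev_seminorm_def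
			by (intro mult_left_mono mult_mono real_sqrt_le_mono sobolev_sq_mono_order[OF open_cimg[OF c] cell(1,2)[OF j] le0]
					Omega2D(4)[OF al c] Omega1D(6)[OF a c] K(1) real_sqrt_ge_zero sobolev_sq_nonneg)
		finally show "norm (local_pairing j \<alpha> a) \<le> K * (sobolev_seminorm k ?c (cell j) \<alpha> * sobolev_seminorm k ?c (cell j) a)" .
	qed
qed

end

section \<open>The trilinear form on Sobolev connections\<close>

definition symmetrized_wedge :: "('n::finite cmat)^3 => ('n cmat)^3 => ('n cmat)^3^3" where
	"symmetrized_wedge u v = wedge_fibre u v - wedge_fibre v u"

lemma bounded_bilinear_symmetrized_wedge: "bounded_bilinear (symmetrized_wedge :: ('n::finite cmat)^3 => _ => _)" proof -
	interpret w: bounded_bilinear "wedge_fibre :: ('n cmat)^3 => _ => _" by (rule bounded_bilinear_wedge_fibre)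
	show ?thesis unfolding bilinear_conv_bounded_bilinear[symmetric] bilinear_def
		by (auto intro!: linearI simp: symmetrized_wedge_def w.add_left w.add_right w.scaleR_left w.scaleR_right scaleR_diff_right)
qed

context compact_charted
begin

context
	fixes s :: nat assumes s: "3 \<le> s"
begin

lemma k: "2 \<le> s - 1" using s by simp

abbreviation "O1 \<equiv> Omega1 At (s - 1) (su :: 'n::finite cmat set)"
abbreviation "O2 \<equiv> Omega2 At (s - 1) (UNIV :: 'n::finite cmat set)"
abbreviation "Z2 \<equiv> sobolev_topology At (s - 1) (O2 :: ('m, 'n::finite) form2 set)"

abbreviation sym_wedge :: "('m, 'n::finite) form1 => ('m, 'n) form1 => ('m, 'n) form2" where
	"sym_wedge A b \<equiv> wedge11 A b - wedge11 b A"

lemma sym_wedge_fibre: "sym_wedge A b c p = symmetrized_wedge (A c p) (b c p)" by (simp add: symmetrized_wedge_def wedge11_fibre)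

lemma local_rep_sym_wedge: "local_rep c (sym_wedge A b) = (\<lambda>x. symmetrized_wedge (local_rep c A x) (local_rep c b x))"
	unfolding local_rep_def sym_wedge_fibre ..

lemma O1_top: "hausdorff_seminorm_topology (O1 :: ('m, 'n::finite) form1 set) (sobolev_seminorms At (s - 1)) (tangent_top At s)"
	unfolding tangent_top_def by (rule seminorm_locale[OF Omega1_subspace[OF subspace_su]]) (auto dest: Omega1D(1,2))

lemma O2_top: "hausdorff_seminorm_topology (O2 :: ('m, 'n::finite) form2 set) (sobolev_seminorms At (s - 1)) Z2"
	by (rule seminorm_locale[OF Omega2_subspace[OF subspace_UNIV]]) (auto dest: Omega2D(1,2))

lemma sym_wedge_in: "A\<in>O1 ==> b\<in>O1 ==> sym_wedge A b\<in>O2"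
	by (intro subspace_diff[OF Omega2_subspace[OF subspace_UNIV]] wedge11_Omega2[OF k])

lemma sym_wedge_bilinear: "bilinear_on_sets O1 O1 (sym_wedge :: ('m, 'n::finite) form1 => _)" proof -
	interpret w: bounded_bilinear "symmetrized_wedge :: ('n cmat)^3 => _ => _" by (rule bounded_bilinear_symmetrized_wedge)
	have "sym_wedge (x + y) z = sym_wedge x z + sym_wedge y z" "sym_wedge (r *\<^sub>R x) z = r *\<^sub>R sym_wedge x z"
		"sym_wedge z (x + y) = sym_wedge z x + sym_wedge z y" "sym_wedge z (r *\<^sub>R x) = r *\<^sub>R sym_wedge z x"
		for x y z :: "('m, 'n) form1" and r
		unfolding fun_eq_iff sym_wedge_fibre plus_fun_apply[of "sym_wedge _ _"] plus_fun_apply[of "sym_wedge _ _ _"]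
			scaleR_fun_def[of r "sym_wedge _ _"] scaleR_fun_def[of r "sym_wedge _ _ _"]
		by (simp_all add: scaleR_fun_def w.add_left w.add_right w.scaleR_left w.scaleR_right)
	thus ?thesis unfolding bilinear_on_sets_def linear_on_set_def by (intro conjI ballI allI)
qed

lemma sym_wedge_bound: assumes p: "p\<in>sobolev_seminorms At (s - 1)"
	shows "\<exists>C p1 p2. 0 \<le> C \<and> p1\<in>sobolev_seminorms At (s - 1) \<and> p2\<in>sobolev_seminorms At (s - 1) \<and>
		(\<forall>x\<in>O1. \<forall>y\<in>O1. p (sym_wedge x (y :: ('m, 'n::finite) form1)) \<le> C * (p1 x * p2 y))" proof -
	obtain c K where c: "p = sobolev_seminorm (s - 1) c K" "c\<in>At" "compact K" "K\<subseteq>cimg c"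
		using p unfolding sobolev_seminorms_def by blast
	let ?S = "cimg c" and ?k = "s - 1"
	obtain C K' where C: "0 \<le> C" "compact K'" "K'\<subseteq>?S" and
		bd: "\<forall>f g. sobolev_loc ?k ?S f \<longrightarrow> sobolev_loc ?k ?S g \<longrightarrow> sobolev_loc ?k ?S (\<lambda>x. symmetrized_wedge (f x) (g x :: ('n cmat)^3)) \<and>
			sobolev_sq ?k ?S K (\<lambda>x. symmetrized_wedge (f x) (g x)) \<le> C * (sobolev_sq ?k ?S K' f * sobolev_sq ?k ?S K' g)"
		using bilinear_sobolev[OF bounded_bilinear_symmetrized_wedge open_cimg[OF c(2)] c(3,4) k] by (elim exE conjE) (rule that)
	let ?p = "sobolev_seminorm ?k c K'"
	show ?thesis proof (rule exI[of _ "sqrt C"], rule exI[of _ ?p], rule exI[of _ ?p], intro conjI ballI)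
		show "0 \<le> sqrt C" using C by simp
		show "?p\<in>sobolev_seminorms At ?k" "?p\<in>sobolev_seminorms At ?k" by (rule sobolev_seminormsI[OF c(2) C(2,3)])+
		fix x y :: "('m, 'n) form1" assume x: "x\<in>O1" and y: "y\<in>O1"
		have "sobolev_sq ?k ?S K (local_rep c (sym_wedge x y)) \<le> C * (sobolev_sq ?k ?S K' (local_rep c x) * sobolev_sq ?k ?S K' (local_rep c y))"
			unfolding local_rep_sym_wedge
			by (rule bd[THEN spec, THEN spec, THEN mp, THEN mp, OF Omega1D(6)[OF x c(2)] Omega1D(6)[OF y c(2)], THEN conjunct2])
		thus "p (sym_wedge x y) \<le> sqrt C * (?p x * ?p y)"
			unfolding c(1) sobolev_seminorm_def real_sqrt_mult[symmetric] by (rule real_sqrt_le_mono)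
	qed
qed

lemma pairing_bilinear:
	"bilinear_on_sets O2 O1 (pairing At :: ('m, 'n::finite) form2 => _)" proof -
	have b: "bilinear_on_sets (O2 :: ('m, 'n) form2 set) O1 (local_pairing j)" if "j < length cover" for j
		by (rule local_pairing_bilinear[OF that])
	show ?thesis unfolding bilinear_on_sets_def linear_on_set_def proof (intro conjI ballI allI)
		fix x x' :: "('m, 'n) form2" and y y' :: "('m, 'n) form1" and r :: real
		assume x: "x\<in>O2" and y: "y\<in>O1"
		show "pairing At (r *\<^sub>R x) y = r *\<^sub>R pairing At x y" "pairing At x (r *\<^sub>R y) = r *\<^sub>R pairing At x y"
			using b x y unfolding pairing_eq bilinear_on_sets_def linear_on_set_def by (simp_all add: scaleR_sum_right[symmetric])
		show "pairing At (x + x') y = pairing At x y + pairing At x' y" if "x'\<in>O2"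
			using b x y that unfolding pairing_eq bilinear_on_sets_def linear_on_set_def by (simp add: sum.distrib distrib_left)
		show "pairing At x (y + y') = pairing At x y + pairing At x y'" if "y'\<in>O1"
			using b x y that unfolding pairing_eq bilinear_on_sets_def linear_on_set_def by (simp add: sum.distrib distrib_left)
	qed
qed

lemma pairing_continuous:
	"continuous_map (prod_topology Z2 (tangent_top At s)) euclidean (\<lambda>(\<alpha> :: ('m, 'n::finite) form2, a). pairing At \<alpha> a)"
proof -
	have h1: "seminorm_topology (O1 :: ('m, 'n) form1 set) (sobolev_seminorms At (s - 1)) (tangent_top At s)"
		and h2: "seminorm_topology (O2 :: ('m, 'n) form2 set) (sobolev_seminorms At (s - 1)) Z2"
		using O1_top O2_top unfolding hausdorff_seminorm_topology_def by blast+
	have c: "continuous_map (prod_topology Z2 (tangent_top At s)) euclidean (\<lambda>(\<alpha> :: ('m, 'n) form2, a). local_pairing j \<alpha> a)"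
		if j: "j < length cover" for j proof -
		obtain K where K: "0 \<le> K" "\<forall>\<alpha>\<in>O2. \<forall>a\<in>O1. norm (local_pairing j (\<alpha> :: ('m, 'n) form2) a) \<le>
			K * (sobolev_seminorm (s - 1) (fst (cover ! j)) (cell j) \<alpha> * sobolev_seminorm (s - 1) (fst (cover ! j)) (cell j) a)"
			using local_pairing_bound[OF j, where k = "s - 1" and V = "su :: 'n cmat set"] by (elim exE conjE) (rule that)
		note sm = sobolev_seminormsI[OF cover_props(1)[OF j] cell(1,2)[OF j]]
		show ?thesis by (rule continuous_map_bilinear_euclidean[OF h2 h1 local_pairing_bilinear[OF j] K(1) sm sm K(2)[THEN bspec, THEN bspec]])
	qed
	have "continuous_map (prod_topology Z2 (tangent_top At s)) euclidean
		(\<lambda>z. complex_of_real (1/(24 * pi^3)) * (\<Sum>j<length cover. case z of (\<alpha> :: ('m, 'n) form2, a) => local_pairing j \<alpha> a))"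
		unfolding continuous_map_atin limitin_canonical_iff
		by (intro ballI tendsto_intros, erule c[unfolded continuous_map_atin limitin_canonical_iff, THEN bspec, rotated]) simp
	thus ?thesis by (simp add: pairing_eq case_prod_unfold)
qed

lemma covector_quotient:
	"quotient_tvs (Z2 :: ('m, 'n::finite) form2 topology) (cotangent_top At s) (covector At s)" proof
	interpret Z: hausdorff_seminorm_topology "O2 :: ('m, 'n) form2 set" "sobolev_seminorms At (s - 1)" Z2 by (rule O2_top)
	show "tvs (Z2 :: ('m, 'n) form2 topology)" by (rule Z.tvs)
	show "linear_on_set (topspace (Z2 :: ('m, 'n) form2 topology)) (covector At s)" unfolding linear_on_set_def Z.topspace_eq
		using pairing_bilinear[where 'n = 'n] unfolding bilinear_on_sets_def linear_on_set_def by (simp add: covector_def fun_eq_iff scaleR_fun_def)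
	show "openin (cotangent_top At s) W \<longleftrightarrow>
		W\<subseteq>covector At s ` topspace Z2 \<and> openin Z2 {x\<in>topspace Z2. covector At s x\<in>W}"
		for W :: "(('m, 'n) form1 => complex) set"
		unfolding cotangent_top_def using openin_quotient_topology[of "covector At s" Z2 "covector At s ` O2" W] unfolding Z.topspace_eq by simp
qed

lemma covector_eq: "a\<in>O1 ==> covector At s \<alpha> a = pairing At \<alpha> a" by (simp add: covector_def)

lemma pairing_cong: assumes "\<And>c p. trace_fibre (\<alpha> c p) (a c p) = r * trace_fibre (\<beta> c p) (b c p)"
	shows "pairing At \<alpha> a = r * pairing At \<beta> b"
	using assms by (simp add: pairing_eq local_pairing_def local_rep_def sum_distrib_left mult.left_commute)

text \<open>Both antisymmetries hold in each fibre and survive integration by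
  \<open>pairing_cong\<close>: the first because exchanging the arguments exchanges the two wedge
  products, the second by \<open>trace_fibre_swap\<close>.\<close>

lemma trilinear_dirac:
	"trilinear_dirac (O1 :: ('m, 'n::finite) form1 set) (sobolev_seminorms At (s - 1)) (tangent_top At s)
		Z2 (cotangent_top At s) (covector At s) sym_wedge" proof -
	interpret X: hausdorff_seminorm_topology "O1 :: ('m, 'n) form1 set" "sobolev_seminorms At (s - 1)" "tangent_top At s" by (rule O1_top)
	interpret Z: hausdorff_seminorm_topology "O2 :: ('m, 'n) form2 set" "sobolev_seminorms At (s - 1)" Z2 by (rule O2_top)
	interpret Y: quotient_tvs "Z2 :: ('m, 'n) form2 topology" "cotangent_top At s" "covector At s" by (rule covector_quotient)
	show ?thesis proof
		show "bilinear_on_sets (O1 :: ('m, 'n) form1 set) O1 sym_wedge" by (rule sym_wedge_bilinear)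
		show "continuous_map (prod_topology (tangent_top At s) (tangent_top At s)) Z2 (\<lambda>(A, b :: ('m, 'n) form1). sym_wedge A b)"
			by (rule continuous_map_bilinear_seminorms[OF X.seminorm_topology_axioms X.seminorm_topology_axioms Z.seminorm_topology_axioms
					sym_wedge_bilinear sym_wedge_in sym_wedge_bound])
		show "bilinear_on_sets (topspace Z2) (O1 :: ('m, 'n) form1 set) (covector At s)"
			unfolding bilinear_on_sets_def linear_on_set_def Z.topspace_eq proof (intro conjI ballI allI)
			note l = pairing_bilinear[where 'n = 'n, unfolded bilinear_on_sets_def linear_on_set_def]
			note Yl = Y.q_linear[unfolded Z.topspace_eq]
			fix x x' :: "('m, 'n) form2" and y y' :: "('m, 'n) form1" and r :: real
			assume x: "x\<in>O2" and y: "y\<in>O1"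
			show "covector At s (r *\<^sub>R x) y = r *\<^sub>R covector At s x y" unfolding Yl(2)[OF x] by (simp add: scaleR_fun_def)
			show "covector At s x (r *\<^sub>R y) = r *\<^sub>R covector At s x y"
				using l x y by (simp only: covector_eq[OF y] covector_eq[OF X.in_F(3)[OF y]])
			show "covector At s (x + x') y = covector At s x y + covector At s x' y" if "x'\<in>O2" by (simp only: Yl(1)[OF x that] plus_fun_apply)
			show "covector At s x (y + y') = covector At s x y + covector At s x y'" if y': "y'\<in>O1"
				using l x y y' by (simp only: covector_eq[OF y] covector_eq[OF y'] covector_eq[OF X.in_F(1)[OF y y']])
		qed
		show "continuous_map (prod_topology Z2 (tangent_top At s)) euclidean (\<lambda>(\<alpha> :: ('m, 'n) form2, a). covector At s \<alpha> a)"
			by (rule continuous_map_eq[OF pairing_continuous]) (auto simp: X.topspace_eq covector_eq)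
		show "covector At s \<alpha> a = 0" if "a\<notin>O1" for \<alpha> and a :: "('m, 'n) form1" using that by (simp add: covector_def)
		fix A b c :: "('m, 'n) form1" assume A: "A\<in>O1" and b: "b\<in>O1" and c: "c\<in>O1"
		have "pairing At (sym_wedge A b) c = (- 1) * pairing At (sym_wedge b A) c" proof (rule pairing_cong)
			fix d p
			interpret t: bounded_bilinear "trace_fibre :: ('n cmat)^3^3 => _ => _" by (rule bounded_bilinear_trace_fibre)
			show "trace_fibre (sym_wedge A b d p) (c d p) = (- 1) * trace_fibre (sym_wedge b A d p) (c d p)"
				unfolding sym_wedge_fibre symmetrized_wedge_def by (simp add: t.diff_left)
		qed
		thus "covector At s (sym_wedge A b) c = - covector At s (sym_wedge b A) c" using c by (simp add: covector_eq)
		have "pairing At (sym_wedge A b) c = (- 1) * pairing At (sym_wedge A c) b" proof (rule pairing_cong)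
			fix d p
			show "trace_fibre (sym_wedge A b d p) (c d p) = (- 1) * trace_fibre (sym_wedge A c d p) (b d p)"
				unfolding sym_wedge_fibre symmetrized_wedge_def trace_fibre_swap[of "A d p" "b d p"] by simp
		qed
		thus "covector At s (sym_wedge A b) c = - covector At s (sym_wedge A c) b" using b c by (simp add: covector_eq)
	qed
qed

lemma twisted_dirac_structure_if_open: assumes U: "openin (tangent_top At s :: ('m, 'n::finite) form1 topology) U"
	shows "twisted_dirac_structure (tangent_top At s) U (cotangent_top At s) (cartan_form At)
		(dirac_bundle At s :: ('m, 'n) form1 => _)" proof -
	interpret D: trilinear_dirac "O1 :: ('m, 'n) form1 set" "sobolev_seminorms At (s - 1)" "tangent_top At s"
		Z2 "cotangent_top At s" "covector At s" sym_wedge by (rule trilinear_dirac)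
	have "D.graph = dirac_bundle At s" unfolding D.graph_def[abs_def] dirac_bundle_def[abs_def] ..
	moreover have "twisted_dirac_structure (tangent_top At s) U (cotangent_top At s) (cartan_form At) D.graph"
	proof (rule D.twisted_dirac_structure_graph[OF U])
		fix A a b c :: "('m, 'n) form1" assume "c\<in>O1"
		\<comment> \<open>1/(8 pi^3) is three times the factor 1/(24 pi^3) of the pairing.\<close>
		have "cartan_form At A a b c = 3 * pairing At (sym_wedge a b) c" by (simp add: cartan_form_def pairing_def)
		thus "cartan_form At A a b c = 3 * covector At s (sym_wedge a b) c" using \<open>c\<in>O1\<close> by (simp add: covector_eq)
	qed
	ultimately show ?thesis by simp
qed

end

end

section \<open>Covariantly constant functions: skewness, norm estimates and regularity\<close>

lemma inner_skew_left: assumes "A\<in>su" shows "f\<bullet>(A ** f) = 0" proof -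
	let ?u = "\<lambda>t j. \<Sum>i\<in>UNIV. \<Sum>k\<in>UNIV. t i k j"
	have A: "A $ j $ i = - cnj (A $ i $ j)" for i j proof -
		have "cnj (A $ i $ j) = - (A $ j $ i)" using assms unfolding su_def by blast
		thus ?thesis by simp
	qed
	define t where "t i k j = (f $ i $ j)\<bullet>(A $ i $ k * f $ k $ j)" for i k j
	\<comment> \<open>For the real inner product on complex entries, exchanging the two indices changes
	  the sign by skew-Hermitian symmetry, so the double sum is its own negative.\<close>
	have anti: "t k i j = - t i k j" for i k j unfolding t_def A[of k i] inner_complex_def by (simp add: algebra_simps)
	have "f\<bullet>(A ** f) = (\<Sum>i\<in>UNIV. \<Sum>j\<in>UNIV. \<Sum>k\<in>UNIV. t i k j)"
		unfolding t_def inner_vec_def matrix_matrix_mult_def by (simp add: inner_sum_right)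
	also have "\<dots> = (\<Sum>j\<in>UNIV. \<Sum>i\<in>UNIV. \<Sum>k\<in>UNIV. t i k j)" by (rule sum.swap)
	also have "\<dots> = 0" proof (rule sum.neutral, rule ballI)
		fix j
		have "(?u t j) = (\<Sum>k\<in>UNIV. \<Sum>i\<in>UNIV. t i k j)" by (rule sum.swap)
		also have "\<dots> = (\<Sum>k\<in>UNIV. \<Sum>i\<in>UNIV. - t k i j)" by (intro sum.cong refl anti)
		also have "\<dots> = - (?u t j)" by (simp add: sum_negf)
		finally show "(?u t j) = 0" by simp
	qed
	finally show ?thesis .
qed

lemma inner_skew_right: assumes "A\<in>su" shows "f\<bullet>(f ** A) = 0" proof -
	let ?u = "\<lambda>t i. \<Sum>j\<in>UNIV. \<Sum>k\<in>UNIV. t i j k"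
	have A: "A $ j $ i = - cnj (A $ i $ j)" for i j proof -
		have "cnj (A $ i $ j) = - (A $ j $ i)" using assms unfolding su_def by blast
		thus ?thesis by simp
	qed
	define t where "t i j k = (f $ i $ j)\<bullet>(f $ i $ k * A $ k $ j)" for i j k
	have anti: "t i k j = - t i j k" for i j k unfolding t_def A[of j k] inner_complex_def by (simp add: algebra_simps)
	have "f\<bullet>(f ** A) = (\<Sum>i\<in>UNIV. \<Sum>j\<in>UNIV. \<Sum>k\<in>UNIV. t i j k)"
		unfolding t_def inner_vec_def matrix_matrix_mult_def by (simp add: inner_sum_right)
	also have "\<dots> = 0" proof (rule sum.neutral, rule ballI)
		fix i
		have "(?u t i) = (\<Sum>k\<in>UNIV. \<Sum>j\<in>UNIV. t i j k)" by (rule sum.swap)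
		also have "\<dots> = (\<Sum>k\<in>UNIV. \<Sum>j\<in>UNIV. - t i k j)" by (intro sum.cong refl anti)
		also have "\<dots> = - (?u t i)" by (simp add: sum_negf)
		finally show "(?u t i) = 0" by simp
	qed
	finally show ?thesis .
qed

lemma ball_derivative_lipschitz:
	fixes f :: "real^3 => 'b::real_normed_vector"
	assumes der: "\<And>x. x\<in>ball z r ==> (f has_derivative (\<lambda>h. \<Sum>i\<in>UNIV. (h $ i) *\<^sub>R G x i)) (at x)"
		and B: "\<And>x i. x\<in>ball z r ==> norm (G x i) \<le> B" and xy: "x\<in>ball z r" "y\<in>ball z r"
	shows "norm (f x - f y) \<le> 3 * B * norm (x - y)" proof (rule differentiable_bound[OF convex_ball _ _ xy(1,2)])
	fix x assume x: "x\<in>ball z r"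
	show "(f has_derivative (\<lambda>h. \<Sum>i\<in>UNIV. (h $ i) *\<^sub>R G x i)) (at x within ball z r)"
		by (rule has_derivative_at_withinI[OF der[OF x]])
	have "0 \<le> B" using B[OF x] norm_ge_zero order_trans by blast
	thus "onorm (\<lambda>h. \<Sum>i\<in>UNIV. (h $ i) *\<^sub>R G x i) \<le> 3 * B" by (intro onorm_bound norm_nth_sum_le B[OF x]) simp
qed

definition bracket :: "'n::finite cmat => 'n cmat => 'n cmat" where
	"bracket X Y = X ** Y - Y ** X"

lemma bounded_bilinear_bracket: "bounded_bilinear (bracket :: 'n::finite cmat => 'n cmat => 'n cmat)"
	unfolding bilinear_conv_bounded_bilinear[symmetric] bilinear_def
	by (auto intro!: linearI simp: bracket_def matrix_bilinear_simps scaleR_diff_right)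

text \<open>The bracket with an element of the Lie algebra is skew, hence does not contribute to the
	derivative of the squared norm.\<close>

lemma inner_bracket: "X\<in>su ==> Y\<bullet>bracket X Y = 0" by (simp add: bracket_def inner_diff_right inner_skew_left inner_skew_right)

text \<open>The bracket term is orthogonal to \<open>f\<close> and drops out of the derivative of
  the squared norm, so only the residual \<open>R\<close> contributes. In the constant 6, the 3
  counts coordinates and the 2 comes from differentiating a square.\<close>

lemma gauge_norm_estimate:
	fixes f :: "real^3 => 'n::finite cmat" and A R :: "real^3 => 3 => 'n cmat"
	assumes der: "\<And>x. x\<in>ball z r ==> (f has_derivative (\<lambda>h. \<Sum>i\<in>UNIV. (h $ i) *\<^sub>R (R x i - bracket (A x i) (f x)))) (at x)"
		and su: "\<And>x i. x\<in>ball z r ==> A x i\<in>su"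
		and b: "\<And>x. x\<in>ball z r ==> norm (f x) \<le> b" and m: "\<And>x i. x\<in>ball z r ==> norm (R x i) \<le> m"
		and xy: "x\<in>ball z r" "y\<in>ball z r"
	shows "\<bar>(norm (f x))\<^sup>2 - (norm (f y))\<^sup>2\<bar> \<le> 6 * b * m * norm (x - y)" proof -
	have d: "((\<lambda>x. f x\<bullet>f x) has_derivative (\<lambda>h. \<Sum>i\<in>UNIV. (h $ i) *\<^sub>R (2 * (f x\<bullet>R x i)))) (at x)" if x: "x\<in>ball z r" for x
		by (rule has_derivative_eq_rhs[OF has_derivative_inner[OF der[OF x] der[OF x]]])
			(simp add: fun_eq_iff inner_sum_right inner_sum_left inner_diff_right inner_diff_left inner_bracket[OF su[OF x]]
				inner_commute[of _ "f x"] sum_distrib_left algebra_simps flip: sum.distrib)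
	have "norm (f x\<bullet>f x - f y\<bullet>f y) \<le> 3 * (2 * (b * m)) * norm (x - y)" proof (rule ball_derivative_lipschitz[OF d _ xy])
		fix x i assume x: "x\<in>ball z r"
		have "\<bar>f x\<bullet>R x i\<bar> \<le> norm (f x) * norm (R x i)" by (rule Cauchy_Schwarz_ineq2)
		also have "\<dots> \<le> b * m" using b[OF x] m[OF x] order_trans[OF norm_ge_zero b[OF x]] by (intro mult_mono) auto
		finally show "norm (2 * (f x\<bullet>R x i)) \<le> 2 * (b * m)" by (simp add: abs_mult)
	qed
	thus ?thesis by (simp add: power2_norm_eq_inner mult.assoc)
qed

lemma L2_loc_continuous_mult:
	fixes u w :: "real^3 => real" assumes S: "open S" and u: "continuous_on S u" and w: "L2_loc S w"
	shows "L2_loc S (\<lambda>x. u x * w x)" proof (rule L2_locI_real)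
	have uL: "L2_loc S u" by (rule L2_loc_continuous[OF S u])
	show "(cut S (\<lambda>x. u x * w x))\<in>borel_measurable borel"
		by (rule indicat_mult_borel[OF L2_loc_borel_real[OF uL] L2_loc_borel_real[OF w]])
	fix K assume K: "compact K" "K\<subseteq>S"
	have "compact (u ` K)" by (rule compact_continuous_image[OF continuous_on_subset[OF u K(2)] K(1)])
	then obtain B where "\<forall>z\<in>u ` K. norm z \<le> B" using compact_imp_bounded bounded_iff by blast
	hence "AE x in lborel. x\<in>K \<longrightarrow> \<bar>u x\<bar> \<le> B" by (intro AE_I2) auto
	thus "L2 (cut K (\<lambda>x. u x * w x))" by (rule L2_mult_Linf(1)[OF uL w K])
qed

text \<open>Order one is below the range of \<open>mult_bounded_on\<close>; continuity, hence local
  boundedness, of both factors takes its place.\<close>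

lemma sobolev_loc_1_mult:
	fixes u v :: "real^3 => real"
	assumes S: "open S" and u: "continuous_on S u" "sobolev_loc (Suc 0) S u" and v: "continuous_on S v" "sobolev_loc (Suc 0) S v"
	shows "sobolev_loc (Suc 0) S (\<lambda>x. u x * v x)" proof -
	obtain u' where u': "\<And>i. weak_pd S i u (u' i)" "\<And>i. L2_loc S (u' i)" by (rule sobolev_locE[OF u(2)]) (rule that, assumption, simp)
	obtain v' where v': "\<And>i. weak_pd S i v (v' i)" "\<And>i. L2_loc S (v' i)" by (rule sobolev_locE[OF v(2)]) (rule that, assumption, simp)
	have L: "L2_loc S u" "L2_loc S v" "L2_loc S (\<lambda>x. u x * v x)" using u v S by (auto intro!: L2_loc_continuous continuous_intros)
	have p: "L2_loc S (\<lambda>x. u' i x * v x + u x * v' i x)" for i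
		using L2_loc_add[OF L2_loc_continuous_mult[OF S v(1) u'(2)] L2_loc_continuous_mult[OF S u(1) v'(2)]] by (simp add: mult.commute)
	show ?thesis by (rule sobolev_locI[OF L(3) weak_pd_mult[OF S u'(1) L(1) u'(2) v'(1) L(2) v'(2)]]) (simp add: p)
qed

lemma sobolev_loc_1_bilinear:
	fixes prod :: "'a::euclidean_space => 'b::euclidean_space => 'c::euclidean_space" assumes P: "bounded_bilinear prod" and S: "open S"
		and f: "continuous_on S f" "sobolev_loc (Suc 0) S f" and g: "continuous_on S g" "sobolev_loc (Suc 0) S g"
	shows "sobolev_loc (Suc 0) S (\<lambda>x. prod (f x) (g x))" proof -
	let ?B = "Basis\<times>Basis :: ('a\<times>'b) set"
	define t where "t p x = ((f x\<bullet>fst p) * (g x\<bullet>snd p)) *\<^sub>R prod (fst p) (snd p)" for p x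
	have t: "sobolev_loc (Suc 0) S (t p)" for p unfolding t_def
		by (intro sobolev_loc_linear[OF bounded_linear_scaleR_left] sobolev_loc_1_mult S continuous_intros f g
				sobolev_loc_linear[OF bounded_linear_inner_left])
	have "sobolev_loc (Suc 0) S (\<lambda>x. \<Sum>p\<in>?B. t p x)"
		by (rule conjunct1[OF sobolev_sum[OF S compact_empty empty_subsetI _ t]]) simp
	moreover have "(\<lambda>x. prod (f x) (g x)) = (\<lambda>x. \<Sum>p\<in>?B. t p x)" unfolding t_def using bilinear_expansion[OF P] by blast
	ultimately show ?thesis by simp
qed

text \<open>Bootstrapping: the weak derivatives of \<open>f\<close> are bilinear in \<open>A\<close>
  and \<open>f\<close>, so they inherit regularity of every order \<open>j\<close> up to
  \<open>k\<close>, and \<open>f\<close> gains one order. The products are treated separately for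
  orders 0, 1 and at least 2.\<close>

lemma gauge_regularity:
	fixes f :: "real^3 => 'n::finite cmat" and A :: "real^3 => ('n cmat)^3"
	assumes S: "open S" and f: "continuous_on S f" and A: "continuous_on S A" "sobolev_loc k S A" and k: "2 \<le> k"
		and w: "\<And>i. weak_pd S i f (\<lambda>x. - bracket (A x $ i) (f x))" shows "sobolev_loc (Suc k) S f" proof -
	have br: "bounded_bilinear (\<lambda>(v :: ('n cmat)^3) (X :: 'n cmat). - bracket (v $ i) X)" for i proof -
		interpret b: bounded_bilinear "bracket :: 'n cmat => 'n cmat => 'n cmat" by (rule bounded_bilinear_bracket)
		show ?thesis unfolding bilinear_conv_bounded_bilinear[symmetric] bilinear_def
			by (auto intro!: linearI simp: b.add_left b.add_right b.scaleR_left b.scaleR_right)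
	qed
	have *: "j \<le> Suc k ==> sobolev_loc j S f" for j proof (induction j)
		case 0
		show ?case using L2_loc_continuous[OF S f] by simp
	next
		case (Suc j)
		hence IH: "sobolev_loc j S f" and j: "j \<le> k" by auto
		have "sobolev_loc j S (\<lambda>x. - bracket (A x $ i) (f x))" for i proof -
			consider "j = 0" | "j = Suc 0" | "2 \<le> j" by linarith
			thus ?thesis proof cases
				case 1
				thus ?thesis using L2_loc_continuous[OF S bounded_bilinear.continuous_on[OF br A(1) f]] by simp
			next
				case 2
				have "sobolev_loc (Suc 0) S A" by (rule sobolev_loc_mono[OF _ A(2)]) (use k in simp)
				thus ?thesis unfolding 2 using sobolev_loc_1_bilinear[OF br S A(1) _ f] IH 2 by simp
			next
				case 3
				show ?thesis by (rule bilinear_sobolev_loc[OF br S 3 sobolev_loc_mono[OF j A(2)] IH])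
			qed
		qed
		thus ?case by (rule sobolev_locI[OF L2_loc_continuous[OF S f] w])
	qed
	show ?thesis by (rule *[OF order_refl])
qed

lemma test_integral_limit:
	fixes F :: "nat => real^3 => 'b::euclidean_space"
	assumes S: "open S" and \<psi>: "continuous_on UNIV \<psi>" "compact K" "K\<subseteq>S" "\<And>x. x\<notin>K ==> \<psi> x = 0"
		and F: "\<And>n. continuous_on S (F n)" "continuous_on S G" "\<And>x. x\<in>S ==> (\<lambda>n. F n x) \<longlonglongrightarrow> G x"
		and b: "\<And>n x. x\<in>K ==> norm (F n x) \<le> b"
	shows "(\<lambda>n. LINT x:S|lborel. \<psi> x *\<^sub>R F n x) \<longlonglongrightarrow> (LINT x:S|lborel. \<psi> x *\<^sub>R G x)"
	unfolding set_lebesgue_integral_def proof (rule integral_dominated_convergence)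
	have m: "(\<lambda>x. indicat_real S x *\<^sub>R (\<psi> x *\<^sub>R H x))\<in>borel_measurable lborel" if "continuous_on S H" for H :: "real^3 => 'b"
		using borel_measurable_continuous_on_indicator[of S "\<lambda>x. \<psi> x *\<^sub>R H x"] S that continuous_on_subset[OF \<psi>(1), of S]
		by (simp add: continuous_on_scaleR)
	show "(\<lambda>x. indicat_real S x *\<^sub>R (\<psi> x *\<^sub>R G x))\<in>borel_measurable lborel"
		"\<And>n. (\<lambda>x. indicat_real S x *\<^sub>R (\<psi> x *\<^sub>R F n x))\<in>borel_measurable lborel" by (intro m F)+
	have "integrable lborel \<psi>" by (rule integrable_continuous_compact_support[OF \<psi>(1,2,4)])
	thus "integrable lborel (\<lambda>x. b * norm (\<psi> x))" by simp
	show "AE x in lborel. (\<lambda>n. indicat_real S x *\<^sub>R (\<psi> x *\<^sub>R F n x)) \<longlonglongrightarrow> indicat_real S x *\<^sub>R (\<psi> x *\<^sub>R G x)"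
		by (intro AE_I2) (auto simp: indicator_def intro!: tendsto_intros F)
	show "AE x in lborel. norm (indicat_real S x *\<^sub>R (\<psi> x *\<^sub>R F n x)) \<le> b * norm (\<psi> x)" for n proof (rule AE_I2)
		fix x
		show "norm (indicat_real S x *\<^sub>R (\<psi> x *\<^sub>R F n x)) \<le> b * norm (\<psi> x)"
			using b[of x n] \<psi>(3,4) mult_right_mono[of "norm (F n x)" b "\<bar>\<psi> x\<bar>"] by (cases "x\<in>K") (auto simp: mult.commute)
	qed
qed

lemma finite_uniform_bound:
	fixes P :: "'a => real => bool"
	assumes "finite I" "\<And>i. i\<in>I ==> \<exists>B\<ge>0. P i B" and mono: "\<And>i B B'. P i B ==> B \<le> B' ==> P i B'"
	shows "\<exists>B\<ge>0. \<forall>i\<in>I. P i B" proof -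
	have "\<forall>i\<in>I. \<exists>B. 0 \<le> B \<and> P i B" using assms(2) by blast
	then obtain B where B: "\<And>i. i\<in>I ==> 0 \<le> B i \<and> P i (B i)" by (auto dest!: bchoice)
	show ?thesis proof (intro exI[of _ "\<Sum>i\<in>I. B i"] conjI ballI)
		show "0 \<le> (\<Sum>i\<in>I. B i)" using B by (intro sum_nonneg) blast
		fix i assume i: "i\<in>I"
		have "B i \<le> (\<Sum>i\<in>I. B i)" using B by (intro member_le_sum[OF i _ assms(1)]) blast
		thus "P i (\<Sum>i\<in>I. B i)" using B[OF i] mono by blast
	qed
qed

lemma bounded_on_compact:
	fixes f :: "'a::topological_space => 'b::real_normed_vector" assumes "compact K" "continuous_on K f"
	shows "\<exists>B\<ge>0. \<forall>x\<in>K. norm (f x) \<le> B" proof -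
	have "bounded (f ` K)" by (rule compact_imp_bounded[OF compact_continuous_image[OF assms(2,1)]])
	then obtain B where "0 < B" "\<forall>y\<in>f ` K. norm y \<le> B" using bounded_pos by blast
	thus ?thesis by (intro exI[of _ B]) auto
qed

lemma norm_matrix_bound: "\<exists>K\<ge>0. \<forall>X Y :: 'n::finite cmat. norm (bracket X Y) \<le> norm X * norm Y * K"
	using bounded_bilinear.nonneg_bounded[OF bounded_bilinear_bracket] by blast

lemma closed_su: "closed (su :: 'n::finite cmat set)" by (rule closed_subspace[OF subspace_su])

section \<open>Uniform control on charts and parallel sections\<close>

context charted
begin

lemma jac_pd: assumes c: "c\<in>At" and x: "x\<in>cimg c" shows "jac c d (cinv c x) $ k $ i = pd i (\<lambda>x. cmap d (cinv c x)) x $ k"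
	by (simp add: jac_def matrix_def pd_def chart_simps(2)[OF c x])

lemma jac_continuous: assumes c: "c\<in>At" and d: "d\<in>At"
	shows "continuous_on (cmap c ` (cdom c \<inter> cdom d)) (\<lambda>x. jac c d (cinv c x) $ k $ i)" proof -
	let ?u = "\<lambda>x. cmap d (cinv c x)"
	let ?O = "cmap c ` (cdom c \<inter> cdom d)"
	have "smooth3 ?O ?u" using atlasD[THEN conjunct2, THEN conjunct2, THEN conjunct1] c d by blast
	hence "Ck (Suc 0) ?O ?u" unfolding smooth3_def by blast
	hence "continuous_on ?O (pd i ?u)" unfolding Ck_Suc by simp
	hence "continuous_on ?O (\<lambda>x. pd i ?u x $ k)" by (intro continuous_intros)
	moreover have "?O\<subseteq>cimg c" unfolding cimg_def by blast
	ultimately show ?thesis by (subst continuous_on_cong[OF refl jac_pd[OF c]]) auto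
qed

end

context compact_charted
begin

text \<open>Uniform bounds in the finitely many chart balls of the cover are bounds on all compact subsets
	of all charts.\<close>

lemma chart_bound: assumes c: "c\<in>At" and K: "compact K" "K\<subseteq>cimg c"
	shows "\<exists>B\<ge>0. \<forall>\<omega>\<in>Omega1 At k (V :: 'n::finite cmat set). \<forall>m.
		(\<forall>t\<in>patches. \<forall>y\<in>chart_cball t. norm (local_rep (fst t) \<omega> y) \<le> m) \<longrightarrow> (\<forall>y\<in>K. norm (local_rep c \<omega> y) \<le> B * m)"
proof -
	have J: "\<exists>B\<ge>0. \<forall>y\<in>K. cinv c y\<in>cinv (fst t) ` chart_cball t \<longrightarrow> (\<forall>k i. \<bar>jac c (fst t) (cinv c y) $ k $ i\<bar> \<le> B)"
		if t: "t\<in>patches" for t proof -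
		let ?d = "fst t" and ?C = "cinv (fst t) ` chart_cball t"
		\<comment> \<open>The part of \<open>K\<close> lying in the closed patch is compact and inside the
		  overlap of both charts, where the Jacobian is continuous.\<close>
		let ?K = "K \<inter> cinv c -` ?C"
		have "closed ?K" by (rule continuous_closed_preimage[OF continuous_on_subset[OF continuous_cinv[OF c] K(2)] compact_imp_closed[OF K(1)]
					compact_imp_closed[OF patchesD(5)[OF t]]])
		hence cK: "compact ?K" using compact_Int_closed[OF K(1), of ?K] by (simp add: Int_absorb1)
		have sub: "?K\<subseteq>cmap c ` (cdom c \<inter> cdom ?d)" proof
			fix y assume y: "y\<in>?K"
			hence "cmap c (cinv c y) = y" "cinv c y\<in>cdom c" using chart_simps(2,4)[OF c] K(2) by auto
			moreover have "cinv c y\<in>cdom ?d" using y patchesD(6)[OF t] by blast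
			ultimately show "y\<in>cmap c ` (cdom c \<inter> cdom ?d)" by (metis IntI image_eqI)
		qed
		have "\<exists>B\<ge>0. \<forall>ki\<in>UNIV. \<forall>y\<in>?K. \<bar>jac c ?d (cinv c y) $ fst ki $ snd ki\<bar> \<le> B"
		proof (rule finite_uniform_bound)
			show "\<exists>B\<ge>0. \<forall>y\<in>?K. \<bar>jac c ?d (cinv c y) $ fst ki $ snd ki\<bar> \<le> B" for ki
				using bounded_on_compact[OF cK continuous_on_subset[OF jac_continuous[OF c patchesD(1)[OF t]] sub], of "fst ki" "snd ki"] by simp
		qed (auto intro: order_trans)
		then obtain B where B: "0 \<le> B" "\<And>ki y. y\<in>?K ==> \<bar>jac c ?d (cinv c y) $ fst ki $ snd ki\<bar> \<le> B" by blast
		show ?thesis proof (intro exI[of _ B] conjI ballI impI allI B(1))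
			fix y k i assume "y\<in>K" "cinv c y\<in>?C"
			thus "\<bar>jac c ?d (cinv c y) $ k $ i\<bar> \<le> B" using B(2)[of y "(k, i)"] by simp
		qed
	qed
	have "\<exists>B\<ge>0. \<forall>t\<in>patches. \<forall>y\<in>K. cinv c y\<in>cinv (fst t) ` chart_cball t \<longrightarrow> (\<forall>k i. \<bar>jac c (fst t) (cinv c y) $ k $ i\<bar> \<le> B)"
		by (rule finite_uniform_bound[OF finite_patches J]) (auto intro: order_trans)
	then obtain B where B: "0 \<le> B" "\<And>t y k i. t\<in>patches ==> y\<in>K ==> cinv c y\<in>cinv (fst t) ` chart_cball t ==>
		\<bar>jac c (fst t) (cinv c y) $ k $ i\<bar> \<le> B" by blast
	\<comment> \<open>9 = 3 * 3: three terms in the transformation law and three components of the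
	  form.\<close>
	show ?thesis proof (intro exI[of _ "9 * B"] conjI ballI allI impI)
		fix \<omega> :: "('m, 'n) form1" and m y
		assume w: "\<omega>\<in>Omega1 At k V" and m: "\<forall>t\<in>patches. \<forall>y\<in>chart_cball t. norm (local_rep (fst t) \<omega> y) \<le> m" and y: "y\<in>K"
		let ?p = "cinv c y"
		have p: "?p\<in>cdom c" using chart_simps(4)[OF c] K(2) y by blast
		obtain t z where t: "t\<in>patches" and z: "z\<in>chart_ball t" "?p = cinv (fst t) z" using patch_ex[of ?p] by blast
		have z': "z\<in>chart_cball t" using z(1) ball_subset_cball by blast
		have pt: "?p\<in>cinv (fst t) ` chart_cball t" using z(2) z' by blast
		have pd: "?p\<in>cdom (fst t)" using patchesD(6)[OF t] pt by blast
		have n: "norm (\<omega> (fst t) ?p) \<le> m" using m t z' z(2) by (simp add: local_rep_def)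
		have i: "norm (\<omega> c ?p $ i) \<le> 3 * (B * m)" for i proof -
			have "norm (\<omega> c ?p $ i) \<le> (\<Sum>k\<in>UNIV. norm ((jac c (fst t) ?p $ k $ i) *\<^sub>R (\<omega> (fst t) ?p $ k)))"
				unfolding Omega1D(4)[OF w c patchesD(1)[OF t] p pd, of i] by (rule norm_sum)
			also have "\<dots> \<le> (\<Sum>k\<in>(UNIV :: 3 set). B * m)" proof (rule sum_mono)
				fix k
				have "norm (\<omega> (fst t) ?p $ k) \<le> m" by (rule order_trans[OF Finite_Cartesian_Product.norm_nth_le n])
				thus "norm ((jac c (fst t) ?p $ k $ i) *\<^sub>R (\<omega> (fst t) ?p $ k)) \<le> B * m"
					using B(2)[OF t y pt, of k i] B(1) by (simp add: mult_mono)
			qed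
			finally show ?thesis by simp
		qed
		have "norm (\<omega> c ?p) \<le> (\<Sum>i\<in>UNIV. norm (\<omega> c ?p $ i))" by (subst norm_vec_def) (rule L2_set_le_sum, simp)
		also have "\<dots> \<le> (\<Sum>i\<in>(UNIV :: 3 set). 3 * (B * m))" by (intro sum_mono i)
		finally show "norm (local_rep c \<omega> y) \<le> 9 * B * m" by (simp add: local_rep_def)
	qed (use B in simp)
qed

text \<open>Through the Sobolev embedding, convergence in the tangent topology becomes uniform
  convergence on the finitely many patches. The seminorm depends on the patch, the constant does
  not.\<close>

lemma patch_bound: assumes "2 \<le> k" shows "\<exists>C q. 0 \<le> C \<and> (\<forall>t\<in>patches. q t\<in>sobolev_seminorms At k) \<and>
		(\<forall>\<omega>\<in>Omega1 At k (V :: 'n::finite cmat set). \<forall>t\<in>patches. \<forall>y\<in>chart_cball t. norm (local_rep (fst t) \<omega> y) \<le> C * q t \<omega>)"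
proof -
	let ?u = "\<lambda>t \<omega> y. local_rep (fst t) \<omega> y"
	have "\<exists>C K'. 0 \<le> C \<and> compact K' \<and> K'\<subseteq>cimg (fst t) \<and> (\<forall>\<omega>\<in>Omega1 At k V. \<forall>y\<in>chart_cball t.
		norm (?u t \<omega> y) \<le> C * sobolev_seminorm k (fst t) K' \<omega>)" if t: "t\<in>patches" for t proof -
		note S = open_cimg[OF patchesD(1)[OF t]]
		obtain C K' where C: "0 \<le> C" "compact K'" "K'\<subseteq>cimg (fst t)" "\<forall>f :: real^3 => ('n cmat)^3.
			sobolev_loc 2 (cimg (fst t)) f \<longrightarrow> continuous_on (cimg (fst t)) f \<longrightarrow>
			(\<forall>x\<in>chart_cball t. norm (f x) \<le> C * sqrt (sobolev_sq 2 (cimg (fst t)) K' f))"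
			using sobolev_sup_bound[OF S compact_cball patchesD(3)[OF t]] by (elim exE conjE) (rule that)
		show ?thesis proof (intro exI[of _ C] exI[of _ K'] conjI ballI C)
			fix \<omega> :: "('m, 'n) form1" and y assume w: "\<omega>\<in>Omega1 At k V" and y: "y\<in>chart_cball t"
			note wk = Omega1D(6)[OF w patchesD(1)[OF t]] and wc = Omega1D(7)[OF w patchesD(1)[OF t]]
			have "norm (?u t \<omega> y) \<le> C * sqrt (sobolev_sq 2 (cimg (fst t)) K' (local_rep (fst t) \<omega>))"
				by (rule C(4)[THEN spec, THEN mp, THEN mp, THEN bspec, OF sobolev_loc_mono[OF assms wk] wc y])
			also have "\<dots> \<le> C * sobolev_seminorm k (fst t) K' \<omega>"
				unfolding sobolev_seminorm_def by (intro mult_left_mono real_sqrt_le_mono sobolev_sq_mono_order[OF S C(2,3) assms wk] C(1))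
			finally show "norm (?u t \<omega> y) \<le> C * sobolev_seminorm k (fst t) K' \<omega>" .
		qed
	qed
	hence "\<forall>t\<in>patches. \<exists>CK. 0 \<le> fst CK \<and> compact (snd CK) \<and> snd CK\<subseteq>cimg (fst t) \<and> (\<forall>\<omega>\<in>Omega1 At k V. \<forall>y\<in>chart_cball t.
		norm (?u t \<omega> y) \<le> fst CK * sobolev_seminorm k (fst t) (snd CK) \<omega>)" by (metis fst_conv snd_conv)
	from bchoice[OF this] obtain CK where CK: "\<forall>t\<in>patches. 0 \<le> fst (CK t) \<and> compact (snd (CK t)) \<and> snd (CK t)\<subseteq>cimg (fst t) \<and>
		(\<forall>\<omega>\<in>Omega1 At k V. \<forall>y\<in>chart_cball t. norm (?u t \<omega> y) \<le> fst (CK t) * sobolev_seminorm k (fst t) (snd (CK t)) \<omega>)" ..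
	let ?q = "\<lambda>t. sobolev_seminorm k (fst t) (snd (CK t))" and ?C = "\<Sum>t\<in>patches. fst (CK t)"
	show ?thesis proof (rule exI[of _ ?C], rule exI[of _ ?q], intro conjI ballI)
		show "0 \<le> ?C" using CK by (intro sum_nonneg) blast
		show "?q t\<in>sobolev_seminorms At k" if "t\<in>patches" for t using CK that by (intro sobolev_seminormsI patchesD(1)) auto
		fix \<omega> :: "('m, 'n) form1" and t y assume w: "\<omega>\<in>Omega1 At k V" and t: "t\<in>patches" and y: "y\<in>chart_cball t"
		have "norm (?u t \<omega> y) \<le> fst (CK t) * ?q t \<omega>" using CK t w y by blast
		also have "\<dots> \<le> ?C * ?q t \<omega>"
			using CK by (intro mult_right_mono member_le_sum[OF t _ finite_patches]) (auto simp: sobolev_seminorm_def sobolev_sq_nonneg)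
		finally show "norm (?u t \<omega> y) \<le> ?C * ?q t \<omega>" .
	qed
qed

text \<open>Continuity is the regularity demanded, since this is what a limit of such sections
  provides; the Sobolev order is recovered by \<open>gauge_regularity\<close>.\<close>

definition parallel :: "('m, 'n::finite) form1 => ('m => 'n cmat) => bool" where
	"parallel A \<xi> \<longleftrightarrow> continuous_on UNIV \<xi> \<and> (\<forall>p. \<xi> p\<in>su) \<and> covariantly_constant At A \<xi>"

lemma covariantly_constant_bracket:
	"covariantly_constant At A \<xi> \<longleftrightarrow>
		(\<forall>c\<in>At. \<forall>i. weak_pd (cimg c) i (\<lambda>x. \<xi> (cinv c x)) (\<lambda>x. - bracket (local_rep c A x $ i) (\<xi> (cinv c x))))"
	by (simp add: covariantly_constant_def bracket_def local_rep_def)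

lemma parallel_local_continuous: assumes "continuous_on UNIV \<xi>" "c\<in>At" shows "continuous_on (cimg c) (\<lambda>x. \<xi> (cinv c x))"
	by (rule continuous_on_compose2[OF assms(1) continuous_cinv[OF assms(2)]]) simp

lemma bracket_continuous: assumes A: "A\<in>Omega1 At k V" and \<xi>: "continuous_on UNIV \<xi>" and c: "c\<in>At"
	shows "continuous_on (cimg c) (\<lambda>x. - bracket (local_rep c A x $ i) (\<xi> (cinv c x)))"
	by (intro continuous_intros bounded_bilinear.continuous_on[OF bounded_bilinear_bracket] parallel_local_continuous[OF \<xi> c]
			Omega1D(7)[OF A c])

text \<open>The weak derivative is a bracket of continuous functions, so \<open>weak_C1\<close>
  makes it a classical one.\<close>

lemma parallel_derivative: assumes A: "A\<in>Omega1 At k V" and \<xi>: "parallel A \<xi>" and c: "c\<in>At" and x: "x\<in>cimg c"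
	shows "((\<lambda>x. \<xi> (cinv c x)) has_derivative
		(\<lambda>h. \<Sum>i\<in>UNIV. (h $ i) *\<^sub>R (- bracket (local_rep c A x $ i) (\<xi> (cinv c x))))) (at x)"
proof (rule weak_C1[OF open_cimg[OF c] _ _ _ x])
	have cont: "continuous_on UNIV \<xi>" using \<xi> by (simp add: parallel_def)
	show "continuous_on (cimg c) (\<lambda>x. \<xi> (cinv c x))" by (rule parallel_local_continuous[OF cont c])
	show "continuous_on (cimg c) (\<lambda>x. - bracket (local_rep c A x $ i) (\<xi> (cinv c x)))" for i by (rule bracket_continuous[OF A cont c])
	show "weak_pd (cimg c) i (\<lambda>x. \<xi> (cinv c x)) (\<lambda>x. - bracket (local_rep c A x $ i) (\<xi> (cinv c x)))" for i
		using \<xi> c unfolding parallel_def covariantly_constant_bracket by blast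
qed

lemma parallel_scaleR: assumes A: "A\<in>Omega1 At k V" and \<xi>: "parallel A \<xi>"
	shows "parallel A (\<lambda>p. r *\<^sub>R \<xi> p)" unfolding parallel_def covariantly_constant_bracket proof (intro conjI ballI allI)
	have cont: "continuous_on UNIV \<xi>" using \<xi> by (simp add: parallel_def)
	thus "continuous_on UNIV (\<lambda>p. r *\<^sub>R \<xi> p)" by (intro continuous_intros)
	show "r *\<^sub>R \<xi> p\<in>su" for p by (rule subspace_scale[OF subspace_su]) (use \<xi> in \<open>simp add: parallel_def\<close>)
	fix c i assume c: "c\<in>At"
	have w: "weak_pd (cimg c) i (\<lambda>x. \<xi> (cinv c x)) (\<lambda>x. - bracket (local_rep c A x $ i) (\<xi> (cinv c x)))"
		using \<xi> c unfolding parallel_def covariantly_constant_bracket by blast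
	have "weak_pd (cimg c) i (\<lambda>x. r *\<^sub>R \<xi> (cinv c x)) (\<lambda>x. r *\<^sub>R (- bracket (local_rep c A x $ i) (\<xi> (cinv c x))))"
		by (rule weak_pd_linear[OF w L2_loc_continuous[OF open_cimg[OF c] parallel_local_continuous[OF cont c]]
				L2_loc_continuous[OF open_cimg[OF c] bracket_continuous[OF A cont c]] bounded_linear_scaleR_right])
	thus "weak_pd (cimg c) i (\<lambda>x. r *\<^sub>R \<xi> (cinv c x)) (\<lambda>x. - bracket (local_rep c A x $ i) (r *\<^sub>R \<xi> (cinv c x)))"
		by (simp add: bounded_bilinear.scaleR_right[OF bounded_bilinear_bracket])
qed

lemma patch_continuous: assumes t: "t\<in>patches" and f: "continuous_on (chart_ball t) (\<lambda>x. \<xi> (cinv (fst t) x))"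
	shows "continuous_on (patch t) \<xi>" proof -
	note c = patchesD(1)[OF t]
	have sub: "patch t\<subseteq>cdom (fst t)" using chart_simps(4)[OF c] patchesD(4)[OF t] by blast
	have "continuous_on (patch t) (\<lambda>p. \<xi> (cinv (fst t) (cmap (fst t) p)))"
		by (rule continuous_on_compose2[OF f continuous_on_subset[OF continuous_cmap[OF c] sub]])
			(use chart_simps(2)[OF c] patchesD(4)[OF t] in auto)
	thus ?thesis by (rule continuous_on_eq) (use chart_simps(1)[OF c] sub in auto)
qed

lemma continuous_on_patches: assumes "\<And>t. t\<in>patches ==> continuous_on (patch t) \<xi>" shows "continuous_on UNIV \<xi>" proof -
	have "continuous_on (\<Union>t\<in>patches. patch t) \<xi>" by (intro continuous_on_open_UN patchesD(7) assms)
	thus ?thesis using patches_props by simp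
qed

lemma Omega0_continuous: assumes "\<xi>\<in>Omega0 At k V" shows "continuous_on UNIV \<xi>" proof (rule continuous_on_patches)
	fix t assume t: "t\<in>patches"
	have "continuous_on (cdom (fst t)) \<xi>" using assms patchesD(1)[OF t] unfolding Omega0_def sobolev_family_def by blast
	moreover have "patch t\<subseteq>cdom (fst t)" using chart_simps(4)[OF patchesD(1)[OF t]] patchesD(4)[OF t] by blast
	ultimately show "continuous_on (patch t) \<xi>" by (rule continuous_on_subset)
qed

text \<open>One order is gained over the connection, which matches the orders \<open>s - 1\<close>
  of connections and \<open>s\<close> of sections in the definition of irreducibility.\<close>

lemma parallel_Omega0: assumes k: "2 \<le> k" and A: "A\<in>Omega1 At k V" and \<xi>: "parallel A \<xi>"
	shows "\<xi>\<in>Omega0 At (Suc k) su" proof -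
	have cont: "continuous_on UNIV \<xi>" using \<xi> by (simp add: parallel_def)
	have "sobolev_loc (Suc k) (cimg c) (\<lambda>x. \<xi> (cinv c x))" if c: "c\<in>At" for c
		by (rule gauge_regularity[OF open_cimg[OF c] parallel_local_continuous[OF cont c] Omega1D(7,6)[OF A c] k])
			(use \<xi> c in \<open>unfold parallel_def covariantly_constant_bracket, blast\<close>)
	moreover have "continuous_on (cdom c) \<xi>" for c :: "'m chart" using cont by (rule continuous_on_subset) simp
	ultimately show ?thesis using \<xi> unfolding Omega0_def sobolev_family_def parallel_def by blast
qed

end

context compact_charted
begin

text \<open>The difference of the two brackets is regrouped as [A - B, \<eta>] +
  [A, \<xi> - \<eta>]: the second is skew in the difference of the sections, the first is the
  residual for \<open>gauge_norm_estimate\<close>.\<close>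

lemma parallel_difference_derivative:
	fixes A B :: "('m, 'n::finite) form1" assumes A: "A\<in>Omega1 At k V" "parallel A \<xi>" and B: "B\<in>Omega1 At k V" "parallel B \<eta>"
		and c: "c\<in>At" and x: "x\<in>cimg c"
	shows "((\<lambda>x. \<xi> (cinv c x) - \<eta> (cinv c x)) has_derivative (\<lambda>h. \<Sum>i\<in>UNIV. (h $ i) *\<^sub>R
		(- bracket (local_rep c (A - B) x $ i) (\<eta> (cinv c x)) - bracket (local_rep c A x $ i) (\<xi> (cinv c x) - \<eta> (cinv c x))))) (at x)"
proof -
	interpret b: bounded_bilinear "bracket :: 'n cmat => 'n cmat => 'n cmat" by (rule bounded_bilinear_bracket)
	show ?thesis by (rule has_derivative_eq_rhs[OF has_derivative_diff[OF parallel_derivative[OF A c x] parallel_derivative[OF B c x]]])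
			(simp add: fun_eq_iff local_rep_diff b.diff_left b.diff_right scaleR_diff_right sum_subtractf sum_negf)
qed

text \<open>Only the difference of the connections can change the distance between the sections
  across a patch. 24 = 6 * 2 * 2: the 6 of \<open>gauge_norm_estimate\<close>, the bound
  \<open>2 * b\<close> on the difference, and the diameter of the ball as twice its radius.\<close>

lemma patch_estimate:
	fixes A B :: "('m, 'n::finite) form1" assumes A: "A\<in>Omega1 At k su" "parallel A \<xi>" and B: "B\<in>Omega1 At k su" "parallel B \<eta>"
		and K: "0 \<le> K" "\<And>X Y :: 'n cmat. norm (bracket X Y) \<le> norm X * norm Y * K"
		and b: "\<And>p. norm (\<xi> p) \<le> b" "\<And>p. norm (\<eta> p) \<le> b"
		and t: "t\<in>patches" and m: "\<And>y. y\<in>chart_cball t ==> norm (local_rep (fst t) (A - B) y) \<le> m"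
		and pq: "p\<in>patch t" "q\<in>patch t"
	shows "\<bar>(norm (\<xi> p - \<eta> p))\<^sup>2 - (norm (\<xi> q - \<eta> q))\<^sup>2\<bar> \<le> 24 * b * (m * b * K) * snd (snd t)"
proof -
	let ?c = "fst t" and ?z = "fst (snd t)" and ?r = "snd (snd t)"
	note c = patchesD(1)[OF t]
	obtain x y where x: "x\<in>chart_ball t" "p = cinv ?c x" and y: "y\<in>chart_ball t" "q = cinv ?c y" using pq by blast
	have b0: "0 \<le> b" using order_trans[OF norm_ge_zero b(1)] .
	have m0: "0 \<le> m" using m[of ?z] patchesD(2)[OF t] by (intro order_trans[OF norm_ge_zero m[of ?z]]) simp
	have xy: "norm (x - y) \<le> 2 * ?r" using norm_triangle_ineq4[of "x - ?z" "y - ?z"] x(1) y(1) by (simp add: dist_norm norm_minus_commute)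
	have "\<bar>(norm (\<xi> (cinv ?c x) - \<eta> (cinv ?c x)))\<^sup>2 - (norm (\<xi> (cinv ?c y) - \<eta> (cinv ?c y)))\<^sup>2\<bar> \<le> 6 * (2 * b) * (m * b * K) * norm (x - y)"
	proof (rule gauge_norm_estimate[OF parallel_difference_derivative[OF A B c] _ _ _ x(1) y(1)])
		fix u assume u: "u\<in>ball ?z ?r"
		show uc: "u\<in>cimg ?c" using u patchesD(4)[OF t] by blast
		show "local_rep ?c A u $ i\<in>su" for i unfolding local_rep_def by (rule Omega1D(3)[OF A(1) c chart_simps(4)[OF c uc]])
		show "norm (\<xi> (cinv ?c u) - \<eta> (cinv ?c u)) \<le> 2 * b"
			by (rule order_trans[OF norm_triangle_ineq4]) (use b(1)[of "cinv ?c u"] b(2)[of "cinv ?c u"] in simp)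
		fix i
		have "norm (local_rep ?c (A - B) u $ i) \<le> m"
			by (rule order_trans[OF Finite_Cartesian_Product.norm_nth_le m]) (use u ball_subset_cball in blast)
		hence "norm (local_rep ?c (A - B) u $ i) * norm (\<eta> (cinv ?c u)) * K \<le> m * b * K"
			using b(2) K(1) m0 by (intro mult_right_mono mult_mono) auto
		thus "norm (- bracket (local_rep ?c (A - B) u $ i) (\<eta> (cinv ?c u))) \<le> m * b * K"
			using K(2)[of "local_rep ?c (A - B) u $ i" "\<eta> (cinv ?c u)"] by simp
	qed
	also have "\<dots> \<le> 6 * (2 * b) * (m * b * K) * (2 * ?r)" using xy b0 m0 K(1) by (intro mult_left_mono) auto
	finally show ?thesis unfolding x(2) y(2) by simp
qed

end

section \<open>Openness of the irreducible connections\<close>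

locale connected_charted = compact_charted At for At :: "'m::t2_space chart set" + assumes connected_M: "connected (UNIV :: 'm set)"
begin

text \<open>The step hypothesis is symmetric in the two points of a patch, so both the points
  satisfying \<open>P\<close> and the remaining ones form open sets, and connectedness leaves only
  one of them.\<close>

lemma patch_induct: assumes p0: "P p0" and step: "\<And>t p q. t\<in>patches ==> p\<in>patch t ==> q\<in>patch t ==> P p ==> P q"
	shows "P q" proof -
	have op: "open {p. Q p}" if "\<And>t p q. t\<in>patches ==> p\<in>patch t ==> q\<in>patch t ==> Q p ==> Q q" for Q
	proof (subst open_subopen, rule ballI)
		fix p assume p: "p\<in>{p. Q p}"
		obtain t where t: "t\<in>patches" "p\<in>patch t" using patch_ex by blast
		thus "\<exists>T. open T \<and> p\<in>T \<and> T\<subseteq>{p. Q p}" using patchesD(7)[OF t(1)] that[OF t] p by blast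
	qed
	have "open {p. P p}" by (rule op[of P]) (rule step)
	moreover have "open {p. \<not> P p}" by (rule op[of "\<lambda>p. \<not> P p"]) (use step in blast)
	ultimately have "{p. P p} \<inter> UNIV = {} \<or> {p. \<not> P p} \<inter> UNIV = {}" by (rule connectedD[OF connected_M]) auto
	thus ?thesis using p0 by blast
qed

text \<open>Comparison with the zero section for the same connection: the residual vanishes, so the
  norm cannot change across a patch.\<close>

lemma parallel_norm_constant:
	fixes A :: "('m, 'n::finite) form1" assumes A: "A\<in>Omega1 At k su" "parallel A \<xi>"
	shows "norm (\<xi> p) = norm (\<xi> q)" proof (rule patch_induct[of "\<lambda>p. norm (\<xi> p) = norm (\<xi> q)" q])
	obtain K where K: "0 \<le> K" "\<And>X Y :: 'n cmat. norm (bracket X Y) \<le> norm X * norm Y * K" using norm_matrix_bound by blast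
	have cont: "continuous_on UNIV \<xi>" using A(2) by (simp add: parallel_def)
	obtain b where b: "0 \<le> b" "\<And>p. norm (\<xi> p) \<le> b" using bounded_on_compact[OF compact_M cont] by blast
	have z: "parallel A (\<lambda>p. 0)" using parallel_scaleR[OF A, of 0] by simp
	fix t p p' assume t: "t\<in>patches" and p: "p\<in>patch t" "p'\<in>patch t" and e: "norm (\<xi> p) = norm (\<xi> q)"
	have "\<bar>(norm (\<xi> p - 0))\<^sup>2 - (norm (\<xi> p' - 0))\<^sup>2\<bar> \<le> 24 * b * (0 * b * K) * snd (snd t)"
		by (rule patch_estimate[OF A A(1) z K b(2) _ t _ p]) (auto simp: b local_rep_def)
	hence "(norm (\<xi> p))\<^sup>2 = (norm (\<xi> p'))\<^sup>2" by simp
	thus "norm (\<xi> p') = norm (\<xi> q)" using e by (metis norm_ge_zero power2_eq_iff_nonneg)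
qed simp

text \<open>Convergence at the single point \<open>p0\<close> spreads over the manifold, in place of
  an Arzela-Ascoli argument: by \<open>patch_estimate\<close> the Cauchy property passes from one
  point of a patch to all others. Uniform Lipschitz bounds in the charts give continuity of the
  limit, and the weak equation passes to the limit under the integral.\<close>

lemma parallel_limit:
	fixes A :: "('m, 'n::finite) form1"
	assumes A: "A\<in>Omega1 At k su" and B: "\<And>n. B n\<in>Omega1 At k su" "\<And>n. parallel (B n) (\<eta> n)"
		and n1: "\<And>n p. norm (\<eta> n p) = 1"
		and close: "\<And>n t y. t\<in>patches ==> y\<in>chart_cball t ==> norm (local_rep (fst t) (B n - A) y) \<le> \<delta> n"
		and \<delta>: "\<delta> \<longlonglongrightarrow> 0" and p0: "Cauchy (\<lambda>n. \<eta> n p0)"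
	shows "\<exists>\<xi>. parallel A \<xi> \<and> (\<forall>p. norm (\<xi> p) = 1)" proof -
	let ?u = "\<lambda>p. \<lambda>n. \<eta> n p"
	obtain K where K: "0 \<le> K" "\<And>X Y :: 'n cmat. norm (bracket X Y) \<le> norm X * norm Y * K" using norm_matrix_bound by blast
	have "Cauchy (?u p)" for p proof (rule patch_induct[of "\<lambda>p. Cauchy (?u p)", OF p0])
		fix t p q assume t: "t\<in>patches" and pq: "p\<in>patch t" "q\<in>patch t" and C: "Cauchy (?u p)"
		let ?E = "24 * K * snd (snd t)"
		have E: "0 \<le> ?E" using K(1) patchesD(2)[OF t] by simp
		\<comment> \<open>The sections are normalised, so the bound is 1, and the connections differ by at
		  most \<open>\<delta> n + \<delta> m\<close> because both are compared with
		  \<open>A\<close>.\<close>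
		have est: "(norm (\<eta> n q - \<eta> m q))\<^sup>2 \<le> (norm (\<eta> n p - \<eta> m p))\<^sup>2 + ?E * (\<delta> n + \<delta> m)" for n m
		proof -
			have "norm (local_rep (fst t) (B n - B m) y) \<le> \<delta> n + \<delta> m" if y: "y\<in>chart_cball t" for y
				using norm_triangle_ineq4[of "local_rep (fst t) (B n - A) y" "local_rep (fst t) (B m - A) y"] close[OF t y, of n] close[OF t y, of m]
				by (simp add: local_rep_diff)
			from patch_estimate[OF B(1) B(2) B(1) B(2) K, of n 1 m t "\<delta> n + \<delta> m" p q, OF _ _ t this pq] n1
			have "\<bar>(norm (\<eta> n p - \<eta> m p))\<^sup>2 - (norm (\<eta> n q - \<eta> m q))\<^sup>2\<bar> \<le> 24 * 1 * ((\<delta> n + \<delta> m) * 1 * K) * snd (snd t)"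
				by simp
			also have "\<dots> = ?E * (\<delta> n + \<delta> m)" by simp
			finally show ?thesis by linarith
		qed
		show "Cauchy (\<lambda>n. \<eta> n q)" proof (rule metric_CauchyI)
			fix e :: real assume e: "0 < e"
			hence "0 < e/2" by simp
			then obtain M1 where M1: "\<And>m n. M1 \<le> m ==> M1 \<le> n ==> dist (\<eta> m p) (\<eta> n p) < e/2"
				using metric_CauchyD[OF C] by blast
			have "(\<lambda>n. ?E * \<delta> n) \<longlonglongrightarrow> ?E * 0" by (intro tendsto_intros \<delta>)
			hence "(\<lambda>n. ?E * \<delta> n) \<longlonglongrightarrow> 0" by simp
			moreover have "0 < e\<^sup>2/4" using e by simp
			ultimately have "eventually (\<lambda>n. ?E * \<delta> n < e\<^sup>2/4) sequentially" by (rule order_tendstoD(2))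
			then obtain M2 where M2: "\<And>n. M2 \<le> n ==> ?E * \<delta> n < e\<^sup>2/4" unfolding eventually_sequentially by blast
			show "\<exists>M. \<forall>m\<ge>M. \<forall>n\<ge>M. dist (\<eta> m q) (\<eta> n q) < e" proof (intro exI[of _ "max M1 M2"] allI impI)
				fix m n assume mn: "max M1 M2 \<le> m" "max M1 M2 \<le> n"
				have "norm (\<eta> m p - \<eta> n p) < e/2" using M1[of m n] mn by (simp add: dist_norm)
				hence "(norm (\<eta> m p - \<eta> n p))\<^sup>2 < (e/2)\<^sup>2" by (intro power_strict_mono) auto
				moreover have "?E * (\<delta> m + \<delta> n) < e\<^sup>2/4 + e\<^sup>2/4" using M2[of m] M2[of n] mn by (simp only: distrib_left) linarith
				ultimately have "(norm (\<eta> m q - \<eta> n q))\<^sup>2 < e\<^sup>2"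
					using est[of m n] \<open>0 < e\<^sup>2/4\<close> by (simp only: power_divide power2_eq_square[of 2])
				thus "dist (\<eta> m q) (\<eta> n q) < e" using e by (simp add: dist_norm power2_less_imp_less)
			qed
		qed
	qed
	hence lim: "(?u p) \<longlonglongrightarrow> lim (?u p)" for p unfolding convergent_LIMSEQ_iff[symmetric] by (rule Cauchy_convergent)
	define \<xi> where "\<xi> p = lim (?u p)" for p
	have \<xi>: "(?u p) \<longlonglongrightarrow> \<xi> p" for p unfolding \<xi>_def by (rule lim)
	have norm1: "norm (\<xi> p) = 1" for p using LIMSEQ_unique[OF tendsto_norm[OF \<xi>[of p]]] n1 by simp
	have su: "\<xi> p\<in>su" for p by (rule closed_sequentially[OF closed_su _ \<xi>]) (use B(2) in \<open>simp add: parallel_def\<close>)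
	obtain M where M: "0 < M" "\<And>n. \<bar>\<delta> n\<bar> \<le> M" using convergent_imp_Bseq[OF convergentI[OF \<delta>]] by (auto simp: Bseq_def)
	\<comment> \<open>Closeness on the patches is carried to compact sets of arbitrary charts, since
	  the weak equation has to be verified in every chart of the atlas.\<close>
	have cb: "\<exists>C\<ge>0. \<forall>n. \<forall>y\<in>L. norm (local_rep c (B n - A) y) \<le> C * \<delta> n" if c: "c\<in>At" and L: "compact L" "L\<subseteq>cimg c" for c L
	proof -
		have BA: "B n - A\<in>Omega1 At k su" for n by (rule subspace_diff[OF Omega1_subspace[OF subspace_su] B(1) A])
		obtain C where C: "0 \<le> C" "\<forall>\<omega>\<in>Omega1 At k (su :: 'n cmat set). \<forall>m.
				(\<forall>t\<in>patches. \<forall>y\<in>chart_cball t. norm (local_rep (fst t) \<omega> y) \<le> m) \<longrightarrow> (\<forall>y\<in>L. norm (local_rep c \<omega> y) \<le> C * m)"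
			using chart_bound[OF c L, where k = k and V = "su :: 'n cmat set"] by (elim exE conjE) (rule that)
		have "\<forall>y\<in>L. norm (local_rep c (B n - A) y) \<le> C * \<delta> n" for n
			by (rule C(2)[THEN bspec, THEN spec, THEN mp, OF BA]) (intro ballI close)
		with C(1) show ?thesis by blast
	qed
	have bound: "\<exists>B'\<ge>0. \<forall>y\<in>L. \<forall>n. norm (local_rep c (B n) y) \<le> B'" if c: "c\<in>At" and L: "compact L" "L\<subseteq>cimg c" for c L
	proof -
		obtain C where C: "0 \<le> C" "\<And>n y. y\<in>L ==> norm (local_rep c (B n - A) y) \<le> C * \<delta> n" using cb[OF c L] by blast
		obtain D where D: "0 \<le> D" "\<And>y. y\<in>L ==> norm (local_rep c A y) \<le> D"
			using bounded_on_compact[OF L(1) continuous_on_subset[OF Omega1D(7)[OF A c] L(2)]] by blast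
		have "norm (local_rep c (B n) y) \<le> C * M + D" if y: "y\<in>L" for n y proof -
			have "norm (local_rep c (B n) y) \<le> norm (local_rep c (B n - A) y) + norm (local_rep c A y)"
				using norm_triangle_ineq[of "local_rep c (B n - A) y" "local_rep c A y"] by (simp add: local_rep_diff)
			also have "\<dots> \<le> C * \<delta> n + D" by (intro add_mono C D y)
			also have "\<dots> \<le> C * M + D" using M(2)[of n] C(1) by (intro add_mono mult_left_mono) auto
			finally show ?thesis .
		qed
		thus ?thesis using C(1) D(1) M(1) by (intro exI[of _ "C * M + D"]) auto
	qed
	\<comment> \<open>In each patch the sections share one Lipschitz constant, because the connections
	  are uniformly bounded there; the constant passes to the pointwise limit.\<close>
	have cont: "continuous_on UNIV \<xi>" proof (rule continuous_on_patches[OF patch_continuous])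
		fix t assume t: "t\<in>patches"
		let ?c = "fst t"
		note c = patchesD(1)[OF t]
		obtain B' where B': "0 \<le> B'" "\<And>y n. y\<in>chart_cball t ==> norm (local_rep ?c (B n) y) \<le> B'"
			using bound[OF c compact_cball patchesD(3)[OF t]] by blast
		have lip: "norm (\<eta> n (cinv ?c x) - \<eta> n (cinv ?c y)) \<le> 3 * (B' * 1 * K) * norm (x - y)"
			if x: "x\<in>chart_ball t" and y: "y\<in>chart_ball t" for n x y
		proof (rule ball_derivative_lipschitz[OF parallel_derivative[OF B(1) B(2) c] _ x y])
			fix u assume u: "u\<in>chart_ball t"
			thus "u\<in>cimg ?c" using patchesD(4)[OF t] by blast
			fix i
			have "norm (local_rep ?c (B n) u $ i) \<le> B'"
				by (rule order_trans[OF Finite_Cartesian_Product.norm_nth_le B'(2)]) (use u ball_subset_cball in blast)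
			hence "norm (local_rep ?c (B n) u $ i) * norm (\<eta> n (cinv ?c u)) * K \<le> B' * 1 * K"
				using K(1) B'(1) n1 by (intro mult_right_mono mult_mono) auto
			thus "norm (- bracket (local_rep ?c (B n) u $ i) (\<eta> n (cinv ?c u))) \<le> B' * 1 * K"
				using K(2)[of "local_rep ?c (B n) u $ i" "\<eta> n (cinv ?c u)"] by simp
		qed
		have "norm (\<xi> (cinv ?c x) - \<xi> (cinv ?c y)) \<le> 3 * (B' * 1 * K) * norm (x - y)"
			if "x\<in>chart_ball t" "y\<in>chart_ball t" for x y
			by (rule LIMSEQ_le_const2[OF tendsto_norm[OF tendsto_diff[OF \<xi> \<xi>]]]) (use lip[OF that] in blast)
		hence "(3 * (B' * 1 * K))-lipschitz_on (chart_ball t) (\<lambda>x. \<xi> (cinv ?c x))"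
			using K(1) B'(1) by (intro lipschitz_onI) (auto simp: dist_norm)
		thus "continuous_on (chart_ball t) (\<lambda>x. \<xi> (cinv ?c x))" by (rule lipschitz_on_continuous_on)
	qed
	have "weak_pd (cimg c) i (\<lambda>x. \<xi> (cinv c x)) (\<lambda>x. - bracket (local_rep c A x $ i) (\<xi> (cinv c x)))"
		if c: "c\<in>At" for c i unfolding weak_pd_iff proof (intro allI impI)
		fix \<phi> assume test: "test_function (cimg c) \<phi>"
		obtain L where \<phi>: "smooth3 UNIV \<phi>" and L: "compact L" "L\<subseteq>cimg c"
			and z: "\<And>x. x\<notin>L ==> \<phi> x = 0" "\<And>x. x\<notin>L ==> pd i \<phi> x = 0" by (rule test_functionE[OF test]) (rule that)
		note S = open_cimg[OF c]
		have contn: "continuous_on UNIV (\<eta> n)" for n using B(2) by (simp add: parallel_def)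
		obtain B' where B': "0 \<le> B'" "\<And>y n. y\<in>L ==> norm (local_rep c (B n) y) \<le> B'" using bound[OF c L] by blast
		have Ac: "(\<lambda>n. local_rep c (B n) x) \<longlonglongrightarrow> local_rep c A x" if x: "x\<in>cimg c" for x proof -
			have "{x}\<subseteq>cimg c" using x by simp
			from cb[OF c compact_sing this] obtain C where "\<And>n y. y\<in>{x} ==> norm (local_rep c (B n - A) y) \<le> C * \<delta> n" by blast
			hence C: "norm (local_rep c (B n - A) x) \<le> C * \<delta> n" for n by simp
			have "(\<lambda>n. local_rep c (B n - A) x) \<longlonglongrightarrow> 0"
				by (rule Lim_null_comparison[OF always_eventually[OF allI[OF C]] tendsto_mult_right_zero[OF \<delta>]])
			thus ?thesis unfolding local_rep_diff by (rule LIM_zero_cancel)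
		qed
		have l1: "(\<lambda>n. LINT x:cimg c|lborel. pd i \<phi> x *\<^sub>R \<eta> n (cinv c x)) \<longlonglongrightarrow> (LINT x:cimg c|lborel. pd i \<phi> x *\<^sub>R \<xi> (cinv c x))"
			by (rule test_integral_limit[OF S smooth3_continuous[OF smooth3_pd[OF \<phi>]] L z(2) parallel_local_continuous[OF contn c]
					parallel_local_continuous[OF cont c] \<xi>, where b = 1]) (simp_all add: n1)
		have l2: "(\<lambda>n. LINT x:cimg c|lborel. \<phi> x *\<^sub>R (- bracket (local_rep c (B n) x $ i) (\<eta> n (cinv c x)))) \<longlonglongrightarrow>
				(LINT x:cimg c|lborel. \<phi> x *\<^sub>R (- bracket (local_rep c A x $ i) (\<xi> (cinv c x))))"
		proof (rule test_integral_limit[OF S smooth3_continuous[OF \<phi>] L z(1) bracket_continuous[OF B(1) contn c] bracket_continuous[OF A cont c]])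
			show "(\<lambda>n. - bracket (local_rep c (B n) x $ i) (\<eta> n (cinv c x))) \<longlonglongrightarrow> - bracket (local_rep c A x $ i) (\<xi> (cinv c x))"
				if "x\<in>cimg c" for x by (intro tendsto_minus bounded_bilinear.tendsto[OF bounded_bilinear_bracket] tendsto_vec_nth Ac[OF that] \<xi>)
			fix n x assume x: "x\<in>L"
			have "norm (local_rep c (B n) x $ i) * norm (\<eta> n (cinv c x)) * K \<le> B' * 1 * K"
				using K(1) B' n1 x by (intro mult_right_mono mult_mono order_trans[OF Finite_Cartesian_Product.norm_nth_le B'(2)]) auto
			thus "norm (- bracket (local_rep c (B n) x $ i) (\<eta> n (cinv c x))) \<le> B' * 1 * K"
				using K(2)[of "local_rep c (B n) x $ i" "\<eta> n (cinv c x)"] by simp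
		qed
		have eq: "(LINT x:cimg c|lborel. pd i \<phi> x *\<^sub>R \<eta> n (cinv c x)) =
				- (LINT x:cimg c|lborel. \<phi> x *\<^sub>R (- bracket (local_rep c (B n) x $ i) (\<eta> n (cinv c x))))" for n proof -
			have "weak_pd (cimg c) i (\<lambda>x. \<eta> n (cinv c x)) (\<lambda>x. - bracket (local_rep c (B n) x $ i) (\<eta> n (cinv c x)))"
				using B(2) c unfolding parallel_def covariantly_constant_bracket by blast
			thus ?thesis using test unfolding weak_pd_iff by blast
		qed
		show "(LINT x:cimg c|lborel. pd i \<phi> x *\<^sub>R \<xi> (cinv c x)) =
				- (LINT x:cimg c|lborel. \<phi> x *\<^sub>R (- bracket (local_rep c A x $ i) (\<xi> (cinv c x))))"
			by (rule LIMSEQ_unique[OF l1]) (unfold eq, rule tendsto_minus[OF l2])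
	qed
	hence "parallel A \<xi>" unfolding parallel_def covariantly_constant_bracket using cont su by blast
	thus ?thesis using norm1 by blast
qed

lemma openin_irreducible_connections: assumes s: "3 \<le> s"
	shows "openin (tangent_top At s :: ('m, 'n::finite) form1 topology) (irreducible_connections At s)"
proof (subst openin_subopen, intro ballI, rule ccontr)
	let ?k = "s - 1" and ?U = "irreducible_connections At s :: ('m, 'n) form1 set"
	let ?F = "Omega1 At (s - 1) (su :: 'n cmat set)"
	interpret X: hausdorff_seminorm_topology ?F "sobolev_seminorms At (s - 1)" "tangent_top At s" by (rule O1_top[OF s])
	have k: "2 \<le> ?k" and Suc_k: "Suc ?k = s" using s by auto
	fix A0 assume A0: "A0\<in>?U" and none: "\<not> (\<exists>T. openin (tangent_top At s) T \<and> A0\<in>T \<and> T\<subseteq>?U)"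
	have A0F: "A0\<in>?F" using A0 by (simp add: irreducible_connections_def)
	obtain C q where C: "0 \<le> C" and q: "\<And>t. t\<in>patches ==> q t\<in>sobolev_seminorms At ?k"
		and Cq: "\<And>\<omega> t y. \<omega>\<in>?F ==> t\<in>patches ==> y\<in>chart_cball t ==> norm (local_rep (fst t) \<omega> y) \<le> C * q t \<omega>"
		using patch_bound[OF k, where V = "su :: 'n cmat set"] by (elim exE conjE) (rule that, assumption, blast, blast)
	have ex: "\<exists>A \<zeta>. A\<in>?F \<and> (\<forall>t\<in>patches. q t (A - A0) < 1/real (Suc n)) \<and> parallel A \<zeta> \<and> (\<forall>p. norm (\<zeta> p) = 1)" for n
	proof -
		\<comment> \<open>A neighbourhood of \<open>A0\<close> on which all patch seminorms are small; by
		  assumption it contains a reducible connection.\<close>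
		let ?W = "(\<Inter>t\<in>patches. {A\<in>?F. q t (A - A0) < 1/real (Suc n)}) \<inter> topspace (tangent_top At s)"
		have "openin (tangent_top At s) ?W" by (rule openin_INT[OF finite_patches]) (intro X.openin_ball q A0F; simp)
		moreover have "A0\<in>?W" using A0F X.seminorm_zero[OF q] by (simp add: X.topspace_eq)
		ultimately obtain A where A: "A\<in>?W" "A\<notin>?U" using none by blast
		have AF: "A\<in>?F" using A(1) by (simp add: X.topspace_eq)
		obtain \<xi> p where \<xi>: "\<xi>\<in>Omega0 At s (su :: 'n cmat set)" "covariantly_constant At A \<xi>" "\<xi> p \<noteq> 0"
			using A(2) AF unfolding irreducible_connections_def by blast
		have par: "parallel A \<xi>" using \<xi>(1,2) Omega0_continuous[OF \<xi>(1)] by (simp add: parallel_def Omega0_def)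
		\<comment> \<open>A section that is nonzero at one point has constant norm and can be normalised
		  everywhere at once.\<close>
		have "norm ((1/norm (\<xi> p)) *\<^sub>R \<xi> r) = 1" for r using parallel_norm_constant[OF AF par, of r p] \<xi>(3) by simp
		thus ?thesis using AF A(1) parallel_scaleR[OF AF par, of "1/norm (\<xi> p)"]
			by (intro exI[of _ A] exI[of _ "\<lambda>r. (1/norm (\<xi> p)) *\<^sub>R \<xi> r"]) blast
	qed
	obtain A \<zeta> where AF: "\<And>n. A n\<in>?F" and Aq: "\<And>n t. t\<in>patches ==> q t (A n - A0) < 1/real (Suc n)"
		and par: "\<And>n. parallel (A n) (\<zeta> n)" and n1: "\<And>n p. norm (\<zeta> n p) = 1" using ex by metis
	obtain p0 :: 'm where True by simp
	\<comment> \<open>Compactness of the unit ball in the fibre over \<open>p0\<close> gives a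
	  subsequence converging there; \<open>parallel_limit\<close> extends the convergence to all
	  points.\<close>
	have "\<forall>n. \<zeta> n p0\<in>cball 0 1" using n1 by simp
	then obtain l r where r: "strict_mono r" "((\<lambda>n. \<zeta> n p0) \<circ> r) \<longlonglongrightarrow> l"
		using compact_cball[of "0 :: 'n cmat" 1, unfolded compact_def, THEN spec, THEN mp, of "\<lambda>n. \<zeta> n p0"] by blast
	have "\<exists>\<xi>. parallel A0 \<xi> \<and> (\<forall>p. norm (\<xi> p) = 1)" proof (rule parallel_limit[OF A0F AF par n1])
		show "Cauchy (\<lambda>n. \<zeta> (r n) p0)" using LIMSEQ_imp_Cauchy[OF r(2)] by (simp add: o_def)
		have "((\<lambda>n. C * (1/real (Suc n))) \<circ> r) \<longlonglongrightarrow> C * 0"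
			by (intro LIMSEQ_subseq_LIMSEQ[OF _ r(1)] tendsto_mult tendsto_const LIMSEQ_Suc[OF lim_1_over_n])
		thus "(\<lambda>n. C * (1/real (Suc (r n)))) \<longlonglongrightarrow> 0" by (simp add: o_def)
		fix n t y assume t: "t\<in>patches" and y: "y\<in>chart_cball t"
		have "norm (local_rep (fst t) (A (r n) - A0) y) \<le> C * q t (A (r n) - A0)" by (rule Cq[OF X.in_F(2)[OF AF A0F] t y])
		also have "\<dots> \<le> C * (1/real (Suc (r n)))" using Aq[OF t, of "r n"] C by (intro mult_left_mono) auto
		finally show "norm (local_rep (fst t) (A (r n) - A0) y) \<le> C * (1/real (Suc (r n)))" .
	qed
	then obtain \<xi> where \<xi>: "parallel A0 \<xi>" "\<And>p. norm (\<xi> p) = 1" by blast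
	\<comment> \<open>Regularity brings the limit into the space of sections that irreducibility tests,
	  which forces it to vanish against its unit norm.\<close>
	have "\<xi>\<in>Omega0 At s su" using parallel_Omega0[OF k A0F \<xi>(1)] unfolding Suc_k .
	hence "\<xi> p0 = 0" using A0 \<xi>(1) unfolding irreducible_connections_def parallel_def by blast
	thus False using \<xi>(2)[of p0] by simp
qed

end

theorem theorem3p4:
  fixes At :: "'m::t2_space chart set"
    and g :: "'m chart \<Rightarrow> 'm \<Rightarrow> real^3^3"
    and s :: nat
  assumes "compact_connected_oriented_riemannian_3manifold At g"
    and "CARD('n::finite) \<ge> 2"
    and "s \<ge> 3"
  shows "twisted_dirac_structure
           (tangent_top At s :: ('m, 'n) form1 topology)
           (irreducible_connections At s)
           (cotangent_top At s)
           (cartan_form At)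
           (dirac_bundle At s)"
proof -
	interpret connected_charted At
		using assms(1) unfolding compact_connected_oriented_riemannian_3manifold_def by unfold_locales auto
	show ?thesis by (rule twisted_dirac_structure_if_open[OF assms(3) openin_irreducible_connections[OF assms(3)]])
qed

end
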